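(* Let $p,q>1$ and suppose that $$(u_0,u_1)\in(H^1\cap L^1)\times(L^2\cap L^1\cap L^q),\qquad (v_0,v_1)\in H^1\times(L^2\cap L^1),$$ and that $\operatorname{supp}(u_0,u_1,v_0,v_1)\subset[-R,R]$ for some $R>0$. Suppose additionally that $$\int_{\mathbb{R}}v_1(x)\,\mathrm{d}x=0.$$ Let $T_\varepsilon\in(0,\infty]$ be the lifespan of the unique maximal mild energy solution of the one-dimensional Nakao problem with initial data $\varepsilon(u_0,u_1)$, $\varepsilon(v_0,v_1)$. Then there exist constants $\varepsilon_0>0$ and $c>0$, independent of $\varepsilon$ (they may depend on $p,q$ and the fixed profiles $u_0,u_1,v_0,v_1$), such that for every $\varepsilon\in(0,\varepsilon_0]$: $$T_\varepsilon\geqslant c\,\varepsilon^{-\frac{pq(pq-1)}{pq(q+1)+1}}\quad\text{if } q\geqslant3,\ \text{ or if }\ 1<q<3\ \text{ and }\ 1<p\leqslant P_{\mathrm{H}}(q),$$ $$T_\varepsilon\geqslant c\,\varepsilon^{-\frac{2q(pq-1)}{pq(3-q)+3q+1}}\quad\text{if } 1<q<3\ \text{ and }\ p>P_{\mathrm{H}}(q).$$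
   Context: All function spaces are over $\mathbb{R}$. For $p,q>1$ and $\varepsilon>0$, the one-dimensional Nakao problem is the Cauchy problem $$u_{tt}-u_{xx}+u_t=|v|^p,\qquad v_{tt}-v_{xx}=|u|^q\qquad (x\in\mathbb{R},\ t>0),$$ $$(u,u_t)(0,x)=\varepsilon(u_0,u_1)(x),\qquad (v,v_t)(0,x)=\varepsilon(v_0,v_1)(x).$$ For data $(u_0,u_1),(v_0,v_1)\in H^1\times L^2$ it has, for every $\varepsilon>0$, a unique maximal mild energy solution $(u,v)$ on $[0,T_\varepsilon)$ with $u,v\in\mathcal{C}([0,T_\varepsilon),H^1)\cap\mathcal{C}^1([0,T_\varepsilon),L^2)$ (mild means satisfying the Duhamel integral formulas for the damped wave and wave equations); $T_\varepsilon\in(0,\infty]$ is called the lifespan, and if $T_\varepsilon<\infty$ then $\limsup_{t\to T_\varepsilon^-}\big(\|(u,u_t)(t,\cdot)\|_{H^1\times L^2}+\|(v,v_t)(t,\cdot)\|_{H^1\times L^2}\big)=+\infty$. $\operatorname{supp}(f_1,\dots,f_k):=\bigcup_{j}\operatorname{supp}f_j$. For $1<q<3$, $P_{\mathrm{H}}(q)$ is the unique root in $(1,\infty)$ of $q(3-q)p^2-(2q^2-q-1)p-2=0$, i.e. $$P_{\mathrm{H}}(q)=\frac{2q^2-q-1+\sqrt{(2q^2-q-1)^2+8q(3-q)}}{2q(3-q)}.$$ *)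

theory Defs
  imports "HOL-Analysis.Analysis"
begin

section \<open>Function spaces on the real line\<close>

text \<open>Classes of functions modulo equality almost everywhere are represented by Borel measurable
  representatives.\<close>

definition Lp :: "real \<Rightarrow> (real \<Rightarrow> real) set" where
  "Lp r = {f \<in> borel_measurable lborel. integrable lborel (\<lambda>x. \<bar>f x\<bar> powr r)}"

definition Lp_norm :: "real \<Rightarrow> (real \<Rightarrow> real) \<Rightarrow> real" where
  "Lp_norm r f = (LINT x|lborel. \<bar>f x\<bar> powr r) powr (1 / r)"

definition test_function :: "(real \<Rightarrow> real) \<Rightarrow> bool" where
  "test_function \<phi> \<longleftrightarrow>
     (\<forall>n x. (deriv ^^ n) \<phi> differentiable (at x)) \<and> compact (closure {x. \<phi> x \<noteq> 0})"

text \<open>Only used for \<open>f\<close> and \<open>g\<close> in \<open>Lp 2\<close>, so that both integrals converge.\<close>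

definition weak_deriv :: "(real \<Rightarrow> real) \<Rightarrow> (real \<Rightarrow> real) \<Rightarrow> bool" where
  "weak_deriv f g \<longleftrightarrow>
     (\<forall>\<phi>. test_function \<phi> \<longrightarrow>
        (LINT x|lborel. f x * deriv \<phi> x) = - (LINT x|lborel. g x * \<phi> x))"

definition H1 :: "(real \<Rightarrow> real) set" where
  "H1 = {f \<in> Lp 2. \<exists>g \<in> Lp 2. weak_deriv f g}"

text \<open>The weak derivative is unique up to a null set, hence the norm does not depend on the choice.\<close>

definition H1_norm :: "(real \<Rightarrow> real) \<Rightarrow> real" where
  "H1_norm f =
     sqrt ((Lp_norm 2 f)\<^sup>2 + (Lp_norm 2 (SOME g. g \<in> Lp 2 \<and> weak_deriv f g))\<^sup>2)"

text \<open>Essential support: the complement of the largest open set on which \<open>f\<close> vanishes almost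
  everywhere.\<close>

definition ess_supp :: "(real \<Rightarrow> real) \<Rightarrow> real set" where
  "ess_supp f = - \<Union>{U. open U \<and> (AE x in lborel. x \<in> U \<longrightarrow> f x = 0)}"

section \<open>Curves in function spaces\<close>

definition time_interval :: "ereal \<Rightarrow> real set" where
  "time_interval T = {t. 0 \<le> t \<and> ereal t < T}"

definition C0_H1 :: "ereal \<Rightarrow> (real \<Rightarrow> real \<Rightarrow> real) \<Rightarrow> bool" where
  "C0_H1 T u \<longleftrightarrow>
     (\<forall>t \<in> time_interval T. u t \<in> H1 \<and>
        ((\<lambda>s. H1_norm (\<lambda>x. u s x - u t x)) \<longlongrightarrow> 0) (at t within time_interval T))"

definition C0_L2 :: "ereal \<Rightarrow> (real \<Rightarrow> real \<Rightarrow> real) \<Rightarrow> bool" where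
  "C0_L2 T u \<longleftrightarrow>
     (\<forall>t \<in> time_interval T. u t \<in> Lp 2 \<and>
        ((\<lambda>s. Lp_norm 2 (\<lambda>x. u s x - u t x)) \<longlongrightarrow> 0) (at t within time_interval T))"

definition C1_L2 :: "ereal \<Rightarrow> (real \<Rightarrow> real \<Rightarrow> real) \<Rightarrow> bool" where
  "C1_L2 T u \<longleftrightarrow> C0_L2 T u \<and>
     (\<exists>u'. C0_L2 T u' \<and>
        (\<forall>t \<in> time_interval T.
           ((\<lambda>s. Lp_norm 2 (\<lambda>x. (u s x - u t x) / (s - t) - u' t x)) \<longlongrightarrow> 0)
             (at t within time_interval T)))"

section \<open>Solution operators of the linear equations\<close>

text \<open>Modified Bessel function of the first kind of integer order \<open>n\<close>.\<close>

definition bessel_I :: "nat \<Rightarrow> real \<Rightarrow> real" where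
  "bessel_I n z = (\<Sum>k. (z / 2) ^ (2 * k + n) / (fact k * fact (k + n)))"

text \<open>
  For the damped wave equation \<open>u\<^sub>t\<^sub>t - u\<^sub>x\<^sub>x + u\<^sub>t = 0\<close> the solution with data
  \<open>(u, u\<^sub>t)(0) = (0, g)\<close> is \<open>damped_K1 t g\<close>: the substitution \<open>w = exp (t / 2) u\<close> leads to
  \<open>w\<^sub>t\<^sub>t - w\<^sub>x\<^sub>x = w / 4\<close>, whose Riemann function is \<open>I\<^sub>0 (sqrt (t\<^sup>2 - y\<^sup>2) / 2)\<close>.
  The solution with data \<open>(f, 0)\<close> is \<open>damped_K0 t f\<close>, which is \<open>damped_K1 t f\<close> plus its
  time derivative, written out with \<open>I\<^sub>0' = I\<^sub>1\<close>.  The quotient by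
  \<open>sqrt (t\<^sup>2 - (x - y)\<^sup>2)\<close> is undefined only at the two endpoints of the integration interval.
\<close>

definition damped_K1 :: "real \<Rightarrow> (real \<Rightarrow> real) \<Rightarrow> real \<Rightarrow> real" where
  "damped_K1 t g x =
     exp (- t / 2) / 2 *
       (LBINT y:{x - t..x + t}. bessel_I 0 (sqrt (t\<^sup>2 - (x - y)\<^sup>2) / 2) * g y)"

definition damped_K0 :: "real \<Rightarrow> (real \<Rightarrow> real) \<Rightarrow> real \<Rightarrow> real" where
  "damped_K0 t f x =
     exp (- t / 2) / 2 * (f (x + t) + f (x - t)) +
     exp (- t / 2) / 4 *
       (LBINT y:{x - t..x + t}.
          (bessel_I 0 (sqrt (t\<^sup>2 - (x - y)\<^sup>2) / 2) +
           t / sqrt (t\<^sup>2 - (x - y)\<^sup>2) * bessel_I 1 (sqrt (t\<^sup>2 - (x - y)\<^sup>2) / 2)) * f y)"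

text \<open>d'Alembert's formula for \<open>v\<^sub>t\<^sub>t - v\<^sub>x\<^sub>x = 0\<close>.\<close>

definition wave_K1 :: "real \<Rightarrow> (real \<Rightarrow> real) \<Rightarrow> real \<Rightarrow> real" where
  "wave_K1 t g x = 1 / 2 * (LBINT y:{x - t..x + t}. g y)"

definition wave_K0 :: "real \<Rightarrow> (real \<Rightarrow> real) \<Rightarrow> real \<Rightarrow> real" where
  "wave_K0 t f x = (f (x + t) + f (x - t)) / 2"

section \<open>The one-dimensional Nakao problem\<close>

text \<open>
  Mild energy solutions on \<open>[0, T)\<close> of
  \<open>u\<^sub>t\<^sub>t - u\<^sub>x\<^sub>x + u\<^sub>t = \<bar>v\<bar>\<^sup>p\<close>, \<open>v\<^sub>t\<^sub>t - v\<^sub>x\<^sub>x = \<bar>u\<bar>\<^sup>q\<close>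
  with data \<open>(u, u\<^sub>t)(0) = (f0, f1)\<close> and \<open>(v, v\<^sub>t)(0) = (g0, g1)\<close>.
  The arguments of \<open>u\<close> and \<open>v\<close> are time and space, in this order.
\<close>

definition nakao_mild_solution ::
  "real \<Rightarrow> real \<Rightarrow> (real \<Rightarrow> real) \<Rightarrow> (real \<Rightarrow> real) \<Rightarrow> (real \<Rightarrow> real) \<Rightarrow> (real \<Rightarrow> real) \<Rightarrow>
   ereal \<Rightarrow> (real \<Rightarrow> real \<Rightarrow> real) \<Rightarrow> (real \<Rightarrow> real \<Rightarrow> real) \<Rightarrow> bool" where
  "nakao_mild_solution p q f0 f1 g0 g1 T u v \<longleftrightarrow>
     0 < T \<and> C0_H1 T u \<and> C1_L2 T u \<and> C0_H1 T v \<and> C1_L2 T v \<and>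
     (\<forall>t \<in> time_interval T.
        (AE x in lborel.
           u t x = damped_K0 t f0 x + damped_K1 t f1 x +
                   (LBINT s:{0..t}. damped_K1 (t - s) (\<lambda>y. \<bar>v s y\<bar> powr p) x)) \<and>
        (AE x in lborel.
           v t x = wave_K0 t g0 x + wave_K1 t g1 x +
                   (LBINT s:{0..t}. wave_K1 (t - s) (\<lambda>y. \<bar>u s y\<bar> powr q) x)))"

definition nakao_maximal_solution ::
  "real \<Rightarrow> real \<Rightarrow> (real \<Rightarrow> real) \<Rightarrow> (real \<Rightarrow> real) \<Rightarrow> (real \<Rightarrow> real) \<Rightarrow> (real \<Rightarrow> real) \<Rightarrow>
   ereal \<Rightarrow> (real \<Rightarrow> real \<Rightarrow> real) \<Rightarrow> (real \<Rightarrow> real \<Rightarrow> real) \<Rightarrow> bool" where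
  "nakao_maximal_solution p q f0 f1 g0 g1 T u v \<longleftrightarrow>
     nakao_mild_solution p q f0 f1 g0 g1 T u v \<and>
     \<not> (\<exists>T' u' v'. T < T' \<and> nakao_mild_solution p q f0 f1 g0 g1 T' u' v' \<and>
          (\<forall>t \<in> time_interval T.
             (AE x in lborel. u' t x = u t x) \<and> (AE x in lborel. v' t x = v t x)))"

definition is_nakao_lifespan ::
  "real \<Rightarrow> real \<Rightarrow> (real \<Rightarrow> real) \<Rightarrow> (real \<Rightarrow> real) \<Rightarrow> (real \<Rightarrow> real) \<Rightarrow> (real \<Rightarrow> real) \<Rightarrow>
   ereal \<Rightarrow> bool" where
  "is_nakao_lifespan p q f0 f1 g0 g1 T \<longleftrightarrow>
     (\<exists>u v. nakao_maximal_solution p q f0 f1 g0 g1 T u v)"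

section \<open>The threshold exponent\<close>

definition P_H :: "real \<Rightarrow> real" where
  "P_H q = (THE p. 1 < p \<and> q * (3 - q) * p\<^sup>2 - (2 * q\<^sup>2 - q - 1) * p - 2 = 0)"

lemma P_H_eq:
  assumes "1 < q" "q < 3"
  shows "P_H q =
    (2 * q\<^sup>2 - q - 1 + sqrt ((2 * q\<^sup>2 - q - 1)\<^sup>2 + 8 * q * (3 - q))) / (2 * q * (3 - q))"
proof -
  define a where "a = q * (3 - q)"
  define b where "b = 2 * q\<^sup>2 - q - 1"
  define r where "r = sqrt (b\<^sup>2 + 8 * a)"
  have a: "a > 0" using assms by (simp add: a_def)
  have r2: "r\<^sup>2 = b\<^sup>2 + 8 * a" using a by (simp add: r_def)
  have r0: "r \<ge> 0" using a by (simp add: r_def)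
  have "(q - 1) * (3 * q - 1) > 0" using assms by (intro mult_pos_pos) auto
  then have "a < 2 + b" by (simp add: a_def b_def power2_eq_square algebra_simps)
  then have "a * a < a * (2 + b)" using a by simp
  then have "(2 * a - b)\<^sup>2 < r\<^sup>2"
    unfolding r2 by (simp add: power2_eq_square algebra_simps)
  then have gt: "2 * a - b < r" using r0 power2_less_imp_less by blast
  have root: "a * ((b + r) / (2 * a))\<^sup>2 - b * ((b + r) / (2 * a)) - 2 = 0"
  proof -
    have "a * ((b + r) / (2 * a))\<^sup>2 - b * ((b + r) / (2 * a)) - 2 = (r\<^sup>2 - b\<^sup>2 - 8 * a) / (4 * a)"
      using a by (simp add: field_simps power2_eq_square)
    then show ?thesis by (simp add: r2)
  qed
  have "P_H q = (b + r) / (2 * a)"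
    unfolding P_H_def a_def[symmetric] b_def[symmetric]
  proof (rule the_equality)
    show "1 < (b + r) / (2 * a) \<and> a * ((b + r) / (2 * a))\<^sup>2 - b * ((b + r) / (2 * a)) - 2 = 0"
      using root gt a by (simp add: field_simps)
  next
    fix p assume p: "1 < p \<and> a * p\<^sup>2 - b * p - 2 = 0"
    define s where "s = (b + r) / (2 * a)"
    have s: "1 < s" "a * s\<^sup>2 - b * s - 2 = 0" using root gt a by (auto simp: s_def field_simps)
    have "(p - s) * (a * p * s + 2) = s * (a * p\<^sup>2 - b * p - 2) - p * (a * s\<^sup>2 - b * s - 2)"
      by (simp add: power2_eq_square algebra_simps)
    also have "\<dots> = 0" using p s by simp
    finally have "p = s \<or> a * p * s + 2 = 0" by auto
    moreover have "a * p * s > 0" using a p s by simp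
    ultimately show "p = (b + r) / (2 * a)" by (auto simp: s_def)
  qed
  then show ?thesis by (simp add: a_def b_def r_def mult.assoc)
qed

end

theory Submission
  imports Defs
begin

text \<open>
  The lifespan is bounded from below by constructing a solution up to the time
  \<open>T = c \<epsilon> powr (- X)\<close>. A maximal solution with a smaller lifespan would agree with it by
  uniqueness and could then be continued, against maximality (\<open>lifespan_ge\<close>).

  The admissible rates \<open>X\<close> come from an a priori estimate. In one space dimension the undamped
  component at a point is the linear field plus half the integral of \<open>\<bar>u\<bar> powr q\<close> over the
  backward light cone; let \<open>N\<close> bound this remainder. Since the initial velocity \<open>v1\<close> has mean
  zero, the linear field of the undamped equation is of size \<open>\<epsilon>\<close> and lives in two strips of
  bounded width around the light cone (\<open>wave_field_strip\<close>). Hence the part of the source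
  \<open>\<bar>v\<bar> powr p\<close> that it generates has \<open>L\<^sup>1\<close> norm of size \<open>\<epsilon> powr p\<close> at every time and contributes
  to \<open>u\<close> at most a multiple of \<open>\<epsilon> powr p * T\<close>, in the supremum norm and in \<open>L\<^sup>1\<close>. The remainder
  contributes at most a multiple of \<open>N powr p * T\<close> pointwise. The linear field of the damped
  equation decays like a solution of the heat equation (\<open>damped_field_decay\<close>): its supremum is of
  size \<open>\<epsilon> * (1 + t) powr (- 1 / 2)\<close> and its \<open>L\<^sup>1\<close> norm of size \<open>\<epsilon>\<close>. Integrating the \<open>q\<close>-th powers
  over space and time gives
  \<open>N \<le> K * (\<epsilon> powr q * T powr \<theta> + \<epsilon> powr (p * q) * T powr (q + 1) + N powr (p * q) * T powr (q + 2))\<close>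
  (\<open>v_bound\<close>), where \<open>\<theta> = (3 - q) / 2\<close> if \<open>q < 3\<close> and \<open>\<theta>\<close> is a small positive number otherwise.
  Taking \<open>N\<close> proportional to the first two terms closes this inequality as long as
  \<open>\<epsilon> powr (q * (p * q - 1)) * T powr (\<theta> * (p * q - 1) + q + 2)\<close> and
  \<open>\<epsilon> powr (p * q * (p * q - 1)) * T powr (p * q * (q + 1) + 1)\<close> are small (\<open>lifespan_rate\<close>). The two
  conditions are the two rates of the theorem, and \<open>P_H q\<close> is the exponent \<open>p\<close> at which they
  coincide (\<open>P_H_sign\<close>); for \<open>q \<ge> 3\<close> the second condition is the stronger one.

  Existence up to time \<open>T\<close> is Banach's fixed point theorem for continuous functions with an
  exponential weight in time (\<open>existence\<close>), and the same contraction gives uniqueness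
  (\<open>coupled_uniqueness\<close>). The remaining work connects these pointwise statements with the energy
  space. Continuous representatives come from the one-dimensional Sobolev embedding
  (\<open>C0_H1_representative\<close>). Conversely, the constructed solution is a classical \<open>C\<^sup>1\<close> function plus
  two travelling waves with profiles in \<open>H\<^sup>1\<close>, and such a curve has energy regularity because
  translations are continuous in \<open>L\<^sup>2\<close> (\<open>travelling_wave_regularity\<close>). The decay of the damped
  linear field rests on the bounds \<open>exp z / sqrt z\<close> for the modified Bessel function and on the
  mass of the kernel, both read off from its power series.
\<close>

section \<open>Test functions and the fundamental lemma of the calculus of variations\<close>

lemma poly_mult_exp_tendsto_0: "((\<lambda>y::real. poly P y * exp (- y)) \<longlongrightarrow> 0) at_top"
proof -
  have "((\<lambda>y::real. \<Sum>i\<le>degree P. coeff P i * (y ^ i / exp y)) \<longlongrightarrow> (\<Sum>i\<le>degree P. coeff P i * 0)) at_top"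
    by (intro tendsto_sum tendsto_mult tendsto_const tendsto_power_div_exp_0)
  then show ?thesis
    by (simp add: poly_altdef sum_distrib_right exp_minus divide_inverse mult.assoc)
qed

text \<open>Multiplying \<open>exp (- 1 / y)\<close> by polynomials in \<open>1 / y\<close> gives a class closed under
  differentiation, which is how all derivatives are controlled at once.\<close>

definition flat :: "real poly \<Rightarrow> real \<Rightarrow> real" where
  "flat P y = (if y > 0 then poly P (1 / y) * exp (- (1 / y)) else 0)"

lemma flat_has_derivative:
  "(flat P has_real_derivative flat ([:0, 0, 1:] * (P - pderiv P)) y) (at y)"
proof -
  consider "y > 0" | "y < 0" | "y = 0" by linarith
  then show ?thesis
  proof cases
    case 1
    have "((\<lambda>y. poly P (1 / y) * exp (- (1 / y))) has_real_derivative
        flat ([:0, 0, 1:] * (P - pderiv P)) y) (at y)"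
      using 1
      by (auto simp: flat_def algebra_simps power2_eq_square divide_inverse
          intro!: derivative_eq_intros DERIV_chain'[OF _ poly_DERIV])
    then show ?thesis
      by (rule has_field_derivative_transform_within_open[where S = "{0<..}"])
         (use 1 in \<open>auto simp: flat_def\<close>)
  next
    case 2
    have "((\<lambda>y. 0) has_real_derivative flat ([:0, 0, 1:] * (P - pderiv P)) y) (at y)"
      using 2 by (auto simp: flat_def)
    then show ?thesis
      by (rule has_field_derivative_transform_within_open[where S = "{..<0}"])
         (use 2 in \<open>auto simp: flat_def\<close>)
  next
    case 3
    have "((\<lambda>h. (flat P h - flat P 0) / (h - 0)) \<longlongrightarrow> 0) (at_right 0)"
    proof (rule Lim_transform_eventually)
      show "((\<lambda>h::real. poly (pCons 0 P) (inverse h) * exp (- inverse h)) \<longlongrightarrow> 0) (at_right 0)"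
        by (rule filterlim_compose[OF poly_mult_exp_tendsto_0 filterlim_inverse_at_top_right])
      show "\<forall>\<^sub>F h in at_right 0. poly (pCons 0 P) (inverse h) * exp (- inverse h) =
          (flat P h - flat P 0) / (h - 0)"
        using eventually_at_right_less[of 0]
        by eventually_elim (simp add: flat_def divide_inverse)
    qed
    moreover have "((\<lambda>h. (flat P h - flat P 0) / (h - 0)) \<longlongrightarrow> 0) (at_left 0)"
    proof (rule Lim_transform_eventually)
      show "((\<lambda>h::real. 0::real) \<longlongrightarrow> 0) (at_left 0)" by simp
      have "\<forall>\<^sub>F h::real in at_left 0. h < 0" by (simp add: eventually_at_filter)
      then show "\<forall>\<^sub>F h in at_left 0. 0 = (flat P h - flat P 0) / (h - 0)"
        by eventually_elim (simp add: flat_def)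
    qed
    ultimately have "((\<lambda>h. (flat P h - flat P 0) / (h - 0)) \<longlongrightarrow> 0) (at 0)"
      by (intro filterlim_split_at)
    then show ?thesis using 3 by (simp add: has_field_derivative_iff flat_def)
  qed
qed

text \<open>An inductively generated class closed under differentiation: membership gives derivatives of
  every order without a formula for them.\<close>

inductive smooth_family :: "(real \<Rightarrow> real) \<Rightarrow> bool" where
  const: "smooth_family (\<lambda>x. c)"
| flat: "smooth_family (\<lambda>x. flat P (m * x + c))"
| add: "smooth_family f \<Longrightarrow> smooth_family g \<Longrightarrow> smooth_family (\<lambda>x. f x + g x)"
| mult: "smooth_family f \<Longrightarrow> smooth_family g \<Longrightarrow> smooth_family (\<lambda>x. f x * g x)"

lemma smooth_family_derivative:
  "smooth_family f \<Longrightarrow> \<exists>f'. smooth_family f' \<and> (\<forall>x. (f has_real_derivative f' x) (at x))"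
proof (induction rule: smooth_family.induct)
  case (const c)
  show ?case by (intro exI[of _ "\<lambda>x. 0"]) (auto intro: smooth_family.const)
next
  case (flat P m c)
  show ?case
    by (rule exI[of _ "\<lambda>x. flat ([:0, 0, 1:] * (P - pderiv P)) (m * x + c) * m"])
       (auto intro!: smooth_family.intros DERIV_chain'[OF _ flat_has_derivative] derivative_eq_intros
         simp del: mult_pCons_left)
next
  case (add f g)
  then obtain f' g' where "smooth_family f'" "smooth_family g'"
    "\<And>x. (f has_real_derivative f' x) (at x)" "\<And>x. (g has_real_derivative g' x) (at x)" by blast
  then show ?case
    by (intro exI[of _ "\<lambda>x. f' x + g' x"]) (auto intro!: smooth_family.intros derivative_intros)
next
  case (mult f g)
  then obtain f' g' where "smooth_family f'" "smooth_family g'"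
    "\<And>x. (f has_real_derivative f' x) (at x)" "\<And>x. (g has_real_derivative g' x) (at x)" by blast
  then show ?case using mult
    by (intro exI[of _ "\<lambda>x. f' x * g x + g' x * f x"])
       (auto intro!: smooth_family.intros derivative_eq_intros)
qed

lemma smooth_family_iterated_deriv: "smooth_family f \<Longrightarrow> smooth_family ((deriv ^^ n) f)"
proof (induction n)
  case (Suc n)
  then obtain f' where "smooth_family f'" "\<And>x. ((deriv ^^ n) f has_real_derivative f' x) (at x)"
    using smooth_family_derivative by blast
  then have "deriv ((deriv ^^ n) f) = f'" by (intro ext DERIV_imp_deriv)
  then show ?case using \<open>smooth_family f'\<close> by simp
qed auto

lemma compact_support_bounded:
  fixes f :: "real \<Rightarrow> real"
  assumes "\<And>x. x \<notin> {a..b} \<Longrightarrow> f x = 0"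
  shows "compact (closure {x. f x \<noteq> 0})"
proof -
  have "{x. f x \<noteq> 0} \<subseteq> {a..b}" using assms by blast
  then show ?thesis using bounded_subset[OF bounded_closed_interval] compact_closure by blast
qed

lemma test_function_smooth_family:
  assumes "smooth_family f" "\<And>x. x \<notin> {a..b} \<Longrightarrow> f x = 0"
  shows "test_function f"
  unfolding test_function_def
  using smooth_family_derivative[OF smooth_family_iterated_deriv[OF assms(1)]]
    compact_support_bounded[of a b f] assms(2)
  by (metis real_differentiable_def)

text \<open>Needed to recognise the antiderivative of a test function of mean zero as a test function.\<close>

lemma test_function_antideriv:
  assumes "test_function g" "\<And>x. (f has_real_derivative g x) (at x)"
    and "\<And>x. x \<notin> {a..b} \<Longrightarrow> f x = 0"
  shows "test_function f"
proof -
  have d: "deriv f = g" using assms(2) by (intro ext DERIV_imp_deriv)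
  have "(deriv ^^ n) f differentiable at x" for n x
  proof (cases n)
    case 0 then show ?thesis using assms(2)[of x] by (auto simp: real_differentiable_def)
  next
    case (Suc m)
    then have "(deriv ^^ n) f = (deriv ^^ m) g" by (simp add: funpow_swap1 d)
    then show ?thesis using assms(1) by (auto simp: test_function_def)
  qed
  then show ?thesis using compact_support_bounded[of a b f] assms(3) by (auto simp: test_function_def)
qed

text \<open>On \<open>(a, b)\<close> the value is \<open>exp (- 1 / (m (x - a)) - 1 / (m (b - x)))\<close> with \<open>m = n + 1\<close>, so
  the sequence increases to the indicator function of \<open>(a, b)\<close>: these functions are rich enough to
  test any locally integrable function.\<close>

definition bump :: "nat \<Rightarrow> real \<Rightarrow> real \<Rightarrow> real \<Rightarrow> real" where
  "bump n a b x = flat 1 (real (Suc n) * x + - (real (Suc n) * a)) * flat 1 (- real (Suc n) * x + real (Suc n) * b)"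

lemma smooth_family_bump: "smooth_family (bump n a b)"
  unfolding bump_def by (intro smooth_family.intros)

lemma bump_eq: "bump n a b x = (if a < x \<and> x < b then
   exp (- (1 / (real (Suc n) * (x - a)))) * exp (- (1 / (real (Suc n) * (b - x)))) else 0)"
proof -
  have "real (Suc n) * x + - (real (Suc n) * a) = real (Suc n) * (x - a)"
    "- real (Suc n) * x + real (Suc n) * b = real (Suc n) * (b - x)" by (simp_all add: algebra_simps)
  moreover have "0 < real (Suc n) * (x - a) \<longleftrightarrow> a < x" "0 < real (Suc n) * (b - x) \<longleftrightarrow> x < b"
    by (simp_all add: zero_less_mult_iff del: of_nat_Suc)
  ultimately show ?thesis unfolding bump_def flat_def by simp
qed

lemma bump_bounds: "0 \<le> bump n a b x" "bump n a b x \<le> indicator {a..b} x"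
proof -
  show "0 \<le> bump n a b x" by (simp add: bump_eq)
  show "bump n a b x \<le> indicator {a..b} x"
    by (auto simp: bump_eq simp del: of_nat_Suc intro!: mult_le_one)
qed

lemma bump_measurable[measurable]: "bump n a b \<in> borel_measurable borel"
  unfolding bump_eq[abs_def] by measurable

lemma bump_tendsto: "(\<lambda>n. bump n a b x) \<longlonglongrightarrow> indicator {a<..<b} x"
proof (cases "a < x \<and> x < b")
  case True
  have "(\<lambda>n. exp (- (inverse (real (Suc n)) * (1 / (x - a)))) * exp (- (inverse (real (Suc n)) * (1/ (b - x)))))
     \<longlonglongrightarrow> exp (- (0 * (1 / (x-a)))) * exp (- (0 * (1 / (b-x))))"
    by (intro tendsto_intros LIMSEQ_inverse_real_of_nat)
  then show ?thesis using True by (simp add: bump_eq field_simps)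
qed (auto simp: bump_eq)

text \<open>Dominated convergence along the bump functions, which are bounded by the indicator of \<open>[a,
  b]\<close>.\<close>

lemma set_integral_interval_of_test_zero:
  fixes h :: "real \<Rightarrow> real"
  assumes int: "\<And>a b. set_integrable lborel {a..b} h"
    and z: "\<And>n. (LINT x|lborel. h x * bump n a b x) = 0"
  shows "(LINT x|lborel. h x * indicator {a<..<b} x) = 0"
proof -
  have hm: "(\<lambda>x. h x) \<in> borel_measurable borel" if "\<And>a b. set_integrable lborel {a..b} h"
  proof (rule borel_measurable_LIMSEQ_real)
    show "(\<lambda>x. indicator {- real n..real n} x *\<^sub>R h x) \<in> borel_measurable borel" for n
      using int[of "- real n" "real n"] by (simp add: set_integrable_def integrable_iff_bounded)
    fix x :: real
    obtain N where N: "\<bar>x\<bar> \<le> real N" using real_arch_simple by blast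
    have "eventually (\<lambda>n. indicator {- real n..real n} x *\<^sub>R h x = h x) sequentially"
      using eventually_ge_at_top[of N] by eventually_elim (use N in \<open>auto simp: indicator_def\<close>)
    then show "(\<lambda>n. indicator {- real n..real n} x *\<^sub>R h x) \<longlonglongrightarrow> h x"
      by (rule tendsto_eventually)
  qed
  note [measurable] = hm[OF int]
  have "(\<lambda>n. LINT x|lborel. h x * bump n a b x) \<longlonglongrightarrow> (LINT x|lborel. h x * indicator {a<..<b} x)"
  proof (rule integral_dominated_convergence[where w = "\<lambda>x. norm (indicator {a..b} x *\<^sub>R h x)"])
    show "integrable lborel (\<lambda>x. norm (indicator {a..b} x *\<^sub>R h x))"
      using int[of a b] by (auto simp: set_integrable_def)
    show "AE x in lborel. (\<lambda>n. h x * bump n a b x) \<longlonglongrightarrow> h x * indicator {a<..<b} x"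
      by (auto intro!: tendsto_mult bump_tendsto)
    show "AE x in lborel. norm (h x * bump n a b x) \<le> norm (indicator {a..b} x *\<^sub>R h x)" for n
      using bump_bounds[of n a b] by (auto simp: abs_mult mult.commute[of "indicator _ _"] intro!: mult_left_mono AE_I2)
  qed measurable
  then show ?thesis using z by (simp add: LIMSEQ_const_iff)
qed

text \<open>The positive and the negative part of \<open>h\<close> are densities of two measures that agree on half
  lines, so they agree as measures and the densities coincide.\<close>

lemma AE_zero_of_interval_integrals:
  fixes h :: "real \<Rightarrow> real"
  assumes m[measurable]: "h \<in> borel_measurable borel"
    and int: "\<And>a b. set_integrable lborel {a..b} h"
    and z: "\<And>a b. a < b \<Longrightarrow> (LINT x|lborel. h x * indicator {a<..<b} x) = 0"
  shows "AE x in lborel. h x = 0"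
proof -
  have "AE x in lborel. x \<in> {- real n<..<real n} \<longrightarrow> h x = 0" for n :: nat
  proof -
    define I where "I = {- real n<..<real n}"
    have I[measurable]: "I \<in> sets borel" by (simp add: I_def)
    define f g where "f = (\<lambda>x. ennreal (max 0 (h x) * indicator I x))"
      and "g = (\<lambda>x. ennreal (max 0 (- h x) * indicator I x))"
    have [measurable]: "f \<in> borel_measurable borel" "g \<in> borel_measurable borel"
      by (auto simp: f_def g_def)
    have "density lborel f = density lborel g"
    proof (rule measure_eqI_lessThan)
      fix x :: real
      define J where "J = I \<inter> {x<..}"
      have [measurable]: "J \<in> sets borel" by (simp add: J_def)
      have Jn: "J \<subseteq> {- real n..real n}" by (auto simp: J_def I_def)
      have ij: "integrable lborel (\<lambda>x. h x * indicator J x)"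
        using set_integrable_subset[OF int[of "- real n" "real n"] _ Jn]
        by (simp add: set_integrable_def mult.commute)
      have ip: "integrable lborel (\<lambda>x. max 0 (h x) * indicator J x)"
        and im: "integrable lborel (\<lambda>x. max 0 (- h x) * indicator J x)"
        by (rule Bochner_Integration.integrable_bound[OF ij]; auto simp: indicator_def)+
      have ef: "emeasure (density lborel f) {x<..} = ennreal (LINT x|lborel. max 0 (h x) * indicator J x)"
        by (subst nn_integral_eq_integral[OF ip, symmetric])
           (auto simp: emeasure_density f_def J_def indicator_def intro!: nn_integral_cong)
      have eg: "emeasure (density lborel g) {x<..} = ennreal (LINT x|lborel. max 0 (- h x) * indicator J x)"
        by (subst nn_integral_eq_integral[OF im, symmetric])
           (auto simp: emeasure_density g_def J_def indicator_def intro!: nn_integral_cong)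
      have "(LINT x|lborel. h x * indicator J x) = 0"
      proof (cases "max x (- real n) < real n")
        case True
        have "J = {max x (- real n)<..<real n}" by (auto simp: J_def I_def)
        then show ?thesis using z[OF True] by simp
      next
        case False
        then have "J = {}" by (auto simp: J_def I_def)
        then show ?thesis by simp
      qed
      moreover have "(LINT x|lborel. h x * indicator J x) =
          (LINT x|lborel. max 0 (h x) * indicator J x) - (LINT x|lborel. max 0 (- h x) * indicator J x)"
        by (subst Bochner_Integration.integral_diff[OF ip im, symmetric])
           (auto intro!: Bochner_Integration.integral_cong simp: max_def)
      ultimately show "emeasure (density lborel f) {x<..} = emeasure (density lborel g) {x<..}"
        using ef eg by simp
      show "emeasure (density lborel f) {x<..} < \<infinity>" using ef by simp
    qed auto
    then have "AE x in lborel. f x = g x"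
      by (intro sigma_finite_measure.density_unique[OF sigma_finite_lborel]) auto
    then show ?thesis
      by eventually_elim (auto simp: f_def g_def I_def max_def indicator_def split: if_splits)
  qed
  then have "AE x in lborel. \<forall>n. x \<in> {- real n<..<real n} \<longrightarrow> h x = 0"
    by (rule AE_all_countable[THEN iffD2, rule_format])
  then show ?thesis
  proof eventually_elim
    case (elim x)
    obtain n :: nat where "\<bar>x\<bar> < real n" using reals_Archimedean2 by blast
    then show ?case using elim by (auto simp: abs_less_iff)
  qed
qed

section \<open>Primitives of locally integrable functions and weak derivatives\<close>

text \<open>Absolutely continuous functions, described by the integral of their derivative;
  integrability of \<open>g\<close> is part of the definition so that the integral is never a default value.\<close>

definition primitive :: "(real \<Rightarrow> real) \<Rightarrow> (real \<Rightarrow> real) \<Rightarrow> bool" where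
  "primitive F g \<longleftrightarrow> g \<in> borel_measurable borel \<and> (\<forall>a b. set_integrable lborel {a..b} g) \<and>
     (\<forall>a b. a \<le> b \<longrightarrow> F b - F a = (LINT y:{a..b}|lborel. g y))"

lemma primitiveD:
  assumes "primitive F g"
  shows "g \<in> borel_measurable borel" "set_integrable lborel {a..b} g"
    "a \<le> b \<Longrightarrow> F b - F a = (LINT y:{a..b}|lborel. g y)"
    "a \<le> b \<Longrightarrow> F b - F a = integral {a..b} g" "g integrable_on {a..b}"
  using assms set_borel_integral_eq_integral[of "{a..b}" g] by (auto simp: primitive_def)

lemma primitive_exists:
  assumes "g \<in> borel_measurable borel" "\<And>a b. set_integrable lborel {a..b} g"
  shows "\<exists>F. primitive F g"
proof -
  define F where "F x = integral {0..x} g - integral {x..0} g" for x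
  note io = set_borel_integral_eq_integral(1)[OF assms(2)]
  note e = set_borel_integral_eq_integral(2)[OF assms(2)]
  have c: "integral {a..c} g + integral {c..b} g = integral {a..b} g" if "a \<le> c" "c \<le> b" for a b c
    using Henstock_Kurzweil_Integration.integral_combine[OF that io] .
  have "F b - F a = integral {a..b} g" if ab: "a \<le> b" for a b
  proof -
    consider "0 \<le> a" | "b \<le> 0" | "a \<le> 0" "0 \<le> b" by linarith
    then show ?thesis
    proof cases
      case 1
      have "integral {a..0} g = 0" "integral {b..0} g = 0" using 1 ab
        by (cases "a = 0"; cases "b = 0"; auto)+
      then show ?thesis using c[of 0 a b] 1 ab by (simp add: F_def)
    next
      case 2
      have "integral {0..a} g = 0" "integral {0..b} g = 0" using 2 ab
        by (cases "a = 0"; cases "b = 0"; auto)+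
      then show ?thesis using c[of a b 0] 2 ab by (simp add: F_def)
    next
      case 3
      have "integral {0..a} g = 0" "integral {b..0} g = 0" using 3
        by (cases "a = 0"; cases "b = 0"; auto)+
      then show ?thesis using c[of a 0 b] 3 by (simp add: F_def)
    qed
  qed
  then show ?thesis using assms e unfolding primitive_def by metis
qed

lemma primitive_continuous:
  assumes F: "primitive F g"
  shows "continuous_on A F"
proof -
  have "isCont F x" for x
  proof -
    have "continuous_on {x-1..x+1} (\<lambda>y. F (x-1) + integral {x-1..y} g)"
      by (intro continuous_intros indefinite_integral_continuous_1 primitiveD(5)[OF F])
    moreover have "F (x-1) + integral {x-1..y} g = F y" if "y \<in> {x-1..x+1}" for y
      using primitiveD(4)[OF F, of "x-1" y] that by simp
    ultimately have "continuous_on {x-1..x+1} F" by (subst continuous_on_cong[OF refl, symmetric]) auto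
    then show ?thesis by (rule continuous_on_interior) (auto simp: interior_atLeastAtMost_real)
  qed
  then show ?thesis by (simp add: continuous_at_imp_continuous_on)
qed

lemma primitive_measurable:
  assumes F: "primitive F g" shows "F \<in> borel_measurable borel"
  using primitive_continuous[OF F] by (rule borel_measurable_continuous_onI)

lemma primitive_add:
  assumes "primitive F f" "primitive G g"
  shows "primitive (\<lambda>x. F x + G x) (\<lambda>x. f x + g x)"
  unfolding primitive_def
proof (intro conjI allI impI)
  show "(\<lambda>x. f x + g x) \<in> borel_measurable borel" using primitiveD(1)[OF assms(1)] primitiveD(1)[OF assms(2)] by simp
  show "set_integrable lborel {a..b} (\<lambda>x. f x + g x)" for a b
    using primitiveD(2)[OF assms(1), of a b] primitiveD(2)[OF assms(2), of a b] by (rule set_integral_add)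
  show "F b + G b - (F a + G a) = (LBINT y:{a..b}. f y + g y)" if "a \<le> b" for a b
    using set_integral_add(2)[OF primitiveD(2)[OF assms(1), of a b] primitiveD(2)[OF assms(2), of a b]]
      primitiveD(3)[OF assms(1) that] primitiveD(3)[OF assms(2) that] by simp
qed

lemma primitive_cmult:
  assumes "primitive F f"
  shows "primitive (\<lambda>x. c * F x) (\<lambda>x. c * f x)"
  unfolding primitive_def
proof (intro conjI allI impI)
  show "(\<lambda>x. c * f x) \<in> borel_measurable borel" using primitiveD(1)[OF assms(1)] by simp
  show "set_integrable lborel {a..b} (\<lambda>x. c * f x)" for a b
    using primitiveD(2)[OF assms(1), of a b] by simp
  show "c * F b - c * F a = (LBINT y:{a..b}. c * f y)" if "a \<le> b" for a b
    using primitiveD(3)[OF assms that] by (simp add: right_diff_distrib[symmetric])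
qed

lemma primitive_add_const: "primitive F f \<Longrightarrow> primitive (\<lambda>x. F x + c) f"
  by (simp add: primitive_def)

lemma continuous_interval_bounded:
  fixes f :: "real \<Rightarrow> real"
  assumes "continuous_on {a..b} f"
  obtains M where "0 \<le> M" "\<And>x. a \<le> x \<Longrightarrow> x \<le> b \<Longrightarrow> \<bar>f x\<bar> \<le> M"
proof -
  have "bounded (f ` {a..b})" using compact_continuous_image[OF assms] compact_imp_bounded by blast
  then obtain M where "\<And>x. x \<in> {a..b} \<Longrightarrow> \<bar>f x\<bar> \<le> M" unfolding bounded_iff by (metis imageI real_norm_def)
  then show ?thesis by (intro that[of "max 0 M"]) (auto simp: le_max_iff_disj)
qed

text \<open>Fubini on the triangle \<open>a \<le> z \<le> y \<le> b\<close>: \<open>\<phi> y - \<phi> a\<close> is the integral of \<open>\<phi>'\<close> and \<open>F b - F z\<close>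
  that of \<open>g\<close>. The rule serves both the weak derivative and the passage from \<open>L\<^sup>2\<close> velocities to
  continuous data in the cone integrals.\<close>

lemma integration_by_parts_primitive:
  assumes F: "primitive F g" and ab: "a \<le> b"
    and d: "\<And>x. (\<phi> has_real_derivative \<phi>' x) (at x)"
    and c: "continuous_on UNIV \<phi>'"
  shows "(LINT y:{a..b}|lborel. \<phi> y * g y) =
    \<phi> b * F b - \<phi> a * F a - (LINT y:{a..b}|lborel. \<phi>' y * F y)"
proof -
  note [measurable] = primitiveD(1)[OF F]
  have cA: "continuous_on A \<phi>'" for A using c continuous_on_subset by blast
  have [measurable]: "\<phi>' \<in> borel_measurable borel" using c by (rule borel_measurable_continuous_onI)
  have cp: "continuous_on A \<phi>" for A
    by (meson d DERIV_isCont continuous_at_imp_continuous_on)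
  have [measurable]: "\<phi> \<in> borel_measurable borel" using cp by (rule borel_measurable_continuous_onI)
  obtain M where M: "\<And>x. x \<in> {a..b} \<Longrightarrow> \<bar>\<phi>' x\<bar> \<le> M"
    using continuous_interval_bounded[OF cA] by (metis atLeastAtMost_iff)
  then have M0: "M \<ge> 0" using ab by force
  define k where "k y z = (indicator {a..b} y * g y) * (indicator {a..y} z * \<phi>' z)" for y z :: real
  have gi: "integrable lborel (\<lambda>y. indicator {a..b} y * g y)"
    using primitiveD(2)[OF F, of a b] by (simp add: set_integrable_def)
  have pi: "integrable lborel (\<lambda>z. indicator {a..y} z * \<phi>' z)" for y
    using borel_integrable_atLeastAtMost'[OF cA, of a y] by (simp add: set_integrable_def)
  have [measurable]: "case_prod k \<in> borel_measurable (lborel \<Otimes>\<^sub>M lborel)"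
  proof -
    have "case_prod k = (\<lambda>(y, z). (indicator {a..b} y * g y) * ((if a \<le> z \<and> z \<le> y then 1 else 0) * \<phi>' z))"
      by (auto simp: k_def indicator_def fun_eq_iff)
    also have "\<dots> \<in> borel_measurable (lborel \<Otimes>\<^sub>M lborel)" by measurable
    finally show ?thesis .
  qed
  have fi: "integrable (lborel \<Otimes>\<^sub>M lborel) (case_prod k)"
  proof (rule lborel_pair.Fubini_integrable)
    show "AE x in lborel. integrable lborel (\<lambda>y. case_prod k (x, y))"
      using pi by (auto simp: k_def)
    show "integrable lborel (\<lambda>x. LINT y|lborel. norm (case_prod k (x, y)))"
    proof (rule Bochner_Integration.integrable_bound[OF integrable_mult_left[OF gi, of "M * (b - a)"]])
      show "AE x in lborel. norm (LINT y|lborel. norm (case_prod k (x, y))) \<le> norm (indicator {a..b} x * g x * (M * (b - a)))"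
      proof (rule AE_I2)
        fix y :: real
        have "(LINT z|lborel. norm (case_prod k (y, z))) = \<bar>indicator {a..b} y * g y\<bar> * (LINT z|lborel. \<bar>indicator {a..y} z * \<phi>' z\<bar>)"
          by (simp add: k_def abs_mult)
        moreover have "(LINT z|lborel. \<bar>indicator {a..y} z * \<phi>' z\<bar>) \<le> M * (b - a)" if y: "y \<in> {a..b}"
        proof -
          have "(LINT z|lborel. \<bar>indicator {a..y} z * \<phi>' z\<bar>) \<le> (LINT z|lborel. indicator {a..b} z * M)"
                  proof (rule integral_mono)
              show "integrable lborel (\<lambda>z. indicator {a..b} z * M)"
                by (auto simp: emeasure_lborel_Icc_eq)
            qed (use y M M0 pi in \<open>auto simp: indicator_def\<close>)
          also have "\<dots> = M * (b - a)" using ab by simp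
          finally show ?thesis .
        qed
        ultimately show "norm (LINT z|lborel. norm (case_prod k (y, z))) \<le> norm (indicator {a..b} y * g y * (M * (b - a)))"
          using M0 ab by (cases "y \<in> {a..b}") (auto simp: abs_mult intro!: mult_left_mono)
      qed
    qed (measurable)
  qed (measurable)
  have fub: "(LINT z|lborel. LINT y|lborel. k y z) = (LINT y|lborel. LINT z|lborel. k y z)"
    by (rule lborel_pair.Fubini_integral[OF fi])
  have "(LINT y|lborel. LINT z|lborel. k y z) = (LINT y|lborel. (indicator {a..b} y * g y) * (\<phi> y - \<phi> a))"
  proof (rule Bochner_Integration.integral_cong[OF refl])
    fix y :: real
    have "(LINT z|lborel. indicator {a..y} z * \<phi>' z) = \<phi> y - \<phi> a" if "a \<le> y"
      using integral_FTC_atLeastAtMost[OF that, of \<phi> \<phi>'] d cA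
      by (auto simp: has_real_derivative_iff_has_vector_derivative[symmetric] intro: has_field_derivative_at_within)
    then show "(LINT z|lborel. k y z) = (indicator {a..b} y * g y) * (\<phi> y - \<phi> a)"
      by (auto simp: k_def indicator_def)
  qed
  also have "\<dots> = (LINT y:{a..b}|lborel. \<phi> y * g y) - \<phi> a * (F b - F a)"
  proof -
    obtain K where K: "\<And>x. x \<in> {a..b} \<Longrightarrow> \<bar>\<phi> x\<bar> \<le> K"
      using continuous_interval_bounded[OF cp] by (metis atLeastAtMost_iff)
    have "integrable lborel (\<lambda>y. indicator {a..b} y * g y * \<phi> y)"
      using K by (intro Bochner_Integration.integrable_bound[OF integrable_mult_left[OF gi, of K]])
        (auto simp: abs_mult indicator_def intro!: mult_left_mono order_trans[OF K] AE_I2)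
    moreover have "(LINT y|lborel. (indicator {a..b} y * g y) * (\<phi> y - \<phi> a)) =
        (LINT y|lborel. indicator {a..b} y * g y * \<phi> y - \<phi> a * (indicator {a..b} y * g y))"
      by (simp add: algebra_simps)
    ultimately show ?thesis using gi primitiveD(3)[OF F ab]
      by (simp add: set_lebesgue_integral_def mult_ac)
  qed
  finally have 1: "(LINT y|lborel. LINT z|lborel. k y z) = (LINT y:{a..b}|lborel. \<phi> y * g y) - \<phi> a * (F b - F a)" .
  have "(LINT z|lborel. LINT y|lborel. k y z) = (LINT z|lborel. (indicator {a..b} z * \<phi>' z) * (F b - F z))"
  proof (rule Bochner_Integration.integral_cong[OF refl])
    fix z :: real
    have "(LINT y|lborel. indicator {z..b} y * g y) = F b - F z" if "z \<le> b"
      using primitiveD(3)[OF F that] by (simp add: set_lebesgue_integral_def)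
    moreover have "k y z = (indicator {a..b} z * \<phi>' z) * (indicator {z..b} y * g y)" for y
      by (auto simp: k_def indicator_def)
    ultimately show "(LINT y|lborel. k y z) = (indicator {a..b} z * \<phi>' z) * (F b - F z)"
      by (auto simp: indicator_def)
  qed
  also have "\<dots> = (\<phi> b - \<phi> a) * F b - (LINT y:{a..b}|lborel. \<phi>' y * F y)"
  proof -
    have "(LINT z|lborel. indicator {a..b} z * \<phi>' z) = \<phi> b - \<phi> a"
      using integral_FTC_atLeastAtMost[OF ab, of \<phi> \<phi>'] d cA
      by (auto simp: has_real_derivative_iff_has_vector_derivative[symmetric] intro: has_field_derivative_at_within)
    moreover have "integrable lborel (\<lambda>z. indicator {a..b} z * (\<phi>' z * F z))"
      using borel_integrable_atLeastAtMost'[OF continuous_on_mult[OF cA primitive_continuous[OF F]], of a b]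
      by (simp add: set_integrable_def)
    moreover have "(LINT z|lborel. (indicator {a..b} z * \<phi>' z) * (F b - F z)) =
        (LINT z|lborel. F b * (indicator {a..b} z * \<phi>' z) - indicator {a..b} z * (\<phi>' z * F z))"
      by (simp add: algebra_simps)
    ultimately show ?thesis using pi[of b]
      by (simp add: set_lebesgue_integral_def mult_ac)
  qed
  finally show ?thesis using 1 fub by (simp add: algebra_simps)
qed

lemma Lp2_iff: "f \<in> Lp 2 \<longleftrightarrow> f \<in> borel_measurable borel \<and> integrable lborel (\<lambda>x. (f x)\<^sup>2)"
  by (simp add: Lp_def powr_numeral)

lemma Lp_norm2_eq: "Lp_norm 2 f = sqrt (LINT x|lborel. (f x)\<^sup>2)"
  by (simp add: Lp_norm_def powr_numeral powr_half_sqrt)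

lemma abs_le_square_plus_1: "\<bar>x::real\<bar> \<le> x\<^sup>2 + 1"
proof -
  have "0 \<le> (\<bar>x\<bar> - 1/2)\<^sup>2" by simp
  then show ?thesis by (simp add: power2_eq_square algebra_simps)
qed

lemma Lp2_set_integrable:
  assumes "f \<in> Lp 2" shows "set_integrable lborel {a..b} f"
  unfolding set_integrable_def
proof (rule Bochner_Integration.integrable_bound)
  show "integrable lborel (\<lambda>x. (f x)\<^sup>2 + indicator {a..b} x)"
    using assms by (intro Bochner_Integration.integrable_add) (auto simp: Lp2_iff emeasure_lborel_Icc_eq)
  show "AE x in lborel. norm (indicator {a..b} x *\<^sub>R f x) \<le> norm ((f x)\<^sup>2 + indicator {a..b} x)"
    using abs_le_square_plus_1[of "f _"] by (auto simp: indicator_def)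
qed (use assms in \<open>auto simp: Lp2_iff\<close>)

lemma test_functionD:
  assumes "test_function \<phi>"
  shows "(\<phi> has_real_derivative deriv \<phi> x) (at x)" "continuous_on UNIV (deriv \<phi>)"
proof -
  have "(deriv ^^ 0) \<phi> differentiable (at x)" "(deriv ^^ 1) \<phi> differentiable (at x)" for x
    using assms unfolding test_function_def by blast+
  then have 1: "\<phi> differentiable at x" "deriv \<phi> differentiable (at x)" for x by simp_all
  show "(\<phi> has_real_derivative deriv \<phi> x) (at x)"
    using 1(1) by (simp add: DERIV_deriv_iff_real_differentiable)
  show "continuous_on UNIV (deriv \<phi>)"
    using 1(2) by (meson continuous_at_imp_continuous_on differentiable_imp_continuous_within)
qed

text \<open>A primitive that vanishes outside \<open>(-L, L)\<close> produces no boundary terms, so cutting its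
  derivative off at \<open>L\<close> gives the weak derivative even though \<open>g\<close> need not be square integrable on
  the whole line.\<close>

lemma weak_deriv_primitive:
  assumes F: "primitive F g" and L: "0 \<le> L" and z: "\<And>x. L \<le> \<bar>x\<bar> \<Longrightarrow> F x = 0"
  shows "weak_deriv F (\<lambda>x. indicator {-L..L} x * g x)"
  unfolding weak_deriv_def
proof (intro allI impI)
  fix \<phi> assume t: "test_function \<phi>"
  have "(LINT y:{-L..L}|lborel. \<phi> y * g y) = - (LINT y:{-L..L}|lborel. deriv \<phi> y * F y)"
    using integration_by_parts_primitive[OF F, of "-L" L \<phi> "deriv \<phi>"] test_functionD[OF t] L z[of L] z[of "-L"] by simp
  moreover have "(LINT y:{-L..L}|lborel. deriv \<phi> y * F y) = (LINT x|lborel. F x * deriv \<phi> x)"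
    unfolding set_lebesgue_integral_def
    by (rule Bochner_Integration.integral_cong) (auto simp: indicator_def intro!: z)
  ultimately show "(LINT x|lborel. F x * deriv \<phi> x) = - (LINT x|lborel. indicator {-L..L} x * g x * \<phi> x)"
    by (simp add: set_lebesgue_integral_def mult_ac)
qed

lemma integrable_mult_compact_support:
  fixes f \<phi> :: "real \<Rightarrow> real"
  assumes f: "set_integrable lborel {a..b} f" and c: "continuous_on UNIV \<phi>"
    and z: "\<And>x. x \<notin> {a..b} \<Longrightarrow> \<phi> x = 0"
  shows "integrable lborel (\<lambda>x. f x * \<phi> x)"
proof -
  obtain M where M: "0 \<le> M" "\<And>x. a \<le> x \<Longrightarrow> x \<le> b \<Longrightarrow> \<bar>\<phi> x\<bar> \<le> M"
    using continuous_interval_bounded[of a b \<phi>] continuous_on_subset[OF c] by blast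
  have [measurable]: "\<phi> \<in> borel_measurable borel" using c by (rule borel_measurable_continuous_onI)
  have eq: "(\<lambda>x. f x * \<phi> x) = (\<lambda>x. (indicator {a..b} x *\<^sub>R f x) * \<phi> x)"
    using z by (auto simp: fun_eq_iff indicator_def)
  have [measurable]: "(\<lambda>x. indicator {a..b} x *\<^sub>R f x) \<in> borel_measurable borel"
    using f by (auto simp: set_integrable_def)
  show ?thesis
    unfolding eq
  proof (rule Bochner_Integration.integrable_bound)
    show "integrable lborel (\<lambda>x. (indicator {a..b} x *\<^sub>R f x) * M)"
      using f by (auto simp: set_integrable_def)
    show "AE x in lborel. norm (indicator {a..b} x *\<^sub>R f x * \<phi> x) \<le> norm (indicator {a..b} x *\<^sub>R f x * M)"
      using M by (auto simp: indicator_def abs_mult intro!: mult_left_mono)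
  qed measurable
qed

lemma bump_continuous: "continuous_on A (bump n a b)"
  using smooth_family_derivative[OF smooth_family_bump]
  by (metis DERIV_isCont continuous_at_imp_continuous_on)

lemma bump_zero: "x \<notin> {a..b} \<Longrightarrow> bump n a b x = 0"
  by (auto simp: bump_eq)

lemma test_function_bump: "test_function (bump n a b)"
  by (rule test_function_smooth_family[OF smooth_family_bump, of a b]) (rule bump_zero)

lemma bump_integral_pos: assumes "a < b" shows "0 < (LINT x|lborel. bump n a b x)"
proof -
  have "integrable lborel (\<lambda>x. 1 * bump n a b x)"
    by (rule integrable_mult_compact_support[where a=a and b=b])
       (auto simp: bump_zero bump_continuous set_integrable_def emeasure_lborel_Icc_eq)
  then have i: "integrable lborel (bump n a b)" by simp
  have "(LINT x|lborel. bump n a b x) \<noteq> 0"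
  proof
    assume "(LINT x|lborel. bump n a b x) = 0"
    then have "AE x in lborel. bump n a b x = 0"
      using integral_nonneg_eq_0_iff_AE[OF i] bump_bounds(1) by simp
    then have "AE x in lborel. x \<notin> {a<..<b}"
      by eventually_elim (auto simp: bump_eq)
    then have "emeasure lborel {a<..<b} = 0"
      by (subst (asm) AE_iff_measurable[where N="{a<..<b}"]) auto
    then show False using assms by simp
  qed
  moreover have "0 \<le> (LINT x|lborel. bump n a b x)" using bump_bounds(1) by (simp add: integral_nonneg_AE)
  ultimately show ?thesis by simp
qed

text \<open>Du Bois-Reymond's argument: a test function of mean zero is the derivative of a test
  function, so \<open>h\<close> minus its mean against a fixed bump is orthogonal to every bump.\<close>

lemma weak_deriv_zero_const:
  assumes h: "h \<in> borel_measurable borel" "\<And>a b. set_integrable lborel {a..b} h"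
    and z: "\<And>\<phi>. test_function \<phi> \<Longrightarrow> (LINT x|lborel. h x * deriv \<phi> x) = 0"
  shows "\<exists>c. AE x in lborel. h x = c"
proof -
  define \<beta> where "\<beta> = bump 0 0 1"
  define I where "I = (LINT x|lborel. \<beta> x)"
  have I: "I > 0" unfolding I_def \<beta>_def by (rule bump_integral_pos) simp
  (* the only possible value of the constant, read off from the fixed bump *)
  define c where "c = (LINT x|lborel. h x * \<beta> x) / I"
  have chi_c: "continuous_on A \<beta>" for A by (simp add: \<beta>_def bump_continuous)
  have hi: "integrable lborel (\<lambda>x. h x * bump n a b x)" for n a b
    by (rule integrable_mult_compact_support[OF h(2) bump_continuous bump_zero])
  have bi: "integrable lborel (bump n a b)" for n a b
  proof -
    have "integrable lborel (\<lambda>x. 1 * bump n a b x)"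
      by (rule integrable_mult_compact_support[where a=a and b=b])
         (auto simp: bump_zero bump_continuous set_integrable_def emeasure_lborel_Icc_eq)
    then show ?thesis by simp
  qed
  have "AE x in lborel. h x - c = 0"
  proof (rule AE_zero_of_interval_integrals)
    show "(\<lambda>x. h x - c) \<in> borel_measurable borel" using h(1) by simp
    show si: "set_integrable lborel {a..b} (\<lambda>x. h x - c)" for a b
      using h(2)[of a b] by (intro set_integral_diff) (auto simp: set_integrable_def emeasure_lborel_Icc_eq)
    fix a b :: real assume ab: "a < b"
    show "(LINT x|lborel. (h x - c) * indicator {a<..<b} x) = 0"
    proof (rule set_integral_interval_of_test_zero[OF si])
      fix n
      define J where "J = (LINT x|lborel. bump n a b x)"
      define \<psi> where "\<psi> x = bump n a b x + (- J / I) * \<beta> x" for x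
      define A B where "A = min a 0 - 1" and "B = max b 1"
      have \<psi>s: "smooth_family \<psi>" unfolding \<psi>_def \<beta>_def by (intro smooth_family.intros smooth_family_bump)
      have \<psi>z: "\<psi> x = 0" if "x \<notin> {A+1..B}" for x
      proof -
        have "bump n a b x = 0" "\<beta> x = 0"
          unfolding \<beta>_def by (rule bump_zero; use that in \<open>auto simp: A_def B_def\<close>)+
        then show ?thesis by (simp add: \<psi>_def)
      qed
      have \<psi>t: "test_function \<psi>" using \<psi>s \<psi>z by (rule test_function_smooth_family)
      have \<psi>c: "continuous_on X \<psi>" for X
        unfolding \<psi>_def by (intro continuous_intros bump_continuous chi_c)
      have \<psi>I: "(LINT x|lborel. \<psi> x) = 0"
        using I bi[of n a b] bi[of 0 0 1] by (simp add: \<psi>_def J_def I_def \<beta>_def)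
      define \<phi> where "\<phi> x = integral {A..x} \<psi>" for x
      have AB: "A < B" "A + 1 < B" using ab by (auto simp: A_def B_def)
      have int0: "integral {A..x} \<psi> = 0" if "x \<ge> B" for x
      proof -
        have "(LINT y:{A..x}|lborel. \<psi> y) = (LINT y|lborel. \<psi> y)"
          unfolding set_lebesgue_integral_def
        proof (rule Bochner_Integration.integral_cong[OF refl])
          fix y show "indicator {A..x} y *\<^sub>R \<psi> y = \<psi> y"
            using \<psi>z[of y] that by (cases "y \<in> {A+1..B}") (auto simp: indicator_def)
        qed
        then show ?thesis
          using \<psi>I set_borel_integral_eq_integral(2)[OF borel_integrable_atLeastAtMost'[OF \<psi>c], of A x] by simp
      qed
      have \<phi>0: "\<phi> x = 0" if "x < A + 1" for x
      proof -
        have "integral {A..x} \<psi> = integral {A..x} (\<lambda>x. 0)"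
          by (rule integral_cong) (use that \<psi>z in auto)
        then show ?thesis by (simp add: \<phi>_def)
      qed
      have d: "(\<phi> has_real_derivative \<psi> x) (at x)" for x
      proof (cases "x > A")
        case True
        have "((\<lambda>u. integral {A..u} \<psi>) has_real_derivative \<psi> x) (at x within {A..x+1})"
          using True by (intro integral_has_real_derivative \<psi>c) auto
        then have "(\<phi> has_real_derivative \<psi> x) (at x within {A<..<x+1})"
          unfolding \<phi>_def[abs_def] by (rule DERIV_subset) auto
        then show ?thesis using True by (subst (asm) at_within_open) auto
      next
        case False
        have "((\<lambda>x. 0) has_real_derivative \<psi> x) (at x)" using False \<psi>z[of x] by simp
        then show ?thesis
          by (rule has_field_derivative_transform_within_open[where S="{..<A+1}"]) (use False \<phi>0 in auto)
      qed
      have "test_function \<phi>"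
      proof (rule test_function_antideriv[OF \<psi>t d])
        fix x assume "x \<notin> {A..B}"
        then show "\<phi> x = 0" using \<phi>0[of x] int0[of x] by (auto simp: \<phi>_def)
      qed
      from z[OF this] have "(LINT x|lborel. h x * \<psi> x) = 0"
        using DERIV_imp_deriv[OF d] by simp
      moreover have "(LINT x|lborel. h x * \<psi> x) = (LINT x|lborel. h x * bump n a b x + (- J / I) * (h x * \<beta> x))"
        by (simp add: \<psi>_def algebra_simps)
      moreover have "\<dots> = (LINT x|lborel. h x * bump n a b x) + (- J / I) * (LINT x|lborel. h x * \<beta> x)"
        using hi[of 0 0 1] by (subst Bochner_Integration.integral_add[OF hi]) (auto simp: \<beta>_def)
      moreover have "(LINT x|lborel. (h x - c) * bump n a b x) = (LINT x|lborel. h x * bump n a b x) - c * J"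
        using hi[of n a b] bi[of n a b] by (simp add: left_diff_distrib J_def)
      ultimately show "(LINT x|lborel. (h x - c) * bump n a b x) = 0"
        by (simp add: c_def)
    qed
  qed
  then show ?thesis by (intro exI[of _ c]) simp
qed

lemma test_function_compact_support:
  assumes "test_function \<phi>"
  obtains a b where "\<And>x. x \<notin> {a..b} \<Longrightarrow> \<phi> x = 0" "\<And>x. x \<notin> {a..b} \<Longrightarrow> deriv \<phi> x = 0" "a \<le> b"
proof -
  have "bounded {x. \<phi> x \<noteq> 0}"
    using assms by (auto simp: test_function_def intro: bounded_subset[OF compact_imp_bounded closure_subset])
  then obtain r where r: "\<And>x. \<phi> x \<noteq> 0 \<Longrightarrow> \<bar>x\<bar> \<le> r" by (auto simp: bounded_iff)
  have z: "\<phi> x = 0" if "x \<notin> {-\<bar>r\<bar>..\<bar>r\<bar>}" for x using r[of x] that by fastforce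
  have "deriv \<phi> x = 0" if "x \<notin> {-\<bar>r\<bar>..\<bar>r\<bar>}" for x
  proof -
    have "((\<lambda>x. 0) has_real_derivative 0) (at x)" by simp
    then have "(\<phi> has_real_derivative 0) (at x)"
      by (rule has_field_derivative_transform_within_open[where S="- {-\<bar>r\<bar>..\<bar>r\<bar>}"]) (use that z in auto)
    then show ?thesis by (rule DERIV_imp_deriv)
  qed
  then show ?thesis using z that[of "-\<bar>r\<bar>" "\<bar>r\<bar>"] by auto
qed

text \<open>Converse of the previous computation: subtracting a primitive of \<open>g\<close> leaves a function with
  weak derivative zero. It supplies the continuous representative of an \<open>H\<^sup>1\<close> function.\<close>

lemma weak_deriv_imp_primitive:
  assumes f: "f \<in> Lp 2" and g: "g \<in> Lp 2" and w: "weak_deriv f g"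
  shows "\<exists>F. primitive F g \<and> (AE x in lborel. f x = F x)"
proof -
  obtain P where P: "primitive P g"
    using primitive_exists[of g] g Lp2_set_integrable[OF g] by (auto simp: Lp2_iff)
  have Pi: "set_integrable lborel {a..b} P" for a b
    by (rule borel_integrable_atLeastAtMost'[OF primitive_continuous[OF P]])
  have "\<exists>c. AE x in lborel. f x - P x = c"
  proof (rule weak_deriv_zero_const)
    show "(\<lambda>x. f x - P x) \<in> borel_measurable borel"
      using f primitive_measurable[OF P] by (auto simp: Lp2_iff)
    show "set_integrable lborel {a..b} (\<lambda>x. f x - P x)" for a b
      using Lp2_set_integrable[OF f] Pi by (rule set_integral_diff)
    fix \<phi> assume t: "test_function \<phi>"
    obtain a b where ab: "\<And>x. x \<notin> {a..b} \<Longrightarrow> \<phi> x = 0" "\<And>x. x \<notin> {a..b} \<Longrightarrow> deriv \<phi> x = 0" "a \<le> b"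
      using test_function_compact_support[OF t] by blast
    note d = test_functionD[OF t]
    have fi: "integrable lborel (\<lambda>x. f x * deriv \<phi> x)"
      by (rule integrable_mult_compact_support[OF Lp2_set_integrable[OF f] d(2) ab(2)])
    have pi: "integrable lborel (\<lambda>x. P x * deriv \<phi> x)"
      by (rule integrable_mult_compact_support[OF Pi d(2) ab(2)])
    have "\<phi> (a - 1) = 0" "\<phi> (b + 1) = 0" using ab by auto
    then have "(LINT y:{a-1..b+1}|lborel. \<phi> y * g y) = - (LINT y:{a-1..b+1}|lborel. deriv \<phi> y * P y)"
      using integration_by_parts_primitive[OF P, of "a-1" "b+1" \<phi> "deriv \<phi>"] d ab(3) by simp
    moreover have "(LINT y:{a-1..b+1}|lborel. \<phi> y * g y) = (LINT x|lborel. g x * \<phi> x)"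
      unfolding set_lebesgue_integral_def
      by (rule Bochner_Integration.integral_cong) (auto simp: indicator_def intro!: ab)
    moreover have "(LINT y:{a-1..b+1}|lborel. deriv \<phi> y * P y) = (LINT x|lborel. P x * deriv \<phi> x)"
      unfolding set_lebesgue_integral_def
      by (rule Bochner_Integration.integral_cong) (auto simp: indicator_def intro!: ab)
    ultimately show "(LINT x|lborel. (f x - P x) * deriv \<phi> x) = 0"
      using w t fi pi by (simp add: weak_deriv_def left_diff_distrib)
  qed
  then obtain c where "AE x in lborel. f x - P x = c" by blast
  then have "AE x in lborel. f x = P x + c" by eventually_elim simp
  then show ?thesis using primitive_add_const[OF P] by blast
qed

text \<open>The difference of the two candidates is orthogonal to every bump function.\<close>

lemma weak_deriv_unique:
  assumes g: "g1 \<in> Lp 2" "g2 \<in> Lp 2" and w: "weak_deriv f g1" "weak_deriv f g2"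
  shows "AE x in lborel. g1 x = g2 x"
proof -
  note i = Lp2_set_integrable[OF g(1)] Lp2_set_integrable[OF g(2)]
  have "AE x in lborel. g1 x - g2 x = 0"
  proof (rule AE_zero_of_interval_integrals)
    show "(\<lambda>x. g1 x - g2 x) \<in> borel_measurable borel" using g by (auto simp: Lp2_iff)
    show si: "set_integrable lborel {a..b} (\<lambda>x. g1 x - g2 x)" for a b
      using i by (rule set_integral_diff)
    fix a b :: real
    show "(LINT x|lborel. (g1 x - g2 x) * indicator {a<..<b} x) = 0"
    proof (rule set_integral_interval_of_test_zero[OF si])
      fix n
      have j: "integrable lborel (\<lambda>x. g1 x * bump n a b x)" "integrable lborel (\<lambda>x. g2 x * bump n a b x)"
        using integrable_mult_compact_support[OF i(1) bump_continuous bump_zero]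
          integrable_mult_compact_support[OF i(2) bump_continuous bump_zero] by blast+
      have "(LINT x|lborel. g1 x * bump n a b x) = (LINT x|lborel. g2 x * bump n a b x)"
        using w test_function_bump[of n a b] by (auto simp: weak_deriv_def)
      then show "(LINT x|lborel. (g1 x - g2 x) * bump n a b x) = 0"
        using j by (simp add: left_diff_distrib)
    qed
  qed
  then show ?thesis by eventually_elim simp
qed

text \<open>Frees the norm from the choice operator in its definition.\<close>

lemma H1_norm_eq:
  assumes "f \<in> Lp 2" "g \<in> Lp 2" "weak_deriv f g"
  shows "H1_norm f = sqrt ((LINT x|lborel. (f x)\<^sup>2) + (LINT x|lborel. (g x)\<^sup>2))"
proof -
  define g' where "g' = (SOME g. g \<in> Lp 2 \<and> weak_deriv f g)"
  have g': "g' \<in> Lp 2" "weak_deriv f g'"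
    using someI[of "\<lambda>g. g \<in> Lp 2 \<and> weak_deriv f g" g] assms by (auto simp: g'_def)
  have "AE x in lborel. g' x = g x" by (rule weak_deriv_unique[OF g'(1) assms(2) g'(2) assms(3)])
  then have "(LINT x|lborel. (g' x)\<^sup>2) = (LINT x|lborel. (g x)\<^sup>2)"
    using g' assms(2) by (intro integral_cong_AE) (auto simp: Lp2_iff)
  moreover have "0 \<le> (LINT x|lborel. (g x)\<^sup>2)" "0 \<le> (LINT x|lborel. (f x)\<^sup>2)" by simp_all
  ultimately show ?thesis
    unfolding H1_norm_def g'_def[symmetric] Lp_norm2_eq by simp
qed

lemma unit_interval_Cauchy_Schwarz:
  assumes "g \<in> Lp 2"
  shows "(LINT y:{a..a+1}|lborel. \<bar>g y\<bar>) \<le> sqrt (LINT x|lborel. (g x)\<^sup>2)"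
proof -
  define s where "s = (LINT y:{a..a+1}|lborel. \<bar>g y\<bar>)"
  have 1: "integrable lborel (\<lambda>y. indicator {a..a+1} y * \<bar>g y\<bar>)"
    using set_integrable_abs[OF Lp2_set_integrable[OF assms, of a "a+1"]]
    unfolding set_integrable_def real_scaleR_def .
  have 2: "integrable lborel (\<lambda>y. indicator {a..a+1} y * (g y)\<^sup>2)"
  proof (rule Bochner_Integration.integrable_bound)
    show "integrable lborel (\<lambda>y. (g y)\<^sup>2)" using assms by (simp add: Lp2_iff)
    have [measurable]: "g \<in> borel_measurable borel" using assms by (simp add: Lp2_iff)
    show "(\<lambda>y. indicator {a..a+1} y * (g y)\<^sup>2) \<in> borel_measurable lborel" by measurable
    show "AE y in lborel. norm (indicator {a..a+1} y * (g y)\<^sup>2) \<le> norm ((g y)\<^sup>2)"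
      by (rule AE_I2) (simp add: indicator_def)
  qed
  have 3: "integrable lborel (\<lambda>y. indicator {a..a+1} y * (s\<^sup>2))"
    by (auto simp: emeasure_lborel_Icc_eq)
  have "0 \<le> (LINT y|lborel. indicator {a..a+1} y * (\<bar>g y\<bar> - s)\<^sup>2)"
    by (intro integral_nonneg_AE AE_I2) auto
  also have "\<dots> = (LINT y|lborel. indicator {a..a+1} y * (g y)\<^sup>2 - 2 * s * (indicator {a..a+1} y * \<bar>g y\<bar>) + indicator {a..a+1} y * s\<^sup>2)"
    by (rule Bochner_Integration.integral_cong) (auto simp: indicator_def power2_diff)
  also have "\<dots> = (LINT y|lborel. indicator {a..a+1} y * (g y)\<^sup>2) - 2 * s * s + s\<^sup>2"
  proof -
    have 4: "(LINT y|lborel. indicator {a..a+1} y * s\<^sup>2) = s\<^sup>2" by simp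
    have 5: "(LINT y|lborel. 2 * s * (indicator {a..a+1} y * \<bar>g y\<bar>)) = 2 * s * s"
      by (subst integral_mult_right_zero) (simp add: s_def set_lebesgue_integral_def)
    show ?thesis
      by (subst Bochner_Integration.integral_add, rule Bochner_Integration.integrable_diff[OF 2 integrable_mult_right[OF 1]], rule 3,
          subst Bochner_Integration.integral_diff[OF 2 integrable_mult_right[OF 1]], simp only: 4 5)
  qed
  finally have "s\<^sup>2 \<le> (LINT y|lborel. indicator {a..a+1} y * (g y)\<^sup>2)" by (simp add: power2_eq_square)
  also have "\<dots> \<le> (LINT y|lborel. (g y)\<^sup>2)"
    using assms 2 by (intro integral_mono) (auto simp: Lp2_iff indicator_def)
  finally show ?thesis unfolding s_def[symmetric] by (rule real_le_rsqrt)
qed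

text \<open>Averaging \<open>\<bar>F x\<bar> \<le> \<bar>F y\<bar> + \<integral>\<bar>g\<bar>\<close> over \<open>y\<close> in an interval of length one and using the
  Cauchy-Schwarz inequality there.\<close>

lemma sobolev_bound:
  assumes P: "primitive F g" and F: "F \<in> Lp 2" and g: "g \<in> Lp 2"
  shows "\<bar>F x\<bar> \<le> sqrt (LINT x|lborel. (F x)\<^sup>2) + sqrt (LINT x|lborel. (g x)\<^sup>2)"
proof -
  define G where "G = (LINT y:{x..x+1}|lborel. \<bar>g y\<bar>)"
  have gi: "set_integrable lborel {a..b} (\<lambda>y. \<bar>g y\<bar>)" for a b
    using set_integrable_abs[OF Lp2_set_integrable[OF g]] .
  have p: "\<bar>F x\<bar> \<le> \<bar>F y\<bar> + G" if y: "y \<in> {x..x+1}" for y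
  proof -
    have "\<bar>F y - F x\<bar> = \<bar>LINT z:{x..y}|lborel. g z\<bar>" using primitiveD(3)[OF P, of x y] y by simp
    also have "\<dots> \<le> (LINT z:{x..y}|lborel. \<bar>g z\<bar>)"
      using set_integral_norm_bound[OF Lp2_set_integrable[OF g], of x y] by simp
    also have "\<dots> \<le> G" unfolding G_def
      unfolding set_lebesgue_integral_def
      by (rule integral_mono[OF gi[unfolded set_integrable_def] gi[unfolded set_integrable_def]])
        (use y in \<open>auto simp: indicator_def\<close>)
    finally show ?thesis by linarith
  qed
  have fi: "set_integrable lborel {x..x+1} (\<lambda>y. \<bar>F y\<bar>)"
    using set_integrable_abs[OF Lp2_set_integrable[OF F]] .
  have ci: "set_integrable lborel {x..x+1} (\<lambda>y. c)" for c :: real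
    by (auto simp: set_integrable_def emeasure_lborel_Icc_eq)
  have "(LINT y:{x..x+1}|lborel. \<bar>F x\<bar>) \<le> (LINT y:{x..x+1}|lborel. \<bar>F y\<bar> + G)"
    by (rule set_integral_mono[OF ci set_integral_add(1)[OF fi ci] p])
  then have "\<bar>F x\<bar> \<le> (LINT y:{x..x+1}|lborel. \<bar>F y\<bar>) + G"
    using set_integral_add(2)[OF fi ci, of G] by (simp add: set_lebesgue_integral_def)
  then show ?thesis
    using unit_interval_Cauchy_Schwarz[OF F, of x] unit_interval_Cauchy_Schwarz[OF g, of x] by (simp add: G_def)
qed

section \<open>Mean-square convergence and continuity of translations\<close>

text \<open>The squared norm takes values in the extended reals so that monotonicity, Tonelli's theorem
  and dominated convergence apply without integrability side conditions.\<close>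

definition L2sq :: "(real \<Rightarrow> real) \<Rightarrow> ennreal" where
  "L2sq f = (\<integral>\<^sup>+x. ennreal ((f x)\<^sup>2) \<partial>lborel)"

lemma L2sq_mono: "(\<And>x. \<bar>f x\<bar> \<le> \<bar>g x\<bar>) \<Longrightarrow> L2sq f \<le> L2sq g"
  unfolding L2sq_def by (intro nn_integral_mono ennreal_leI) (simp add: abs_le_square_iff)

lemma L2sq_minus: "L2sq (\<lambda>x. - f x) = L2sq f"
  by (simp add: L2sq_def)

lemma L2sq_add:
  assumes [measurable]: "f \<in> borel_measurable borel" "g \<in> borel_measurable borel"
  shows "L2sq (\<lambda>x. f x + g x) \<le> 2 * L2sq f + 2 * L2sq g"
proof -
  have "L2sq (\<lambda>x. f x + g x) \<le> (\<integral>\<^sup>+x. 2 * ennreal ((f x)\<^sup>2) + 2 * ennreal ((g x)\<^sup>2) \<partial>lborel)"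
    unfolding L2sq_def
  proof (rule nn_integral_mono)
    fix x
    have "(f x + g x)\<^sup>2 \<le> 2 * (f x)\<^sup>2 + 2 * (g x)\<^sup>2"
      using sum_squares_bound[of "f x" "g x"] by (simp add: power2_sum)
    then have "ennreal ((f x + g x)\<^sup>2) \<le> ennreal (2 * (f x)\<^sup>2 + 2 * (g x)\<^sup>2)" by (rule ennreal_leI)
    also have "\<dots> = 2 * ennreal ((f x)\<^sup>2) + 2 * ennreal ((g x)\<^sup>2)"
      by (simp add: ennreal_mult ennreal_plus)
    finally show "ennreal ((f x + g x)\<^sup>2) \<le> 2 * ennreal ((f x)\<^sup>2) + 2 * ennreal ((g x)\<^sup>2)" .
  qed
  also have "\<dots> = 2 * L2sq f + 2 * L2sq g"
    unfolding L2sq_def by (simp add: nn_integral_add nn_integral_cmult)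
  finally show ?thesis .
qed

lemma L2sq_cmult:
  assumes [measurable]: "f \<in> borel_measurable borel"
  shows "L2sq (\<lambda>x. c * f x) = ennreal (c\<^sup>2) * L2sq f"
  unfolding L2sq_def by (simp add: power_mult_distrib ennreal_mult nn_integral_cmult)

lemma L2sq_shift:
  assumes [measurable]: "f \<in> borel_measurable borel"
  shows "L2sq (\<lambda>x. f (x + h)) = L2sq f"
proof -
  have "(\<integral>\<^sup>+x. ennreal ((f x)\<^sup>2) \<partial>lborel) = (\<integral>\<^sup>+x. ennreal ((f (h + 1 * x))\<^sup>2) \<partial>lborel)"
    by (subst nn_integral_real_affine[where c=1 and t=h]) auto
  then show ?thesis by (simp add: L2sq_def add.commute)
qed

lemma Lp2_iff_L2sq: "f \<in> Lp 2 \<longleftrightarrow> f \<in> borel_measurable borel \<and> L2sq f < \<infinity>"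
  unfolding Lp2_iff L2sq_def integrable_iff_bounded by auto

lemma Lp_norm2_L2sq: "f \<in> borel_measurable borel \<Longrightarrow> Lp_norm 2 f = sqrt (enn2real (L2sq f))"
  unfolding Lp_norm2_eq L2sq_def by (subst integral_eq_nn_integral) auto

text \<open>Convergence to zero in mean square along a filter; measurability is only required eventually
  because the curves below are controlled on a time interval only.\<close>

definition L2_null :: "'a filter \<Rightarrow> ('a \<Rightarrow> real \<Rightarrow> real) \<Rightarrow> bool" where
  "L2_null G h \<longleftrightarrow> (\<forall>\<^sub>F s in G. h s \<in> borel_measurable borel) \<and> ((\<lambda>s. L2sq (h s)) \<longlongrightarrow> 0) G"

lemma ennreal_tendsto_0_le:
  fixes f g :: "'a \<Rightarrow> ennreal"
  assumes "(g \<longlongrightarrow> 0) G" "\<forall>\<^sub>F s in G. f s \<le> g s" shows "(f \<longlongrightarrow> 0) G"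
  by (rule tendsto_sandwich[OF _ assms(2) tendsto_const assms(1)]) simp

lemma L2_null_Lp_norm:
  assumes "L2_null G h" shows "((\<lambda>s. Lp_norm 2 (h s)) \<longlongrightarrow> 0) G"
proof (rule Lim_transform_eventually)
  have "((\<lambda>s. enn2real (L2sq (h s))) \<longlongrightarrow> 0) G"
    using assms by (intro tendsto_enn2real) (auto simp: L2_null_def)
  from tendsto_real_sqrt[OF this] show "((\<lambda>s. sqrt (enn2real (L2sq (h s)))) \<longlongrightarrow> 0) G" by simp
  show "\<forall>\<^sub>F s in G. sqrt (enn2real (L2sq (h s))) = Lp_norm 2 (h s)"
    using assms unfolding L2_null_def by (auto simp: Lp_norm2_L2sq elim: eventually_mono)
qed

lemma L2_null_mono:
  assumes "L2_null G k" "\<forall>\<^sub>F s in G. h s \<in> borel_measurable borel"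
    and "\<forall>\<^sub>F s in G. \<forall>x. \<bar>h s x\<bar> \<le> \<bar>k s x\<bar>"
  shows "L2_null G h"
  unfolding L2_null_def
proof (intro conjI assms(2))
  have "\<forall>\<^sub>F s in G. L2sq (h s) \<le> L2sq (k s)"
    using assms(3) by eventually_elim (rule L2sq_mono, blast)
  then show "((\<lambda>s. L2sq (h s)) \<longlongrightarrow> 0) G"
    using assms(1) unfolding L2_null_def by (blast intro: ennreal_tendsto_0_le)
qed

lemma L2_null_add:
  assumes "L2_null G h" "L2_null G k" shows "L2_null G (\<lambda>s x. h s x + k s x)"
  unfolding L2_null_def
proof
  have hm: "\<forall>\<^sub>F s in G. h s \<in> borel_measurable borel" and km: "\<forall>\<^sub>F s in G. k s \<in> borel_measurable borel"
    and ht: "((\<lambda>s. L2sq (h s)) \<longlongrightarrow> 0) G" and kt: "((\<lambda>s. L2sq (k s)) \<longlongrightarrow> 0) G"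
    using assms by (auto simp: L2_null_def)
  show "\<forall>\<^sub>F s in G. (\<lambda>x. h s x + k s x) \<in> borel_measurable borel"
    using hm km by eventually_elim auto
  have "((\<lambda>s. 2 * L2sq (h s) + 2 * L2sq (k s)) \<longlongrightarrow> 2 * 0 + 2 * 0) G"
    by (intro tendsto_add ennreal_tendsto_cmult ht kt) auto
  moreover have "\<forall>\<^sub>F s in G. L2sq (\<lambda>x. h s x + k s x) \<le> 2 * L2sq (h s) + 2 * L2sq (k s)"
    using hm km by eventually_elim (rule L2sq_add)
  ultimately show "((\<lambda>s. L2sq (\<lambda>x. h s x + k s x)) \<longlongrightarrow> 0) G"
    by (simp add: ennreal_tendsto_0_le)
qed

lemma L2_null_minus: "L2_null G h \<Longrightarrow> L2_null G (\<lambda>s x. - h s x)"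
  by (simp add: L2_null_def L2sq_minus)

lemma L2_null_cmult:
  fixes c :: "'a \<Rightarrow> real"
  assumes "L2_null G h" "(c \<longlongrightarrow> l) G" shows "L2_null G (\<lambda>s x. c s * h s x)"
proof -
  have b: "\<forall>\<^sub>F s in G. \<bar>c s\<bar> < \<bar>l\<bar> + 1"
    using order_tendstoD(2)[OF tendsto_rabs[OF assms(2)], of "\<bar>l\<bar> + 1"] by simp
  have hm: "\<forall>\<^sub>F s in G. h s \<in> borel_measurable borel" and ht: "((\<lambda>s. L2sq (h s)) \<longlongrightarrow> 0) G"
    using assms by (auto simp: L2_null_def)
  have "((\<lambda>s. ennreal ((\<bar>l\<bar> + 1)\<^sup>2) * L2sq (h s)) \<longlongrightarrow> ennreal ((\<bar>l\<bar> + 1)\<^sup>2) * 0) G"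
    by (intro ennreal_tendsto_cmult ht) auto
  moreover have "\<forall>\<^sub>F s in G. L2sq (\<lambda>x. c s * h s x) \<le> ennreal ((\<bar>l\<bar> + 1)\<^sup>2) * L2sq (h s)"
    using b hm
  proof eventually_elim
    case (elim s)
    have "(c s)\<^sup>2 \<le> (\<bar>l\<bar> + 1)\<^sup>2" using elim(1) by (simp add: abs_le_square_iff[symmetric])
    then show ?case using elim by (simp add: L2sq_cmult ennreal_leI mult_right_mono)
  qed
  ultimately have "((\<lambda>s. L2sq (\<lambda>x. c s * h s x)) \<longlongrightarrow> 0) G"
    by (simp add: ennreal_tendsto_0_le)
  then show ?thesis using hm by (auto simp: L2_null_def elim!: eventually_mono)
qed

lemma L2_null_scalar:
  assumes "f \<in> Lp 2" "(c \<longlongrightarrow> 0) G" shows "L2_null G (\<lambda>s x. c s * f x)"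
proof -
  have f[measurable]: "f \<in> borel_measurable borel" "L2sq f < \<infinity>" using assms by (auto simp: Lp2_iff_L2sq)
  have "((\<lambda>s. L2sq f * ennreal ((c s)\<^sup>2)) \<longlongrightarrow> L2sq f * ennreal (0\<^sup>2)) G"
    using f by (intro ennreal_tendsto_cmult tendsto_ennrealI tendsto_power assms) auto
  then show ?thesis by (simp add: L2_null_def L2sq_cmult[OF f(1)] mult.commute)
qed

lemma L2_null_uniform:
  assumes m: "\<forall>\<^sub>F s in G. h s \<in> borel_measurable borel"
    and u: "\<And>e. 0 < e \<Longrightarrow> \<forall>\<^sub>F s in G. \<forall>x. \<bar>h s x\<bar> \<le> e * indicator {-L..L} x"
  shows "L2_null G h"
  unfolding L2_null_def
proof
  show "((\<lambda>s. L2sq (h s)) \<longlongrightarrow> 0) G"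
  proof (rule order_tendstoI)
    fix a :: ennreal assume a: "0 < a"
    define b where "b = min a 1"
    have b: "0 < b" "b \<le> a" "b < \<infinity>" using a by (auto simp: b_def min_less_iff_disj)
    define r where "r = enn2real b"
    have r: "0 < r" "ennreal r = b" using b by (auto simp: r_def enn2real_positive_iff less_top)
    (* two factors of two: one gives strict inequality, and L may be negative or zero *)
    define e where "e = sqrt (r / (2 * (2 * \<bar>L\<bar> + 1)))"
    have e: "e > 0" "e\<^sup>2 = r / (2 * (2 * \<bar>L\<bar> + 1))" using r by (auto simp: e_def)
    have "\<forall>\<^sub>F s in G. L2sq (h s) < a"
      using u[OF e(1)]
    proof eventually_elim
      case (elim s)
      have "L2sq (h s) \<le> L2sq (\<lambda>x. e * indicator {-L..L} x)"
        using elim e by (intro L2sq_mono) (auto simp: abs_mult)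
      also have "\<dots> = ennreal (e\<^sup>2) * L2sq (indicator {-L..L})" by (rule L2sq_cmult) auto
      also have "L2sq (indicator {-L..L}) = emeasure lborel {-L..L}"
      proof -
        have "L2sq (indicator {-L..L}) = (\<integral>\<^sup>+x. indicator {-L..L} x \<partial>lborel)"
          unfolding L2sq_def by (intro nn_integral_cong) (auto simp: indicator_def)
        then show ?thesis by simp
      qed
      also have "\<dots> \<le> ennreal (2 * \<bar>L\<bar> + 1)" by (auto simp: emeasure_lborel_Icc_eq intro!: ennreal_leI)
      finally have "L2sq (h s) \<le> ennreal (e\<^sup>2) * ennreal (2 * \<bar>L\<bar> + 1)" by (simp add: mult_left_mono)
      also have "\<dots> = ennreal (r / 2)"
      proof -
        have "2 * \<bar>L\<bar> + 1 \<noteq> 0" by (simp add: add_nonneg_eq_0_iff)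
        then have "e\<^sup>2 * (2 * \<bar>L\<bar> + 1) = r / 2" unfolding e(2) by (simp add: divide_simps)
        moreover have "ennreal (e\<^sup>2) * ennreal (2 * \<bar>L\<bar> + 1) = ennreal (e\<^sup>2 * (2 * \<bar>L\<bar> + 1))"
          by (rule ennreal_mult[symmetric]) auto
        ultimately show ?thesis by (simp only:)
      qed
      also have "\<dots> < ennreal r" using r(1) by (simp add: ennreal_less_iff)
      also have "\<dots> \<le> a" using r b by simp
      finally show ?case .
    qed
    then show "\<forall>\<^sub>F s in G. L2sq (h s) < a" .
  qed auto
qed (rule m)

lemma L2_null_indicator:
  assumes "L2_null G h" shows "L2_null G (\<lambda>s x. indicator {-L..L} x * h s x)"
  by (rule L2_null_mono[OF assms]) (use assms in \<open>auto simp: L2_null_def indicator_def elim!: eventually_mono\<close>)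

lemma L2_null_filterlim:
  assumes "L2_null F h" "filterlim \<phi> F G" shows "L2_null G (\<lambda>s. h (\<phi> s))"
  using assms unfolding L2_null_def
  by (auto intro: filterlim_compose[of "\<lambda>s. L2sq (h s)"] eventually_compose_filterlim)

lemma L2sq_dominated_convergence:
  assumes [measurable]: "\<And>n. f n \<in> borel_measurable borel" "g \<in> borel_measurable borel"
    and w: "w \<in> Lp 2" and b: "\<And>n x. \<bar>f n x\<bar> \<le> \<bar>w x\<bar>" and l: "\<And>x. (\<lambda>n. f n x) \<longlonglongrightarrow> g x"
  shows "(\<lambda>n. L2sq (\<lambda>x. f n x - g x)) \<longlonglongrightarrow> 0"
proof -
  have [measurable]: "w \<in> borel_measurable borel" using w by (simp add: Lp2_iff)
  have gb: "\<bar>g x\<bar> \<le> \<bar>w x\<bar>" for x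
    by (rule LIMSEQ_le_const2[OF tendsto_rabs[OF l]]) (use b in auto)
  have "(\<lambda>n. \<integral>\<^sup>+x. ennreal ((f n x - g x)\<^sup>2) \<partial>lborel) \<longlonglongrightarrow> (\<integral>\<^sup>+(x::real). 0 \<partial>lborel)"
  proof (rule nn_integral_dominated_convergence[where w = "\<lambda>x. ennreal (4 * (w x)\<^sup>2)"])
    show "AE x in lborel. ennreal ((f n x - g x)\<^sup>2) \<le> ennreal (4 * (w x)\<^sup>2)" for n
    proof (rule AE_I2, rule ennreal_leI)
      fix x
      have "\<bar>f n x - g x\<bar> \<le> \<bar>2 * w x\<bar>" using b[of n x] gb[of x] by linarith
      then have "(f n x - g x)\<^sup>2 \<le> (2 * w x)\<^sup>2" by (simp add: abs_le_square_iff)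
      then show "(f n x - g x)\<^sup>2 \<le> 4 * (w x)\<^sup>2" by (simp add: power_mult_distrib)
    qed
    have "(\<integral>\<^sup>+x. ennreal (4 * (w x)\<^sup>2) \<partial>lborel) = 4 * L2sq w"
      unfolding L2sq_def by (simp add: ennreal_mult nn_integral_cmult)
    also have "\<dots> < \<infinity>" using w by (simp add: Lp2_iff_L2sq ennreal_mult_less_top)
    finally show "(\<integral>\<^sup>+x. ennreal (4 * (w x)\<^sup>2) \<partial>lborel) < \<infinity>" .
    show "AE x in lborel. (\<lambda>n. ennreal ((f n x - g x)\<^sup>2)) \<longlonglongrightarrow> 0"
    proof (rule AE_I2)
      fix x
      have "(\<lambda>n. ennreal ((f n x - g x)\<^sup>2)) \<longlonglongrightarrow> ennreal ((g x - g x)\<^sup>2)"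
        by (intro tendsto_ennrealI tendsto_intros l)
      then show "(\<lambda>n. ennreal ((f n x - g x)\<^sup>2)) \<longlonglongrightarrow> 0" by simp
    qed
  qed measurable
  then show ?thesis by (simp add: L2sq_def)
qed

definition translation_continuous :: "(real \<Rightarrow> real) \<Rightarrow> bool" where
  "translation_continuous g \<longleftrightarrow> g \<in> Lp 2 \<and> L2_null (at 0) (\<lambda>h x. g (x + h) - g x)"

lemma Lp2_mono:
  assumes "g \<in> Lp 2" "f \<in> borel_measurable borel" "\<And>x. \<bar>f x\<bar> \<le> \<bar>g x\<bar>"
  shows "f \<in> Lp 2"
  using assms L2sq_mono[of f g] by (auto simp: Lp2_iff_L2sq dest: le_less_trans)

lemma Lp2_add: "f \<in> Lp 2 \<Longrightarrow> g \<in> Lp 2 \<Longrightarrow> (\<lambda>x. f x + g x) \<in> Lp 2"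
  using L2sq_add[of f g] le_less_trans by (force simp: Lp2_iff_L2sq ennreal_mult_less_top)

lemma Lp2_cmult: "f \<in> Lp 2 \<Longrightarrow> (\<lambda>x. c * f x) \<in> Lp 2"
  by (auto simp: Lp2_iff_L2sq ennreal_mult_less_top L2sq_cmult)

lemma Lp2_shift: "f \<in> Lp 2 \<Longrightarrow> (\<lambda>x. f (x + h)) \<in> Lp 2"
  by (auto simp: Lp2_iff_L2sq L2sq_shift)

lemma Lp2_continuous_compact:
  assumes "continuous_on UNIV f"
  shows "(\<lambda>x. indicator {a..b} x * f x) \<in> Lp 2"
proof -
  have "integrable lborel (\<lambda>x. indicator {a..b} x *\<^sub>R (f x)\<^sup>2)"
    using assms by (intro borel_integrable_compact) (auto intro!: continuous_intros intro: continuous_on_subset)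
  moreover have "(\<lambda>x. (indicator {a..b} x * f x)\<^sup>2) = (\<lambda>x. indicator {a..b} x *\<^sub>R (f x)\<^sup>2)"
    by (auto simp: indicator_def)
  moreover have "f \<in> borel_measurable borel" using assms by (rule borel_measurable_continuous_onI)
  ultimately show ?thesis by (simp add: Lp2_iff)
qed

text \<open>Translation is an isometry, hence a uniform limit argument: the set of translation
  continuous functions is closed in mean square.\<close>

lemma translation_continuous_approx:
  assumes g: "g \<in> Lp 2" and f: "\<And>n. translation_continuous (f n)"
    and l: "(\<lambda>n. L2sq (\<lambda>x. f n x - g x)) \<longlonglongrightarrow> 0"
  shows "translation_continuous g"
  unfolding translation_continuous_def L2_null_def
proof (intro conjI g)
  have [measurable]: "g \<in> borel_measurable borel" "f n \<in> borel_measurable borel" for n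
    using g f by (auto simp: translation_continuous_def Lp2_iff)
  show "\<forall>\<^sub>F s in at 0. (\<lambda>x. g (x + s) - g x) \<in> borel_measurable borel" by simp
  show "((\<lambda>h. L2sq (\<lambda>x. g (x + h) - g x)) \<longlongrightarrow> 0) (at 0)"
  proof (rule order_tendstoI)
    fix a :: ennreal assume a: "0 < a"
    have "(\<lambda>n. 6 * L2sq (\<lambda>x. f n x - g x)) \<longlonglongrightarrow> 6 * 0"
      using l by (intro ennreal_tendsto_cmult) auto
    then have "\<forall>\<^sub>F n in sequentially. 6 * L2sq (\<lambda>x. f n x - g x) < a"
      using a by (intro order_tendstoD) auto
    then obtain n where n: "6 * L2sq (\<lambda>x. f n x - g x) < a" by (auto simp: eventually_sequentially)
    have "((\<lambda>h. 6 * L2sq (\<lambda>x. f n x - g x) + 4 * L2sq (\<lambda>x. f n (x + h) - f n x)) \<longlongrightarrow> 6 * L2sq (\<lambda>x. f n x - g x) + 4 * 0) (at 0)"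
      using f[of n] by (intro tendsto_add tendsto_const ennreal_tendsto_cmult) (auto simp: translation_continuous_def L2_null_def)
    then have "\<forall>\<^sub>F h in at 0. 6 * L2sq (\<lambda>x. f n x - g x) + 4 * L2sq (\<lambda>x. f n (x + h) - f n x) < a"
      using n by (intro order_tendstoD) auto
    then show "\<forall>\<^sub>F h in at 0. L2sq (\<lambda>x. g (x + h) - g x) < a"
    proof eventually_elim
      case (elim h)
      have 1: "L2sq (\<lambda>x. - (f n (x + h) - g (x + h))) = L2sq (\<lambda>x. f n x - g x)"
        using L2sq_shift[of "\<lambda>x. f n x - g x" h] by (subst L2sq_minus) simp
      have "L2sq (\<lambda>x. g (x + h) - g x) = L2sq (\<lambda>x. - (f n (x + h) - g (x + h)) + ((f n (x + h) - f n x) + (f n x - g x)))"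
        by simp
      also have "\<dots> \<le> 2 * L2sq (\<lambda>x. f n x - g x) + 2 * L2sq (\<lambda>x. (f n (x + h) - f n x) + (f n x - g x))"
        unfolding 1[symmetric] by (rule L2sq_add) measurable
      also have "\<dots> \<le> 2 * L2sq (\<lambda>x. f n x - g x) + 2 * (2 * L2sq (\<lambda>x. f n (x + h) - f n x) + 2 * L2sq (\<lambda>x. f n x - g x))"
        by (intro add_left_mono mult_left_mono L2sq_add) auto
      also have "\<dots> = 6 * L2sq (\<lambda>x. f n x - g x) + 4 * L2sq (\<lambda>x. f n (x + h) - f n x)"
      proof -
        have six: "(6::ennreal) = 2 + 4" by simp
        show ?thesis by (simp only: six distrib_left distrib_right) (simp add: add_ac mult.assoc[symmetric])
      qed
      also note elim
      finally show ?case .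
    qed
  qed auto
qed

lemma translation_continuous_add: "translation_continuous f \<Longrightarrow> translation_continuous g \<Longrightarrow> translation_continuous (\<lambda>x. f x + g x)"
  using L2_null_add[of "at 0" "\<lambda>h x. f (x + h) - f x" "\<lambda>h x. g (x + h) - g x"] Lp2_add[of f g]
  by (simp add: translation_continuous_def algebra_simps)

lemma translation_continuous_cmult: "translation_continuous f \<Longrightarrow> translation_continuous (\<lambda>x. c * f x)"
  using L2_null_cmult[of "at 0" "\<lambda>h x. f (x + h) - f x" "\<lambda>_. c" c] Lp2_cmult[of f c]
  by (simp add: translation_continuous_def algebra_simps)

lemma translation_continuous_sum:
  assumes "finite I" "\<And>i. i \<in> I \<Longrightarrow> translation_continuous (f i)" shows "translation_continuous (\<lambda>x. \<Sum>i\<in>I. f i x)"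
  using assms
proof (induction I rule: finite_induct)
  case empty
  have "(\<lambda>x. 0::real) \<in> Lp 2" by (simp add: Lp2_iff)
  moreover have "L2_null (at (0::real)) (\<lambda>h x. 0)" by (simp add: L2_null_def L2sq_def)
  ultimately show ?case by (simp add: translation_continuous_def)
qed (auto intro: translation_continuous_add)

lemma translation_continuous_continuous:
  assumes c: "continuous_on UNIV f" and L: "L \<ge> 0" and z: "\<And>x. \<bar>x\<bar> > L \<Longrightarrow> f x = 0"
  shows "translation_continuous f"
proof -
  have [measurable]: "f \<in> borel_measurable borel" using c by (rule borel_measurable_continuous_onI)
  have eq: "(\<lambda>x. indicator {-L..L} x * f x) = f" using z by (force simp: indicator_def)
  have "L2_null (at 0) (\<lambda>h x. f (x + h) - f x)"
  proof (rule L2_null_uniform[where L="L+1"])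
    fix e :: real assume "0 < e"
    have "uniformly_continuous_on {-L-2..L+2} f"
      using c by (intro compact_uniformly_continuous) (auto intro: continuous_on_subset)
    then obtain d where d: "d > 0" "\<And>x y. x \<in> {-L-2..L+2} \<Longrightarrow> y \<in> {-L-2..L+2} \<Longrightarrow> \<bar>y - x\<bar> < d \<Longrightarrow> \<bar>f y - f x\<bar> < e"
      unfolding uniformly_continuous_on_def dist_real_def using \<open>0 < e\<close> by metis
    have "\<forall>\<^sub>F h in at (0::real). h \<in> ball 0 (min 1 d)"
      using d by (intro eventually_at_in_open') auto
    then show "\<forall>\<^sub>F h in at 0. \<forall>x. \<bar>f (x + h) - f x\<bar> \<le> e * indicator {-(L+1)..L+1} x"
    proof (eventually_elim, intro allI)
      fix h x :: real assume h: "h \<in> ball 0 (min 1 d)"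
      show "\<bar>f (x + h) - f x\<bar> \<le> e * indicator {-(L+1)..L+1} x"
      proof (cases "\<bar>x\<bar> \<le> L + 1")
        case True
        then have "\<bar>f (x + h) - f x\<bar> < e" using h by (intro d(2)) (auto simp: abs_le_iff)
        then show ?thesis using True by (auto simp: indicator_def abs_le_iff)
      next
        case False
        then have "f x = 0" "f (x + h) = 0" using h by (auto intro!: z)
        then show ?thesis using \<open>0 < e\<close> by simp
      qed
    qed
  qed simp
  moreover have "f \<in> Lp 2" using Lp2_continuous_compact[OF c, of "-L" L] eq by simp
  ultimately show ?thesis by (simp add: translation_continuous_def)
qed

lemma indicator_Lp2:
  fixes A :: "real set"
  assumes "A \<in> sets borel" "A \<subseteq> {-L..L}" shows "indicator A \<in> Lp 2"
proof -
  have "(\<lambda>x. indicator {-L..L} x * 1) \<in> Lp 2" by (rule Lp2_continuous_compact) simp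
  then show ?thesis by (rule Lp2_mono) (use assms in \<open>auto simp: indicator_def\<close>)
qed

text \<open>The indicator of a bounded open set is the increasing limit of truncated multiples of the
  distance to the complement.\<close>

lemma translation_continuous_indicator_open:
  assumes W: "open W" "W \<subseteq> {-L..L}" "L \<ge> 0"
  shows "translation_continuous (indicator W)"
proof -
  have ne: "- W \<noteq> {}"
  proof
    assume "- W = {}" then have "L + 1 \<in> W" by auto
    then show False using W by auto
  qed
  define f where "f n x = min 1 (real n * infdist x (- W))" for n x
  have fc: "continuous_on UNIV (f n)" for n unfolding f_def by (intro continuous_intros)
  have f0: "f n x = 0" if "x \<notin> W" for n x using that by (simp add: f_def)
  have f1: "0 \<le> f n x" "f n x \<le> 1" for n x by (auto simp: f_def infdist_nonneg)
  have Wb: "W \<in> sets borel" using W by simp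
  show ?thesis
  proof (rule translation_continuous_approx[where f = f])
    show "indicator W \<in> Lp 2" using Wb W(2) by (rule indicator_Lp2)
    show "translation_continuous (f n)" for n
      by (rule translation_continuous_continuous[OF fc W(3)], rule f0) (use W(2) in \<open>auto simp: subset_iff abs_le_iff not_le[symmetric]\<close>)
    show "(\<lambda>n. L2sq (\<lambda>x. f n x - indicator W x)) \<longlonglongrightarrow> 0"
    proof (rule L2sq_dominated_convergence[OF _ _ indicator_Lp2[OF Wb W(2)]])
      show "f n \<in> borel_measurable borel" for n using fc by (rule borel_measurable_continuous_onI)
      show "\<bar>f n x\<bar> \<le> \<bar>indicator W x\<bar>" for n x using f0[of x n] f1[of n x] by (auto simp: indicator_def)
      show "(\<lambda>n. f n x) \<longlonglongrightarrow> indicator W x" for x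
      proof (cases "x \<in> W")
        case True
        have d: "infdist x (- W) > 0"
          using True W(1) ne in_closed_iff_infdist_zero[of "- W" x] infdist_nonneg[of x "- W"] by fastforce
        obtain N :: nat where N: "1 \<le> real N * infdist x (- W)"
          using reals_Archimedean3[OF d] by (meson less_imp_le)
        (* the distance to the complement is positive, so the truncation at one is eventually active *)
        have "\<forall>\<^sub>F n in sequentially. f n x = 1"
          using eventually_ge_at_top[of N]
        proof eventually_elim
          case (elim n)
          have "real N * infdist x (- W) \<le> real n * infdist x (- W)" using elim d by (simp add: mult_right_mono)
          then show ?case using N by (simp add: f_def)
        qed
        then show ?thesis using True by (simp add: tendsto_eventually)
      qed (simp add: f0)
    qed (use Wb in measurable)
  qed
qed

text \<open>Outer regularity of Lebesgue measure reduces Borel sets to open sets.\<close>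

lemma translation_continuous_indicator:
  assumes A: "A \<in> sets borel" "A \<subseteq> {-L..L}" and L: "L \<ge> 0"
  shows "translation_continuous (indicator A)"
proof -
  have "\<exists>W. open W \<and> A \<subseteq> W \<and> W \<subseteq> {-(L+1)..L+1} \<and> emeasure lborel (W - A) \<le> ennreal (inverse (real (Suc n)))" for n
  proof -
    obtain U where U: "open U" "A \<subseteq> U" "emeasure lborel (U - A) < ennreal (inverse (real (Suc n)))"
      using outer_regular_lborel[of A "inverse (real (Suc n))"] A by auto
    have "emeasure lborel (U \<inter> {-(L+1)<..<L+1} - A) \<le> emeasure lborel (U - A)"
      using U A by (intro emeasure_mono) auto
    then show ?thesis using U A(2)
      by (intro exI[of _ "U \<inter> {-(L+1)<..<L+1}"]) force
  qed
  then obtain W where W: "\<And>n. open (W n)" "\<And>n. A \<subseteq> W n" "\<And>n. W n \<subseteq> {-(L+1)..L+1}"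
    "\<And>n. emeasure lborel (W n - A) \<le> ennreal (inverse (real (Suc n)))" by metis
  show ?thesis
  proof (rule translation_continuous_approx[where f = "\<lambda>n. indicator (W n)"])
    show "indicator A \<in> Lp 2" using A by (rule indicator_Lp2)
    show "translation_continuous (indicator (W n))" for n
      using L by (intro translation_continuous_indicator_open[where L="L+1"] W) auto
    have "L2sq (\<lambda>x. indicator (W n) x - indicator A x) = emeasure lborel (W n - A)" for n
    proof -
      have "L2sq (\<lambda>x. indicator (W n) x - indicator A x) = (\<integral>\<^sup>+x. indicator (W n - A) x \<partial>lborel)"
        unfolding L2sq_def using W(2)[of n] by (intro nn_integral_cong) (auto simp: indicator_def)
      then show ?thesis using W(1)[of n] A(1) by simp
    qed
    moreover have "(\<lambda>n. ennreal (inverse (real (Suc n)))) \<longlonglongrightarrow> ennreal 0"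
      by (rule tendsto_ennrealI[OF LIMSEQ_inverse_real_of_nat])
    ultimately show "(\<lambda>n. L2sq (\<lambda>x. indicator (W n) x - indicator A x)) \<longlonglongrightarrow> 0"
      using W(4) by (simp add: ennreal_tendsto_0_le[of "\<lambda>n. ennreal (inverse (real (Suc n)))"])
  qed
qed

text \<open>From indicators to simple functions by linearity, and to all of \<open>L\<^sup>2\<close> by approximation with
  simple functions of bounded support.\<close>

theorem L2_translation_continuous:
  assumes g: "g \<in> Lp 2" shows "L2_null (at 0) (\<lambda>h x. g (x + h) - g x)"
proof -
  have [measurable]: "g \<in> borel_measurable borel" using g by (simp add: Lp2_iff)
  obtain F where F: "\<And>i. simple_function borel (F i)" "\<And>x. (\<lambda>i. F i x) \<longlonglongrightarrow> g x"
    "\<And>i x. dist (F i x) 0 \<le> 2 * dist (g x) 0"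
    using borel_measurable_implies_sequence_metric[of g borel 0] by auto
  define f where "f n x = indicator {- real n..real n} x * F n x" for n x
  have [measurable]: "F n \<in> borel_measurable borel" for n using F(1) by (rule borel_measurable_simple_function)
  have "translation_continuous g"
  proof (rule translation_continuous_approx[OF g, where f = f])
    fix n
    have "f n = (\<lambda>x. \<Sum>y\<in>range (F n). y * indicator (F n -` {y} \<inter> {- real n..real n}) x)"
    proof
      fix x
      have fin: "finite (range (F n))" using F(1)[of n] by (auto simp: simple_function_def)
      have "(\<Sum>y\<in>range (F n). y * indicator (F n -` {y} \<inter> {- real n..real n}) x) =
        (\<Sum>y\<in>range (F n). if y = F n x then y * indicator {- real n..real n} x else 0)"
        by (intro sum.cong) (auto simp: indicator_def)
      also have "\<dots> = f n x" using fin by (simp add: f_def mult.commute)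
      finally show "f n x = (\<Sum>y\<in>range (F n). y * indicator (F n -` {y} \<inter> {- real n..real n}) x)" ..
    qed
    moreover have "translation_continuous (\<lambda>x. y * indicator (F n -` {y} \<inter> {- real n..real n}) x)" for y
      by (intro translation_continuous_cmult translation_continuous_indicator[where L = "real n"]) (auto intro!: measurable_sets_borel[of "F n" borel, simplified])
    moreover have "finite (range (F n))" using F(1)[of n] by (auto simp: simple_function_def)
    ultimately show "translation_continuous (f n)"
      using translation_continuous_sum[of "range (F n)" "\<lambda>y x. y * indicator (F n -` {y} \<inter> {- real n..real n}) x"]
      by (simp only:)
  next
    show "(\<lambda>n. L2sq (\<lambda>x. f n x - g x)) \<longlonglongrightarrow> 0"
    proof (rule L2sq_dominated_convergence[OF _ _ Lp2_cmult[OF g, of 2]])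
      show "f n \<in> borel_measurable borel" for n unfolding f_def by measurable
      show "\<bar>f n x\<bar> \<le> \<bar>2 * g x\<bar>" for n x using F(3)[of n x] by (auto simp: f_def indicator_def)
      show "(\<lambda>n. f n x) \<longlonglongrightarrow> g x" for x
      proof (rule Lim_transform_eventually[OF F(2)])
        obtain N where N: "\<bar>x\<bar> \<le> real N" using real_arch_simple by blast
        show "\<forall>\<^sub>F n in sequentially. F n x = f n x"
          using eventually_ge_at_top[of N] by eventually_elim (use N in \<open>auto simp: indicator_def f_def\<close>)
      qed
    qed measurable
  qed
  then show ?thesis by (simp add: translation_continuous_def)
qed

section \<open>Mean-square differentiability of translated primitives\<close>

lemma square_integral_le:
  fixes w :: "real \<Rightarrow> real"
  assumes h: "0 < h" and w: "set_integrable lborel {0..h} w" "set_integrable lborel {0..h} (\<lambda>r. (w r)\<^sup>2)"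
  shows "(LINT r:{0..h}|lborel. w r)\<^sup>2 \<le> h * (LINT r:{0..h}|lborel. (w r)\<^sup>2)"
proof -
  define m where "m = (LINT r:{0..h}|lborel. w r) / h"
  have c: "set_integrable lborel {0..h} (\<lambda>r. m\<^sup>2)" by (auto simp: set_integrable_def emeasure_lborel_Icc_eq)
  have w1: "set_integrable lborel {0..h} (\<lambda>r. 2 * m * w r)" using w(1) by simp
  have "0 \<le> (LINT r:{0..h}|lborel. (w r - m)\<^sup>2)"
    unfolding set_lebesgue_integral_def by (intro integral_nonneg_AE AE_I2) auto
  also have "\<dots> = (LINT r:{0..h}|lborel. ((w r)\<^sup>2 - 2 * m * w r) + m\<^sup>2)"
    by (simp add: power2_diff algebra_simps)
  also have "\<dots> = (LINT r:{0..h}|lborel. (w r)\<^sup>2) - 2 * m * (LINT r:{0..h}|lborel. w r) + h * m\<^sup>2"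
    using set_integral_diff[OF w(2) w1] set_integral_add(2)[OF _ c, of "\<lambda>r. (w r)\<^sup>2 - 2 * m * w r"] h
    by (simp add: set_integral_mult_right) (simp add: set_lebesgue_integral_def)
  finally show ?thesis using h by (simp add: m_def power2_eq_square field_simps)
qed

lemma primitive_shift:
  assumes "primitive F g" shows "primitive (\<lambda>x. F (x + t)) (\<lambda>x. g (x + t))"
proof -
  note [measurable] = primitiveD(1)[OF assms]
  have eq: "indicator {a..b} x *\<^sub>R g (x + t) = indicator {a+t..b+t} (t + 1 * x) *\<^sub>R g (t + 1 * x)" for a b x :: real
    by (auto simp: indicator_def add.commute)
  have i: "set_integrable lborel {a..b} (\<lambda>x. g (x + t))" for a b
    unfolding set_integrable_def eq
    using lborel_integrable_real_affine[OF primitiveD(2)[OF assms, of "a+t" "b+t", unfolded set_integrable_def], of 1 t] by simp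
  show ?thesis
    unfolding primitive_def
  proof (intro conjI allI impI i)
    show "(\<lambda>x. g (x + t)) \<in> borel_measurable borel" by measurable
    fix a b :: real assume "a \<le> b"
    have "(LBINT y:{a..b}. g (y + t)) = (LBINT y:{a+t..b+t}. g y)"
      unfolding set_lebesgue_integral_def eq
      by (subst (2) lborel_integral_real_affine[where c=1 and t=t]) auto
    then show "F (b + t) - F (a + t) = (LBINT y:{a..b}. g (y + t))"
      using primitiveD(3)[OF assms, of "a+t" "b+t"] \<open>a \<le> b\<close> by simp
  qed
qed

text \<open>The difference quotient of \<open>A\<close> minus \<open>A'\<close> is the mean of the translation increments of \<open>A'\<close>
  over \<open>[0, h]\<close>; Jensen's inequality and Tonelli's theorem bound it by the largest increment.\<close>

lemma difference_quotient_L2_bound: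
  assumes P: "primitive A A'" and A': "A' \<in> Lp 2" and h: "0 < h"
    and e: "\<And>r. 0 \<le> r \<Longrightarrow> r \<le> h \<Longrightarrow> L2sq (\<lambda>x. A' (x + r) - A' x) \<le> e"
  shows "L2sq (\<lambda>x. (A (x + h) - A x) / h - A' x) \<le> e"
proof -
  have [measurable]: "A' \<in> borel_measurable borel" using A' by (simp add: Lp2_iff)
  have pw: "ennreal (((A (x + h) - A x) / h - A' x)\<^sup>2) \<le>
     (\<integral>\<^sup>+r. ennreal (1 / h) * (indicator {0..h} r * ennreal ((A' (x + r) - A' x)\<^sup>2)) \<partial>lborel)" for x
  proof -
    define w where "w r = A' (x + r) - A' x" for r
    have s2: "(\<lambda>r. A' (x + r)) \<in> Lp 2" using Lp2_shift[OF A', of x] by (simp add: add.commute)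
    have Pr: "primitive (\<lambda>r. A (r + x)) (\<lambda>r. A' (r + x))" by (rule primitive_shift[OF P])
    have c: "set_integrable lborel {0..h} (\<lambda>r. c)" for c :: real by (auto simp: set_integrable_def emeasure_lborel_Icc_eq)
    have i1: "set_integrable lborel {0..h} (\<lambda>r. A' (x + r))" by (rule Lp2_set_integrable[OF s2])
    have wi: "set_integrable lborel {0..h} w" unfolding w_def by (intro set_integral_diff i1 c)
    have weq: "(\<lambda>r. indicator {0..h} r * w r) = (\<lambda>r. indicator {0..h} r * A' (x + r) + indicator {0..h} r * (- A' x))"
      by (auto simp: w_def algebra_simps)
    have "(\<lambda>r. indicator {0..h} r * A' (x + r)) \<in> Lp 2"
      by (rule Lp2_mono[OF s2]) (auto simp: indicator_def)
    from Lp2_add[OF this Lp2_continuous_compact[of "\<lambda>r. - A' x" 0 h]]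
    have "(\<lambda>r. indicator {0..h} r * w r) \<in> Lp 2"
      unfolding weq by simp
    then have "integrable lborel (\<lambda>r. (indicator {0..h} r * w r)\<^sup>2)" by (simp add: Lp2_iff)
    moreover have "(\<lambda>r. (indicator {0..h} r * w r)\<^sup>2) = (\<lambda>r. indicator {0..h} r *\<^sub>R (w r)\<^sup>2)"
      by (auto simp: indicator_def)
    ultimately have w2: "set_integrable lborel {0..h} (\<lambda>r. (w r)\<^sup>2)" by (simp add: set_integrable_def)
    have "A (x + h) - A x = (LINT r:{0..h}|lborel. A' (x + r))"
      using primitiveD(3)[OF Pr, of 0 h] h by (simp add: add.commute)
    moreover have "(LINT r:{0..h}|lborel. w r) = (LINT r:{0..h}|lborel. A' (x + r)) - h * A' x"
      unfolding w_def using set_integral_diff(2)[OF i1 c, of "A' x"] h by (simp add: set_lebesgue_integral_def)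
    ultimately have "(A (x + h) - A x) / h - A' x = (LINT r:{0..h}|lborel. w r) / h"
      using h by (simp add: field_simps)
    then have "((A (x + h) - A x) / h - A' x)\<^sup>2 = (LINT r:{0..h}|lborel. w r)\<^sup>2 / h\<^sup>2" by (simp add: power_divide)
    also have "\<dots> \<le> (h * (LINT r:{0..h}|lborel. (w r)\<^sup>2)) / h\<^sup>2"
      by (intro divide_right_mono square_integral_le h wi w2) auto
    also have "\<dots> = (1 / h) * (LINT r:{0..h}|lborel. (w r)\<^sup>2)" using h by (simp add: power2_eq_square)
    finally have "ennreal (((A (x + h) - A x) / h - A' x)\<^sup>2) \<le> ennreal ((1 / h) * (LINT r:{0..h}|lborel. (w r)\<^sup>2))"
      by (rule ennreal_leI)
    also have "\<dots> = ennreal (1 / h) * ennreal (LINT r|lborel. indicator {0..h} r *\<^sub>R (w r)\<^sup>2)"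
      using h by (subst ennreal_mult') (auto simp: set_lebesgue_integral_def)
    also have "ennreal (LINT r|lborel. indicator {0..h} r *\<^sub>R (w r)\<^sup>2) = (\<integral>\<^sup>+r. ennreal (indicator {0..h} r *\<^sub>R (w r)\<^sup>2) \<partial>lborel)"
      by (rule nn_integral_eq_integral[symmetric]) (use w2 in \<open>auto simp: set_integrable_def\<close>)
    also have "\<dots> = (\<integral>\<^sup>+r. indicator {0..h} r * ennreal ((w r)\<^sup>2) \<partial>lborel)"
      by (intro nn_integral_cong) (auto simp: indicator_def)
    finally show ?thesis unfolding w_def by (subst nn_integral_cmult) auto
  qed
  have "L2sq (\<lambda>x. (A (x + h) - A x) / h - A' x) \<le>
    (\<integral>\<^sup>+x. \<integral>\<^sup>+r. ennreal (1 / h) * (indicator {0..h} r * ennreal ((A' (x + r) - A' x)\<^sup>2)) \<partial>lborel \<partial>lborel)"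
    unfolding L2sq_def by (intro nn_integral_mono pw)
  also have "\<dots> = (\<integral>\<^sup>+r. \<integral>\<^sup>+x. ennreal (1 / h) * (indicator {0..h} r * ennreal ((A' (x + r) - A' x)\<^sup>2)) \<partial>lborel \<partial>lborel)"
    by (rule lborel_pair.Fubini') measurable
  also have "\<dots> = (\<integral>\<^sup>+r. ennreal (1 / h) * (indicator {0..h} r * L2sq (\<lambda>x. A' (x + r) - A' x)) \<partial>lborel)"
    unfolding L2sq_def by (intro nn_integral_cong) (simp add: nn_integral_cmult)
  also have "\<dots> \<le> (\<integral>\<^sup>+r. ennreal (1 / h) * (indicator {0..h} r * e) \<partial>lborel)"
    by (intro nn_integral_mono) (auto simp: indicator_def intro!: mult_left_mono e)
  also have "\<dots> = ennreal (1 / h) * (\<integral>\<^sup>+r. e * indicator {0..h} r \<partial>lborel)"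
    by (subst nn_integral_cmult) (auto simp: mult.commute)
  also have "\<dots> = ennreal (1 / h) * (e * ennreal h)"
    using h by (simp add: nn_integral_cmult_indicator)
  also have "\<dots> = e * (ennreal (1 / h) * ennreal h)" by (simp add: mult_ac)
  also have "ennreal (1 / h) * ennreal h = 1" using h by (simp add: ennreal_mult[symmetric])
  finally show ?thesis by simp
qed

text \<open>For negative increments the quotient at \<open>x\<close> is the quotient for the positive increment at
  the shifted point, up to one more translation increment of \<open>A'\<close>.\<close>

theorem primitive_L2_differentiable:
  assumes P: "primitive A A'" and A': "A' \<in> Lp 2"
  shows "L2_null (at 0) (\<lambda>h x. (A (x + h) - A x) / h - A' x)"
  unfolding L2_null_def
proof
  have [measurable]: "A' \<in> borel_measurable borel" "A \<in> borel_measurable borel"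
    using A' primitive_measurable[OF P] by (auto simp: Lp2_iff)
  show "\<forall>\<^sub>F s in at 0. (\<lambda>x. (A (x + s) - A x) / s - A' x) \<in> borel_measurable borel" by simp
  define D where "D h x = (A (x + h) - A x) / h - A' x" for h x
  have [measurable]: "D h \<in> borel_measurable borel" for h unfolding D_def by measurable
  define \<omega> where "\<omega> h = L2sq (\<lambda>x. A' (x + h) - A' x)" for h
  have w0: "(\<omega> \<longlongrightarrow> 0) (at 0)"
    using L2_translation_continuous[OF A'] by (simp add: L2_null_def \<omega>_def[abs_def])
  show "((\<lambda>h. L2sq (\<lambda>x. (A (x + h) - A x) / h - A' x)) \<longlongrightarrow> 0) (at 0)"
    unfolding D_def[symmetric]
  proof (rule order_tendstoI)
    fix a :: ennreal assume a: "0 < a"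
    define b where "b = min a 1 / 5"
    have b0: "0 < min a 1" "min a 1 < \<infinity>" using a by (auto simp: min_less_iff_disj)
    obtain r where r: "min a 1 = ennreal r" "r \<ge> 0" using b0 by (cases "min a 1") auto
    have r0: "r > 0" using b0 r by simp
    have "\<forall>\<^sub>F h in at 0. \<omega> h < ennreal (r / 5)"
      using w0 r0 by (intro order_tendstoD) auto
    then obtain d where d: "d > 0" "\<And>h. h \<noteq> 0 \<Longrightarrow> \<bar>h\<bar> < d \<Longrightarrow> \<omega> h < ennreal (r / 5)"
      unfolding eventually_at dist_real_def by auto
    have \<omega>: "\<omega> h \<le> ennreal (r / 5)" if "\<bar>h\<bar> < d" for h
      using d(2)[of h] that by (cases "h = 0") (auto simp: \<omega>_def L2sq_def)
    have pos: "L2sq (D h) \<le> ennreal (r / 5)" if "0 < h" "h < d" for h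
      unfolding D_def by (rule difference_quotient_L2_bound[OF P A' that(1)])
        (use \<omega> that in \<open>auto simp: \<omega>_def\<close>)
    have all: "L2sq (D h) < a" if h: "h \<noteq> 0" "\<bar>h\<bar> < d" for h
    proof -
      have "L2sq (D h) \<le> ennreal (4 * r / 5)"
      proof (cases "h > 0")
        case True
        have "L2sq (D h) \<le> ennreal (r / 5)" using pos[of h] True h by simp
        also have "\<dots> \<le> ennreal (4 * r / 5)" using r0 by (intro ennreal_leI) auto
        finally show ?thesis .
      next
        case False
        have eq: "D h x = D (- h) (x + h) + (A' (x + h) - A' x)" for x
          using h(1) by (simp add: D_def minus_divide_right[symmetric] field_simps)
        have "L2sq (D h) \<le> 2 * L2sq (\<lambda>x. D (- h) (x + h)) + 2 * \<omega> h"
          unfolding eq[abs_def] \<omega>_def by (rule L2sq_add) measurable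
        also have "\<dots> = 2 * L2sq (D (- h)) + 2 * \<omega> h" by (simp add: L2sq_shift)
        also have "\<dots> \<le> 2 * ennreal (r / 5) + 2 * ennreal (r / 5)"
          using pos[of "- h"] \<omega>[of h] h False by (intro add_mono mult_left_mono) auto
        also have "\<dots> = ennreal (4 * r / 5)"
        proof -
          have "2 * ennreal (r / 5) = ennreal (2 * (r / 5))" using r0 by (subst ennreal_mult) auto
          then show ?thesis using r0 by (simp add: ennreal_plus[symmetric] del: ennreal_plus)
        qed
        finally show ?thesis .
      qed
      also have "\<dots> < ennreal r" using r0 by (simp add: ennreal_less_iff)
      also have "\<dots> \<le> a" using r(1) by (metis min.cobounded1)
      finally show ?thesis .
    qed
    show "\<forall>\<^sub>F h in at 0. L2sq (D h) < a"
      unfolding eventually_at using d(1) all by (intro exI[of _ d]) (auto simp: dist_real_def)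
  qed auto
qed

section \<open>Energy regularity of travelling waves\<close>

text \<open>\<open>W\<close> is continuously differentiable on \<open>[0, \<infinity>) \<times> \<real>\<close> with the partial derivatives \<open>Wt\<close> and
  \<open>Wx\<close>; the time derivative is one-sided at zero.\<close>

definition C1_cylinder :: "(real \<Rightarrow> real \<Rightarrow> real) \<Rightarrow> (real \<Rightarrow> real \<Rightarrow> real) \<Rightarrow> (real \<Rightarrow> real \<Rightarrow> real) \<Rightarrow> bool" where
  "C1_cylinder W Wt Wx \<longleftrightarrow>
     continuous_on ({0..} \<times> UNIV) (\<lambda>(t, x). W t x) \<and>
     continuous_on ({0..} \<times> UNIV) (\<lambda>(t, x). Wt t x) \<and>
     continuous_on ({0..} \<times> UNIV) (\<lambda>(t, x). Wx t x) \<and>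
     (\<forall>t\<ge>0. \<forall>x. ((\<lambda>t. W t x) has_real_derivative Wt t x) (at t within {0..})) \<and>
     (\<forall>t\<ge>0. \<forall>x. (W t has_real_derivative Wx t x) (at x))"

lemma C1_cylinder_add:
  assumes "C1_cylinder V Vt Vx" "C1_cylinder W Wt Wx"
  shows "C1_cylinder (\<lambda>t x. V t x + W t x) (\<lambda>t x. Vt t x + Wt t x) (\<lambda>t x. Vx t x + Wx t x)"
  using assms unfolding C1_cylinder_def case_prod_beta
  by (auto intro!: continuous_intros derivative_intros)

lemma joint_continuous_uniform:
  assumes c: "continuous_on ({0..} \<times> UNIV) (\<lambda>(t::real, x::real). V t x)" and t: "0 \<le> t" and e: "(0::real) < e"
  shows "\<exists>d>0. \<forall>s x. 0 \<le> s \<and> \<bar>s - t\<bar> < d \<and> \<bar>x\<bar> \<le> L \<longrightarrow> \<bar>V s x - V t x\<bar> < (e::real)"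
proof -
  define K where "K = {max 0 (t - 1)..t + 1} \<times> {-L..L}"
  have "compact K" unfolding K_def by (intro compact_Times compact_Icc)
  then have "uniformly_continuous_on K (\<lambda>(t, x). V t x)"
    by (intro compact_uniformly_continuous continuous_on_subset[OF c]) (auto simp: K_def)
  then obtain d where d: "d > 0" "\<And>p q. p \<in> K \<Longrightarrow> q \<in> K \<Longrightarrow> dist q p < d \<Longrightarrow>
      dist ((\<lambda>(t, x). V t x) q) ((\<lambda>(t, x). V t x) p) < e"
    unfolding uniformly_continuous_on_def using e by metis
  have "\<bar>V s x - V t x\<bar> < e" if "0 \<le> s" "\<bar>s - t\<bar> < min d 1" "\<bar>x\<bar> \<le> L" for s x
    using d(2)[of "(t, x)" "(s, x)"] that t by (auto simp: K_def dist_Pair_Pair dist_real_def abs_le_iff abs_less_iff)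
  then show ?thesis using d(1) by (intro exI[of _ "min d 1"]) auto
qed

lemma joint_continuous_section:
  assumes "continuous_on ({0..} \<times> UNIV) (\<lambda>(t, x). V t x)" "0 \<le> t"
  shows "continuous_on UNIV (V t)"
proof -
  have "continuous_on UNIV (\<lambda>x. (\<lambda>(t, x). V t x) (t, x))"
    by (rule continuous_on_compose2[OF assms(1)]) (use assms(2) in \<open>auto intro!: continuous_intros\<close>)
  then show ?thesis by simp
qed

lemma L2_null_eq:
  assumes "L2_null G k" "\<forall>\<^sub>F s in G. \<forall>x. h s x = k s x" shows "L2_null G h"
proof -
  have e: "\<forall>\<^sub>F s in G. h s = k s" using assms(2) by eventually_elim auto
  have "\<forall>\<^sub>F s in G. k s \<in> borel_measurable borel" using assms(1) by (simp add: L2_null_def)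
  with e have "\<forall>\<^sub>F s in G. h s \<in> borel_measurable borel" by eventually_elim simp
  then show ?thesis by (rule L2_null_mono[OF assms(1)]) (use e in \<open>auto elim: eventually_mono\<close>)
qed

lemma L2_null_shift:
  assumes "L2_null G h" shows "L2_null G (\<lambda>s x. h s (x + r))"
proof -
  have m: "\<forall>\<^sub>F s in G. h s \<in> borel_measurable borel" and l: "((\<lambda>s. L2sq (h s)) \<longlongrightarrow> 0) G"
    using assms by (auto simp: L2_null_def)
  have "\<forall>\<^sub>F s in G. L2sq (h s) = L2sq (\<lambda>x. h s (x + r))" using m by eventually_elim (simp add: L2sq_shift)
  from Lim_transform_eventually[OF l this] show ?thesis
    using m by (auto simp: L2_null_def elim!: eventually_mono)
qed

text \<open>On a compact space interval joint continuity is uniform in space.\<close>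

lemma joint_continuous_L2_null:
  assumes c: "continuous_on ({0..} \<times> UNIV) (\<lambda>(t::real, x::real). V t x)" and t: "0 \<le> t" and S: "S \<subseteq> {0..}"
  shows "L2_null (at t within S) (\<lambda>s x. indicator {-L..L} x * (V s x - V t x))"
proof (rule L2_null_uniform[where L = L])
  have S0: "\<forall>\<^sub>F s in at t within S. 0 \<le> s" using S by (auto simp: eventually_at_filter subset_iff intro!: always_eventually)
  have Vm: "V s \<in> borel_measurable borel" if "0 \<le> s" for s
    using joint_continuous_section[OF c that] by (rule borel_measurable_continuous_onI)
  show "\<forall>\<^sub>F s in at t within S. (\<lambda>x. indicator {-L..L} x * (V s x - V t x)) \<in> borel_measurable borel"
    using S0
  proof eventually_elim
    case (elim s) then show ?case using Vm[OF t] Vm[OF elim] by simp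
  qed
  fix e :: real assume "0 < e"
  from joint_continuous_uniform[OF c t this, of L]
  obtain d where d: "d > 0" "\<And>s x. 0 \<le> s \<Longrightarrow> \<bar>s - t\<bar> < d \<Longrightarrow> \<bar>x\<bar> \<le> L \<Longrightarrow> \<bar>V s x - V t x\<bar> < e" by blast
  have "\<forall>\<^sub>F s in at t within S. \<bar>s - t\<bar> < d"
    unfolding eventually_at using d(1) by (auto simp: dist_real_def)
  with S0 show "\<forall>\<^sub>F s in at t within S. \<forall>x. \<bar>indicator {-L..L} x * (V s x - V t x)\<bar> \<le> e * indicator {-L..L} x"
  proof eventually_elim
    case (elim s)
    show ?case
    proof
      fix x show "\<bar>indicator {-L..L} x * (V s x - V t x)\<bar> \<le> e * indicator {-L..L} x"
        using d(2)[OF elim, of x] by (cases "\<bar>x\<bar> \<le> L") (auto simp: indicator_def abs_le_iff)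
    qed
  qed
qed

text \<open>By the mean value theorem the difference quotient is a value of \<open>Wt\<close> at a nearby time, so it
  converges uniformly on compact space intervals.\<close>

lemma C1_cylinder_quotient_L2_null:
  assumes W: "C1_cylinder W Wt Wx" and t: "0 \<le> t" and S: "S \<subseteq> {0..}"
  shows "L2_null (at t within S) (\<lambda>s x. indicator {-L..L} x * ((W s x - W t x) / (s - t) - Wt t x))"
proof (rule L2_null_uniform[where L = L])
  have cW: "continuous_on ({0..} \<times> UNIV) (\<lambda>(t, x). W t x)"
    and cWt: "continuous_on ({0..} \<times> UNIV) (\<lambda>(t, x). Wt t x)"
    and dW: "\<And>t x. t \<ge> 0 \<Longrightarrow> ((\<lambda>t. W t x) has_real_derivative Wt t x) (at t within {0..})"
    using W by (auto simp: C1_cylinder_def)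
  have S0: "\<forall>\<^sub>F s in at t within S. 0 \<le> s \<and> s \<noteq> t" using S by (auto simp: eventually_at_filter subset_iff intro!: always_eventually)
  have Wm: "W s \<in> borel_measurable borel" "Wt s \<in> borel_measurable borel" if "0 \<le> s" for s
    using joint_continuous_section[OF cW that] joint_continuous_section[OF cWt that]
    by (auto intro: borel_measurable_continuous_onI)
  show "\<forall>\<^sub>F s in at t within S. (\<lambda>x. indicator {-L..L} x * ((W s x - W t x) / (s - t) - Wt t x)) \<in> borel_measurable borel"
    using S0
  proof eventually_elim
    case (elim s) then show ?case using Wm[OF t] Wm[of s] by simp
  qed
  fix e :: real assume "0 < e"
  from joint_continuous_uniform[OF cWt t this, of L]
  obtain d where d: "d > 0" "\<And>s x. 0 \<le> s \<Longrightarrow> \<bar>s - t\<bar> < d \<Longrightarrow> \<bar>x\<bar> \<le> L \<Longrightarrow> \<bar>Wt s x - Wt t x\<bar> < e" by blast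
  have mv: "\<exists>z\<in>{a<..<b}. W b x - W a x = Wt z x * (b - a)" if "0 \<le> a" "a < b" for a b x
  proof -
    have "\<exists>z\<in>{a<..<b}. W b x - W a x = (\<lambda>h. Wt z x * h) (b - a)"
      using that by (intro mvt_simple) (auto intro!: DERIV_subset[OF dW, unfolded has_field_derivative_def])
    then show ?thesis by simp
  qed
  have "\<forall>\<^sub>F s in at t within S. \<bar>s - t\<bar> < d"
    unfolding eventually_at using d(1) by (auto simp: dist_real_def)
  with S0 show "\<forall>\<^sub>F s in at t within S. \<forall>x. \<bar>indicator {-L..L} x * ((W s x - W t x) / (s - t) - Wt t x)\<bar> \<le> e * indicator {-L..L} x"
  proof (eventually_elim, intro allI)
    fix s x assume s: "0 \<le> s \<and> s \<noteq> t" "\<bar>s - t\<bar> < d"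
    show "\<bar>indicator {-L..L} x * ((W s x - W t x) / (s - t) - Wt t x)\<bar> \<le> e * indicator {-L..L} x"
    proof (cases "\<bar>x\<bar> \<le> L")
      case True
      obtain z where z: "0 \<le> z" "\<bar>z - t\<bar> < d" "W s x - W t x = Wt z x * (s - t)"
      proof (cases "s < t")
        case True
        from mv[OF _ True, of x] s obtain z where "z \<in> {s<..<t}" "W t x - W s x = Wt z x * (t - s)" by auto
        then show ?thesis using s by (intro that[of z]) (auto simp: algebra_simps)
      next
        case False
        then have "t < s" using s by auto
        from mv[OF t this, of x] obtain z where "z \<in> {t<..<s}" "W s x - W t x = Wt z x * (s - t)" by auto
        then show ?thesis using s t by (intro that[of z]) auto
      qed
      have "\<bar>(W s x - W t x) / (s - t) - Wt t x\<bar> < e"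
        using d(2)[OF z(1,2) True] z(3) s by simp
      then show ?thesis using True by (auto simp: abs_le_iff)
    qed (auto simp: indicator_def)
  qed
qed

lemma primitive_of_derivative:
  assumes "\<And>x. (F has_real_derivative f x) (at x)" "continuous_on UNIV f"
  shows "primitive F f"
  unfolding primitive_def
proof (intro conjI allI impI)
  show "f \<in> borel_measurable borel" using assms(2) by (rule borel_measurable_continuous_onI)
  show "set_integrable lborel {a..b} f" for a b
    by (rule borel_integrable_atLeastAtMost'[OF continuous_on_subset[OF assms(2)]]) simp
  fix a b :: real assume "a \<le> b"
  then show "F b - F a = (LBINT y:{a..b}. f y)"
    unfolding set_lebesgue_integral_def
    by (intro integral_FTC_atLeastAtMost[symmetric] continuous_on_subset[OF assms(2)])
       (auto simp: has_real_derivative_iff_has_vector_derivative[symmetric] intro: has_field_derivative_at_within assms(1))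
qed

lemma time_interval_ereal: "time_interval (ereal T) = {0..<T}"
  by (auto simp: time_interval_def)

lemma filterlim_minus_at_0: "filterlim (\<lambda>s::real. s - t) (at 0) (at t within S)"
  and filterlim_minus_at_0': "filterlim (\<lambda>s::real. t - s) (at 0) (at t within S)"
  unfolding filterlim_at
  by (auto intro!: tendsto_eq_intros simp: eventually_at_filter)

text \<open>All fields below are sums of a classical part and of two travelling waves whose profiles are
  primitives of \<open>L\<^sup>2\<close> functions. The classical part and the profiles are not square integrable by
  themselves; only the sum vanishes outside \<open>[-L, L]\<close>. Therefore every derivative is multiplied by
  the indicator of this interval, and mean-square convergence is checked for each part after this
  cut-off.\<close>

theorem travelling_wave_regularity:
  fixes T L :: real
  assumes L: "0 \<le> L" and W: "C1_cylinder W Wt Wx"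
    and a: "\<And>t. (a has_real_derivative a' t) (at t)" and ca': "continuous_on UNIV a'"
    and A: "primitive A A'" "A' \<in> Lp 2" and B: "primitive B B'" "B' \<in> Lp 2"
    and U: "\<And>t x. 0 \<le> t \<Longrightarrow> t < T \<Longrightarrow> U t x = W t x + a t * A (x + t) + a t * B (x - t)"
    and Z: "\<And>t x. 0 \<le> t \<Longrightarrow> t < T \<Longrightarrow> L \<le> \<bar>x\<bar> \<Longrightarrow> U t x = 0"
  shows "C0_H1 (ereal T) U" "C1_L2 (ereal T) U"
proof -
  define I where "I = (indicator {-L..L} :: real \<Rightarrow> real)"
  define gx where "gx t x = Wx t x + a t * A' (x + t) + a t * B' (x - t)" for t x
  define gt where "gt t x = Wt t x + a' t * (A (x + t) + B (x - t)) + a t * (A' (x + t) - B' (x - t))" for t x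
  have cW: "continuous_on ({0..} \<times> UNIV) (\<lambda>(t, x). W t x)"
    and cWt: "continuous_on ({0..} \<times> UNIV) (\<lambda>(t, x). Wt t x)"
    and cWx: "continuous_on ({0..} \<times> UNIV) (\<lambda>(t, x). Wx t x)"
    and dWx: "\<And>t x. t \<ge> 0 \<Longrightarrow> (W t has_real_derivative Wx t x) (at x)"
    using W by (auto simp: C1_cylinder_def)
  have cA: "continuous_on X A" and cB: "continuous_on X B" for X
    using primitive_continuous A B by auto
  have ca: "continuous_on X a" for X
    using a by (meson DERIV_isCont continuous_at_imp_continuous_on)
  have at: "(a \<longlongrightarrow> a t) (at t within X)" for t X
    using ca[of UNIV] by (meson UNIV_I continuous_on_def tendsto_within_subset subset_UNIV)
  have cU: "continuous_on ({0..} \<times> UNIV) (\<lambda>(t, x). W t x + a t * A (x + t) + a t * B (x - t))"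
    using cW unfolding case_prod_beta
    by (auto intro!: continuous_intros continuous_on_compose2[OF cA[of UNIV]] continuous_on_compose2[OF cB[of UNIV]]
        continuous_on_compose2[OF ca[of UNIV]])
  have UI: "U t x = I x * U t x" if "0 \<le> t" "t < T" for t x
    using Z[OF that, of x] by (cases "L \<le> \<bar>x\<bar>") (auto simp: I_def indicator_def abs_less_iff)
  have cUt: "continuous_on UNIV (U t)" if "0 \<le> t" "t < T" for t
    using joint_continuous_section[OF cU, of t] U[OF that] that by simp
  have ILp: "(\<lambda>x. I x * f x) \<in> Lp 2" if "f \<in> Lp 2" for f
    by (rule Lp2_mono[OF that]) (use that in \<open>auto simp: I_def indicator_def Lp2_iff\<close>)
  have cont_Lp: "(\<lambda>x. I x * f x) \<in> Lp 2" if "continuous_on UNIV f" for f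
    unfolding I_def by (rule Lp2_continuous_compact[OF that])
  have U_Lp: "U t \<in> Lp 2" if "0 \<le> t" "t < T" for t
  proof -
    have "U t = (\<lambda>x. I x * U t x)" using UI[OF that] by (intro ext)
    then show ?thesis using cont_Lp[OF cUt[OF that]] by simp
  qed
  have A'_Lp: "(\<lambda>x. A' (x + t)) \<in> Lp 2" and B'_Lp: "(\<lambda>x. B' (x - t)) \<in> Lp 2" for t
    using Lp2_shift[OF A(2), of t] Lp2_shift[OF B(2), of "-t"] by simp_all
  have AB_c: "continuous_on UNIV (\<lambda>x. A (x + t))" "continuous_on UNIV (\<lambda>x. B (x - t))" for t
    by (auto intro!: continuous_on_compose2[OF cA[of UNIV]] continuous_on_compose2[OF cB[of UNIV]] continuous_intros)
  have gx_Lp: "(\<lambda>x. I x * gx t x) \<in> Lp 2" if "0 \<le> t" for t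
  proof -
    have "(\<lambda>x. I x * gx t x) = (\<lambda>x. I x * Wx t x + I x * (a t * A' (x + t) + a t * B' (x - t)))"
      by (auto simp: gx_def algebra_simps)
    then show ?thesis
      using Lp2_add[OF cont_Lp[OF joint_continuous_section[OF cWx that]] ILp[OF Lp2_add[OF Lp2_cmult[OF A'_Lp, of "a t"] Lp2_cmult[OF B'_Lp, of "a t"]]]]
      by simp
  qed
  have gt_Lp: "(\<lambda>x. I x * gt t x) \<in> Lp 2" if "0 \<le> t" for t
  proof -
    have "(\<lambda>x. I x * gt t x) = (\<lambda>x. I x * (Wt t x + a' t * (A (x + t) + B (x - t))) + I x * (a t * A' (x + t) + - a t * B' (x - t)))"
      by (auto simp: gt_def algebra_simps)
    moreover have "continuous_on UNIV (\<lambda>x. Wt t x + a' t * (A (x + t) + B (x - t)))"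
      using AB_c joint_continuous_section[OF cWt that] by (intro continuous_intros) auto
    ultimately show ?thesis
      using Lp2_add[OF cont_Lp ILp[OF Lp2_add[OF Lp2_cmult[OF A'_Lp, of "a t"] Lp2_cmult[OF B'_Lp, of "- a t"]]]]
      by simp
  qed
  have prim: "primitive (U t) (gx t)" if "0 \<le> t" "t < T" for t
  proof -
    have "primitive (W t) (Wx t)"
      using dWx that joint_continuous_section[OF cWx] by (intro primitive_of_derivative) auto
    from primitive_add[OF primitive_add[OF this primitive_cmult[OF primitive_shift[OF A(1), of t], of "a t"]]
        primitive_cmult[OF primitive_shift[OF B(1), of "-t"], of "a t"]]
    have "primitive (\<lambda>x. W t x + a t * A (x + t) + a t * B (x - t)) (gx t)" by (simp add: gx_def[abs_def])
    moreover have "U t = (\<lambda>x. W t x + a t * A (x + t) + a t * B (x - t))" using U[OF that] by (intro ext)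
    ultimately show ?thesis by simp
  qed
  have weak: "weak_deriv (U t) (\<lambda>x. I x * gx t x)" if "0 \<le> t" "t < T" for t
    unfolding I_def by (rule weak_deriv_primitive[OF prim[OF that] L Z[OF that]])
  have weakd: "weak_deriv (\<lambda>x. U s x - U t x) (\<lambda>x. I x * (gx s x - gx t x))"
    if "0 \<le> t" "t < T" "0 \<le> s" "s < T" for s t
    unfolding I_def
  proof (rule weak_deriv_primitive[OF _ L])
    show "primitive (\<lambda>x. U s x - U t x) (\<lambda>x. gx s x - gx t x)"
      using primitive_add[OF prim[OF that(3,4)] primitive_cmult[OF prim[OF that(1,2)], of "-1"]] by simp
  qed (use Z that in auto)
  have nullA: "L2_null (at t within S) (\<lambda>s x. A' (x + s) - A' (x + t))" for t S
    using L2_null_shift[OF L2_null_filterlim[OF L2_translation_continuous[OF A(2)] filterlim_minus_at_0[of t S]], of t]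
    by (simp add: add_ac)
  have nullB: "L2_null (at t within S) (\<lambda>s x. B' (x - s) - B' (x - t))" for t S
    using L2_null_shift[OF L2_null_filterlim[OF L2_translation_continuous[OF B(2)] filterlim_minus_at_0'[of t S]], of "-t"]
    by (simp add: algebra_simps)
  have nullA1: "L2_null (at t within S) (\<lambda>s x. (A (x + s) - A (x + t)) / (s - t) - A' (x + t))" for t S
    using L2_null_shift[OF L2_null_filterlim[OF primitive_L2_differentiable[OF A] filterlim_minus_at_0[of t S]], of t]
    by (simp add: add_ac)
  have nullB1: "L2_null (at t within S) (\<lambda>s x. (B (x - s) - B (x - t)) / (t - s) - B' (x - t))" for t S
    using L2_null_shift[OF L2_null_filterlim[OF primitive_L2_differentiable[OF B] filterlim_minus_at_0'[of t S]], of "-t"]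
    by (simp add: algebra_simps)
  have a0: "((\<lambda>s. a s - a t) \<longlongrightarrow> 0) (at t within S)" for t S
    using tendsto_diff[OF at[of t S] tendsto_const[of "a t"]] by simp
  have a1: "((\<lambda>s. (a s - a t) / (s - t) - a' t) \<longlongrightarrow> 0) (at t within S)" for t S
  proof -
    have "(a has_real_derivative a' t) (at t within S)" using a by (rule has_field_derivative_at_within)
    then have "((\<lambda>s. (a s - a t) / (s - t)) \<longlongrightarrow> a' t) (at t within S)" by (simp add: has_field_derivative_iff)
    from tendsto_diff[OF this tendsto_const[of "a' t"]] show ?thesis by simp
  qed
  have ev: "\<forall>\<^sub>F s in at t within {0..<T}. 0 \<le> s \<and> s < T \<and> s \<noteq> t" for t
    by (auto simp: eventually_at_filter)
  have N0: "L2_null (at t within {0..<T}) (\<lambda>s x. U s x - U t x)" if "0 \<le> t" "t < T" for t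
  proof (rule L2_null_eq[OF joint_continuous_L2_null[OF cU that(1), of "{0..<T}" L]])
    show "\<forall>\<^sub>F s in at t within {0..<T}. \<forall>x. U s x - U t x = indicator {-L..L} x *
      (W s x + a s * A (x + s) + a s * B (x - s) - (W t x + a t * A (x + t) + a t * B (x - t)))"
      using ev[of t]
    proof (eventually_elim, intro allI)
      fix s x assume "0 \<le> s \<and> s < T \<and> s \<noteq> t"
      then show "U s x - U t x = indicator {-L..L} x *
      (W s x + a s * A (x + s) + a s * B (x - s) - (W t x + a t * A (x + t) + a t * B (x - t)))"
        using UI[of s x] UI[of t x] that U[of s x] U[of t x] unfolding I_def
        by (metis right_diff_distrib)
    qed
  qed auto
  have Nx: "L2_null (at t within {0..<T}) (\<lambda>s x. I x * (gx s x - gx t x))" if "0 \<le> t" "t < T" for t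
  proof (rule L2_null_eq)
    show "L2_null (at t within {0..<T}) (\<lambda>s x. I x * (Wx s x - Wx t x) +
      I x * (a s * ((A' (x + s) - A' (x + t)) + (B' (x - s) - B' (x - t)))
       + (a s - a t) * (A' (x + t) + B' (x - t))))"
      unfolding I_def
      by (intro L2_null_add joint_continuous_L2_null[OF cWx that(1)] L2_null_indicator
            L2_null_cmult[OF _ at] nullA nullB L2_null_scalar Lp2_add A'_Lp B'_Lp a0) auto
  qed (auto simp: gx_def algebra_simps)
  have Nt: "L2_null (at t within {0..<T}) (\<lambda>s x. I x * (gt s x - gt t x))"
    if "0 \<le> t" "t < T" for t
  proof (rule L2_null_eq)
    have c: "continuous_on ({0..} \<times> UNIV) (\<lambda>(t, x). Wt t x + a' t * (A (x + t) + B (x - t)))"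
      using cWt unfolding case_prod_beta
      by (auto intro!: continuous_intros continuous_on_compose2[OF cA[of UNIV]] continuous_on_compose2[OF cB[of UNIV]]
          continuous_on_compose2[OF ca'])
    show "L2_null (at t within {0..<T}) (\<lambda>s x. I x * ((Wt s x + a' s * (A (x + s) + B (x - s))) - (Wt t x + a' t * (A (x + t) + B (x - t)))) +
      I x * (a s * ((A' (x + s) - A' (x + t)) + - (B' (x - s) - B' (x - t)))
       + (a s - a t) * (A' (x + t) + (-1) * B' (x - t))))"
      unfolding I_def
      by (intro L2_null_add joint_continuous_L2_null[OF c that(1)] L2_null_indicator L2_null_minus
            L2_null_cmult[OF _ at] nullA nullB L2_null_scalar Lp2_add A'_Lp Lp2_cmult[OF B'_Lp] a0) auto
  qed (auto simp: gt_def algebra_simps)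
  have Nq: "L2_null (at t within {0..<T}) (\<lambda>s x. (U s x - U t x) / (s - t) - I x * gt t x)"
    if t: "0 \<le> t" "t < T" for t
  proof (rule L2_null_eq)
    have IAB: "(\<lambda>x. I x * (A (x + t) + B (x - t))) \<in> Lp 2"
      using AB_c by (intro cont_Lp continuous_intros) auto
    show "L2_null (at t within {0..<T}) (\<lambda>s x. I x * ((W s x - W t x) / (s - t) - Wt t x) +
      (I x * (a s * (((A (x + s) - A (x + t)) / (s - t) - A' (x + t)) + - ((B (x - s) - B (x - t)) / (t - s) - B' (x - t)))
       + (a s - a t) * (A' (x + t) + (-1) * B' (x - t)))
       + ((a s - a t) / (s - t) - a' t) * (I x * (A (x + t) + B (x - t)))))"
      unfolding I_def
      by (intro L2_null_add C1_cylinder_quotient_L2_null[OF W that(1)] L2_null_indicator L2_null_minus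
            L2_null_cmult[OF _ at] nullA1 nullB1 L2_null_scalar Lp2_add A'_Lp Lp2_cmult[OF B'_Lp] a0 a1
            IAB[unfolded I_def]) auto
    show "\<forall>\<^sub>F s in at t within {0..<T}. \<forall>x. (U s x - U t x) / (s - t) - I x * gt t x =
      I x * ((W s x - W t x) / (s - t) - Wt t x) +
      (I x * (a s * (((A (x + s) - A (x + t)) / (s - t) - A' (x + t)) + - ((B (x - s) - B (x - t)) / (t - s) - B' (x - t)))
       + (a s - a t) * (A' (x + t) + (-1) * B' (x - t)))
       + ((a s - a t) / (s - t) - a' t) * (I x * (A (x + t) + B (x - t))))"
      using ev[of t]
    proof (eventually_elim, intro allI)
      fix s x assume s: "0 \<le> s \<and> s < T \<and> s \<noteq> t"
      define k where "k = 1 / (s - t)"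
      have k: "z / (s - t) = z * k" "z / (t - s) = - (z * k)" for z
        using s by (simp_all add: k_def minus_divide_right)
      have "(U s x - U t x) / (s - t) = I x * ((U s x - U t x) / (s - t))"
        using UI[of s x] UI[of t x] s t by (metis right_diff_distrib times_divide_eq_right)
      then show "(U s x - U t x) / (s - t) - I x * gt t x =
      I x * ((W s x - W t x) / (s - t) - Wt t x) +
      (I x * (a s * (((A (x + s) - A (x + t)) / (s - t) - A' (x + t)) + - ((B (x - s) - B (x - t)) / (t - s) - B' (x - t)))
       + (a s - a t) * (A' (x + t) + (-1) * B' (x - t)))
       + ((a s - a t) / (s - t) - a' t) * (I x * (A (x + t) + B (x - t))))"
        using U[of s x] U[of t x] s t unfolding k gt_def by (simp add: algebra_simps)
    qed
  qed
  have TI: "time_interval (ereal T) = {0..<T}" by (rule time_interval_ereal)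
  have H1: "((\<lambda>s. H1_norm (\<lambda>x. U s x - U t x)) \<longlongrightarrow> 0) (at t within {0..<T})" if t: "0 \<le> t" "t < T" for t
  proof (rule Lim_transform_eventually)
    have "((\<lambda>s. sqrt ((Lp_norm 2 (\<lambda>x. U s x - U t x))\<^sup>2 + (Lp_norm 2 (\<lambda>x. I x * (gx s x - gx t x)))\<^sup>2))
      \<longlongrightarrow> sqrt (0\<^sup>2 + 0\<^sup>2)) (at t within {0..<T})"
      by (intro tendsto_intros L2_null_Lp_norm N0 Nx t)
    then show "((\<lambda>s. sqrt ((Lp_norm 2 (\<lambda>x. U s x - U t x))\<^sup>2 + (Lp_norm 2 (\<lambda>x. I x * (gx s x - gx t x)))\<^sup>2))
      \<longlongrightarrow> 0) (at t within {0..<T})" by simp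
    show "\<forall>\<^sub>F s in at t within {0..<T}. sqrt ((Lp_norm 2 (\<lambda>x. U s x - U t x))\<^sup>2 + (Lp_norm 2 (\<lambda>x. I x * (gx s x - gx t x)))\<^sup>2) = H1_norm (\<lambda>x. U s x - U t x)"
      using ev[of t]
    proof eventually_elim
      case (elim s)
      then have s: "0 \<le> s" "s < T" by auto
      have 1: "(\<lambda>x. U s x - U t x) \<in> Lp 2"
        using Lp2_add[OF U_Lp[OF s] Lp2_cmult[OF U_Lp[OF t], of "-1"]] by simp
      have 2: "(\<lambda>x. I x * (gx s x - gx t x)) \<in> Lp 2"
        using Lp2_add[OF gx_Lp[OF s(1)] Lp2_cmult[OF gx_Lp[OF t(1)], of "-1"]] by (simp add: right_diff_distrib)
      show ?case
        using H1_norm_eq[OF 1 2 weakd[OF t s]] by (simp add: Lp_norm2_eq)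
    qed
  qed
  show "C0_H1 (ereal T) U"
    unfolding C0_H1_def TI
  proof (intro ballI conjI H1)
    fix t assume "t \<in> {0..<T}"
    then have t: "0 \<le> t" "t < T" by auto
    show "U t \<in> H1" unfolding H1_def using U_Lp[OF t] weak[OF t] gx_Lp[OF t(1)] by blast
  qed auto
  show "C1_L2 (ereal T) U"
    unfolding C1_L2_def C0_L2_def TI
  proof (intro conjI ballI exI[of _ "\<lambda>t x. I x * gt t x"])
    fix t assume "t \<in> {0..<T}"
    then have t: "0 \<le> t" "t < T" by auto
    show "U t \<in> Lp 2" by (rule U_Lp[OF t])
    show "((\<lambda>s. Lp_norm 2 (\<lambda>x. U s x - U t x)) \<longlongrightarrow> 0) (at t within {0..<T})"
      by (rule L2_null_Lp_norm[OF N0[OF t]])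
    show "(\<lambda>x. I x * gt t x) \<in> Lp 2" by (rule gt_Lp[OF t(1)])
    show "((\<lambda>s. Lp_norm 2 (\<lambda>x. I x * gt s x - I x * gt t x)) \<longlongrightarrow> 0) (at t within {0..<T})"
      using L2_null_Lp_norm[OF Nt[OF t]] by (simp add: right_diff_distrib)
    show "((\<lambda>s. Lp_norm 2 (\<lambda>x. (U s x - U t x) / (s - t) - I x * gt t x)) \<longlongrightarrow> 0) (at t within {0..<T})"
      by (rule L2_null_Lp_norm[OF Nq[OF t]])
  qed
qed

section \<open>Integrals over light cones depending on parameters\<close>

abbreviation cont2 :: "(real \<Rightarrow> real \<Rightarrow> real) \<Rightarrow> bool" where
  "cont2 g \<equiv> continuous_on UNIV (\<lambda>(s, y). g s y)"

lemma cont2_compose: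
  assumes "cont2 g" "continuous_on A f" "continuous_on A h"
  shows "continuous_on A (\<lambda>p. g (f p) (h p))"
  using continuous_on_compose2[OF assms(1) continuous_on_Pair[OF assms(2,3)]] by simp

lemma integral_unit_interval:
  fixes f :: "real \<Rightarrow> real"
  assumes f: "continuous_on UNIV f" and ab: "a \<le> b"
  shows "integral {a..b} f = (b - a) * integral {0..1} (\<lambda>r. f (a + (b - a) * r))"
proof (cases "a = b")
  case False
  then have m: "b - a > 0" using ab by simp
  have "f integrable_on cbox a b" using continuous_on_subset[OF f] by (intro integrable_continuous) auto
  then have "(f has_integral integral {a..b} f) (cbox a b)" by (simp add: integrable_integral)
  from has_integral_affinity'[OF this m, of a]
  have "((\<lambda>r. f ((b - a) * r + a)) has_integral integral {a..b} f / (b - a)) {0..1}"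
    using m by (simp add: divide_inverse_commute)
  then have "integral {0..1} (\<lambda>r. f (a + (b - a) * r)) = integral {a..b} f / (b - a)"
    by (intro integral_unique) (simp add: add.commute)
  then show ?thesis using m by simp
qed simp

text \<open>Rescaling to the unit interval moves the variable limit into the integrand.\<close>

lemma continuous_on_integral_upper:
  fixes f :: "'a::topological_space \<Rightarrow> real \<Rightarrow> real"
  assumes f: "continuous_on (A \<times> UNIV) (\<lambda>(p, y). f p y)"
    and b: "continuous_on A b" "\<And>p. p \<in> A \<Longrightarrow> c \<le> b p"
  shows "continuous_on A (\<lambda>p. integral {c..b p} (f p))"
proof -
  have fp: "continuous_on UNIV (f p)" if "p \<in> A" for p
  proof -
    have "continuous_on UNIV (\<lambda>y. (\<lambda>(p, y). f p y) (p, y))"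
      by (rule continuous_on_compose2[OF f]) (use that in \<open>auto intro!: continuous_intros\<close>)
    then show ?thesis by simp
  qed
  have "continuous_on A (\<lambda>p. (b p - c) * integral (cbox 0 1) (\<lambda>r. f p (c + (b p - c) * r)))"
  proof (intro continuous_intros b integral_continuous_on_param)
    have "continuous_on (A \<times> cbox 0 1) (\<lambda>x. (\<lambda>(p, y). f p y) (fst x, c + (b (fst x) - c) * snd x))"
      by (rule continuous_on_compose2[OF f])
         (auto intro!: continuous_intros continuous_on_compose2[OF b(1)])
    then show "continuous_on (A \<times> cbox 0 1) (\<lambda>(p, r). f p (c + (b p - c) * r))"
      by (simp add: case_prod_beta)
  qed
  then show ?thesis
    by (rule continuous_on_eq) (use integral_unit_interval[OF fp] b(2) in auto)
qed

text \<open>Leibniz' rule with a variable upper limit, by the chain rule for \<open>(x, t) \<mapsto> \<integral>\<^bsub>c\<^esub>\<^bsup>x\<^esup> g t\<close>,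
  whose two partial derivatives are continuous.\<close>

lemma leibniz_upper:
  assumes cg: "cont2 g" and dg: "\<And>t y. ((\<lambda>t. g t y) has_real_derivative gt t y) (at t)"
    and cgt: "cont2 gt" and b: "(b has_real_derivative b') (at t0)" and c: "c < b t0"
  shows "((\<lambda>t. integral {c..b t} (g t)) has_real_derivative
     (g t0 (b t0) * b' + integral {c..b t0} (gt t0))) (at t0)"
proof -
  define X where "X = {c<..}"
  have cgs: "continuous_on S (g t)" "continuous_on S (gt t)" for t S
    using cont2_compose[OF cg, of S "\<lambda>_. t" "\<lambda>y. y"] cont2_compose[OF cgt, of S "\<lambda>_. t" "\<lambda>y. y"] by auto
  have "((\<lambda>(x, y). integral {c..x} (g y)) has_derivative
      (\<lambda>(tx, ty). tx * g t0 (b t0) + blinfun_apply (blinfun_mult_right (integral {c..b t0} (gt t0))) ty))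
      (at (b t0, t0) within X \<times> UNIV)"
  proof (rule has_derivative_partialsI[where fx = "\<lambda>tx. tx * g t0 (b t0)"])
    show "((\<lambda>x. integral {c..x} (g t0)) has_derivative (\<lambda>tx. tx * g t0 (b t0))) (at (b t0) within X)"
    proof -
      have "((\<lambda>u. integral {c..u} (g t0)) has_real_derivative g t0 (b t0)) (at (b t0) within {c..b t0 + 1})"
        using c by (intro integral_has_real_derivative cgs) auto
      then have "((\<lambda>u. integral {c..u} (g t0)) has_real_derivative g t0 (b t0)) (at (b t0) within {c<..<b t0 + 1})"
        by (rule DERIV_subset) auto
      then have "((\<lambda>u. integral {c..u} (g t0)) has_real_derivative g t0 (b t0)) (at (b t0))"
        using c by (subst (asm) at_within_open) auto
      then have "((\<lambda>u. integral {c..u} (g t0)) has_real_derivative g t0 (b t0)) (at (b t0) within X)"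
        by (rule has_field_derivative_at_within)
      then show ?thesis by (simp add: has_field_derivative_def mult.commute[of _ "g t0 (b t0)"])
    qed
    fix x y :: real assume "x \<in> X" "y \<in> UNIV"
    have "((\<lambda>y. integral (cbox c x) (g y)) has_real_derivative integral (cbox c x) (gt y)) (at y within UNIV)"
      by (rule leibniz_rule_field_derivative)
         (auto intro!: dg integrable_continuous_real cgs continuous_on_subset[OF cgt])
    then show "((\<lambda>y. integral {c..x} (g y)) has_derivative blinfun_apply (blinfun_mult_right (integral {c..x} (gt y)))) (at y within UNIV)"
      by (simp add: has_field_derivative_def mult_commute_abs)
  next
    have "continuous_on (X \<times> UNIV) (\<lambda>p. integral {c..fst p} (gt (snd p)))"
    proof (rule continuous_on_integral_upper)
      show "continuous_on ((X \<times> UNIV) \<times> UNIV) (\<lambda>(p, y). gt (snd p) y)"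
        unfolding case_prod_beta by (intro cont2_compose[OF cgt] continuous_intros)
    qed (auto simp: X_def intro!: continuous_intros)
    then have "continuous_on (X \<times> UNIV) (\<lambda>p. blinfun_mult_right (integral {c..fst p} (gt (snd p))))"
      by (intro continuous_intros)
    then show "continuous (at (b t0, t0) within X \<times> UNIV) (\<lambda>(x, y). blinfun_mult_right (integral {c..x} (gt y)))"
      using c by (auto simp: continuous_on_eq_continuous_within X_def case_prod_beta')
  qed auto
  then have D: "((\<lambda>(x, y). integral {c..x} (g y)) has_derivative
      (\<lambda>(tx, ty). tx * g t0 (b t0) + integral {c..b t0} (gt t0) * ty)) (at (b t0, t0))"
    using c by (subst (asm) at_within_open) (auto simp: X_def open_Times)
  have P: "((\<lambda>t. (b t, t)) has_derivative (\<lambda>h. (b' * h, h))) (at t0)"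
    using b by (intro has_derivative_Pair has_derivative_ident) (simp add: has_field_derivative_def)
  have "((\<lambda>t. (\<lambda>(x, y). integral {c..x} (g y)) (b t, t)) has_derivative
     (\<lambda>h. (\<lambda>(tx, ty). tx * g t0 (b t0) + integral {c..b t0} (gt t0) * ty) (b' * h, h))) (at t0)"
    by (rule has_derivative_compose[OF P D])
  from this[simplified] show ?thesis
    unfolding has_field_derivative_def by (rule has_derivative_eq_rhs) (auto simp: fun_eq_iff algebra_simps)
qed

text \<open>The integral of \<open>k \<tau> (x - y) * f y\<close> over \<open>[x - \<tau>, x + \<tau>]\<close>, rescaled to \<open>[-1, 1]\<close>. In this
  form it extends to negative \<open>\<tau>\<close> as an oriented integral, which makes it differentiable across \<open>\<tau>
  = 0\<close>, and its joint continuity in all parameters is immediate.\<close>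

definition signed_cone :: "(real \<Rightarrow> real \<Rightarrow> real) \<Rightarrow> (real \<Rightarrow> real) \<Rightarrow> real \<Rightarrow> real \<Rightarrow> real" where
  "signed_cone k f \<tau> x = \<tau> * integral {-1..1} (\<lambda>r. k \<tau> (- (\<tau> * r)) * f (x + \<tau> * r))"

lemma signed_cone_0 [simp]: "signed_cone k f 0 x = 0"
  by (simp add: signed_cone_def)

lemma continuous_on_signed_cone:
  fixes \<sigma> \<tau> \<xi> :: "'a::topological_space \<Rightarrow> real"
  assumes k: "cont2 k" and F: "cont2 F"
    and c: "continuous_on A \<sigma>" "continuous_on A \<tau>" "continuous_on A \<xi>"
  shows "continuous_on A (\<lambda>p. signed_cone k (F (\<sigma> p)) (\<tau> p) (\<xi> p))"
proof -
  have "continuous_on A (\<lambda>p. \<tau> p * integral (cbox (-1) 1) (\<lambda>r. k (\<tau> p) (- (\<tau> p * r)) * F (\<sigma> p) (\<xi> p + \<tau> p * r)))"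
    by (intro continuous_intros c integral_continuous_on_param)
       (auto simp: case_prod_beta intro!: continuous_intros cont2_compose[OF k] cont2_compose[OF F]
          continuous_on_compose2[OF c(1)] continuous_on_compose2[OF c(2)] continuous_on_compose2[OF c(3)])
  then show ?thesis by (simp add: signed_cone_def)
qed

lemma signed_cone_eq_integral:
  assumes k: "cont2 k" and f: "continuous_on UNIV f" and t: "0 \<le> \<tau>"
  shows "signed_cone k f \<tau> x = integral {x - \<tau>..x + \<tau>} (\<lambda>y. k \<tau> (x - y) * f y)"
proof (cases "\<tau> = 0")
  case False
  then have m: "\<tau> > 0" using t by simp
  let ?h = "\<lambda>y. k \<tau> (x - y) * f y"
  have "?h integrable_on cbox (x - \<tau>) (x + \<tau>)"
    by (intro integrable_continuous continuous_intros cont2_compose[OF k] continuous_on_subset[OF f]) auto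
  then have "(?h has_integral integral {x - \<tau>..x + \<tau>} ?h) (cbox (x - \<tau>) (x + \<tau>))" by (simp add: integrable_integral)
  from has_integral_affinity'[OF this m, of x]
  have "((\<lambda>r. ?h (\<tau> * r + x)) has_integral integral {x - \<tau>..x + \<tau>} ?h / \<tau>) {-1..1}"
    using m by (simp add: divide_inverse_commute)
  then have "integral {-1..1} (\<lambda>r. ?h (\<tau> * r + x)) = integral {x - \<tau>..x + \<tau>} ?h / \<tau>"
    by (rule integral_unique)
  then show ?thesis using m by (simp add: signed_cone_def add.commute)
qed (simp add: signed_cone_def)

text \<open>With a common lower limit \<open>c\<close> left of the cone the integral becomes a difference of two
  integrals with variable upper limits, valid for both signs of \<open>\<tau>\<close>.\<close>

lemma signed_cone_signed:
  assumes k: "cont2 k" and f: "continuous_on UNIV f" and c: "c \<le> x - \<bar>\<tau>\<bar>"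
  shows "signed_cone k f \<tau> x = integral {c..x + \<tau>} (\<lambda>y. k \<tau> (x - y) * f y) - integral {c..x - \<tau>} (\<lambda>y. k \<tau> (x - y) * f y)"
proof -
  let ?h = "\<lambda>y. k \<tau> (x - y) * f y"
  have i: "?h integrable_on {a..b}" for a b
    by (intro integrable_continuous_real continuous_intros cont2_compose[OF k] continuous_on_subset[OF f]) auto
  show ?thesis
  proof (cases "0 \<le> \<tau>")
    case True
    then show ?thesis
      using Henstock_Kurzweil_Integration.integral_combine[OF _ _ i, of c "x - \<tau>" "x + \<tau>"] c
      by (simp add: signed_cone_eq_integral[OF k f])
  next
    case False
    define k' where "k' = (\<lambda>t z. k (- t) z)"
    have k': "cont2 k'" unfolding k'_def case_prod_beta by (intro cont2_compose[OF k] continuous_intros)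
    have "integral {-1..1} (\<lambda>r. k \<tau> (- (\<tau> * r)) * f (x + \<tau> * r)) = integral {-1..1} (\<lambda>r. k \<tau> (\<tau> * r) * f (x - \<tau> * r))"
    proof -
      define h where "h = (\<lambda>r. k \<tau> (\<tau> * r) * f (x - \<tau> * r))"
      have "(\<lambda>r. k \<tau> (- (\<tau> * r)) * f (x + \<tau> * r)) = (\<lambda>r. h (- r))" by (simp add: h_def)
      moreover have "integral {-1..1} (\<lambda>r. h (- r)) = integral {-1..1} h"
        using Henstock_Kurzweil_Integration.integral_reflect_real[where a = "-1" and b = 1 and f = h]
        unfolding minus_minus .
      ultimately show ?thesis by (simp only: h_def)
    qed
    then have "signed_cone k f \<tau> x = - signed_cone k' f (- \<tau>) x"
      by (simp add: signed_cone_def k'_def)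
    also have "signed_cone k' f (- \<tau>) x = integral {x + \<tau>..x - \<tau>} ?h"
      using False signed_cone_eq_integral[OF k' f, of "- \<tau>" x] by (simp add: k'_def)
    finally show ?thesis
      using False Henstock_Kurzweil_Integration.integral_combine[OF _ _ i, of c "x + \<tau>" "x - \<tau>"] c by simp
  qed
qed

definition C1_kernel :: "(real \<Rightarrow> real \<Rightarrow> real) \<Rightarrow> (real \<Rightarrow> real \<Rightarrow> real) \<Rightarrow> (real \<Rightarrow> real \<Rightarrow> real) \<Rightarrow> bool" where
  "C1_kernel k kt kz \<longleftrightarrow> cont2 k \<and> cont2 kt \<and> cont2 kz \<and>
     (\<forall>t z. ((\<lambda>t. k t z) has_real_derivative kt t z) (at t)) \<and>
     (\<forall>t z. (k t has_real_derivative kz t z) (at z))"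

text \<open>The boundary terms are the values on the two characteristics; the source \<open>f\<close> itself is
  merely continuous.\<close>

lemma signed_cone_has_derivative_time:
  assumes k: "C1_kernel k kt kz" and f: "continuous_on UNIV f"
  shows "((\<lambda>\<tau>. signed_cone k f \<tau> x) has_real_derivative
     (k \<tau> (- \<tau>) * f (x + \<tau>) + k \<tau> \<tau> * f (x - \<tau>) + signed_cone kt f \<tau> x)) (at \<tau>)"
proof -
  have ck: "cont2 k" and ckt: "cont2 kt" and dk: "\<And>t z. ((\<lambda>t. k t z) has_real_derivative kt t z) (at t)"
    using k by (auto simp: C1_kernel_def)
  have cf: "continuous_on A (\<lambda>p. f (h p))" if "continuous_on A h" for A :: "(real \<times> real) set" and h
    by (rule continuous_on_compose2[OF f that]) auto
  have cg: "cont2 (\<lambda>\<tau> y. k \<tau> (x - y) * f y)" "cont2 (\<lambda>\<tau> y. kt \<tau> (x - y) * f y)"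
    unfolding case_prod_beta by (intro continuous_intros cont2_compose[OF ck] cont2_compose[OF ckt] cf)+
  have dg: "((\<lambda>\<tau>. k \<tau> (x - y) * f y) has_real_derivative kt t (x - y) * f y) (at t)" for t y
    by (intro DERIV_cmult_right dk)
  define c where "c = x - \<bar>\<tau>\<bar> - 2"
  have "((\<lambda>t. integral {c..x + t} (\<lambda>y. k t (x - y) * f y) - integral {c..x - t} (\<lambda>y. k t (x - y) * f y)) has_real_derivative
    ((k \<tau> (x - (x + \<tau>)) * f (x + \<tau>)) * 1 + integral {c..x + \<tau>} (\<lambda>y. kt \<tau> (x - y) * f y)) -
    ((k \<tau> (x - (x - \<tau>)) * f (x - \<tau>)) * (- 1) + integral {c..x - \<tau>} (\<lambda>y. kt \<tau> (x - y) * f y))) (at \<tau>)"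
    by (intro DERIV_diff leibniz_upper[OF cg(1) dg cg(2)]) (auto simp: c_def intro!: derivative_eq_intros)
  moreover have "signed_cone kt f \<tau> x = integral {c..x + \<tau>} (\<lambda>y. kt \<tau> (x - y) * f y) - integral {c..x - \<tau>} (\<lambda>y. kt \<tau> (x - y) * f y)"
    by (rule signed_cone_signed[OF ckt f]) (simp add: c_def)
  ultimately have "((\<lambda>t. integral {c..x + t} (\<lambda>y. k t (x - y) * f y) - integral {c..x - t} (\<lambda>y. k t (x - y) * f y)) has_real_derivative
    (k \<tau> (- \<tau>) * f (x + \<tau>) + k \<tau> \<tau> * f (x - \<tau>) + signed_cone kt f \<tau> x)) (at \<tau>)"
    by (elim DERIV_cong) simp
  then show ?thesis
  proof (rule has_field_derivative_transform_within_open[where S = "ball \<tau> 1"])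
    fix t assume "t \<in> ball \<tau> 1"
    then have "c \<le> x - \<bar>t\<bar>" by (auto simp: c_def dist_real_def)
    from signed_cone_signed[OF ck f this]
    show "integral {c..x + t} (\<lambda>y. k t (x - y) * f y) - integral {c..x - t} (\<lambda>y. k t (x - y) * f y) = signed_cone k f t x" ..
  qed auto
qed

lemma signed_cone_has_derivative_space:
  assumes k: "C1_kernel k kt kz" and f: "continuous_on UNIV f"
  shows "(signed_cone k f \<tau> has_real_derivative
     (k \<tau> (- \<tau>) * f (x + \<tau>) - k \<tau> \<tau> * f (x - \<tau>) + signed_cone kz f \<tau> x)) (at x)"
proof -
  have ck: "cont2 k" and ckz: "cont2 kz" and dk: "\<And>t z. (k t has_real_derivative kz t z) (at z)"
    using k by (auto simp: C1_kernel_def)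
  have cf: "continuous_on A (\<lambda>p. f (h p))" if "continuous_on A h" for A :: "(real \<times> real) set" and h
    by (rule continuous_on_compose2[OF f that]) auto
  have cg: "cont2 (\<lambda>x y. k \<tau> (x - y) * f y)" "cont2 (\<lambda>x y. kz \<tau> (x - y) * f y)"
    unfolding case_prod_beta by (intro continuous_intros cont2_compose[OF ck] cont2_compose[OF ckz] cf)+
  have dg: "((\<lambda>x. k \<tau> (x - y) * f y) has_real_derivative kz \<tau> (x - y) * f y) (at x)" for x y
    by (intro DERIV_cmult_right DERIV_cong[OF DERIV_chain'[OF _ dk]]) (auto intro!: derivative_eq_intros)
  define c where "c = x - \<bar>\<tau>\<bar> - 2"
  have "((\<lambda>x. integral {c..x + \<tau>} (\<lambda>y. k \<tau> (x - y) * f y) - integral {c..x - \<tau>} (\<lambda>y. k \<tau> (x - y) * f y)) has_real_derivative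
    ((k \<tau> (x - (x + \<tau>)) * f (x + \<tau>)) * 1 + integral {c..x + \<tau>} (\<lambda>y. kz \<tau> (x - y) * f y)) -
    ((k \<tau> (x - (x - \<tau>)) * f (x - \<tau>)) * 1 + integral {c..x - \<tau>} (\<lambda>y. kz \<tau> (x - y) * f y))) (at x)"
    by (intro DERIV_diff leibniz_upper[OF cg(1) dg cg(2)]) (auto simp: c_def intro!: derivative_eq_intros)
  moreover have "signed_cone kz f \<tau> x = integral {c..x + \<tau>} (\<lambda>y. kz \<tau> (x - y) * f y) - integral {c..x - \<tau>} (\<lambda>y. kz \<tau> (x - y) * f y)"
    by (rule signed_cone_signed[OF ckz f]) (simp add: c_def)
  ultimately have "((\<lambda>x. integral {c..x + \<tau>} (\<lambda>y. k \<tau> (x - y) * f y) - integral {c..x - \<tau>} (\<lambda>y. k \<tau> (x - y) * f y)) has_real_derivative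
    (k \<tau> (- \<tau>) * f (x + \<tau>) - k \<tau> \<tau> * f (x - \<tau>) + signed_cone kz f \<tau> x)) (at x)"
    by (elim DERIV_cong) simp
  then show ?thesis
  proof (rule has_field_derivative_transform_within_open[where S = "ball x 1"])
    fix z assume "z \<in> ball x 1"
    then have "c \<le> z - \<bar>\<tau>\<bar>" by (auto simp: c_def dist_real_def)
    from signed_cone_signed[OF ck f this]
    show "integral {c..z + \<tau>} (\<lambda>y. k \<tau> (z - y) * f y) - integral {c..z - \<tau>} (\<lambda>y. k \<tau> (z - y) * f y) = signed_cone k f \<tau> z" ..
  qed auto
qed

lemma C1_cylinder_signed_cone:
  assumes k: "C1_kernel k kt kz" and f: "continuous_on UNIV f"
  shows "C1_cylinder (signed_cone k f)
    (\<lambda>\<tau> x. k \<tau> (- \<tau>) * f (x + \<tau>) + k \<tau> \<tau> * f (x - \<tau>) + signed_cone kt f \<tau> x)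
    (\<lambda>\<tau> x. k \<tau> (- \<tau>) * f (x + \<tau>) - k \<tau> \<tau> * f (x - \<tau>) + signed_cone kz f \<tau> x)"
proof -
  have ck: "cont2 k" "cont2 kt" "cont2 kz" using k by (auto simp: C1_kernel_def)
  have cF: "cont2 (\<lambda>(s::real) y. f y)" unfolding case_prod_beta by (intro continuous_on_compose2[OF f] continuous_intros) auto
  have cf: "continuous_on A (\<lambda>p. f (h p))" if "continuous_on A h" for A :: "(real \<times> real) set" and h
    by (rule continuous_on_compose2[OF f that]) auto
  note cs = continuous_on_signed_cone[OF _ cF, where \<sigma> = "\<lambda>_. 0"]
  show ?thesis
    unfolding C1_cylinder_def case_prod_beta
    using signed_cone_has_derivative_time[OF k f] signed_cone_has_derivative_space[OF k f]
    by (auto intro!: continuous_intros cs ck cf cont2_compose[OF ck(1)] intro: has_field_derivative_at_within)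
qed

text \<open>The signed form of the cone integral keeps the integrand meaningful for all \<open>s\<close>.\<close>

definition duhamel :: "(real \<Rightarrow> real \<Rightarrow> real) \<Rightarrow> (real \<Rightarrow> real \<Rightarrow> real) \<Rightarrow> real \<Rightarrow> real \<Rightarrow> real" where
  "duhamel k F t x = integral {0..t} (\<lambda>s. signed_cone k (F s) (t - s) x)"

text \<open>A continuous source gains one derivative. For the time derivative the integral over \<open>[0, t]\<close>
  is written as a difference of integrals from \<open>-1\<close>, so that Leibniz' rule applies at \<open>t = 0\<close> as
  well; the term from the upper limit vanishes because the cone degenerates there.\<close>

lemma C1_cylinder_duhamel:
  assumes k: "C1_kernel k kt kz" and F: "cont2 F"
  shows "\<exists>Wt Wx. C1_cylinder (duhamel k F) Wt Wx"
proof -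
  have ck: "cont2 k" "cont2 kt" "cont2 kz" using k by (auto simp: C1_kernel_def)
  have Fs: "continuous_on UNIV (F s)" for s
    using cont2_compose[OF F, of UNIV "\<lambda>_. s" "\<lambda>y. y"] by simp
  define D where "D s \<tau> x = k \<tau> (- \<tau>) * F s (x + \<tau>) + k \<tau> \<tau> * F s (x - \<tau>) + signed_cone kt (F s) \<tau> x" for s \<tau> x
  define E where "E s \<tau> x = k \<tau> (- \<tau>) * F s (x + \<tau>) - k \<tau> \<tau> * F s (x - \<tau>) + signed_cone kz (F s) \<tau> x" for s \<tau> x
  define Wt where "Wt t x = integral {0..t} (\<lambda>s. D s (t - s) x)" for t x
  define Wx where "Wx t x = integral {0..t} (\<lambda>s. E s (t - s) x)" for t x
  have cM: "continuous_on A (\<lambda>p. signed_cone k (F (\<sigma> p)) (\<tau> p) (\<xi> p))"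
    "continuous_on A (\<lambda>p. D (\<sigma> p) (\<tau> p) (\<xi> p))" "continuous_on A (\<lambda>p. E (\<sigma> p) (\<tau> p) (\<xi> p))"
    if "continuous_on A \<sigma>" "continuous_on A \<tau>" "continuous_on A \<xi>"
    for A :: "'a::topological_space set" and \<sigma> \<tau> \<xi>
    unfolding D_def E_def
    by (intro continuous_intros continuous_on_signed_cone[OF _ F] ck cont2_compose[OF ck(1)] cont2_compose[OF F] that)+
  have cW: "continuous_on ({0..} \<times> UNIV) (\<lambda>p. integral {0..fst p} (\<lambda>s. G s (fst p - s) (snd p)))"
    if G: "\<And>(A :: ((real \<times> real) \<times> real) set) \<sigma> \<tau> \<xi>. continuous_on A \<sigma> \<Longrightarrow> continuous_on A \<tau> \<Longrightarrow> continuous_on A \<xi> \<Longrightarrow>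
      continuous_on A (\<lambda>p. G (\<sigma> p) (\<tau> p) (\<xi> p))" for G :: "real \<Rightarrow> real \<Rightarrow> real \<Rightarrow> real"
    by (rule continuous_on_integral_upper) (auto simp: case_prod_beta intro!: G continuous_intros)
  have dt: "((\<lambda>t. duhamel k F t x) has_real_derivative Wt t x) (at t within {0..})" if t: "0 \<le> t" for t x
  proof -
    let ?g = "\<lambda>t s. signed_cone k (F s) (t - s) x" and ?gt = "\<lambda>t s. D s (t - s) x"
    have cg: "cont2 ?g" "cont2 ?gt" unfolding case_prod_beta by (intro cM continuous_intros)+
    have dg: "((\<lambda>t. ?g t s) has_real_derivative ?gt t s) (at t)" for t s
      unfolding D_def
      by (rule DERIV_cong[OF DERIV_chain'[OF _ signed_cone_has_derivative_time[OF k Fs]]]) (auto intro!: derivative_eq_intros)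
    have "((\<lambda>t. integral {-1..t} (?g t) - integral {-1..0} (?g t)) has_real_derivative
      ((?g t t * 1 + integral {-1..t} (?gt t)) - (?g t 0 * 0 + integral {-1..0} (?gt t)))) (at t)"
      by (intro DERIV_diff leibniz_upper[OF cg(1) dg cg(2)]) (use t in \<open>auto intro!: derivative_eq_intros\<close>)
    moreover have comb: "integral {-1..u} h - integral {-1..0} h = integral {0..u} h" if "0 \<le> u" "continuous_on UNIV h" for u and h :: "real \<Rightarrow> real"
    proof -
      have "h integrable_on {-1..u}"
        by (intro integrable_continuous_real continuous_on_subset[OF that(2)]) auto
      then show ?thesis using Henstock_Kurzweil_Integration.integral_combine[of "-1" 0 u h] that by simp
    qed
    moreover have "continuous_on UNIV (?g u)" "continuous_on UNIV (?gt u)" for u by (intro cM continuous_intros)+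
    ultimately have "((\<lambda>t. integral {-1..t} (?g t) - integral {-1..0} (?g t)) has_real_derivative Wt t x) (at t)"
      using t by (simp add: Wt_def)
    then have 1: "((\<lambda>t. integral {-1..t} (?g t) - integral {-1..0} (?g t)) has_real_derivative Wt t x) (at t within {0..})"
      by (rule has_field_derivative_at_within)
    show ?thesis
      unfolding has_field_derivative_def
      by (rule has_derivative_transform[OF _ _ 1[unfolded has_field_derivative_def]])
         (use t comb \<open>\<And>u. continuous_on UNIV (?g u)\<close> in \<open>auto simp: duhamel_def\<close>)
  qed
  have dx: "(duhamel k F t has_real_derivative Wx t x) (at x)" for t x
  proof -
    have "((\<lambda>x. integral (cbox 0 t) (\<lambda>s. signed_cone k (F s) (t - s) x)) has_real_derivative
       integral (cbox 0 t) (\<lambda>s. E s (t - s) x)) (at x within UNIV)"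
    proof (rule leibniz_rule_field_derivative)
      show "((\<lambda>x. signed_cone k (F s) (t - s) x) has_real_derivative E s (t - s) x) (at x within UNIV)" for x s
        unfolding E_def by (rule has_field_derivative_at_within[OF signed_cone_has_derivative_space[OF k Fs]])
      show "(\<lambda>s. signed_cone k (F s) (t - s) x) integrable_on cbox 0 t" for x
        by (intro integrable_continuous cM continuous_intros)
      show "continuous_on (UNIV \<times> cbox 0 t) (\<lambda>(x, s). E s (t - s) x)"
        unfolding case_prod_beta by (intro cM continuous_intros)
    qed auto
    then show ?thesis by (simp add: duhamel_def[abs_def] Wx_def)
  qed
  have "C1_cylinder (duhamel k F) Wt Wx"
    unfolding C1_cylinder_def case_prod_beta
  proof (intro conjI allI impI dt dx)
    show "continuous_on ({0..} \<times> UNIV) (\<lambda>p. duhamel k F (fst p) (snd p))"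
      unfolding duhamel_def using cW[of "\<lambda>s \<tau> x. signed_cone k (F s) \<tau> x"] cM(1) by blast
    show "continuous_on ({0..} \<times> UNIV) (\<lambda>p. Wt (fst p) (snd p))"
      unfolding Wt_def using cW[of D] cM(2) by blast
    show "continuous_on ({0..} \<times> UNIV) (\<lambda>p. Wx (fst p) (snd p))"
      unfolding Wx_def using cW[of E] cM(3) by blast
  qed
  then show ?thesis by blast
qed

section \<open>The modified Bessel functions of order zero and one\<close>

definition bessel_coeff :: "nat \<Rightarrow> nat \<Rightarrow> real" where
  "bessel_coeff n k = 1 / (16 ^ k * fact k * fact (k + n))"

text \<open>The entire function \<open>s \<mapsto> (sqrt s / 4) ^ (- n) * bessel_I n (sqrt s / 2)\<close>: the square root
  disappears since the Bessel series is even up to the factor \<open>z ^ n\<close>. Evaluated at \<open>s = t\<^sup>2 -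
  z\<^sup>2\<close> it shows that the kernels of the damped wave equation are smooth.\<close>

definition bessel_entire :: "nat \<Rightarrow> real \<Rightarrow> real" where
  "bessel_entire n s = (\<Sum>k. bessel_coeff n k * s ^ k)"

lemma bessel_coeff_nonneg: "0 \<le> bessel_coeff n k"
  by (simp add: bessel_coeff_def)

lemma bessel_summable: "summable (\<lambda>k. bessel_coeff n k * s ^ k)"
proof (rule summable_comparison_test')
  show "summable (\<lambda>k. inverse (fact k) * \<bar>s\<bar> ^ k)" using summable_exp[of "\<bar>s\<bar>"] by (simp add: mult.commute)
  fix k :: nat
  have "1 \<le> (16::real) ^ k * fact (k + n)"
    using mult_mono[of 1 "16 ^ k" 1 "fact (k + n) :: real"] by simp
  then have "fact k \<le> (16::real) ^ k * fact k * fact (k + n)"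
    using mult_right_mono[of 1 "(16::real) ^ k * fact (k + n)" "fact k"] by (simp add: mult_ac)
  then have "bessel_coeff n k \<le> inverse (fact k)"
    unfolding bessel_coeff_def inverse_eq_divide by (intro divide_left_mono) auto
  then show "norm (bessel_coeff n k * s ^ k) \<le> inverse (fact k) * \<bar>s\<bar> ^ k"
    using bessel_coeff_nonneg[of n k] by (simp add: abs_mult power_abs mult_right_mono)
qed

lemma bessel_entire_derivative: "(bessel_entire n has_real_derivative bessel_entire (Suc n) s / 16) (at s)"
proof -
  have "((\<lambda>s. \<Sum>k. bessel_coeff n k * s ^ k) has_real_derivative (\<Sum>k. diffs (bessel_coeff n) k * s ^ k)) (at s)"
    by (rule termdiffs_strong_converges_everywhere) (rule bessel_summable)
  moreover have "diffs (bessel_coeff n) k * s ^ k = (bessel_coeff (Suc n) k * s ^ k) / 16" for k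
    by (simp add: diffs_def bessel_coeff_def field_simps del: of_nat_Suc)
  ultimately show ?thesis
    using suminf_divide[OF bessel_summable, of "Suc n" s 16] by (simp add: bessel_entire_def[abs_def])
qed

lemma bessel_entire_continuous: "continuous_on A (bessel_entire n)"
  by (meson bessel_entire_derivative DERIV_isCont continuous_at_imp_continuous_on)

lemma bessel_entire_nonneg: "0 \<le> s \<Longrightarrow> 0 \<le> bessel_entire n s"
  unfolding bessel_entire_def by (intro suminf_nonneg bessel_summable) (simp add: bessel_coeff_nonneg)

lemma bessel_entire_mono: "0 \<le> s \<Longrightarrow> s \<le> r \<Longrightarrow> bessel_entire n s \<le> bessel_entire n r"
  unfolding bessel_entire_def
  by (intro suminf_le bessel_summable mult_left_mono power_mono bessel_coeff_nonneg)

lemma bessel_I_sqrt: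
  assumes "0 \<le> s" shows "bessel_I n (sqrt s / 2) = (sqrt s / 4) ^ n * bessel_entire n s"
proof -
  have "(sqrt s / 2 / 2) ^ (2 * k + n) / (fact k * fact (k + n)) = (sqrt s / 4) ^ n * (bessel_coeff n k * s ^ k)" for k
  proof -
    have "(sqrt s / 4) ^ (2 * k) = (s / 16) ^ k"
      using assms by (simp add: power_mult power_divide)
    then show ?thesis by (simp add: power_add bessel_coeff_def power_divide field_simps)
  qed
  then show ?thesis
    unfolding bessel_I_def bessel_entire_def by (simp add: suminf_mult[OF bessel_summable])
qed

lemma sum_even_odd: "(\<Sum>k<N. f (2 * k) + f (2 * k + 1)) = (\<Sum>j<2 * N. f j)"
  for f :: "nat \<Rightarrow> real"
  by (induction N) auto

lemma exp_partial_sum_le: "0 \<le> y \<Longrightarrow> (\<Sum>j<N. y ^ j / fact j) \<le> exp (y::real)"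
  using sum_le_suminf[OF summable_exp[of y], of "{..<N}"]
  by (simp add: exp_def divide_inverse mult.commute scaleR_conv_of_real)

text \<open>The quantity under the square is the central binomial coefficient divided by \<open>4 ^ k\<close>; it is
  at most \<open>1 / sqrt (2 k + 1)\<close>.\<close>

lemma central_binomial_bound: "(fact (2 * k) / (4 ^ k * (fact k)\<^sup>2))\<^sup>2 * (2 * real k + 1) \<le> 1"
proof (induction k)
  case (Suc k)
  define b where "b = fact (2 * k) / (4 ^ k * (fact k)\<^sup>2 :: real)"
  have r: "fact (2 * Suc k) / (4 ^ Suc k * (fact (Suc k))\<^sup>2) = b * ((2 * real k + 1) / (2 * real k + 2))"
    by (simp add: b_def divide_simps power2_eq_square) (simp add: algebra_simps)
  have "(b * ((2 * real k + 1) / (2 * real k + 2)))\<^sup>2 * (2 * real (Suc k) + 1)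
     = (b\<^sup>2 * (2 * real k + 1)) * ((2 * real k + 1) * (2 * real k + 3) / (2 * real k + 2)\<^sup>2)"
    by (simp add: power_divide power_mult_distrib power2_eq_square algebra_simps)
  also have "\<dots> \<le> 1 * 1"
  proof (rule mult_mono)
    show "b\<^sup>2 * (2 * real k + 1) \<le> 1" using Suc by (simp add: b_def)
    show "(2 * real k + 1) * (2 * real k + 3) / (2 * real k + 2)\<^sup>2 \<le> 1"
    proof (subst divide_le_eq_1_pos)
      show "0 < (2 * real k + 2)\<^sup>2" by (rule zero_less_power) simp
    qed (simp add: power2_eq_square algebra_simps)
  qed auto
  finally show ?case unfolding r by simp
qed simp

lemma bessel_entire0_square_term:
  "bessel_coeff 0 k * (t\<^sup>2) ^ k = (t / 2) ^ (2 * k) / fact (2 * k) * (fact (2 * k) / (4 ^ k * (fact k)\<^sup>2))"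
proof -
  have "(t / 2) ^ (2 * k) = (t\<^sup>2) ^ k / 4 ^ k" by (simp add: power_mult power_divide)
  moreover have "(16::real) ^ k = 4 ^ k * 4 ^ k" by (simp add: power_mult_distrib[symmetric])
  ultimately show ?thesis by (simp add: bessel_coeff_def power2_eq_square)
qed

lemma bessel_entire0_le_exp: assumes "0 \<le> t" shows "bessel_entire 0 (t\<^sup>2) \<le> exp (t / 2)"
  unfolding bessel_entire_def
proof (rule suminf_le_const[OF bessel_summable])
  fix N
  define b where "b k = fact (2 * k) / (4 ^ k * (fact k)\<^sup>2 :: real)" for k
  have b1: "b k \<le> 1" for k
  proof -
    have "(b k)\<^sup>2 * 1 \<le> (b k)\<^sup>2 * (2 * real k + 1)" by (intro mult_left_mono) auto
    from order_trans[OF this central_binomial_bound[of k, folded b_def]] have "(b k)\<^sup>2 \<le> 1" by simp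
    then show ?thesis by (simp add: abs_square_le_1 abs_le_iff)
  qed
  have "(\<Sum>k<N. bessel_coeff 0 k * (t\<^sup>2) ^ k) \<le> (\<Sum>k<N. (t/2) ^ (2 * k) / fact (2 * k) + (t/2) ^ (2 * k + 1) / fact (2 * k + 1))"
  proof (rule sum_mono)
    fix k
    have "bessel_coeff 0 k * (t\<^sup>2) ^ k = (t/2) ^ (2 * k) / fact (2 * k) * b k"
      unfolding bessel_entire0_square_term b_def ..
    also have "\<dots> \<le> (t/2) ^ (2 * k) / fact (2 * k) * 1" using assms by (intro mult_left_mono b1) auto
    also have "\<dots> \<le> (t/2) ^ (2 * k) / fact (2 * k) + (t/2) ^ (2 * k + 1) / fact (2 * k + 1)" using assms by simp
    finally show "bessel_coeff 0 k * (t\<^sup>2) ^ k \<le> (t/2) ^ (2 * k) / fact (2 * k) + (t/2) ^ (2 * k + 1) / fact (2 * k + 1)" .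
  qed
  also have "\<dots> \<le> exp (t / 2)"
    unfolding sum_even_odd[of "\<lambda>j. (t/2) ^ j / fact j"] using assms by (intro exp_partial_sum_le) auto
  finally show "(\<Sum>k<N. bessel_coeff 0 k * (t\<^sup>2) ^ k) \<le> exp (t / 2)" .
qed

text \<open>The bound \<open>exp z / sqrt z\<close> for the Bessel function at \<open>z = t / 2\<close>. Termwise, the series of
  the Bessel function is that of \<open>cosh\<close> weighted by normalised central binomial coefficients, and
  the inequality \<open>1 / sqrt m \<le> (l / m + 1 / l) / 2\<close> with \<open>l = sqrt z\<close> splits this weight so that
  the terms of \<open>cosh\<close> and \<open>sinh\<close> together form the exponential series.\<close>

lemma bessel_entire0_decay: assumes "0 < t" shows "bessel_entire 0 (t\<^sup>2) \<le> exp (t / 2) / sqrt (2 * t)"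
  unfolding bessel_entire_def
proof (rule suminf_le_const[OF bessel_summable])
  fix N
  define y where "y = t / 2"
  define l where "l = sqrt y"
  have y: "y > 0" "l > 0" "l\<^sup>2 = y" using assms by (auto simp: y_def l_def)
  define b where "b k = fact (2 * k) / (4 ^ k * (fact k)\<^sup>2 :: real)" for k
  have b1: "b k \<le> (l / (2 * real k + 1) + 1 / l) / 2" for k
  proof -
    define m where "m = 2 * real k + 1"
    have m: "m > 0" by (simp add: m_def)
    define c where "c = (l / m + 1 / l) / 2"
    have c0: "c > 0" using y m by (simp add: c_def add_pos_pos)
    have "0 \<le> (l / m - 1 / l)\<^sup>2" by simp
    then have "4 * (1 / m) \<le> (l / m + 1 / l)\<^sup>2"
      using y m by (simp add: power2_sum power2_diff)
    then have "1 / m \<le> c\<^sup>2" by (simp add: c_def power_divide)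
    moreover have "(b k)\<^sup>2 \<le> 1 / m"
      using central_binomial_bound[of k] m by (simp add: b_def m_def field_simps)
    ultimately have "(b k)\<^sup>2 \<le> c\<^sup>2" by linarith
    then have "b k \<le> c" using less_imp_le[OF c0] by (rule power2_le_imp_le)
    then show ?thesis by (simp add: c_def m_def)
  qed
  have "(\<Sum>k<N. bessel_coeff 0 k * (t\<^sup>2) ^ k) \<le> (\<Sum>k<N. (y ^ (2 * k) / fact (2 * k) + y ^ (2 * k + 1) / fact (2 * k + 1)) / (2 * l))"
  proof (rule sum_mono)
    fix k
    have "bessel_coeff 0 k * (t\<^sup>2) ^ k = y ^ (2 * k) / fact (2 * k) * b k"
      unfolding bessel_entire0_square_term b_def y_def ..
    also have "\<dots> \<le> y ^ (2 * k) / fact (2 * k) * ((l / (2 * real k + 1) + 1 / l) / 2)"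
      using y by (intro mult_left_mono b1) auto
    also have "\<dots> = (y ^ (2 * k) / fact (2 * k) + y ^ (2 * k) / fact (2 * k) * l\<^sup>2 / (2 * real k + 1)) / (2 * l)"
    proof -
      have gen: "Y * ((l / M + 1 / l) / 2) = (Y + Y * l\<^sup>2 / M) / (2 * l)" if "M > 0" for Y M :: real
        using y(2) that by (simp add: field_simps power2_eq_square)
      show ?thesis by (rule gen) simp
    qed
    also have "y ^ (2 * k) / fact (2 * k) * l\<^sup>2 / (2 * real k + 1) = y ^ (2 * k + 1) / fact (2 * k + 1)"
      unfolding y(3) by (simp add: field_simps)
    finally show "bessel_coeff 0 k * (t\<^sup>2) ^ k \<le> (y ^ (2 * k) / fact (2 * k) + y ^ (2 * k + 1) / fact (2 * k + 1)) / (2 * l)" .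
  qed
  also have "\<dots> = (\<Sum>j<2 * N. y ^ j / fact j) / (2 * l)"
    unfolding sum_even_odd[of "\<lambda>j. y ^ j / fact j", symmetric] sum_divide_distrib ..
  also have "\<dots> \<le> exp y / (2 * l)"
    using y by (intro divide_right_mono exp_partial_sum_le) auto
  also have "2 * l = sqrt (2 * t)"
  proof -
    have "2 * l = sqrt (4 * y)" by (simp add: l_def real_sqrt_mult)
    then show ?thesis by (simp add: y_def)
  qed
  finally show "(\<Sum>k<N. bessel_coeff 0 k * (t\<^sup>2) ^ k) \<le> exp (t / 2) / sqrt (2 * t)" by (simp add: y_def)
qed

text \<open>The factor \<open>exp (- t / 2)\<close> of the damped kernel exactly balances the growth of the Bessel
  function and leaves the decay rate of the heat kernel.\<close>

lemma damped_bessel_decay: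
  assumes "0 \<le> t" shows "exp (- t / 2) * bessel_entire 0 (t\<^sup>2) \<le> 1" "exp (- t / 2) * bessel_entire 0 (t\<^sup>2) \<le> 2 / sqrt (1 + t)"
proof -
  have e: "exp (- t / 2) * exp (t / 2) = 1" by (simp add: exp_add[symmetric])
  have "exp (- t / 2) * bessel_entire 0 (t\<^sup>2) \<le> exp (- t / 2) * exp (t / 2)"
    by (intro mult_left_mono bessel_entire0_le_exp assms) auto
  then show 1: "exp (- t / 2) * bessel_entire 0 (t\<^sup>2) \<le> 1" by (simp only: e)
  show "exp (- t / 2) * bessel_entire 0 (t\<^sup>2) \<le> 2 / sqrt (1 + t)"
  proof (cases "t \<le> 1")
    case True
    have "sqrt (1 + t) \<le> 2" using True by (intro real_le_lsqrt) auto
    then have "1 \<le> 2 / sqrt (1 + t)" using assms by simp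
    then show ?thesis using 1 by linarith
  next
    case False
    have "exp (- t / 2) * bessel_entire 0 (t\<^sup>2) \<le> exp (- t / 2) * (exp (t / 2) / sqrt (2 * t))"
      using False by (intro mult_left_mono bessel_entire0_decay) auto
    also have "\<dots> = 1 / sqrt (2 * t)" using e by simp
    also have "\<dots> \<le> 2 / sqrt (1 + t)"
      using False by (intro frac_le) auto
    finally show ?thesis .
  qed
qed

text \<open>In terms of Bessel functions this is \<open>I\<^sub>1 \<le> I\<^sub>0\<close>; each term of the left series is a product
  of square roots of consecutive terms on the right.\<close>

lemma bessel_entire1_le: assumes "0 \<le> t" shows "t / 4 * bessel_entire 1 (t\<^sup>2) \<le> bessel_entire 0 (t\<^sup>2)"
proof -
  define f where "f k = bessel_coeff 0 k * (t\<^sup>2) ^ k" for k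
  have fs: "summable f" unfolding f_def by (rule bessel_summable)
  then have fs': "summable (\<lambda>k. f (Suc k))" by (simp add: summable_Suc_iff)
  have "t / 4 * bessel_entire 1 (t\<^sup>2) = (\<Sum>k. t / 4 * (bessel_coeff 1 k * (t\<^sup>2) ^ k))"
    unfolding bessel_entire_def by (rule suminf_mult[OF bessel_summable, symmetric])
  also have "\<dots> \<le> (\<Sum>k. (f k + f (Suc k)) / 2)"
  proof (intro suminf_le summable_mult bessel_summable summable_divide summable_add fs fs')
    fix k
    define a b where "a = (t / 4) ^ k / fact k" and "b = (t / 4) ^ Suc k / fact (Suc k)"
    have p: "(t / 4) ^ (2 * j) = (t\<^sup>2) ^ j / 16 ^ j" for j by (simp add: power_mult power_divide)
    have q: "f j = ((t / 4) ^ j / fact j)\<^sup>2" for j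
    proof -
      have "((t / 4) ^ j / fact j)\<^sup>2 = (t / 4) ^ (2 * j) / (fact j * fact j)"
        by (simp only: power2_eq_square times_divide_times_eq mult_2 power_add)
      then show ?thesis unfolding p by (simp add: f_def bessel_coeff_def)
    qed
    have "t / 4 * (bessel_coeff 1 k * (t\<^sup>2) ^ k) = (t / 4) * (t / 4) ^ (2 * k) / (fact k * fact (Suc k))"
      unfolding p by (simp add: bessel_coeff_def)
    also have "\<dots> = a * b" unfolding a_def b_def mult_2 power_add power_Suc by (simp only: times_divide_times_eq mult_ac)
    also have "\<dots> \<le> (a\<^sup>2 + b\<^sup>2) / 2" using sum_squares_bound[of a b] by simp
    also have "\<dots> = (f k + f (Suc k)) / 2" unfolding q a_def b_def ..
    finally show "t / 4 * (bessel_coeff 1 k * (t\<^sup>2) ^ k) \<le> (f k + f (Suc k)) / 2" .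
  qed
  also have "\<dots> = (suminf f + (suminf f - f 0)) / 2"
    by (simp add: suminf_divide[OF summable_add[OF fs fs']] suminf_add[OF fs fs', symmetric] suminf_split_head[OF fs])
  also have "\<dots> \<le> suminf f" using bessel_coeff_nonneg[of 0 0] by (simp add: f_def)
  finally show ?thesis by (simp add: f_def[abs_def] bessel_entire_def)
qed

text \<open>The recursion in \<open>k\<close> comes from the derivative of \<open>z (t\<^sup>2 - z\<^sup>2) ^ (k + 1)\<close>, which has equal
  boundary values.\<close>

lemma integral_square_diff_power:
  assumes t: "0 \<le> (t::real)"
  shows "integral {-t..t} (\<lambda>z. (t\<^sup>2 - z\<^sup>2) ^ k) = 2 * t ^ (2 * k + 1) * 4 ^ k * (fact k)\<^sup>2 / fact (2 * k + 1)"
proof (induction k)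
  case 0 then show ?case using t by simp
next
  case (Suc k)
  have "((\<lambda>z. (2 * real k + 3) * (t\<^sup>2 - z\<^sup>2) ^ Suc k - 2 * (real k + 1) * t\<^sup>2 * (t\<^sup>2 - z\<^sup>2) ^ k) has_integral
    (t * (t\<^sup>2 - t\<^sup>2) ^ Suc k - (- t) * (t\<^sup>2 - (- t)\<^sup>2) ^ Suc k)) {-t..t}"
  proof (rule fundamental_theorem_of_calculus)
    fix z
    have "((\<lambda>z. z * (t\<^sup>2 - z\<^sup>2) ^ Suc k) has_real_derivative
      ((2 * real k + 3) * (t\<^sup>2 - z\<^sup>2) ^ Suc k - 2 * (real k + 1) * t\<^sup>2 * (t\<^sup>2 - z\<^sup>2) ^ k)) (at z within {-t..t})"
      by (rule derivative_eq_intros refl)+ (simp add: algebra_simps power2_eq_square)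
    then show "((\<lambda>z. z * (t\<^sup>2 - z\<^sup>2) ^ Suc k) has_vector_derivative
      ((2 * real k + 3) * (t\<^sup>2 - z\<^sup>2) ^ Suc k - 2 * (real k + 1) * t\<^sup>2 * (t\<^sup>2 - z\<^sup>2) ^ k)) (at z within {-t..t})"
      by (simp add: has_real_derivative_iff_has_vector_derivative)
  qed (use t in auto)
  then have z: "integral {-t..t} (\<lambda>z. (2 * real k + 3) * (t\<^sup>2 - z\<^sup>2) ^ Suc k - 2 * (real k + 1) * t\<^sup>2 * (t\<^sup>2 - z\<^sup>2) ^ k) = 0"
    by (simp add: integral_unique)
  have i: "(\<lambda>z. c * (t\<^sup>2 - z\<^sup>2) ^ j) integrable_on {-t..t}" for c and j
    by (intro integrable_continuous_real continuous_intros)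
  have "(2 * real k + 3) * integral {-t..t} (\<lambda>z. (t\<^sup>2 - z\<^sup>2) ^ Suc k) = 2 * (real k + 1) * t\<^sup>2 * integral {-t..t} (\<lambda>z. (t\<^sup>2 - z\<^sup>2) ^ k)"
    using z unfolding Henstock_Kurzweil_Integration.integral_diff[OF i i] by simp
  then have "integral {-t..t} (\<lambda>z. (t\<^sup>2 - z\<^sup>2) ^ Suc k) = 2 * (real k + 1) * t\<^sup>2 / (2 * real k + 3) * integral {-t..t} (\<lambda>z. (t\<^sup>2 - z\<^sup>2) ^ k)"
    by (simp add: field_simps)
  also have "\<dots> = 2 * t ^ (2 * Suc k + 1) * 4 ^ Suc k * (fact (Suc k))\<^sup>2 / fact (2 * Suc k + 1)"
    unfolding Suc by (simp add: divide_simps power2_eq_square) (simp add: algebra_simps)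
  finally show ?case .
qed

text \<open>Monotone convergence of the partial sums, all of whose terms are nonnegative inside the
  cone.\<close>

lemma bessel_entire_mass:
  assumes t: "0 \<le> t"
    and B: "\<And>N. (\<Sum>k<N. bessel_coeff n k * (2 * t ^ (2 * k + 1) * 4 ^ k * (fact k)\<^sup>2 / fact (2 * k + 1))) \<le> B"
  shows "integral {-t..t} (\<lambda>z. bessel_entire n (t\<^sup>2 - z\<^sup>2)) \<le> B"
proof -
  define f where "f N z = (\<Sum>k<N. bessel_coeff n k * (t\<^sup>2 - z\<^sup>2) ^ k)" for N z
  have i: "(\<lambda>z. bessel_coeff n j * (t\<^sup>2 - z\<^sup>2) ^ j) integrable_on {-t..t}" for j
    by (intro integrable_continuous_real continuous_intros)
  have fi: "f N integrable_on {-t..t}" for N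
    unfolding f_def by (intro integrable_sum i) auto
  have nn: "0 \<le> t\<^sup>2 - z\<^sup>2" if "z \<in> {-t..t}" for z
    using that t abs_le_square_iff[of z t] by (auto simp: abs_le_iff)
  have int: "integral {-t..t} (f N) = (\<Sum>k<N. bessel_coeff n k * (2 * t ^ (2 * k + 1) * 4 ^ k * (fact k)\<^sup>2 / fact (2 * k + 1)))" for N
    unfolding f_def by (subst Henstock_Kurzweil_Integration.integral_sum) (auto simp: i integral_square_diff_power[OF t])
  have i0: "0 \<le> integral {-t..t} (f N)" for N
    by (rule Henstock_Kurzweil_Integration.integral_nonneg[OF fi])
       (auto simp: f_def intro!: sum_nonneg mult_nonneg_nonneg bessel_coeff_nonneg zero_le_power nn)
  have "(\<lambda>z. bessel_entire n (t\<^sup>2 - z\<^sup>2)) integrable_on {-t..t} \<and>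
    (\<lambda>N. integral {-t..t} (f N)) \<longlonglongrightarrow> integral {-t..t} (\<lambda>z. bessel_entire n (t\<^sup>2 - z\<^sup>2))"
  proof (rule monotone_convergence_increasing[OF fi])
    show "f N z \<le> f (Suc N) z" if "z \<in> {-t..t}" for N z
      using nn[OF that] bessel_coeff_nonneg by (simp add: f_def)
    show "(\<lambda>N. f N z) \<longlonglongrightarrow> bessel_entire n (t\<^sup>2 - z\<^sup>2)" for z
      unfolding f_def bessel_entire_def by (rule summable_LIMSEQ[OF bessel_summable])
    show "bounded (range (\<lambda>N. integral {-t..t} (f N)))"
      unfolding bounded_iff using B int i0 by (intro exI[of _ B]) auto
  qed
  then show ?thesis using B int by (intro LIMSEQ_le_const2[where X = "\<lambda>N. integral {-t..t} (f N)"]) auto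
qed

lemma sixteen_pow: "(16::real) ^ k = 4 ^ k * 4 ^ k"
  by (simp add: power_mult_distrib[symmetric])

text \<open>Integrating termwise gives \<open>4 * sinh (t / 2)\<close>, whose series is part of the exponential
  series.\<close>

lemma bessel_entire0_mass: assumes t: "0 \<le> t" shows "integral {-t..t} (\<lambda>z. bessel_entire 0 (t\<^sup>2 - z\<^sup>2)) \<le> 4 * exp (t / 2)"
proof (rule bessel_entire_mass[OF t])
  fix N
  define y where "y = t / 2"
  have ty: "t = 2 * y" by (simp add: y_def)
  have y: "y \<ge> 0" using t by (simp add: y_def)
  have "(\<Sum>k<N. bessel_coeff 0 k * (2 * t ^ (2 * k + 1) * 4 ^ k * (fact k)\<^sup>2 / fact (2 * k + 1)))
     \<le> (\<Sum>k<N. 4 * (y ^ (2 * k) / fact (2 * k) + y ^ (2 * k + 1) / fact (2 * k + 1)))"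
  proof (rule sum_mono)
    fix k
    have eq: "bessel_coeff 0 k * (2 * t ^ (2 * k + 1) * 4 ^ k * (fact k)\<^sup>2 / fact (2 * k + 1)) = 4 * (y ^ (2 * k + 1) / fact (2 * k + 1))"
      unfolding ty bessel_coeff_def sixteen_pow
      by (simp add: power_mult_distrib power2_eq_square power_mult)
    have "0 \<le> y ^ (2 * k) / fact (2 * k)" using y by simp
    then show "bessel_coeff 0 k * (2 * t ^ (2 * k + 1) * 4 ^ k * (fact k)\<^sup>2 / fact (2 * k + 1)) \<le> 4 * (y ^ (2 * k) / fact (2 * k) + y ^ (2 * k + 1) / fact (2 * k + 1))"
      unfolding eq by (intro mult_left_mono) (simp_all only: le_add_same_cancel2 zero_le_numeral)
  qed
  also have "\<dots> = 4 * (\<Sum>j<2 * N. y ^ j / fact j)"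
    unfolding sum_distrib_left[symmetric] sum_even_odd[of "\<lambda>j. y ^ j / fact j"] ..
  also have "\<dots> \<le> 4 * exp y" using exp_partial_sum_le[OF y] by simp
  finally show "(\<Sum>k<N. bessel_coeff 0 k * (2 * t ^ (2 * k + 1) * 4 ^ k * (fact k)\<^sup>2 / fact (2 * k + 1))) \<le> 4 * exp (t / 2)"
    by (simp add: y_def)
qed

text \<open>Integrating termwise gives \<open>4 * (cosh (t / 2) - 1)\<close>.\<close>

lemma bessel_entire1_mass: assumes t: "0 < t" shows "t / 4 * integral {-t..t} (\<lambda>z. bessel_entire 1 (t\<^sup>2 - z\<^sup>2)) \<le> 4 * exp (t / 2)"
proof -
  have "integral {-t..t} (\<lambda>z. bessel_entire 1 (t\<^sup>2 - z\<^sup>2)) \<le> 4 * exp (t / 2) / (t / 4)"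
  proof (rule bessel_entire_mass)
    fix N
    define y where "y = t / 2"
    have ty: "t = 2 * y" by (simp add: y_def)
    have y: "y > 0" using t by (simp add: y_def)
    have "(t / 4) * (\<Sum>k<N. bessel_coeff 1 k * (2 * t ^ (2 * k + 1) * 4 ^ k * (fact k)\<^sup>2 / fact (2 * k + 1)))
       = (\<Sum>k<N. 4 * (y ^ (2 * Suc k) / fact (2 * Suc k)))"
      unfolding sum_distrib_left
    proof (rule sum.cong[OF refl])
      fix k
      show "(t / 4) * (bessel_coeff 1 k * (2 * t ^ (2 * k + 1) * 4 ^ k * (fact k)\<^sup>2 / fact (2 * k + 1))) = 4 * (y ^ (2 * Suc k) / fact (2 * Suc k))"
        unfolding ty bessel_coeff_def sixteen_pow
        by (simp add: power_mult_distrib power2_eq_square power_mult divide_simps)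
    qed
    also have "\<dots> \<le> 4 * (\<Sum>k<Suc N. y ^ (2 * k) / fact (2 * k) + y ^ (2 * k + 1) / fact (2 * k + 1))"
    proof -
      have "(\<Sum>k<N. y ^ (2 * Suc k) / fact (2 * Suc k)) \<le> (\<Sum>k<Suc N. y ^ (2 * k) / fact (2 * k))"
        unfolding sum.lessThan_Suc_shift by simp
      also have "\<dots> \<le> (\<Sum>k<Suc N. y ^ (2 * k) / fact (2 * k) + y ^ (2 * k + 1) / fact (2 * k + 1))"
        using y by (intro sum_mono) simp
      finally show ?thesis by (simp only: sum_distrib_left[symmetric])
    qed
    also have "\<dots> = 4 * (\<Sum>j<2 * Suc N. y ^ j / fact j)"
      unfolding sum_even_odd[of "\<lambda>j. y ^ j / fact j"] ..
    also have "\<dots> \<le> 4 * exp y" using exp_partial_sum_le[of y "2 * Suc N"] y by simp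
    finally show "(\<Sum>k<N. bessel_coeff 1 k * (2 * t ^ (2 * k + 1) * 4 ^ k * (fact k)\<^sup>2 / fact (2 * k + 1))) \<le> 4 * exp (t / 2) / (t / 4)"
      using t by (simp add: y_def pos_le_divide_eq mult.commute)
  qed (use t in simp)
  then show ?thesis using t by (simp add: pos_le_divide_eq mult.commute)
qed

section \<open>The kernels of the damped wave equation\<close>

text \<open>Closed under sums and products, so that the kernels need no explicit derivatives.\<close>

definition smooth_kernel :: "(real \<Rightarrow> real \<Rightarrow> real) \<Rightarrow> bool" where
  "smooth_kernel k \<longleftrightarrow> (\<exists>kt kz. C1_kernel k kt kz)"

lemma smooth_kernel_add:
  assumes "smooth_kernel k" "smooth_kernel l" shows "smooth_kernel (\<lambda>t z. k t z + l t z)"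
proof -
  obtain kt kz lt lz where "C1_kernel k kt kz" "C1_kernel l lt lz" using assms by (auto simp: smooth_kernel_def)
  then have "C1_kernel (\<lambda>t z. k t z + l t z) (\<lambda>t z. kt t z + lt t z) (\<lambda>t z. kz t z + lz t z)"
    unfolding C1_kernel_def case_prod_beta by (auto intro!: continuous_intros derivative_intros)
  then show ?thesis by (auto simp: smooth_kernel_def)
qed

lemma smooth_kernel_mult:
  assumes "smooth_kernel k" "smooth_kernel l" shows "smooth_kernel (\<lambda>t z. k t z * l t z)"
proof -
  obtain kt kz lt lz where "C1_kernel k kt kz" "C1_kernel l lt lz" using assms by (auto simp: smooth_kernel_def)
  then have "C1_kernel (\<lambda>t z. k t z * l t z) (\<lambda>t z. kt t z * l t z + lt t z * k t z) (\<lambda>t z. kz t z * l t z + lz t z * k t z)"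
    unfolding C1_kernel_def case_prod_beta by (auto intro!: continuous_intros derivative_intros DERIV_mult)
  then show ?thesis by (auto simp: smooth_kernel_def)
qed

lemma smooth_kernel_const: "smooth_kernel (\<lambda>t z. c)"
  unfolding smooth_kernel_def C1_kernel_def case_prod_beta
  by (intro exI[of _ "\<lambda>t z. 0"]) (auto intro!: continuous_intros)

lemma smooth_kernel_time: "smooth_kernel (\<lambda>t z. t)"
  unfolding smooth_kernel_def C1_kernel_def case_prod_beta
  by (rule exI[of _ "\<lambda>t z. 1"], rule exI[of _ "\<lambda>t z. 0"]) (auto intro!: continuous_intros derivative_eq_intros)

lemma smooth_kernel_space: "smooth_kernel (\<lambda>t z. z)"
  unfolding smooth_kernel_def C1_kernel_def case_prod_beta
  by (rule exI[of _ "\<lambda>t z. 0"], rule exI[of _ "\<lambda>t z. 1"]) (auto intro!: continuous_intros derivative_eq_intros)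

lemma smooth_kernel_exp: "smooth_kernel (\<lambda>t z. exp (- t / 2))"
  unfolding smooth_kernel_def C1_kernel_def case_prod_beta
  by (rule exI[of _ "\<lambda>t z. - exp (- t / 2) / 2"], rule exI[of _ "\<lambda>t z. 0"])
     (auto intro!: continuous_intros derivative_eq_intros)

lemma smooth_kernel_bessel: "smooth_kernel (\<lambda>t z. bessel_entire n (t\<^sup>2 - z\<^sup>2))"
proof -
  have c: "continuous_on A (\<lambda>p. bessel_entire m (h p))" if "continuous_on A h" for A :: "(real \<times> real) set" and h m
    by (rule continuous_on_compose2[OF bessel_entire_continuous[of UNIV] that]) auto
  have "C1_kernel (\<lambda>t z. bessel_entire n (t\<^sup>2 - z\<^sup>2)) (\<lambda>t z. bessel_entire (Suc n) (t\<^sup>2 - z\<^sup>2) / 16 * (2 * t))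
     (\<lambda>t z. bessel_entire (Suc n) (t\<^sup>2 - z\<^sup>2) / 16 * (- 2 * z))"
    unfolding C1_kernel_def case_prod_beta
    by (auto intro!: continuous_intros c DERIV_cong[OF DERIV_chain'[OF _ bessel_entire_derivative]] derivative_eq_intros)
  then show ?thesis by (auto simp: smooth_kernel_def)
qed

lemma smooth_kernel_cont2: "smooth_kernel k \<Longrightarrow> cont2 k"
  by (auto simp: smooth_kernel_def C1_kernel_def)

text \<open>The Riemann function of the damped wave equation inside the light cone.\<close>

definition damped_kernel :: "real \<Rightarrow> real \<Rightarrow> real" where
  "damped_kernel t z = exp (- t / 2) * (1 / 2) * bessel_entire 0 (t\<^sup>2 - z\<^sup>2)"

text \<open>The space derivative of the damped kernel.\<close>

definition damped_kernel_dz :: "real \<Rightarrow> real \<Rightarrow> real" where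
  "damped_kernel_dz t z = exp (- t / 2) * (- 1 / 16) * (z * bessel_entire 1 (t\<^sup>2 - z\<^sup>2))"

text \<open>The regular part of the propagator for the initial displacement: the damped kernel plus its
  time derivative.\<close>

definition damped_kernel0 :: "real \<Rightarrow> real \<Rightarrow> real" where
  "damped_kernel0 t z = exp (- t / 2) * (1 / 4) * (bessel_entire 0 (t\<^sup>2 - z\<^sup>2) + t * (1 / 4) * bessel_entire 1 (t\<^sup>2 - z\<^sup>2))"

lemma smooth_damped_kernels:
  "smooth_kernel damped_kernel" "smooth_kernel damped_kernel_dz" "smooth_kernel damped_kernel0"
  unfolding damped_kernel_def[abs_def] damped_kernel_dz_def[abs_def] damped_kernel0_def[abs_def]
  by (intro smooth_kernel_add smooth_kernel_mult smooth_kernel_const smooth_kernel_time smooth_kernel_space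
      smooth_kernel_exp smooth_kernel_bessel)+

lemma damped_kernel_derivative_z: "(damped_kernel t has_real_derivative damped_kernel_dz t z) (at z)"
proof -
  have "((\<lambda>z. bessel_entire 0 (t\<^sup>2 - z\<^sup>2)) has_real_derivative bessel_entire (Suc 0) (t\<^sup>2 - z\<^sup>2) / 16 * (- 2 * z)) (at z)"
    by (rule DERIV_cong[OF DERIV_chain'[OF _ bessel_entire_derivative]]) (auto intro!: derivative_eq_intros)
  from DERIV_cmult[OF this, of "exp (- t / 2) * (1 / 2)"] show ?thesis
    unfolding damped_kernel_def[abs_def] damped_kernel_dz_def by (rule DERIV_cong) simp
qed

lemma bessel_entire_zero [simp]: "bessel_entire 0 0 = 1"
  using powser_zero[of "bessel_coeff 0"] by (simp add: bessel_entire_def bessel_coeff_def)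

lemma damped_kernel_boundary: "damped_kernel t t = exp (- t / 2) / 2" "damped_kernel t (- t) = exp (- t / 2) / 2"
  by (simp_all add: damped_kernel_def)

lemma square_diff_bounds:
  fixes t z :: real assumes "\<bar>z\<bar> \<le> t" shows "0 \<le> t\<^sup>2 - z\<^sup>2" "t\<^sup>2 - z\<^sup>2 \<le> t\<^sup>2"
  using assms abs_le_square_iff[of z t] by auto

text \<open>All bounds reduce to \<open>z = 0\<close> because the power series are increasing in \<open>t\<^sup>2 - z\<^sup>2\<close>.\<close>

lemma damped_kernel_bounds:
  assumes "\<bar>z\<bar> \<le> t"
  shows "0 \<le> damped_kernel t z" "damped_kernel t z \<le> 1 / 2" "damped_kernel t z \<le> 1 / sqrt (1 + t)"
    "0 \<le> damped_kernel0 t z" "damped_kernel0 t z \<le> 1 / sqrt (1 + t)"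
proof -
  have t: "0 \<le> t" using assms by linarith
  note s = square_diff_bounds[OF assms]
  define E where "E = exp (- t / 2) * bessel_entire 0 (t\<^sup>2)"
  have E: "E \<le> 1" "E \<le> 2 / sqrt (1 + t)" using damped_bessel_decay[OF t] by (simp_all add: E_def)
  have J0: "bessel_entire 0 (t\<^sup>2 - z\<^sup>2) \<le> bessel_entire 0 (t\<^sup>2)" by (rule bessel_entire_mono[OF s])
  have J1: "t * (1 / 4) * bessel_entire 1 (t\<^sup>2 - z\<^sup>2) \<le> bessel_entire 0 (t\<^sup>2)"
  proof -
    have "t * (1 / 4) * bessel_entire 1 (t\<^sup>2 - z\<^sup>2) \<le> t * (1 / 4) * bessel_entire 1 (t\<^sup>2)"
      using t by (intro mult_left_mono bessel_entire_mono s) auto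
    then show ?thesis using bessel_entire1_le[OF t] by simp
  qed
  show "0 \<le> damped_kernel t z" using bessel_entire_nonneg[OF s(1), of 0] by (simp add: damped_kernel_def)
  show "0 \<le> damped_kernel0 t z"
    using bessel_entire_nonneg[OF s(1), of 0] bessel_entire_nonneg[OF s(1), of 1] t by (simp add: damped_kernel0_def)
  have "damped_kernel t z \<le> exp (- t / 2) * (1 / 2) * bessel_entire 0 (t\<^sup>2)"
    unfolding damped_kernel_def by (intro mult_left_mono J0) auto
  then have 1: "damped_kernel t z \<le> E / 2" by (simp add: E_def)
  have "damped_kernel0 t z \<le> exp (- t / 2) * (1 / 4) * (bessel_entire 0 (t\<^sup>2) + bessel_entire 0 (t\<^sup>2))"
    unfolding damped_kernel0_def by (intro mult_left_mono add_mono J0 J1) auto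
  then have 2: "damped_kernel0 t z \<le> E / 2" by (simp add: E_def algebra_simps)
  show "damped_kernel t z \<le> 1 / 2" "damped_kernel t z \<le> 1 / sqrt (1 + t)" "damped_kernel0 t z \<le> 1 / sqrt (1 + t)"
    using 1 2 E by simp_all
qed

lemma kernel_integrable: "cont2 k \<Longrightarrow> k t integrable_on {a..b}"
  using cont2_compose[of k "{a..b}" "\<lambda>_. t" "\<lambda>z. z"] by (intro integrable_continuous_real) auto

lemma damped_kernel_mass:
  assumes t: "0 \<le> t"
  shows "integral {-t..t} (damped_kernel t) \<le> 2" "integral {-t..t} (damped_kernel0 t) \<le> 2"
proof -
  have e: "exp (- t / 2) * exp (t / 2) = 1" by (simp add: exp_add[symmetric])
  have i: "(\<lambda>z. c * bessel_entire n (t\<^sup>2 - z\<^sup>2)) integrable_on {-t..t}" for c n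
    using kernel_integrable[OF smooth_kernel_cont2[OF smooth_kernel_mult[OF smooth_kernel_const smooth_kernel_bessel]], of c n] by simp
  have "integral {-t..t} (damped_kernel t) = exp (- t / 2) * (1 / 2) * integral {-t..t} (\<lambda>z. bessel_entire 0 (t\<^sup>2 - z\<^sup>2))"
    unfolding damped_kernel_def[abs_def] by (rule integral_mult_right)
  also have "\<dots> \<le> exp (- t / 2) * (1 / 2) * (4 * exp (t / 2))"
    by (intro mult_left_mono bessel_entire0_mass t) auto
  also have "\<dots> = 2 * (exp (- t / 2) * exp (t / 2))" by simp
  finally show "integral {-t..t} (damped_kernel t) \<le> 2" unfolding e by simp
  have J1: "t * (1 / 4) * integral {-t..t} (\<lambda>z. bessel_entire 1 (t\<^sup>2 - z\<^sup>2)) \<le> 4 * exp (t / 2)"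
    using bessel_entire1_mass[of t] t by (cases "t = 0") auto
  have "integral {-t..t} (damped_kernel0 t) = exp (- t / 2) * (1 / 4) *
     integral {-t..t} (\<lambda>z. 1 * bessel_entire 0 (t\<^sup>2 - z\<^sup>2) + t * (1 / 4) * bessel_entire 1 (t\<^sup>2 - z\<^sup>2))"
    unfolding damped_kernel0_def[abs_def] by simp
  also have "integral {-t..t} (\<lambda>z. 1 * bessel_entire 0 (t\<^sup>2 - z\<^sup>2) + t * (1 / 4) * bessel_entire 1 (t\<^sup>2 - z\<^sup>2)) =
     integral {-t..t} (\<lambda>z. bessel_entire 0 (t\<^sup>2 - z\<^sup>2)) + t * (1 / 4) * integral {-t..t} (\<lambda>z. bessel_entire 1 (t\<^sup>2 - z\<^sup>2))"
    by (subst Henstock_Kurzweil_Integration.integral_add[OF i i]) (simp only: integral_mult_right mult_1)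
  also have "exp (- t / 2) * (1 / 4) * \<dots> \<le> exp (- t / 2) * (1 / 4) * (4 * exp (t / 2) + 4 * exp (t / 2))"
    by (intro mult_left_mono add_mono bessel_entire0_mass t J1) auto
  also have "\<dots> = 2 * (exp (- t / 2) * exp (t / 2))" by simp
  finally show "integral {-t..t} (damped_kernel0 t) \<le> 2" unfolding e by simp
qed

text \<open>The same integral as \<open>signed_cone\<close> in Lebesgue form, for data that are merely integrable.\<close>

definition cone_integral :: "(real \<Rightarrow> real \<Rightarrow> real) \<Rightarrow> (real \<Rightarrow> real) \<Rightarrow> real \<Rightarrow> real \<Rightarrow> real" where
  "cone_integral k f t x = (LBINT y:{x - t..x + t}. k t (x - y) * f y)"

lemma damped_K1_cone_integral: assumes "0 \<le> t" shows "damped_K1 t g x = cone_integral damped_kernel g t x"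
proof -
  have "(LBINT y:{x - t..x + t}. bessel_I 0 (sqrt (t\<^sup>2 - (x - y)\<^sup>2) / 2) * g y) =
    (LBINT y:{x - t..x + t}. bessel_entire 0 (t\<^sup>2 - (x - y)\<^sup>2) * g y)"
  proof (rule set_lebesgue_integral_cong, simp, intro allI impI)
    fix y assume "y \<in> {x - t..x + t}"
    then have "0 \<le> t\<^sup>2 - (x - y)\<^sup>2" by (intro square_diff_bounds) auto
    from bessel_I_sqrt[OF this, of 0]
    show "bessel_I 0 (sqrt (t\<^sup>2 - (x - y)\<^sup>2) / 2) * g y = bessel_entire 0 (t\<^sup>2 - (x - y)\<^sup>2) * g y" by simp
  qed
  then have "damped_K1 t g x = (exp (- t / 2) / 2) * (LBINT y:{x - t..x + t}. bessel_entire 0 (t\<^sup>2 - (x - y)\<^sup>2) * g y)"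
    by (simp add: damped_K1_def)
  also have "\<dots> = cone_integral damped_kernel g t x"
    unfolding cone_integral_def damped_kernel_def by (subst set_integral_mult_right[symmetric]) (simp add: mult_ac)
  finally show ?thesis .
qed

text \<open>At the two endpoints the quotient by the square root is a division by zero; they form a null
  set.\<close>

lemma damped_K0_cone_integral:
  assumes t: "0 \<le> t" and [measurable]: "f \<in> borel_measurable borel"
  shows "damped_K0 t f x = exp (- t / 2) / 2 * (f (x + t) + f (x - t)) + cone_integral damped_kernel0 f t x"
proof -
  let ?r = "\<lambda>y. sqrt (t\<^sup>2 - (x - y)\<^sup>2)"
  have ae: "AE y in lborel. y \<noteq> x - t \<and> y \<noteq> x + t"
    by (intro AE_conjI AE_lborel_singleton)
  have "(bessel_I 0 (?r y / 2) + t / ?r y * bessel_I 1 (?r y / 2)) * f y =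
     (bessel_entire 0 (t\<^sup>2 - (x - y)\<^sup>2) + t * (1 / 4) * bessel_entire 1 (t\<^sup>2 - (x - y)\<^sup>2)) * f y"
    if "y \<in> {x - t..x + t}" "y \<noteq> x - t" "y \<noteq> x + t" for y
  proof -
    have a: "\<bar>x - y\<bar> < t" using that by auto
    then have "\<bar>x - y\<bar>\<^sup>2 < t\<^sup>2" by (intro power_strict_mono) auto
    then have "0 < t\<^sup>2 - (x - y)\<^sup>2" by simp
    then show ?thesis by (simp add: bessel_I_sqrt)
  qed
  then have "(LBINT y:{x - t..x + t}. (bessel_I 0 (?r y / 2) + t / ?r y * bessel_I 1 (?r y / 2)) * f y) =
    (LBINT y:{x - t..x + t}. (bessel_entire 0 (t\<^sup>2 - (x - y)\<^sup>2) + t * (1 / 4) * bessel_entire 1 (t\<^sup>2 - (x - y)\<^sup>2)) * f y)"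
    unfolding set_lebesgue_integral_def
  proof (intro integral_cong_AE)
    have [measurable]: "bessel_I n \<in> borel_measurable borel" for n
      unfolding bessel_I_def[abs_def] by measurable
    have [measurable]: "bessel_entire n \<in> borel_measurable borel" for n
      by (rule borel_measurable_continuous_onI[OF bessel_entire_continuous])
    show "(\<lambda>y. indicator {x - t..x + t} y *\<^sub>R ((bessel_I 0 (?r y / 2) + t / ?r y * bessel_I 1 (?r y / 2)) * f y)) \<in> borel_measurable lborel"
      by measurable
    show "(\<lambda>y. indicator {x - t..x + t} y *\<^sub>R ((bessel_entire 0 (t\<^sup>2 - (x - y)\<^sup>2) + t * (1 / 4) * bessel_entire 1 (t\<^sup>2 - (x - y)\<^sup>2)) * f y)) \<in> borel_measurable lborel"
      by measurable
  qed (use ae in \<open>eventually_elim, auto simp: indicator_def\<close>)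
  moreover have "cone_integral damped_kernel0 f t x = exp (- t / 2) / 4 *
    (LBINT y:{x - t..x + t}. (bessel_entire 0 (t\<^sup>2 - (x - y)\<^sup>2) + t * (1 / 4) * bessel_entire 1 (t\<^sup>2 - (x - y)\<^sup>2)) * f y)"
    unfolding cone_integral_def damped_kernel0_def by (subst set_integral_mult_right[symmetric]) (simp add: mult_ac)
  ultimately show ?thesis unfolding damped_K0_def by simp
qed

lemma wave_K1_cone_integral: "wave_K1 t g x = cone_integral (\<lambda>t z. 1 / 2) g t x"
  unfolding wave_K1_def cone_integral_def by (rule set_integral_mult_right[symmetric])

lemma cone_integral_eq_signed_cone:
  assumes k: "cont2 k" and f: "continuous_on UNIV f" and t: "0 \<le> t"
  shows "cone_integral k f t x = signed_cone k f t x"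
  unfolding cone_integral_def signed_cone_eq_integral[OF k f t]
  by (rule set_borel_integral_eq_integral(2)[OF borel_integrable_atLeastAtMost'])
     (intro continuous_intros cont2_compose[OF k] continuous_on_subset[OF f], auto)

lemma cone_integral_cong_AE:
  assumes k: "cont2 k" and m: "f \<in> borel_measurable borel" "g \<in> borel_measurable borel"
    and ae: "AE y in lborel. f y = g y"
  shows "cone_integral k f t x = cone_integral k g t x"
proof -
  have "continuous_on UNIV (\<lambda>y. k t (x - y))" by (intro cont2_compose[OF k] continuous_intros)
  then have [measurable]: "(\<lambda>y. k t (x - y)) \<in> borel_measurable borel" by (rule borel_measurable_continuous_onI)
  note [measurable] = m
  show ?thesis
    unfolding cone_integral_def set_lebesgue_integral_def
    by (rule integral_cong_AE) (measurable, use ae in \<open>eventually_elim, simp\<close>)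
qed

text \<open>Integration by parts turns the integrable datum \<open>g\<close> into its continuous primitive. The
  boundary terms are travelling waves with profile \<open>P\<close>.\<close>

lemma cone_integral_primitive:
  assumes k: "cont2 k" and kz: "cont2 kz" and d: "\<And>t z. (k t has_real_derivative kz t z) (at z)"
    and P: "primitive P g" and t: "0 \<le> t"
  shows "cone_integral k g t x = k t (- t) * P (x + t) - k t t * P (x - t) + signed_cone kz P t x"
proof -
  have d': "((\<lambda>y. k t (x - y)) has_real_derivative - kz t (x - y)) (at y)" for y
    by (rule DERIV_cong[OF DERIV_chain'[OF _ d]]) (auto intro!: derivative_eq_intros)
  have c: "continuous_on UNIV (\<lambda>y. - kz t (x - y))" by (intro continuous_intros cont2_compose[OF kz])
  have "(LBINT y:{x - t..x + t}. - kz t (x - y) * P y) = - cone_integral kz P t x"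
    unfolding cone_integral_def by (simp add: set_lebesgue_integral_def)
  then show ?thesis
    using integration_by_parts_primitive[OF P _ d' c, of "x - t" "x + t"] t
      cone_integral_eq_signed_cone[OF kz primitive_continuous[OF P] t] by (simp add: cone_integral_def)
qed

lemma cone_integral_measurable:
  assumes k: "cont2 k" and m: "f \<in> borel_measurable borel"
  shows "(\<lambda>x. cone_integral k f t x) \<in> borel_measurable borel"
proof -
  have "continuous_on UNIV (k t)" using cont2_compose[OF k, of UNIV "\<lambda>_. t" "\<lambda>z. z"] by simp
  then have [measurable]: "k t \<in> borel_measurable borel" by (rule borel_measurable_continuous_onI)
  note [measurable] = m
  have "(\<lambda>x. LINT y|lborel. (if x - t \<le> y \<and> y \<le> x + t then k t (x - y) * f y else 0)) \<in> borel_measurable borel"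
    by measurable
  then show ?thesis
    unfolding cone_integral_def set_lebesgue_integral_def
    by (rule measurable_cong[THEN iffD1, rotated]) (auto intro!: Bochner_Integration.integral_cong simp: indicator_def)
qed

lemma cone_integral_abs_le:
  assumes k: "cont2 k" and b: "\<And>z. \<bar>z\<bar> \<le> t \<Longrightarrow> 0 \<le> k t z \<and> k t z \<le> c" and f: "integrable lborel f"
    and c: "0 \<le> c"
  shows "\<bar>cone_integral k f t x\<bar> \<le> c * (LINT y|lborel. \<bar>f y\<bar>)"
proof -
  have "continuous_on UNIV (\<lambda>y. k t (x - y))" by (intro cont2_compose[OF k] continuous_intros)
  then have [measurable]: "(\<lambda>y. k t (x - y)) \<in> borel_measurable borel" by (rule borel_measurable_continuous_onI)
  have [measurable]: "f \<in> borel_measurable borel" using f by auto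
  have le: "\<bar>indicator {x - t..x + t} y * (k t (x - y) * f y)\<bar> \<le> c * \<bar>f y\<bar>" for y
  proof (cases "y \<in> {x - t..x + t}")
    case True
    then have "\<bar>x - y\<bar> \<le> t" by auto
    from b[OF this] show ?thesis using True by (auto simp: abs_mult intro!: mult_right_mono)
  qed (use c in simp)
  have i: "integrable lborel (\<lambda>y. indicator {x - t..x + t} y * (k t (x - y) * f y))"
  proof (rule Bochner_Integration.integrable_bound)
    show "integrable lborel (\<lambda>y. c * \<bar>f y\<bar>)" using f by (intro integrable_mult_right integrable_abs)
    show "AE y in lborel. norm (indicator {x - t..x + t} y * (k t (x - y) * f y)) \<le> norm (c * \<bar>f y\<bar>)"
      using le c by (auto simp: abs_mult)
  qed measurable
  have "\<bar>cone_integral k f t x\<bar> \<le> (LINT y|lborel. \<bar>indicator {x - t..x + t} y * (k t (x - y) * f y)\<bar>)"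
    unfolding cone_integral_def set_lebesgue_integral_def real_scaleR_def by (rule integral_abs_bound)
  also have "\<dots> \<le> (LINT y|lborel. c * \<bar>f y\<bar>)"
    using f by (intro integral_mono integrable_abs i integrable_mult_right le)
  finally show ?thesis by simp
qed

text \<open>Tonelli's theorem: the kernel is integrated first, so only its mass enters.\<close>

lemma cone_integral_L1_le:
  assumes k: "cont2 k" and b: "\<And>z. \<bar>z\<bar> \<le> t \<Longrightarrow> 0 \<le> k t z" and mass: "integral {-t..t} (k t) \<le> m"
    and f: "integrable lborel f" and m: "0 \<le> m"
  shows "(\<integral>\<^sup>+x. ennreal \<bar>cone_integral k f t x\<bar> \<partial>lborel) \<le> ennreal (m * (LINT y|lborel. \<bar>f y\<bar>))"
proof -
  have ck: "continuous_on UNIV (k t)" using cont2_compose[OF k, of UNIV "\<lambda>_. t" "\<lambda>z. z"] by simp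
  then have [measurable]: "k t \<in> borel_measurable borel" by (rule borel_measurable_continuous_onI)
  have [measurable]: "f \<in> borel_measurable borel" using f by auto
  define K where "K z = indicator {-t..t} z * k t z" for z
  have [measurable]: "K \<in> borel_measurable borel" unfolding K_def by measurable
  have remainder_const: "0 \<le> K z" for z using b[of z] by (auto simp: K_def indicator_def abs_le_iff)
  have Ki: "(\<integral>\<^sup>+z. ennreal (K z) \<partial>lborel) \<le> ennreal m"
  proof -
    have si: "set_integrable lborel {-t..t} (k t)"
      by (rule borel_integrable_atLeastAtMost'[OF continuous_on_subset[OF ck]]) auto
    then have "(\<integral>\<^sup>+z. ennreal (K z) \<partial>lborel) = ennreal (LINT z|lborel. K z)"
      using remainder_const by (intro nn_integral_eq_integral) (auto simp: K_def set_integrable_def)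
    also have "(LINT z|lborel. K z) = integral {-t..t} (k t)"
      using set_borel_integral_eq_integral(2)[OF si] by (simp add: K_def set_lebesgue_integral_def)
    finally show ?thesis using mass by (simp add: ennreal_leI)
  qed
  have "ennreal \<bar>cone_integral k f t x\<bar> \<le> (\<integral>\<^sup>+y. ennreal (K (x - y)) * ennreal \<bar>f y\<bar> \<partial>lborel)" for x
  proof -
    have "norm (cone_integral k f t x) \<le> (\<integral>\<^sup>+y. norm (indicator {x - t..x + t} y *\<^sub>R (k t (x - y) * f y)) \<partial>lborel)"
    proof (cases "integrable lborel (\<lambda>y. indicator {x - t..x + t} y *\<^sub>R (k t (x - y) * f y))")
      case True
      then show ?thesis unfolding cone_integral_def set_lebesgue_integral_def by (rule integral_norm_bound_ennreal)
    next
      case False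
      then show ?thesis unfolding cone_integral_def set_lebesgue_integral_def by (simp add: not_integrable_integral_eq)
    qed
    also have "\<dots> = (\<integral>\<^sup>+y. ennreal (K (x - y)) * ennreal \<bar>f y\<bar> \<partial>lborel)"
    proof (rule nn_integral_cong)
      fix y
      have "norm (indicator {x - t..x + t} y *\<^sub>R (k t (x - y) * f y)) = K (x - y) * \<bar>f y\<bar>"
        using b[of "x - y"] by (auto simp: K_def indicator_def abs_mult abs_le_iff)
      then show "ennreal (norm (indicator {x - t..x + t} y *\<^sub>R (k t (x - y) * f y))) = ennreal (K (x - y)) * ennreal \<bar>f y\<bar>"
        using remainder_const by (simp add: ennreal_mult)
    qed
    finally show ?thesis by simp
  qed
  then have "(\<integral>\<^sup>+x. ennreal \<bar>cone_integral k f t x\<bar> \<partial>lborel) \<le> (\<integral>\<^sup>+x. \<integral>\<^sup>+y. ennreal (K (x - y)) * ennreal \<bar>f y\<bar> \<partial>lborel \<partial>lborel)"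
    by (intro nn_integral_mono)
  also have "\<dots> = (\<integral>\<^sup>+y. \<integral>\<^sup>+x. ennreal (K (x - y)) * ennreal \<bar>f y\<bar> \<partial>lborel \<partial>lborel)"
    by (rule lborel_pair.Fubini') measurable
  also have "\<dots> = (\<integral>\<^sup>+y. (\<integral>\<^sup>+x. ennreal (K x) \<partial>lborel) * ennreal \<bar>f y\<bar> \<partial>lborel)"
  proof (rule nn_integral_cong)
    fix y
    have "(\<integral>\<^sup>+x. ennreal (K x) \<partial>lborel) = (\<integral>\<^sup>+x. ennreal (K (- y + 1 * x)) \<partial>lborel)"
      by (subst nn_integral_real_affine[where c = 1 and t = "- y"]) auto
    then show "(\<integral>\<^sup>+x. ennreal (K (x - y)) * ennreal \<bar>f y\<bar> \<partial>lborel) = (\<integral>\<^sup>+x. ennreal (K x) \<partial>lborel) * ennreal \<bar>f y\<bar>"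
      by (simp add: nn_integral_multc)
  qed
  also have "\<dots> = (\<integral>\<^sup>+x. ennreal (K x) \<partial>lborel) * (\<integral>\<^sup>+y. ennreal \<bar>f y\<bar> \<partial>lborel)"
    by (rule nn_integral_cmult) measurable
  also have "\<dots> \<le> ennreal m * ennreal (LINT y|lborel. \<bar>f y\<bar>)"
    using f by (subst nn_integral_eq_integral[symmetric]) (auto intro!: mult_right_mono Ki)
  finally show ?thesis using m by (simp add: ennreal_mult)
qed

section \<open>Solutions of the linear equations\<close>

lemma ess_supp_AE: "AE x in lborel. x \<notin> ess_supp f \<longrightarrow> f x = 0"
proof -
  define F where "F = {U. open U \<and> (AE x in lborel. x \<in> U \<longrightarrow> f x = 0)}"
  obtain F' where F': "F' \<subseteq> F" "countable F'" "\<Union>F' = \<Union>F"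
    using Lindelof[of F] by (auto simp: F_def)
  have "AE x in lborel. \<forall>U\<in>F'. x \<in> U \<longrightarrow> f x = 0"
    using F' by (subst AE_ball_countable) (auto simp: F_def)
  then show ?thesis
  proof eventually_elim
    case (elim x)
    show ?case
    proof
      assume "x \<notin> ess_supp f"
      then have "x \<in> \<Union>F'" unfolding F'(3) ess_supp_def F_def by blast
      then show "f x = 0" using elim by blast
    qed
  qed
qed

lemma ess_supp_interval_AE:
  assumes "ess_supp f \<subseteq> {-R..R}" shows "AE x in lborel. R < \<bar>x\<bar> \<longrightarrow> f x = 0"
  using ess_supp_AE[of f] by eventually_elim (use assms in \<open>fastforce simp: abs_le_iff\<close>)

text \<open>Where two continuous functions differ they differ on an open set, which has positive
  measure.\<close>

lemma AE_eq_continuous_on_open: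
  fixes f g :: "real \<Rightarrow> real"
  assumes c: "continuous_on UNIV f" "continuous_on UNIV g" and S: "open S"
    and ae: "AE x in lborel. x \<in> S \<longrightarrow> f x = g x" and x: "x \<in> S"
  shows "f x = g x"
proof (rule ccontr)
  assume ne: "f x \<noteq> g x"
  define U where "U = S \<inter> {x. f x \<noteq> g x}"
  have "open U" unfolding U_def using c S by (intro open_Int open_Collect_neq) auto
  have "U \<in> sets lborel" using \<open>open U\<close> by simp
  moreover have "AE x in lborel. x \<notin> U" using ae by eventually_elim (auto simp: U_def)
  ultimately have "emeasure lborel U = 0" by (subst (asm) AE_iff_measurable[where N = U]) auto
  moreover have "x \<in> U" using x ne by (simp add: U_def)
  then obtain e where e: "e > 0" "ball x e \<subseteq> U" using \<open>open U\<close> open_contains_ball by blast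
  have "emeasure lborel (ball x e) \<le> emeasure lborel U"
    using e \<open>open U\<close> by (intro emeasure_mono) auto
  moreover have "ball x e = {x - e<..<x + e}" by (auto simp: dist_real_def)
  then have "emeasure lborel (ball x e) = ennreal (2 * e)" using e by simp
  ultimately show False using e by simp
qed

text \<open>The continuous representative vanishes at the end points \<open>-R\<close> and \<open>R\<close> too, by continuity
  from outside.\<close>

lemma H1_compact_representative:
  assumes f: "f \<in> H1" and s: "ess_supp f \<subseteq> {-R..R}"
  shows "\<exists>F f'. primitive F f' \<and> f' \<in> Lp 2 \<and> (AE x in lborel. f x = F x) \<and> (\<forall>x. R \<le> \<bar>x\<bar> \<longrightarrow> F x = 0)"
proof -
  obtain f' where f': "f' \<in> Lp 2" "weak_deriv f f'" and fL: "f \<in> Lp 2" using f by (auto simp: H1_def)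
  obtain F where F: "primitive F f'" "AE x in lborel. f x = F x"
    using weak_deriv_imp_primitive[OF fL f'] by blast
  have ae: "AE x in lborel. x \<in> - {-R..R} \<longrightarrow> F x = 0"
    using ess_supp_interval_AE[OF s] F(2) by eventually_elim (auto simp: abs_le_iff not_le)
  have z: "F x = 0" if "x \<in> - {-R..R}" for x
    by (rule AE_eq_continuous_on_open[OF primitive_continuous[OF F(1)] _ _ ae that]) auto
  have "F x = 0" if "R \<le> \<bar>x\<bar>" for x
  proof (cases "R < \<bar>x\<bar>")
    case False
    then have x: "\<bar>x\<bar> = R" using that by simp
    have c: "(F \<longlongrightarrow> F x) (at x within T)" for T
      using primitive_continuous[OF F(1), of UNIV] by (meson UNIV_I continuous_on_def tendsto_within_subset subset_UNIV)
    show ?thesis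
    proof (cases "x = R")
      case True
      have "\<forall>\<^sub>F y in at_right x. F y = 0"
        unfolding eventually_at_filter by (rule always_eventually) (use True z in auto)
      then have "(F \<longlongrightarrow> 0) (at_right x)" by (rule tendsto_eventually)
      from tendsto_unique[OF trivial_limit_at_right_real c this] show ?thesis .
    next
      case False
      then have xm: "x = - R" using x by auto
      have "\<forall>\<^sub>F y in at_left x. F y = 0"
        unfolding eventually_at_filter by (rule always_eventually) (use xm z in auto)
      then have "(F \<longlongrightarrow> 0) (at_left x)" by (rule tendsto_eventually)
      from tendsto_unique[OF trivial_limit_at_left_real c this] show ?thesis .
    qed
  next
    case True
    then show ?thesis by (intro z) (auto simp: abs_if split: if_splits)
  qed
  then show ?thesis using F f' by blast
qed

text \<open>The primitive is normalised to vanish on the left; on the right it equals the total mass,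
  which is zero for the initial velocity of the undamped component.\<close>

lemma L2_compact_primitive:
  assumes g: "g \<in> Lp 2" and s: "ess_supp g \<subseteq> {-R..R}" and R: "0 < R"
  shows "\<exists>P. primitive P g \<and> (\<forall>x\<le>-R. P x = 0) \<and> (\<forall>x\<ge>R. P x = (LINT y|lborel. g y)) \<and> integrable lborel g"
proof -
  have [measurable]: "g \<in> borel_measurable borel" using g by (simp add: Lp2_iff)
  obtain Q where Q: "primitive Q g"
    using primitive_exists[of g] g Lp2_set_integrable[OF g] by (auto simp: Lp2_iff)
  define P where "P x = Q x + - Q (- R)" for x
  have P: "primitive P g" unfolding P_def by (rule primitive_add_const[OF Q])
  note ae = ess_supp_interval_AE[OF s]
  have z: "(LBINT y:{a..b}. g y) = 0" if "b \<le> - R" for a b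
  proof -
    have "AE y in lborel. y \<noteq> - R" by (rule AE_lborel_singleton)
    then have "AE y in lborel. indicator {a..b} y *\<^sub>R g y = 0"
      using ae by eventually_elim (use that in \<open>auto simp: indicator_def\<close>)
    then show ?thesis unfolding set_lebesgue_integral_def
      by (subst integral_cong_AE[where g = "\<lambda>_. 0"]) auto
  qed
  have eqi: "AE y in lborel. indicator {-R..b} y *\<^sub>R g y = g y" if "R \<le> b" for b
    using ae by eventually_elim (use that R in \<open>auto simp: indicator_def\<close>)
  have gi: "integrable lborel g"
    using Lp2_set_integrable[OF g, of "-R" R] eqi[of R] unfolding set_integrable_def
    by (subst integrable_cong_AE[symmetric]) auto
  have "P x = 0" if "x \<le> - R" for x
    using primitiveD(3)[OF P that] z[of "-R" x] by (simp add: P_def)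
  moreover have "P x = (LINT y|lborel. g y)" if "R \<le> x" for x
  proof -
    have "P x - P (- R) = (LBINT y:{-R..x}. g y)" using that R by (intro primitiveD(3)[OF P]) auto
    also have "\<dots> = (LINT y|lborel. g y)"
      unfolding set_lebesgue_integral_def by (intro integral_cong_AE eqi that) auto
    finally show ?thesis by (simp add: P_def)
  qed
  ultimately show ?thesis using P gi by blast
qed

text \<open>What the damped and the undamped equation have in common: \<open>k\<close> propagates the velocity and
  the sources, \<open>\<kappa>\<close> (its value on the characteristics) together with \<open>k0\<close> propagates the
  displacement.\<close>

definition kernel_system where
  "kernel_system \<kappa> \<kappa>' k k0 kz \<longleftrightarrow> smooth_kernel k \<and> smooth_kernel k0 \<and> smooth_kernel kz \<and>
     (\<forall>t z. (k t has_real_derivative kz t z) (at z)) \<and> (\<forall>t. k t t = \<kappa> t \<and> k t (- t) = \<kappa> t) \<and>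
     (\<forall>t. (\<kappa> has_real_derivative \<kappa>' t) (at t)) \<and> continuous_on UNIV \<kappa>'"

lemma damped_kernel_system:
  "kernel_system (\<lambda>t. exp (- t / 2) / 2) (\<lambda>t. - exp (- t / 2) / 4) damped_kernel damped_kernel0 damped_kernel_dz"
  unfolding kernel_system_def
  by (auto simp: smooth_damped_kernels damped_kernel_derivative_z damped_kernel_boundary
      intro!: derivative_eq_intros continuous_intros)

lemma wave_kernel_system:
  "kernel_system (\<lambda>t. 1 / 2) (\<lambda>t. 0) (\<lambda>t z. 1 / 2) (\<lambda>t z. 0) (\<lambda>t z. 0)"
  unfolding kernel_system_def by (auto intro!: smooth_kernel_const)

text \<open>The solution with displacement \<open>F\<close> and velocity \<open>P'\<close>, written as a classical part plus two
  travelling waves of amplitude \<open>\<kappa>\<close> with profiles \<open>F + P\<close> and \<open>F - P\<close>.\<close>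

definition linear_field where
  "linear_field \<kappa> k0 kz F P t x =
     (signed_cone k0 F t x + signed_cone kz P t x) + \<kappa> t * (F (x + t) + P (x + t)) + \<kappa> t * (F (x - t) + (-1) * P (x - t))"

lemma signed_cone_cmult: "signed_cone k (\<lambda>y. c * f y) t x = c * signed_cone k f t x"
proof -
  have "integral {-1..1} (\<lambda>r. k t (- (t * r)) * (c * f (x + t * r))) =
     integral {-1..1} (\<lambda>r. c * (k t (- (t * r)) * f (x + t * r)))"
    by (simp add: mult.left_commute)
  then show ?thesis by (simp add: signed_cone_def mult_ac)
qed

lemma linear_field_cmult:
  "linear_field \<kappa> k0 kz (\<lambda>y. c * F y) (\<lambda>y. c * P y) t x = c * linear_field \<kappa> k0 kz F P t x"
  by (simp add: linear_field_def signed_cone_cmult algebra_simps)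

text \<open>Undoes the integration by parts: for positive times this is the representation by the
  propagators.\<close>

lemma linear_field_eq:
  assumes K: "kernel_system \<kappa> \<kappa>' k k0 kz" and F: "continuous_on UNIV F" and P: "primitive P g" and t: "0 \<le> t"
  shows "linear_field \<kappa> k0 kz F P t x = \<kappa> t * (F (x + t) + F (x - t)) + cone_integral k0 F t x + cone_integral k g t x"
proof -
  have "cone_integral k g t x = \<kappa> t * P (x + t) - \<kappa> t * P (x - t) + signed_cone kz P t x"
    using cone_integral_primitive[of k kz P g t x] K P t by (auto simp: kernel_system_def intro: smooth_kernel_cont2)
  moreover have "cone_integral k0 F t x = signed_cone k0 F t x"
    using K by (intro cone_integral_eq_signed_cone F t) (auto simp: kernel_system_def intro: smooth_kernel_cont2)
  ultimately show ?thesis by (simp add: linear_field_def algebra_simps)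
qed

lemma linear_field_eq_AE:
  assumes K: "kernel_system \<kappa> \<kappa>' k k0 kz" and F: "continuous_on UNIV F" and P: "primitive P g" and t: "0 \<le> t"
    and f: "f \<in> borel_measurable borel" "AE x in lborel. f x = F x"
  shows "AE x in lborel. \<kappa> t * (f (x + t) + f (x - t)) + cone_integral k0 f t x + cone_integral k g t x = linear_field \<kappa> k0 kz F P t x"
proof -
  have [measurable]: "F \<in> borel_measurable borel" using F by (rule borel_measurable_continuous_onI)
  note [measurable] = f(1)
  have 1: "AE x in lborel. f (x + t) = F (x + t)"
    using AE_borel_affine[of 1 "\<lambda>x. f x = F x" t] f(2) by (simp add: add.commute)
  have 2: "AE x in lborel. f (x - t) = F (x - t)"
    using AE_borel_affine[of 1 "\<lambda>x. f x = F x" "-t"] f(2) by (simp add: add.commute)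
  have 3: "cone_integral k0 f t x = cone_integral k0 F t x" for x
    using K by (intro cone_integral_cong_AE f) (auto simp: kernel_system_def intro: smooth_kernel_cont2)
  show ?thesis using 1 2
    by eventually_elim (simp add: 3 linear_field_eq[OF K F P t])
qed

lemma linear_field_C1:
  assumes K: "kernel_system \<kappa> \<kappa>' k k0 kz" and F: "continuous_on UNIV F" and P: "continuous_on UNIV P"
  shows "\<exists>Wt Wx. C1_cylinder (\<lambda>t x. signed_cone k0 F t x + signed_cone kz P t x) Wt Wx"
proof -
  obtain a b c d where "C1_kernel k0 a b" "C1_kernel kz c d" using K by (auto simp: kernel_system_def smooth_kernel_def)
  from C1_cylinder_add[OF C1_cylinder_signed_cone[OF this(1) F] C1_cylinder_signed_cone[OF this(2) P]]
  show ?thesis by blast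
qed

lemma linear_field_continuous:
  assumes K: "kernel_system \<kappa> \<kappa>' k k0 kz" and F: "continuous_on UNIV F" and P: "continuous_on UNIV P"
  shows "cont2 (linear_field \<kappa> k0 kz F P)"
proof -
  have cF: "cont2 (\<lambda>(s::real) y. F y)" "cont2 (\<lambda>(s::real) y. P y)" unfolding case_prod_beta
    by (intro continuous_on_compose2[OF F] continuous_on_compose2[OF P] continuous_intros; simp)+
  have ck: "cont2 k0" "cont2 kz" using K by (auto simp: kernel_system_def intro: smooth_kernel_cont2)
  have c\<kappa>: "continuous_on UNIV \<kappa>"
    using K unfolding kernel_system_def by (meson DERIV_isCont continuous_at_imp_continuous_on)
  note cs = continuous_on_signed_cone[OF _ cF(1), where \<sigma> = "\<lambda>_. 0"] continuous_on_signed_cone[OF _ cF(2), where \<sigma> = "\<lambda>_. 0"]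
  show ?thesis
    unfolding linear_field_def case_prod_beta
    by (intro continuous_intros cs ck continuous_on_compose2[OF F] continuous_on_compose2[OF P]
        continuous_on_compose2[OF c\<kappa>]) auto
qed

text \<open>Finite speed of propagation.\<close>

lemma linear_field_support:
  assumes K: "kernel_system \<kappa> \<kappa>' k k0 kz" and F: "continuous_on UNIV F" and P: "primitive P g" and t: "0 \<le> t"
    and Fz: "\<And>x. R \<le> \<bar>x\<bar> \<Longrightarrow> F x = 0" and gz: "AE x in lborel. R < \<bar>x\<bar> \<longrightarrow> g x = 0" and R: "0 < R" and x: "R + t \<le> \<bar>x\<bar>"
  shows "linear_field \<kappa> k0 kz F P t x = 0"
proof -
  have 1: "F (x + t) = 0" "F (x - t) = 0" using x t R by (auto intro!: Fz)
  have gm: "g \<in> borel_measurable borel" using primitiveD(1)[OF P] .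
  have ae: "AE y in lborel. y \<noteq> x - t \<and> y \<noteq> x + t" by (intro AE_conjI AE_lborel_singleton)
  have ck: "cont2 k" "cont2 k0" using K by (auto simp: kernel_system_def intro: smooth_kernel_cont2)
  have z: "cone_integral l h t x = 0" if "cont2 l" "AE x in lborel. R < \<bar>x\<bar> \<longrightarrow> h x = 0" "h \<in> borel_measurable borel" for l h
  proof -
    have "continuous_on UNIV (\<lambda>y. l t (x - y))" by (intro cont2_compose[OF that(1)] continuous_intros)
    then have [measurable]: "(\<lambda>y. l t (x - y)) \<in> borel_measurable borel" by (rule borel_measurable_continuous_onI)
    note [measurable] = that(3)
    have "AE y in lborel. indicator {x - t..x + t} y *\<^sub>R (l t (x - y) * h y) = 0"
      using ae that(2)
    proof eventually_elim
      case (elim y)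
      have "R < \<bar>y\<bar>" if "y \<in> {x - t..x + t}" using that elim(1) x R t by (auto simp: abs_if split: if_splits)
      then show ?case using elim by (auto simp: indicator_def)
    qed
    then show ?thesis unfolding cone_integral_def set_lebesgue_integral_def
      by (subst integral_cong_AE[where g = "\<lambda>_. 0"]) auto
  qed
  have "AE x in lborel. R < \<bar>x\<bar> \<longrightarrow> F x = 0" using Fz by auto
  then show ?thesis
    unfolding linear_field_eq[OF K F P t] using 1 z[OF ck(1) gz gm] z[OF ck(2) _ borel_measurable_continuous_onI[OF F]] by simp
qed

lemma compact_continuous_integrable:
  assumes F: "continuous_on UNIV (F :: real \<Rightarrow> real)" and Fz: "\<And>x. R \<le> \<bar>x\<bar> \<Longrightarrow> F x = 0"
  shows "integrable lborel F" "\<exists>M\<ge>0. \<forall>x. \<bar>F x\<bar> \<le> M"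
proof -
  have eq: "(\<lambda>x. indicator {-R..R} x *\<^sub>R F x) = F" using Fz by (force simp: indicator_def)
  have "integrable lborel (\<lambda>x. indicator {-R..R} x *\<^sub>R F x)"
    by (rule borel_integrable_compact) (auto intro: continuous_on_subset[OF F])
  then show "integrable lborel F" unfolding eq .
  obtain M where "0 \<le> M" "\<And>x. -R \<le> x \<Longrightarrow> x \<le> R \<Longrightarrow> \<bar>F x\<bar> \<le> M"
    using continuous_interval_bounded[OF continuous_on_subset[OF F]] by blast
  then show "\<exists>M\<ge>0. \<forall>x. \<bar>F x\<bar> \<le> M" using Fz by (intro exI[of _ M]) (metis abs_le_iff abs_zero linear minus_le_iff)
qed

lemma exp_half_decay: assumes "0 \<le> t" shows "exp (- t / 2) \<le> 2 / sqrt (1 + t)"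
proof -
  have "bessel_entire 0 0 \<le> bessel_entire 0 (t\<^sup>2)" by (rule bessel_entire_mono) auto
  then have "exp (- t / 2) * 1 \<le> exp (- t / 2) * bessel_entire 0 (t\<^sup>2)" by (intro mult_left_mono) auto
  from order_trans[OF this damped_bessel_decay(2)[OF assms]] show ?thesis by (simp only: mult_1_right)
qed

text \<open>Kernel bounds for \<open>L\<^sup>1\<close> data give the rate of the heat equation in the supremum norm and
  boundedness in \<open>L\<^sup>1\<close>; interpolation between the two is what the a priori estimate uses.\<close>

theorem damped_field_decay:
  assumes F: "continuous_on UNIV F" and P: "primitive P g" and Fz: "\<And>x. R \<le> \<bar>x\<bar> \<Longrightarrow> F x = 0"
    and g: "integrable lborel g"
  defines "u \<equiv> linear_field (\<lambda>t. exp (- t / 2) / 2) damped_kernel0 damped_kernel_dz F P"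
  shows "\<exists>C>0. \<forall>t\<ge>0. (\<forall>x. \<bar>u t x\<bar> \<le> C / sqrt (1 + t)) \<and> (\<integral>\<^sup>+x. ennreal \<bar>u t x\<bar> \<partial>lborel) \<le> ennreal C"
proof -
  obtain M where M: "0 \<le> M" "\<And>x. \<bar>F x\<bar> \<le> M" using compact_continuous_integrable(2)[OF F Fz] by blast
  have Fi: "integrable lborel F" by (rule compact_continuous_integrable(1)[OF F Fz])
  have [measurable]: "F \<in> borel_measurable borel" "g \<in> borel_measurable borel"
    using F g by (auto intro: borel_measurable_continuous_onI)
  define I J where "I = (LINT y|lborel. \<bar>F y\<bar>)" and "J = (LINT y|lborel. \<bar>g y\<bar>)"
  have IJ: "0 \<le> I" "0 \<le> J" by (auto simp: I_def J_def)
  define C where "C = 2 * M + 4 * I + 2 * J + 1"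
  have ck: "cont2 damped_kernel" "cont2 damped_kernel0" using smooth_damped_kernels by (auto intro: smooth_kernel_cont2)
  show ?thesis
  proof (intro exI[of _ C] conjI allI impI)
    show "C > 0" using M IJ by (simp add: C_def)
    fix t :: real assume t: "0 \<le> t"
    define r where "r = 1 / sqrt (1 + t)"
    have r: "0 < r" "r \<le> 1" using t by (auto simp: r_def)
    have er: "exp (- t / 2) \<le> 2 * r" using exp_half_decay[OF t] by (simp add: r_def)
    have u: "u t x = exp (- t / 2) / 2 * (F (x + t) + F (x - t)) + cone_integral damped_kernel0 F t x + cone_integral damped_kernel g t x" for x
      unfolding u_def by (rule linear_field_eq[OF damped_kernel_system F P t])
    { fix x
      have "\<bar>exp (- t / 2) / 2 * (F (x + t) + F (x - t))\<bar> = exp (- t / 2) / 2 * \<bar>F (x + t) + F (x - t)\<bar>" by (simp add: abs_mult)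
      also have "\<dots> \<le> r * (M + M)"
        using er M(2)[of "x + t"] M(2)[of "x - t"] r M(1) by (intro mult_mono) auto
      finally have 1: "\<bar>exp (- t / 2) / 2 * (F (x + t) + F (x - t))\<bar> \<le> r * (M + M)" .
      have 2: "\<bar>cone_integral damped_kernel0 F t x\<bar> \<le> r * I" unfolding I_def
        using damped_kernel_bounds(4,5)[where t = t] r by (intro cone_integral_abs_le ck Fi) (auto simp: r_def)
      have 3: "\<bar>cone_integral damped_kernel g t x\<bar> \<le> r * J" unfolding J_def
        using damped_kernel_bounds(1,3)[where t = t] r by (intro cone_integral_abs_le ck g) (auto simp: r_def)
      have "\<bar>u t x\<bar> \<le> r * (M + M) + r * I + r * J" unfolding u using 1 2 3 by linarith
      also have "\<dots> = r * (2 * M + I + J)" by (simp add: algebra_simps)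
      also have "\<dots> \<le> r * C" using r IJ by (intro mult_left_mono) (auto simp: C_def)
      finally show "\<bar>u t x\<bar> \<le> C / sqrt (1 + t)" by (simp add: r_def) }
    note [measurable] = cone_integral_measurable[OF ck(2), of F t, simplified] cone_integral_measurable[OF ck(1), of g t, simplified]
    have "(\<integral>\<^sup>+x. ennreal \<bar>u t x\<bar> \<partial>lborel) \<le>
      (\<integral>\<^sup>+x. ennreal \<bar>F (x + t)\<bar> + ennreal \<bar>F (x - t)\<bar> + ennreal \<bar>cone_integral damped_kernel0 F t x\<bar> + ennreal \<bar>cone_integral damped_kernel g t x\<bar> \<partial>lborel)"
    proof (rule nn_integral_mono)
      fix x
      have e1: "exp (- t / 2) \<le> 1" using t by simp
      have "\<bar>exp (- t / 2) / 2 * (F (x + t) + F (x - t))\<bar> = exp (- t / 2) / 2 * \<bar>F (x + t) + F (x - t)\<bar>" by (simp add: abs_mult)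
      also have "\<dots> \<le> 1 * \<bar>F (x + t) + F (x - t)\<bar>" using e1 by (intro mult_right_mono) linarith+
      also have "\<dots> \<le> \<bar>F (x + t)\<bar> + \<bar>F (x - t)\<bar>" by simp
      finally have 1: "\<bar>exp (- t / 2) / 2 * (F (x + t) + F (x - t))\<bar> \<le> \<bar>F (x + t)\<bar> + \<bar>F (x - t)\<bar>" .
      have tri: "\<bar>a + b + c\<bar> \<le> \<bar>a\<bar> + \<bar>b\<bar> + \<bar>c\<bar>" for a b c :: real by linarith
      have "\<bar>u t x\<bar> \<le> \<bar>F (x + t)\<bar> + \<bar>F (x - t)\<bar> + \<bar>cone_integral damped_kernel0 F t x\<bar> + \<bar>cone_integral damped_kernel g t x\<bar>"
        unfolding u by (rule order_trans[OF tri add_right_mono[OF add_right_mono[OF 1]]])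
      then have "ennreal \<bar>u t x\<bar> \<le> ennreal (\<bar>F (x + t)\<bar> + \<bar>F (x - t)\<bar> + \<bar>cone_integral damped_kernel0 F t x\<bar> + \<bar>cone_integral damped_kernel g t x\<bar>)"
        by (rule ennreal_leI)
      then show "ennreal \<bar>u t x\<bar> \<le> ennreal \<bar>F (x + t)\<bar> + ennreal \<bar>F (x - t)\<bar> + ennreal \<bar>cone_integral damped_kernel0 F t x\<bar> + ennreal \<bar>cone_integral damped_kernel g t x\<bar>"
        by (simp add: ennreal_plus)
    qed
    also have "\<dots> = (\<integral>\<^sup>+x. ennreal \<bar>F (x + t)\<bar> \<partial>lborel) + (\<integral>\<^sup>+x. ennreal \<bar>F (x - t)\<bar> \<partial>lborel) +
       (\<integral>\<^sup>+x. ennreal \<bar>cone_integral damped_kernel0 F t x\<bar> \<partial>lborel) + (\<integral>\<^sup>+x. ennreal \<bar>cone_integral damped_kernel g t x\<bar> \<partial>lborel)"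
      by (simp add: nn_integral_add)
    also have "\<dots> \<le> ennreal I + ennreal I + ennreal (2 * I) + ennreal (2 * J)"
    proof (intro add_mono)
      have FI: "(\<integral>\<^sup>+x. ennreal \<bar>F x\<bar> \<partial>lborel) = ennreal I"
        unfolding I_def using Fi by (intro nn_integral_eq_integral) auto
      have "(\<integral>\<^sup>+x. ennreal \<bar>F (x + s)\<bar> \<partial>lborel) = ennreal I" for s
        unfolding FI[symmetric] by (subst (2) nn_integral_real_affine[where c = 1 and t = s]) (auto simp: add.commute)
      from this[of t] this[of "-t"] show "(\<integral>\<^sup>+x. ennreal \<bar>F (x + t)\<bar> \<partial>lborel) \<le> ennreal I" "(\<integral>\<^sup>+x. ennreal \<bar>F (x - t)\<bar> \<partial>lborel) \<le> ennreal I"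
        by simp_all
      show "(\<integral>\<^sup>+x. ennreal \<bar>cone_integral damped_kernel0 F t x\<bar> \<partial>lborel) \<le> ennreal (2 * I)" unfolding I_def
        by (intro cone_integral_L1_le ck damped_kernel_bounds damped_kernel_mass t Fi) auto
      show "(\<integral>\<^sup>+x. ennreal \<bar>cone_integral damped_kernel g t x\<bar> \<partial>lborel) \<le> ennreal (2 * J)" unfolding J_def
        by (intro cone_integral_L1_le ck damped_kernel_bounds damped_kernel_mass t g) auto
    qed
    also have "\<dots> = ennreal (I + I + 2 * I + 2 * J)"
      using IJ by (simp add: ennreal_plus[symmetric] del: ennreal_plus)
    also have "\<dots> \<le> ennreal C" using M IJ by (intro ennreal_leI) (simp add: C_def)
    finally show "(\<integral>\<^sup>+x. ennreal \<bar>u t x\<bar> \<partial>lborel) \<le> ennreal C" .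
  qed
qed

text \<open>Since the velocity has mean zero, its primitive vanishes outside the support interval as the
  displacement does. By d'Alembert's formula the field then lives in two strips of width \<open>2 R\<close>
  around the light cone, so powers of it have integrals that stay bounded in time.\<close>

theorem wave_field_strip:
  assumes F: "continuous_on UNIV F" and P: "primitive P g" and Fz: "\<And>x. R \<le> \<bar>x\<bar> \<Longrightarrow> F x = 0"
    and Pz: "\<And>x. R \<le> \<bar>x\<bar> \<Longrightarrow> P x = 0"
  defines "v \<equiv> linear_field (\<lambda>t. 1 / 2) (\<lambda>t z. 0) (\<lambda>t z. 0) F P"
  shows "\<exists>C>0. \<forall>t\<ge>0. (\<forall>x. \<bar>v t x\<bar> \<le> C) \<and> (\<forall>x. R \<le> \<bar>\<bar>x\<bar> - t\<bar> \<longrightarrow> v t x = 0)"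
proof -
  obtain M where M: "0 \<le> M" "\<And>x. \<bar>F x\<bar> \<le> M" using compact_continuous_integrable(2)[OF F Fz] by blast
  obtain N where N: "0 \<le> N" "\<And>x. \<bar>P x\<bar> \<le> N" using compact_continuous_integrable(2)[OF primitive_continuous[OF P] Pz] by blast
  have v: "v t x = (F (x + t) + P (x + t) + (F (x - t) - P (x - t))) / 2" for t x
    by (simp add: v_def linear_field_def signed_cone_def add_divide_distrib)
  have "\<bar>v t x\<bar> \<le> M + N + 1" for t x
  proof -
    have "\<bar>F (x + t) + P (x + t) + (F (x - t) - P (x - t))\<bar> \<le> 2 * (M + N)"
    proof -
      have tri: "\<bar>a + b + (c - d)\<bar> \<le> \<bar>a\<bar> + \<bar>b\<bar> + \<bar>c\<bar> + \<bar>d\<bar>" for a b c d :: real by linarith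
      show ?thesis
        using order_trans[OF tri add_mono[OF add_mono[OF add_mono[OF M(2)[of "x + t"] N(2)[of "x + t"]] M(2)[of "x - t"]] N(2)[of "x - t"]]]
        by simp
    qed
    then show ?thesis unfolding v by simp
  qed
  moreover have "v t x = 0" if "0 \<le> t" "R \<le> \<bar>\<bar>x\<bar> - t\<bar>" for t x
  proof -
    have "R \<le> \<bar>x + t\<bar>" "R \<le> \<bar>x - t\<bar>" using that by (auto simp: abs_if split: if_splits)
    then show ?thesis unfolding v by (simp add: Fz Pz)
  qed
  ultimately show ?thesis using M N by (intro exI[of _ "M + N + 1"]) auto
qed

section \<open>Estimates for Duhamel integrals\<close>

lemma powr_sum_le:
  fixes a b :: real assumes "0 \<le> a" "0 \<le> b" "0 \<le> p"
  shows "(a + b) powr p \<le> 2 powr p * (a powr p + b powr p)"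
proof -
  have "(a + b) powr p \<le> (2 * max a b) powr p" using assms by (intro powr_mono2) auto
  also have "\<dots> = 2 powr p * (max a b) powr p" using assms by (simp add: powr_mult)
  also have "\<dots> \<le> 2 powr p * (a powr p + b powr p)"
    by (intro mult_left_mono) (auto simp: max_def)
  finally show ?thesis .
qed

lemma powr_sum3_le:
  fixes a b c :: real assumes "0 \<le> a" "0 \<le> b" "0 \<le> c" "0 \<le> p"
  shows "(a + b + c) powr p \<le> 3 powr p * (a powr p + b powr p + c powr p)"
proof -
  have "(a + b + c) powr p \<le> (3 * max (max a b) c) powr p" using assms by (intro powr_mono2) auto
  also have "\<dots> = 3 powr p * (max (max a b) c) powr p" using assms by (simp add: powr_mult)
  also have "\<dots> \<le> 3 powr p * (a powr p + b powr p + c powr p)"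
    by (intro mult_left_mono) (auto simp: max_def add_nonneg_nonneg)
  finally show ?thesis .
qed

lemma cont2_abs_powr: assumes "cont2 V" "0 < p" shows "cont2 (\<lambda>s y. \<bar>V s y\<bar> powr p)"
  using assms unfolding case_prod_beta by (intro continuous_on_powr' continuous_intros) auto

lemma cont2_section: "cont2 F \<Longrightarrow> continuous_on A (F s)"
  using cont2_compose[of F A "\<lambda>_. s" "\<lambda>y. y"] by simp

text \<open>The pointwise bounds shared by the damped and the undamped propagator.\<close>

definition light_cone_kernel :: "(real \<Rightarrow> real \<Rightarrow> real) \<Rightarrow> bool" where
  "light_cone_kernel k \<longleftrightarrow> smooth_kernel k \<and> (\<forall>t z. \<bar>z\<bar> \<le> t \<longrightarrow> 0 \<le> k t z \<and> k t z \<le> 1 / 2)"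

lemma light_cone_kernel_damped: "light_cone_kernel damped_kernel"
  using damped_kernel_bounds(1,2) by (simp add: light_cone_kernel_def smooth_damped_kernels)

lemma light_cone_kernel_half: "light_cone_kernel (\<lambda>t z. 1 / 2)"
  by (simp add: light_cone_kernel_def smooth_kernel_const)

lemma signed_cone_mono:
  assumes k: "light_cone_kernel k" and f: "continuous_on UNIV f" "continuous_on UNIV g" and t: "0 \<le> t"
    and le: "\<And>y. \<bar>x - y\<bar> \<le> t \<Longrightarrow> f y \<le> g y"
  shows "signed_cone k f t x \<le> signed_cone k g t x"
proof -
  have ck: "cont2 k" using k by (auto simp: light_cone_kernel_def intro: smooth_kernel_cont2)
  show ?thesis
    unfolding signed_cone_eq_integral[OF ck f(1) t] signed_cone_eq_integral[OF ck f(2) t]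
  proof (rule integral_le)
    fix y assume "y \<in> {x - t..x + t}"
    then have a: "\<bar>x - y\<bar> \<le> t" by auto
    then show "k t (x - y) * f y \<le> k t (x - y) * g y"
      using k le[OF a] by (intro mult_left_mono) (auto simp: light_cone_kernel_def)
  qed (intro integrable_continuous_real continuous_intros cont2_compose[OF ck] continuous_on_subset[OF f(1)]
      continuous_on_subset[OF f(2)]; simp)+
qed

lemma signed_cone_zero: "signed_cone k (\<lambda>y. 0) t x = 0"
  by (simp add: signed_cone_def)

lemma signed_cone_nonneg:
  assumes k: "light_cone_kernel k" and f: "continuous_on UNIV f" and t: "0 \<le> t" and "\<And>y. 0 \<le> f y"
  shows "0 \<le> signed_cone k f t x"
  using signed_cone_mono[OF k continuous_on_const f t, of x 0] assms(4) by (simp add: signed_cone_zero)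

lemma signed_cone_diff:
  assumes k: "cont2 k" and f: "continuous_on UNIV f" "continuous_on UNIV g"
  shows "signed_cone k f t x - signed_cone k g t x = signed_cone k (\<lambda>y. f y - g y) t x"
proof -
  have i: "(\<lambda>r. k t (- (t * r)) * h (x + t * r)) integrable_on {-1..1}" if "continuous_on UNIV h" for h
    by (intro integrable_continuous_real continuous_intros cont2_compose[OF k] continuous_on_compose2[OF that]) auto
  show ?thesis
    unfolding signed_cone_def right_diff_distrib
    by (subst Henstock_Kurzweil_Integration.integral_diff[OF i[OF f(1)] i[OF f(2)]]) (simp add: algebra_simps)
qed

lemma signed_cone_abs_le:
  assumes k: "light_cone_kernel k" and f: "continuous_on UNIV f" and t: "0 \<le> t" and b: "\<And>y. \<bar>x - y\<bar> \<le> t \<Longrightarrow> \<bar>f y\<bar> \<le> c"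
  shows "\<bar>signed_cone k f t x\<bar> \<le> t * c"
proof -
  have ck: "cont2 k" using k by (auto simp: light_cone_kernel_def intro: smooth_kernel_cont2)
  have c0: "0 \<le> c" using b[of x] t by auto
  have "norm (integral (cbox (x - t) (x + t)) (\<lambda>y. k t (x - y) * f y)) \<le> (1 / 2 * c) * measure lborel (cbox (x - t) (x + t))"
  proof (rule integrable_bound)
    show "(\<lambda>y. k t (x - y) * f y) integrable_on cbox (x - t) (x + t)"
      by (intro integrable_continuous continuous_intros cont2_compose[OF ck] continuous_on_subset[OF f]) auto
    fix y assume "y \<in> cbox (x - t) (x + t)"
    then have a: "\<bar>x - y\<bar> \<le> t" by auto
    then show "norm (k t (x - y) * f y) \<le> 1 / 2 * c"
      unfolding real_norm_def abs_mult using k b[OF a] by (intro mult_mono) (auto simp: light_cone_kernel_def)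
  qed (use c0 in simp)
  then show ?thesis unfolding signed_cone_eq_integral[OF ck f t] using t by (simp add: algebra_simps)
qed

lemma signed_cone_const_le:
  assumes k: "light_cone_kernel k" and m: "\<And>t. 0 \<le> t \<Longrightarrow> integral {-t..t} (k t) \<le> 2" and t: "0 \<le> t" and c: "0 \<le> c"
  shows "signed_cone k (\<lambda>y. c) t x \<le> 2 * c"
proof -
  have ck: "cont2 k" using k by (auto simp: light_cone_kernel_def intro: smooth_kernel_cont2)
  have "signed_cone k (\<lambda>y. c) t x = c * signed_cone k (\<lambda>y. 1) t 0"
    using signed_cone_cmult[of k c "\<lambda>y. 1" t x] by (simp add: signed_cone_def)
  also have "signed_cone k (\<lambda>y. 1) t 0 = integral {-t..t} (\<lambda>y. k t (- y))"
    using signed_cone_eq_integral[OF ck _ t, of "\<lambda>y. 1" 0] by simp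
  also have "\<dots> = integral {-t..t} (k t)"
    using Henstock_Kurzweil_Integration.integral_reflect_real[where a = "-t" and b = t and f = "k t"] unfolding minus_minus .
  also have "c * \<dots> \<le> c * 2" by (intro mult_left_mono m t c)
  finally show ?thesis by simp
qed

lemma continuous_nn_integrable:
  assumes f: "continuous_on UNIV (f :: real \<Rightarrow> real)" and b: "(\<integral>\<^sup>+x. ennreal \<bar>f x\<bar> \<partial>lborel) \<le> ennreal e" and e: "0 \<le> e"
  shows "integrable lborel f" "(LINT x|lborel. \<bar>f x\<bar>) \<le> e"
proof -
  have [measurable]: "f \<in> borel_measurable borel" using f by (rule borel_measurable_continuous_onI)
  show i: "integrable lborel f"
    using le_less_trans[OF b ennreal_less_top] by (intro integrableI_bounded) (simp_all add: top_ennreal_def)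
  have "ennreal (LINT x|lborel. \<bar>f x\<bar>) \<le> ennreal e"
    using nn_integral_eq_integral[of lborel "\<lambda>x. \<bar>f x\<bar>"] i b by simp
  then show "(LINT x|lborel. \<bar>f x\<bar>) \<le> e" using e by simp
qed

text \<open>The kernel is at most one half.\<close>

lemma signed_cone_L1_sup:
  assumes k: "light_cone_kernel k" and f: "continuous_on UNIV f" and t: "0 \<le> t"
    and b: "(\<integral>\<^sup>+x. ennreal \<bar>f x\<bar> \<partial>lborel) \<le> ennreal e" and e: "0 \<le> e"
  shows "\<bar>signed_cone k f t x\<bar> \<le> e / 2"
proof -
  have ck: "cont2 k" using k by (auto simp: light_cone_kernel_def intro: smooth_kernel_cont2)
  note i = continuous_nn_integrable[OF f b e]
  have "\<bar>cone_integral k f t x\<bar> \<le> 1 / 2 * (LINT y|lborel. \<bar>f y\<bar>)"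
    using k by (intro cone_integral_abs_le ck i) (auto simp: light_cone_kernel_def)
  then show ?thesis using i(2) unfolding cone_integral_eq_signed_cone[OF ck f t] by simp
qed

text \<open>The kernel has mass at most two.\<close>

lemma signed_cone_L1_L1:
  assumes k: "light_cone_kernel k" and m: "\<And>t. 0 \<le> t \<Longrightarrow> integral {-t..t} (k t) \<le> 2"
    and f: "continuous_on UNIV f" and t: "0 \<le> t"
    and b: "(\<integral>\<^sup>+x. ennreal \<bar>f x\<bar> \<partial>lborel) \<le> ennreal e" and e: "0 \<le> e"
  shows "(\<integral>\<^sup>+x. ennreal \<bar>signed_cone k f t x\<bar> \<partial>lborel) \<le> ennreal (2 * e)"
proof -
  have ck: "cont2 k" using k by (auto simp: light_cone_kernel_def intro: smooth_kernel_cont2)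
  note i = continuous_nn_integrable[OF f b e]
  have "(\<integral>\<^sup>+x. ennreal \<bar>cone_integral k f t x\<bar> \<partial>lborel) \<le> ennreal (2 * (LINT y|lborel. \<bar>f y\<bar>))"
    using k by (intro cone_integral_L1_le ck i m t) (auto simp: light_cone_kernel_def)
  also have "\<dots> \<le> ennreal (2 * e)" using i by (intro ennreal_leI) simp
  finally show ?thesis unfolding cone_integral_eq_signed_cone[OF ck f t] .
qed

lemma duhamel_integrable:
  assumes k: "cont2 k" and F: "cont2 F"
  shows "(\<lambda>s. signed_cone k (F s) (t - s) x) integrable_on {a..b}"
  by (intro integrable_continuous_real continuous_on_signed_cone[OF k F] continuous_intros)

lemma duhamel_bound:
  assumes k: "light_cone_kernel k" and F: "cont2 F" and t: "0 \<le> t"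
    and b: "\<And>s. 0 \<le> s \<Longrightarrow> s \<le> t \<Longrightarrow> \<bar>signed_cone k (F s) (t - s) x\<bar> \<le> e s" and e: "e integrable_on {0..t}"
  shows "\<bar>duhamel k F t x\<bar> \<le> integral {0..t} e"
proof -
  have ck: "cont2 k" using k by (auto simp: light_cone_kernel_def intro: smooth_kernel_cont2)
  have "norm (integral {0..t} (\<lambda>s. signed_cone k (F s) (t - s) x)) \<le> integral {0..t} e"
    using b by (intro integral_norm_bound_integral duhamel_integrable ck F e) auto
  then show ?thesis by (simp add: duhamel_def)
qed

lemma duhamel_mono:
  assumes k: "light_cone_kernel k" and F: "cont2 F" "cont2 G"
    and le: "\<And>s y. 0 \<le> s \<Longrightarrow> s \<le> t \<Longrightarrow> F s y \<le> G s y"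
  shows "duhamel k F t x \<le> duhamel k G t x"
proof -
  have ck: "cont2 k" using k by (auto simp: light_cone_kernel_def intro: smooth_kernel_cont2)
  show ?thesis
    unfolding duhamel_def
    by (intro integral_le duhamel_integrable ck F signed_cone_mono k cont2_section le) auto
qed

lemma duhamel_zero: "duhamel k (\<lambda>s y. 0) t x = 0"
  by (simp add: duhamel_def signed_cone_zero)

lemma duhamel_nonneg:
  assumes "light_cone_kernel k" "cont2 F" "\<And>s y. 0 \<le> F s y"
  shows "0 \<le> duhamel k F t x"
  using duhamel_mono[OF assms(1) _ assms(2), of "\<lambda>s y. 0" t x] assms(3) by (simp add: duhamel_zero)

lemma duhamel_add:
  assumes k: "cont2 k" and F: "cont2 F" "cont2 G"
  shows "duhamel k (\<lambda>s y. F s y + G s y) t x = duhamel k F t x + duhamel k G t x"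
proof -
  have "signed_cone k (\<lambda>y. F s y + G s y) (t - s) x = signed_cone k (F s) (t - s) x + signed_cone k (G s) (t - s) x" for s
  proof -
    have "continuous_on UNIV (\<lambda>y. F s y + G s y)" using F by (intro continuous_intros cont2_section)
    from signed_cone_diff[OF k this cont2_section[OF F(2)], of "t - s" x s] show ?thesis by simp
  qed
  then show ?thesis
    unfolding duhamel_def
    by (simp add: Henstock_Kurzweil_Integration.integral_add[OF duhamel_integrable[OF k F(1)] duhamel_integrable[OF k F(2)]])
qed

lemma duhamel_diff:
  assumes k: "cont2 k" and F: "cont2 F" "cont2 G"
  shows "duhamel k F t x - duhamel k G t x = duhamel k (\<lambda>s y. F s y - G s y) t x"
  unfolding duhamel_def signed_cone_diff[OF k cont2_section[OF F(1)] cont2_section[OF F(2)], symmetric]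
  by (rule Henstock_Kurzweil_Integration.integral_diff[OF duhamel_integrable[OF k F(1)] duhamel_integrable[OF k F(2)], symmetric])

lemma duhamel_const_le:
  assumes k: "light_cone_kernel k" and m: "\<And>t. 0 \<le> t \<Longrightarrow> integral {-t..t} (k t) \<le> 2" and t: "0 \<le> t" and c: "0 \<le> c"
  shows "duhamel k (\<lambda>s y. c) t x \<le> 2 * c * t"
proof -
  have cc: "cont2 (\<lambda>s y. c)" by simp
  have "\<bar>duhamel k (\<lambda>s y. c) t x\<bar> \<le> integral {0..t} (\<lambda>s. 2 * c)"
  proof (rule duhamel_bound[OF k cc t])
    fix s assume "0 \<le> s" "s \<le> t"
    then show "\<bar>signed_cone k (\<lambda>y. c) (t - s) x\<bar> \<le> 2 * c"
      using signed_cone_const_le[OF k m _ c, of "t - s" x] signed_cone_nonneg[OF k continuous_on_const, of "t - s" c x] c by simp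
  qed auto
  then show ?thesis using t by (simp add: abs_le_iff mult_ac)
qed

text \<open>Finite speed of propagation for sources supported in the cone.\<close>

lemma duhamel_support:
  assumes k: "light_cone_kernel k" and F: "cont2 F" and t: "0 \<le> t" and x: "R + t \<le> \<bar>x\<bar>"
    and z: "\<And>s y. 0 \<le> s \<Longrightarrow> s \<le> t \<Longrightarrow> R + s \<le> \<bar>y\<bar> \<Longrightarrow> F s y = 0"
  shows "duhamel k F t x = 0"
proof -
  have "\<bar>duhamel k F t x\<bar> \<le> integral {0..t} (\<lambda>s. 0)"
  proof (rule duhamel_bound[OF k F t])
    fix s assume s: "0 \<le> s" "s \<le> t"
    have "\<bar>signed_cone k (F s) (t - s) x\<bar> \<le> (t - s) * 0"
    proof (rule signed_cone_abs_le[OF k cont2_section[OF F]])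
      fix y assume "\<bar>x - y\<bar> \<le> t - s"
      then have "R + s \<le> \<bar>y\<bar>" using x by linarith
      then show "\<bar>F s y\<bar> \<le> 0" using z s by simp
    qed (use s in simp)
    then show "\<bar>signed_cone k (F s) (t - s) x\<bar> \<le> 0" by simp
  qed (rule integrable_0)
  then show ?thesis by simp
qed

lemma duhamel_L1_sup:
  assumes k: "light_cone_kernel k" and F: "cont2 F" and t: "0 \<le> t" and e: "0 \<le> e"
    and b: "\<And>s. 0 \<le> s \<Longrightarrow> s \<le> t \<Longrightarrow> (\<integral>\<^sup>+y. ennreal \<bar>F s y\<bar> \<partial>lborel) \<le> ennreal e"
  shows "\<bar>duhamel k F t x\<bar> \<le> e * t"
proof -
  have "\<bar>duhamel k F t x\<bar> \<le> integral {0..t} (\<lambda>s. e / 2)"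
  proof (rule duhamel_bound[OF k F t])
    show "\<bar>signed_cone k (F s) (t - s) x\<bar> \<le> e / 2" if "0 \<le> s" "s \<le> t" for s
      by (rule signed_cone_L1_sup[OF k cont2_section[OF F] _ b[OF that] e]) (use that in simp)
  qed auto
  then show ?thesis using t mult_nonneg_nonneg[OF t e] by (simp add: mult.commute)
qed

lemma duhamel_L1_L1:
  assumes k: "light_cone_kernel k" and m: "\<And>t. 0 \<le> t \<Longrightarrow> integral {-t..t} (k t) \<le> 2"
    and F: "cont2 F" and t: "0 \<le> t" and e: "0 \<le> e"
    and b: "\<And>s. 0 \<le> s \<Longrightarrow> s \<le> t \<Longrightarrow> (\<integral>\<^sup>+y. ennreal \<bar>F s y\<bar> \<partial>lborel) \<le> ennreal e"
  shows "(\<integral>\<^sup>+x. ennreal \<bar>duhamel k F t x\<bar> \<partial>lborel) \<le> ennreal (2 * e * t)"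
proof -
  have ck: "cont2 k" using k by (auto simp: light_cone_kernel_def intro: smooth_kernel_cont2)
  define G where "G s x = signed_cone k (F s) (t - s) x" for s x
  have cG: "cont2 G" unfolding G_def case_prod_beta by (intro continuous_on_signed_cone[OF ck F] continuous_intros)
  have [measurable]: "(\<lambda>(x, s). G s x) \<in> borel_measurable (lborel \<Otimes>\<^sub>M lborel)"
  proof -
    have "continuous_on UNIV (\<lambda>p. G (snd p) (fst p))" by (intro cont2_compose[OF cG] continuous_intros)
    then have "(\<lambda>p. G (snd p) (fst p)) \<in> borel_measurable borel" by (rule borel_measurable_continuous_onI)
    then have "(\<lambda>p. G (snd p) (fst p)) \<in> borel_measurable (borel \<Otimes>\<^sub>M borel)" by (simp add: borel_prod)
    then show ?thesis by (simp add: case_prod_beta' cong: measurable_cong_sets sets_pair_measure_cong)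
  qed
  have Gs: "continuous_on UNIV (\<lambda>s. G s x)" for x
    using cont2_compose[OF cG, of UNIV "\<lambda>s. s" "\<lambda>_. x"] by simp
  have "ennreal \<bar>duhamel k F t x\<bar> \<le> (\<integral>\<^sup>+s. indicator {0..t} s * ennreal \<bar>G s x\<bar> \<partial>lborel)" for x
  proof -
    have si: "set_integrable lborel {0..t} (\<lambda>s. G s x)"
      by (rule borel_integrable_atLeastAtMost'[OF continuous_on_subset[OF Gs]]) auto
    have "duhamel k F t x = (LINT s|lborel. indicator {0..t} s *\<^sub>R G s x)"
      using set_borel_integral_eq_integral(2)[OF si] by (simp add: duhamel_def G_def set_lebesgue_integral_def)
    then have "norm (duhamel k F t x) \<le> (\<integral>\<^sup>+s. norm (indicator {0..t} s *\<^sub>R G s x) \<partial>lborel)"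
      using si by (simp only: set_integrable_def integral_norm_bound_ennreal)
    also have "\<dots> = (\<integral>\<^sup>+s. indicator {0..t} s * ennreal \<bar>G s x\<bar> \<partial>lborel)"
      by (intro nn_integral_cong) (auto simp: indicator_def)
    finally show ?thesis by simp
  qed
  then have "(\<integral>\<^sup>+x. ennreal \<bar>duhamel k F t x\<bar> \<partial>lborel) \<le> (\<integral>\<^sup>+x. \<integral>\<^sup>+s. indicator {0..t} s * ennreal \<bar>G s x\<bar> \<partial>lborel \<partial>lborel)"
    by (intro nn_integral_mono)
  also have "\<dots> = (\<integral>\<^sup>+s. \<integral>\<^sup>+x. indicator {0..t} s * ennreal \<bar>G s x\<bar> \<partial>lborel \<partial>lborel)"
    by (rule lborel_pair.Fubini') measurable
  also have "\<dots> \<le> (\<integral>\<^sup>+s. ennreal (2 * e) * indicator {0..t} s \<partial>lborel)"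
  proof (rule nn_integral_mono)
    fix s
    have [measurable]: "G s \<in> borel_measurable borel" using cont2_section[OF cG] by (rule borel_measurable_continuous_onI)
    have "(\<integral>\<^sup>+x. ennreal \<bar>G s x\<bar> \<partial>lborel) \<le> ennreal (2 * e)" if "s \<in> {0..t}"
      unfolding G_def using that by (intro signed_cone_L1_L1[OF k m cont2_section[OF F] _ b e]) auto
    then show "(\<integral>\<^sup>+x. indicator {0..t} s * ennreal \<bar>G s x\<bar> \<partial>lborel) \<le> ennreal (2 * e) * indicator {0..t} s"
      by (cases "s \<in> {0..t}") auto
  qed
  also have "\<dots> = ennreal (2 * e) * ennreal t" using t by (simp add: nn_integral_cmult_indicator)
  also have "\<dots> = ennreal (2 * e * t)" using t e by (simp add: ennreal_mult)
  finally show ?thesis .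
qed

text \<open>Interpolation: \<open>\<bar>f\<bar> powr q \<le> M powr (q - 1) * \<bar>f\<bar>\<close>.\<close>

lemma nn_integral_powr_le:
  assumes [measurable]: "f \<in> borel_measurable borel" and M: "\<And>x. \<bar>f x\<bar> \<le> M" and q: "1 \<le> q"
    and I: "(\<integral>\<^sup>+x. ennreal \<bar>f x\<bar> \<partial>lborel) \<le> ennreal I" "0 \<le> I"
  shows "(\<integral>\<^sup>+x. ennreal (\<bar>f x\<bar> powr q) \<partial>lborel) \<le> ennreal (M powr (q - 1) * I)"
proof -
  have "(\<integral>\<^sup>+x. ennreal (\<bar>f x\<bar> powr q) \<partial>lborel) \<le> (\<integral>\<^sup>+x. ennreal (M powr (q - 1)) * ennreal \<bar>f x\<bar> \<partial>lborel)"
  proof (rule nn_integral_mono)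
    fix x
    have "\<bar>f x\<bar> powr q = \<bar>f x\<bar> powr (q - 1) * \<bar>f x\<bar>"
      using powr_add[of "\<bar>f x\<bar>" "q - 1" 1] by simp
    also have "\<dots> \<le> M powr (q - 1) * \<bar>f x\<bar>" using M q by (intro mult_right_mono powr_mono2) auto
    finally show "ennreal (\<bar>f x\<bar> powr q) \<le> ennreal (M powr (q - 1)) * ennreal \<bar>f x\<bar>"
      by (simp add: ennreal_mult[symmetric] ennreal_leI)
  qed
  also have "\<dots> \<le> ennreal (M powr (q - 1)) * ennreal I" using I by (simp add: nn_integral_cmult mult_left_mono)
  also have "\<dots> = ennreal (M powr (q - 1) * I)" using I by (simp add: ennreal_mult)
  finally show ?thesis .
qed

section \<open>The a priori estimate\<close>

text \<open>The set where \<open>\<bar>\<bar>y\<bar> - s\<bar> < R\<close> is covered by two intervals of length \<open>2 R\<close>.\<close>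

lemma strip_nn_integral:
  assumes F: "\<And>y. \<bar>F y\<bar> \<le> M" "\<And>y. R \<le> \<bar>\<bar>y\<bar> - s\<bar> \<Longrightarrow> F y = 0" and R: "0 < R" and M: "0 \<le> M"
  shows "(\<integral>\<^sup>+y. ennreal \<bar>F y\<bar> \<partial>lborel) \<le> ennreal (4 * R * M)"
proof -
  define A B where "A = {s - R..s + R}" and "B = {- s - R..- s + R}"
  have "(\<integral>\<^sup>+y. ennreal \<bar>F y\<bar> \<partial>lborel) \<le> (\<integral>\<^sup>+y. ennreal M * indicator A y + ennreal M * indicator B y \<partial>lborel)"
  proof (rule nn_integral_mono)
    fix y
    show "ennreal \<bar>F y\<bar> \<le> ennreal M * indicator A y + ennreal M * indicator B y"
    proof (cases "y \<in> A \<union> B")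
      case True
      then show ?thesis using ennreal_leI[OF F(1)[of y]] by (auto simp: indicator_def add_increasing add_increasing2)
    next
      case False
      then have "R \<le> \<bar>\<bar>y\<bar> - s\<bar>" by (auto simp: A_def B_def abs_if split: if_splits)
      then show ?thesis using F(2) by simp
    qed
  qed
  also have "\<dots> = ennreal M * ennreal (2 * R) + ennreal M * ennreal (2 * R)"
    using R by (simp add: nn_integral_add nn_integral_cmult_indicator A_def B_def)
  also have "\<dots> = ennreal (M * (2 * R) + M * (2 * R))"
  proof -
    have "ennreal M * ennreal (2 * R) = ennreal (M * (2 * R))" using R M by (intro ennreal_mult[symmetric]) auto
    then show ?thesis using R M by (simp only: ennreal_plus mult_nonneg_nonneg)
  qed
  finally show ?thesis by (simp add: mult_ac)
qed

text \<open>The linear fields enter the a priori estimate only through these bounds. The exponent \<open>\<theta>\<close>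
  measures the growth of the space-time integral of \<open>\<bar>Lu\<bar> powr q\<close>: it equals \<open>(3 - q) / 2\<close> for \<open>q
  < 3\<close> and can be any positive number for \<open>q \<ge> 3\<close>.\<close>

locale nakao_fields =
  fixes p q R C \<theta> :: real and k Lu Lv :: "real \<Rightarrow> real \<Rightarrow> real"
  assumes p: "1 < p" and q: "1 < q" and R: "0 < R" and C: "0 < C"
    and \<theta>: "0 < \<theta>" "\<theta> \<le> 1" "1 - (q - 1) / 2 \<le> \<theta>"
    and k: "light_cone_kernel k" and mass: "\<And>t. 0 \<le> t \<Longrightarrow> integral {-t..t} (k t) \<le> 2"
    and cLu: "cont2 Lu" and cLv: "cont2 Lv"
    and Lu_sup: "\<And>t x. 0 \<le> t \<Longrightarrow> \<bar>Lu t x\<bar> \<le> C / sqrt (1 + t)"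
    and Lu_L1: "\<And>t. 0 \<le> t \<Longrightarrow> (\<integral>\<^sup>+x. ennreal \<bar>Lu t x\<bar> \<partial>lborel) \<le> ennreal C"
    and Lu_supp: "\<And>t x. 0 \<le> t \<Longrightarrow> R + t \<le> \<bar>x\<bar> \<Longrightarrow> Lu t x = 0"
    and Lv_sup: "\<And>t x. 0 \<le> t \<Longrightarrow> \<bar>Lv t x\<bar> \<le> C"
    and Lv_strip: "\<And>t x. 0 \<le> t \<Longrightarrow> R \<le> \<bar>\<bar>x\<bar> - t\<bar> \<Longrightarrow> Lv t x = 0"
begin

definition strip_mass :: real where "strip_mass = 2 powr p * C powr p * (4 * R)"

definition power_const :: real where
  "power_const = 3 powr q * max (C powr q) (max (2 * strip_mass powr q) (2 * (R + 1) * (2 powr (p + 1) * 2) powr q))"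

lemma power_const_pos: "0 < power_const"
  using C unfolding power_const_def by (intro mult_pos_pos) (auto simp: less_max_iff_disj)

text \<open>The damped component is bounded by three contributions. The linear field satisfies the
  bounds of the heat equation. The source made of the linear undamped field lives in the strips,
  so its Duhamel integral is of size \<open>\<epsilon> powr p * s\<close> both in the supremum norm and in \<open>L\<^sup>1\<close>. The
  source made of the remainder \<open>n\<close> is at most \<open>N powr p\<close> pointwise, and its Duhamel integral is
  multiplied by the length of the cone. Each \<open>q\<close>-th power is then integrated by interpolation.\<close>

lemma u_bound:
  assumes e: "0 < \<epsilon>" and T: "1 \<le> T" and s: "0 \<le> s" "s \<le> T" and N: "0 \<le> N"
    and cV: "cont2 V" and cU: "continuous_on UNIV U"
    and V: "\<And>r y. 0 \<le> r \<Longrightarrow> r \<le> s \<Longrightarrow> V r y = \<epsilon> * Lv r y + n r y"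
    and n: "\<And>r y. 0 \<le> r \<Longrightarrow> r \<le> s \<Longrightarrow> 0 \<le> n r y \<and> n r y \<le> N"
    and nz: "\<And>r y. 0 \<le> r \<Longrightarrow> r \<le> s \<Longrightarrow> R + r \<le> \<bar>y\<bar> \<Longrightarrow> n r y = 0"
    and U: "\<And>x. U x = \<epsilon> * Lu s x + duhamel k (\<lambda>r y. \<bar>V r y\<bar> powr p) s x"
  shows "R + s \<le> \<bar>x\<bar> \<Longrightarrow> U x = 0"
    and "(\<integral>\<^sup>+x. ennreal (\<bar>U x\<bar> powr q) \<partial>lborel) \<le>
      ennreal (power_const * (\<epsilon> powr q * (1 + s) powr (\<theta> - 1) + \<epsilon> powr (p * q) * T powr q + N powr (p * q) * T powr (q + 1)))"
proof -
  note cVp = cont2_abs_powr[OF cV, of p]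
  have p0: "0 < p" "0 \<le> p" "0 < q" "0 \<le> q" "1 \<le> q" using p q by auto
  have Vz: "V r y = 0" if "0 \<le> r" "r \<le> s" "R + r \<le> \<bar>y\<bar>" for r y
  proof -
    have "R \<le> \<bar>\<bar>y\<bar> - r\<bar>" using that by linarith
    then show ?thesis using V[OF that(1,2)] nz[OF that] Lv_strip[OF that(1)] by simp
  qed
  show Uz: "U x = 0" if x: "R + s \<le> \<bar>x\<bar>" for x
  proof -
    have "duhamel k (\<lambda>r y. \<bar>V r y\<bar> powr p) s x = 0"
      using p0 by (intro duhamel_support[OF k cVp s(1) x]) (auto simp: Vz)
    then show ?thesis unfolding U using Lu_supp[OF s(1) x] by simp
  qed
  define F1 where "F1 r y = 2 powr p * \<bar>\<epsilon> * Lv r y\<bar> powr p" for r y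
  have cF1: "cont2 F1"
  proof -
    have "cont2 (\<lambda>r y. \<epsilon> * Lv r y)" using cLv unfolding case_prod_beta by (intro continuous_intros)
    from cont2_abs_powr[OF this p0(1)] show ?thesis
      unfolding F1_def case_prod_beta by (rule continuous_on_mult_left)
  qed
  define c where "c = 2 powr p * N powr p"
  have c0: "0 \<le> c" by (simp add: c_def)
  define D1 where "D1 = duhamel k F1 s"
  have wk: "cont2 k" using k by (auto simp: light_cone_kernel_def intro: smooth_kernel_cont2)
  have F1n: "0 \<le> F1 r y" for r y by (simp add: F1_def)
  have D1n: "0 \<le> D1 x" for x unfolding D1_def by (rule duhamel_nonneg[OF k cF1 F1n])
  define D where "D x = duhamel k (\<lambda>r y. \<bar>V r y\<bar> powr p) s x" for x
  have Dn: "0 \<le> D x" for x unfolding D_def using p0 by (intro duhamel_nonneg[OF k cVp]) auto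
  have DD: "D x \<le> D1 x + 2 * c * s" for x
  proof -
    have "D x \<le> duhamel k (\<lambda>r y. F1 r y + c) s x"
      unfolding D_def
    proof (rule duhamel_mono[OF k cVp[OF p0(1)]])
      show "cont2 (\<lambda>r y. F1 r y + c)" using cF1 unfolding case_prod_beta by (intro continuous_intros)
      fix r y assume r: "0 \<le> r" "r \<le> s"
      have "\<bar>V r y\<bar> \<le> \<bar>\<epsilon> * Lv r y\<bar> + N" unfolding V[OF r] using n[OF r, of y] by linarith
      then have "\<bar>V r y\<bar> powr p \<le> (\<bar>\<epsilon> * Lv r y\<bar> + N) powr p" using p0 by (intro powr_mono2) auto
      also have "\<dots> \<le> 2 powr p * (\<bar>\<epsilon> * Lv r y\<bar> powr p + N powr p)" using N p0 by (intro powr_sum_le) auto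
      finally show "\<bar>V r y\<bar> powr p \<le> F1 r y + c" by (simp add: F1_def c_def distrib_left)
    qed
    also have "\<dots> = D1 x + duhamel k (\<lambda>r y. c) s x"
      unfolding D1_def by (rule duhamel_add[OF wk cF1]) simp
    also have "\<dots> \<le> D1 x + 2 * c * s" using duhamel_const_le[OF k mass s(1) c0] by simp
    finally show ?thesis .
  qed
  define B where "B = \<epsilon> powr p * strip_mass"
  have strip_mass: "0 \<le> strip_mass" "0 \<le> B" using R by (auto simp: strip_mass_def B_def)
  have F1L: "(\<integral>\<^sup>+y. ennreal \<bar>F1 r y\<bar> \<partial>lborel) \<le> ennreal B" if r: "0 \<le> r" "r \<le> s" for r
  proof -
    have "(\<integral>\<^sup>+y. ennreal \<bar>F1 r y\<bar> \<partial>lborel) \<le> ennreal (4 * R * (2 powr p * (\<epsilon> * C) powr p))"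
    proof (rule strip_nn_integral[where s = r, OF _ _ R])
      fix y
      have "\<bar>\<epsilon> * Lv r y\<bar> \<le> \<epsilon> * C" using Lv_sup[OF r(1), of y] e by (simp add: abs_mult)
      then have "\<bar>\<epsilon> * Lv r y\<bar> powr p \<le> (\<epsilon> * C) powr p" using p0 by (intro powr_mono2) auto
      then show "\<bar>F1 r y\<bar> \<le> 2 powr p * (\<epsilon> * C) powr p" by (simp add: F1_def)
    qed (use Lv_strip[OF r(1)] p0 in \<open>auto simp: F1_def\<close>)
    also have "4 * R * (2 powr p * (\<epsilon> * C) powr p) = B" using e C by (simp add: B_def strip_mass_def powr_mult)
    finally show ?thesis .
  qed
  have D1s: "\<bar>D1 x\<bar> \<le> B * s" for x unfolding D1_def by (rule duhamel_L1_sup[OF k cF1 s(1) strip_mass(2) F1L])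
  have D1L: "(\<integral>\<^sup>+x. ennreal \<bar>D1 x\<bar> \<partial>lborel) \<le> ennreal (2 * B * s)"
    unfolding D1_def by (rule duhamel_L1_L1[OF k mass cF1 s(1) strip_mass(2) F1L])
  have cD1: "continuous_on UNIV D1"
  proof -
    obtain kt kz where "C1_kernel k kt kz" using k by (auto simp: light_cone_kernel_def smooth_kernel_def)
    from C1_cylinder_duhamel[OF this cF1] obtain Wt Wx where "C1_cylinder (duhamel k F1) Wt Wx" by blast
    then have "continuous_on ({0..} \<times> UNIV) (\<lambda>(t, x). duhamel k F1 t x)" by (simp add: C1_cylinder_def)
    from joint_continuous_section[OF this s(1)] show ?thesis unfolding D1_def .
  qed
  have [measurable]: "D1 \<in> borel_measurable borel" "U \<in> borel_measurable borel" "Lu s \<in> borel_measurable borel"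
    using cD1 cU cont2_section[OF cLu] by (auto intro: borel_measurable_continuous_onI)
  define a where "a x = \<epsilon> * Lu s x" for x
  have [measurable]: "a \<in> borel_measurable borel" unfolding a_def by measurable
  define I where "I = {- (R + s)..R + s}"
  have pw: "\<bar>U x\<bar> powr q \<le> 3 powr q * (\<bar>a x\<bar> powr q + \<bar>D1 x\<bar> powr q + (2 * c * s) powr q * indicator I x)" for x
  proof (cases "x \<in> I")
    case True
    have "\<bar>U x\<bar> \<le> \<bar>a x\<bar> + \<bar>D1 x\<bar> + 2 * c * s"
      unfolding U D_def[symmetric] a_def[symmetric] using Dn[of x] DD[of x] D1n[of x] by linarith
    then have "\<bar>U x\<bar> powr q \<le> (\<bar>a x\<bar> + \<bar>D1 x\<bar> + 2 * c * s) powr q" using p0 by (intro powr_mono2) auto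
    also have "\<dots> \<le> 3 powr q * (\<bar>a x\<bar> powr q + \<bar>D1 x\<bar> powr q + (2 * c * s) powr q)"
      using p0 c0 s by (intro powr_sum3_le) auto
    finally show ?thesis using True by simp
  next
    case False
    then have "R + s \<le> \<bar>x\<bar>" by (auto simp: I_def abs_if split: if_splits)
    from Uz[OF this] show ?thesis using p0 False by (simp add: add_nonneg_nonneg)
  qed
  define X1 X2 X3 where "X1 = C powr q * (\<epsilon> powr q * (1 + s) powr (\<theta> - 1))"
    and "X2 = 2 * strip_mass powr q * (\<epsilon> powr (p * q) * T powr q)"
    and "X3 = 2 * (R + 1) * (2 powr (p + 1) * 2) powr q * (N powr (p * q) * T powr (q + 1))"
  have X0: "0 \<le> X1" "0 \<le> X2" "0 \<le> X3" using R by (auto simp: X1_def X2_def X3_def)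
  have A1: "(\<integral>\<^sup>+x. ennreal (\<bar>a x\<bar> powr q) \<partial>lborel) \<le> ennreal X1"
  proof -
    have "(\<integral>\<^sup>+x. ennreal (\<bar>a x\<bar> powr q) \<partial>lborel) \<le> ennreal ((\<epsilon> * (C / sqrt (1 + s))) powr (q - 1) * (\<epsilon> * C))"
    proof (rule nn_integral_powr_le)
      show "\<bar>a x\<bar> \<le> \<epsilon> * (C / sqrt (1 + s))" for x
        unfolding a_def using Lu_sup[OF s(1), of x] e by (simp add: abs_mult mult_left_mono del: times_divide_eq_right)
      have "(\<integral>\<^sup>+x. ennreal \<bar>a x\<bar> \<partial>lborel) = ennreal \<epsilon> * (\<integral>\<^sup>+x. ennreal \<bar>Lu s x\<bar> \<partial>lborel)"
        unfolding a_def using e by (simp add: abs_mult ennreal_mult nn_integral_cmult)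
      also have "\<dots> \<le> ennreal \<epsilon> * ennreal C" by (intro mult_left_mono Lu_L1 s) auto
      finally show "(\<integral>\<^sup>+x. ennreal \<bar>a x\<bar> \<partial>lborel) \<le> ennreal (\<epsilon> * C)" using e C by (simp add: ennreal_mult)
    qed (use p0 e C in auto)
    also have "(\<epsilon> * (C / sqrt (1 + s))) powr (q - 1) * (\<epsilon> * C) \<le> X1"
    proof -
      have sq: "sqrt (1 + s) powr (q - 1) = (1 + s) powr ((q - 1) / 2)"
        using s by (simp add: powr_half_sqrt[symmetric] powr_powr)
      have "(\<epsilon> * (C / sqrt (1 + s))) powr (q - 1) * (\<epsilon> * C) =
        (\<epsilon> powr (q - 1) * \<epsilon>) * (C powr (q - 1) * C) * (1 / (1 + s) powr ((q - 1) / 2))"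
        using e C s by (simp add: powr_mult powr_divide sq)
      also have "\<epsilon> powr (q - 1) * \<epsilon> = \<epsilon> powr q" using powr_add[of \<epsilon> "q - 1" 1] e by simp
      also have "C powr (q - 1) * C = C powr q" using powr_add[of C "q - 1" 1] C by simp
      also have "1 / (1 + s) powr ((q - 1) / 2) = (1 + s) powr (- ((q - 1) / 2))"
        by (simp add: powr_minus_divide)
      also have "\<epsilon> powr q * C powr q * \<dots> \<le> \<epsilon> powr q * C powr q * (1 + s) powr (\<theta> - 1)"
        using s \<theta> by (intro mult_left_mono powr_mono) auto
      finally show ?thesis by (simp add: X1_def mult_ac)
    qed
    finally show ?thesis by (simp add: ennreal_leI)
  qed
  have A2: "(\<integral>\<^sup>+x. ennreal (\<bar>D1 x\<bar> powr q) \<partial>lborel) \<le> ennreal X2"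
  proof -
    have "(\<integral>\<^sup>+x. ennreal (\<bar>D1 x\<bar> powr q) \<partial>lborel) \<le> ennreal ((B * s) powr (q - 1) * (2 * B * s))"
      using strip_mass s p0 by (intro nn_integral_powr_le D1s D1L) auto
    also have "(B * s) powr (q - 1) * (2 * B * s) = 2 * (B * s) powr q"
      using powr_add[of "B * s" "q - 1" 1] strip_mass s by simp
    also have "(B * s) powr q \<le> (B * T) powr q" using strip_mass s p0 by (intro powr_mono2 mult_left_mono) auto
    also have "(B * T) powr q = strip_mass powr q * (\<epsilon> powr (p * q) * T powr q)"
      using strip_mass T e by (simp add: B_def powr_mult powr_powr)
    finally show ?thesis by (simp add: X2_def ennreal_leI mult_ac)
  qed
  have A3: "(\<integral>\<^sup>+x. ennreal ((2 * c * s) powr q * indicator I x) \<partial>lborel) \<le> ennreal X3"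
  proof -
    have "(\<integral>\<^sup>+x. ennreal ((2 * c * s) powr q * indicator I x) \<partial>lborel) = (\<integral>\<^sup>+x. ennreal ((2 * c * s) powr q) * indicator I x \<partial>lborel)"
      by (intro nn_integral_cong) (auto simp: indicator_def)
    also have "\<dots> = ennreal ((2 * c * s) powr q) * ennreal (2 * (R + s))"
      using R s by (simp add: nn_integral_cmult_indicator I_def)
    also have "\<dots> = ennreal ((2 * c * s) powr q * (2 * (R + s)))" using R s by (simp add: ennreal_mult)
    also have "(2 * c * s) powr q * (2 * (R + s)) \<le> (2 * c * T) powr q * (2 * ((R + 1) * T))"
    proof (intro mult_mono powr_mono2)
      have "R * 1 \<le> R * T" using R T by (intro mult_left_mono) auto
      then show "R + s \<le> (R + 1) * T" using s by (simp add: distrib_right)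
    qed (use c0 s p0 R T in \<open>auto intro: mult_left_mono\<close>)
    also have "(2 * c * T) powr q = (2 powr p * 2) powr q * (N powr (p * q) * T powr q)"
      using N T by (simp add: c_def powr_mult powr_powr mult_ac)
    also have "(2 powr p * 2) powr q * (N powr (p * q) * T powr q) * (2 * ((R + 1) * T)) =
       2 * (R + 1) * (2 powr p * 2) powr q * (N powr (p * q) * (T powr q * T))" by (simp add: mult_ac)
    also have "T powr q * T = T powr (q + 1)" using T by (simp add: powr_add)
    also have "2 * (R + 1) * (2 powr p * 2) powr q * (N powr (p * q) * T powr (q + 1)) \<le> X3"
      unfolding X3_def using R p0 by (intro mult_right_mono mult_left_mono powr_mono2) (auto simp: powr_add)
    finally show ?thesis by (simp add: ennreal_leI)
  qed
  have "(\<integral>\<^sup>+x. ennreal (\<bar>U x\<bar> powr q) \<partial>lborel) \<le>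
    (\<integral>\<^sup>+x. ennreal (3 powr q) * (ennreal (\<bar>a x\<bar> powr q) + ennreal (\<bar>D1 x\<bar> powr q) + ennreal ((2 * c * s) powr q * indicator I x)) \<partial>lborel)"
    by (intro nn_integral_mono order_trans[OF ennreal_leI[OF pw]]) (simp add: ennreal_mult ennreal_plus add_nonneg_nonneg)
  also have "\<dots> = ennreal (3 powr q) * ((\<integral>\<^sup>+x. ennreal (\<bar>a x\<bar> powr q) \<partial>lborel) + (\<integral>\<^sup>+x. ennreal (\<bar>D1 x\<bar> powr q) \<partial>lborel)
      + (\<integral>\<^sup>+x. ennreal ((2 * c * s) powr q * indicator I x) \<partial>lborel))"
  proof -
    have [measurable]: "I \<in> sets borel" by (simp add: I_def)
    show ?thesis by (simp add: nn_integral_cmult nn_integral_add)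
  qed
  also have "\<dots> \<le> ennreal (3 powr q) * (ennreal X1 + ennreal X2 + ennreal X3)"
    by (intro mult_left_mono add_mono A1 A2 A3) auto
  also have "\<dots> = ennreal (3 powr q * (X1 + X2 + X3))"
    using X0 by (simp add: ennreal_mult ennreal_plus)
  also have "\<dots> \<le> ennreal (power_const * (\<epsilon> powr q * (1 + s) powr (\<theta> - 1) + \<epsilon> powr (p * q) * T powr q + N powr (p * q) * T powr (q + 1)))"
  proof (rule ennreal_leI)
    define m where "m = max (C powr q) (max (2 * strip_mass powr q) (2 * (R + 1) * (2 powr (p + 1) * 2) powr q))"
    have "X1 + X2 + X3 \<le> m * (\<epsilon> powr q * (1 + s) powr (\<theta> - 1)) + m * (\<epsilon> powr (p * q) * T powr q) + m * (N powr (p * q) * T powr (q + 1))"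
      unfolding X1_def X2_def X3_def by (intro add_mono mult_right_mono) (auto simp: m_def)
    then have "3 powr q * (X1 + X2 + X3) \<le> 3 powr q * (m * (\<epsilon> powr q * (1 + s) powr (\<theta> - 1)) + m * (\<epsilon> powr (p * q) * T powr q) + m * (N powr (p * q) * T powr (q + 1)))"
      by (intro mult_left_mono) auto
    moreover have "power_const = 3 powr q * m" by (simp only: power_const_def m_def)
    ultimately show "3 powr q * (X1 + X2 + X3) \<le> power_const * (\<epsilon> powr q * (1 + s) powr (\<theta> - 1) + \<epsilon> powr (p * q) * T powr q + N powr (p * q) * T powr (q + 1))"
      by (simp only: distrib_left mult.assoc)
  qed
  finally show "(\<integral>\<^sup>+x. ennreal (\<bar>U x\<bar> powr q) \<partial>lborel) \<le>
      ennreal (power_const * (\<epsilon> powr q * (1 + s) powr (\<theta> - 1) + \<epsilon> powr (p * q) * T powr q + N powr (p * q) * T powr (q + 1)))" .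
qed

end

section \<open>Contraction and uniqueness\<close>

lemma integral_exp_le:
  assumes "0 < (\<mu>::real)" "0 \<le> t"
  shows "integral {0..t} (\<lambda>s. c * exp (\<mu> * s)) = c * ((exp (\<mu> * t) - 1) / \<mu>)"
proof -
  have "((\<lambda>s. exp (\<mu> * s)) has_integral (exp (\<mu> * t) / \<mu> - exp (\<mu> * 0) / \<mu>)) {0..t}"
    using assms
    by (intro fundamental_theorem_of_calculus)
       (auto simp: has_real_derivative_iff_has_vector_derivative[symmetric] intro!: derivative_eq_intros)
  then show ?thesis using assms by (simp add: integral_unique diff_divide_distrib)
qed

text \<open>Integrating an exponential weight gains the factor \<open>1 / \<mu>\<close>, which makes the fixed point map
  a contraction on a time interval of arbitrary length.\<close>

lemma duhamel_exp_weight: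
  assumes k: "light_cone_kernel k" and F: "cont2 F" "cont2 G" and \<mu>: "0 < \<mu>" and d: "0 \<le> d" and t: "0 \<le> t" "t \<le> T"
    and b: "\<And>s y. 0 \<le> s \<Longrightarrow> s \<le> t \<Longrightarrow> \<bar>F s y - G s y\<bar> \<le> d * exp (\<mu> * s)"
  shows "\<bar>duhamel k F t x - duhamel k G t x\<bar> \<le> T * d / \<mu> * exp (\<mu> * t)"
proof -
  have ck: "cont2 k" using k by (auto simp: light_cone_kernel_def intro: smooth_kernel_cont2)
  have cD: "cont2 (\<lambda>s y. F s y - G s y)" using F unfolding case_prod_beta by (intro continuous_intros)
  have "\<bar>duhamel k (\<lambda>s y. F s y - G s y) t x\<bar> \<le> integral {0..t} (\<lambda>s. T * d * exp (\<mu> * s))"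
  proof (rule duhamel_bound[OF k cD t(1)])
    fix s assume s: "0 \<le> s" "s \<le> t"
    have "\<bar>signed_cone k (\<lambda>y. F s y - G s y) (t - s) x\<bar> \<le> (t - s) * (d * exp (\<mu> * s))"
      using s by (intro signed_cone_abs_le k cont2_section[OF cD] b) auto
    also have "\<dots> \<le> T * (d * exp (\<mu> * s))" using s t d by (intro mult_right_mono) auto
    finally show "\<bar>signed_cone k (\<lambda>y. F s y - G s y) (t - s) x\<bar> \<le> T * d * exp (\<mu> * s)" by (simp add: mult.assoc)
  qed (intro integrable_continuous_real continuous_intros)
  also have "\<dots> = T * d * ((exp (\<mu> * t) - 1) / \<mu>)" by (rule integral_exp_le[OF \<mu> t(1)])
  also have "\<dots> \<le> T * d * (exp (\<mu> * t) / \<mu>)"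
    using t d \<mu> by (intro mult_left_mono divide_right_mono mult_nonneg_nonneg) auto
  finally show ?thesis unfolding duhamel_diff[OF ck F] by simp
qed

text \<open>The mean value theorem on the interval between the two absolute values, whose left end may
  be the singular point zero.\<close>

lemma abs_powr_Lipschitz:
  fixes a b :: real
  assumes p: "1 < p" and M: "\<bar>a\<bar> \<le> M" "\<bar>b\<bar> \<le> M"
  shows "\<bar>\<bar>a\<bar> powr p - \<bar>b\<bar> powr p\<bar> \<le> p * M powr (p - 1) * \<bar>a - b\<bar>"
proof -
  have main: "\<bar>x powr p - y powr p\<bar> \<le> p * M powr (p - 1) * \<bar>x - y\<bar>" if "0 \<le> y" "y < x" "x \<le> M" for x y
  proof -
    have "\<exists>z\<in>{y<..<x}. x powr p - y powr p = (\<lambda>h. p * z powr (p - 1) * h) (x - y)"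
    proof (rule mvt[OF that(2)])
      show "continuous_on {y..x} (\<lambda>x. x powr p)"
        using that p by (intro continuous_on_powr' continuous_intros) auto
      fix z assume "y < z" "z < x"
      then have "((\<lambda>x. x powr p) has_real_derivative p * z powr (p - 1)) (at z)"
        using that by (intro has_real_derivative_powr) auto
      then show "((\<lambda>x. x powr p) has_derivative (\<lambda>h. p * z powr (p - 1) * h)) (at z)"
        by (simp add: has_field_derivative_def)
    qed (meson greaterThanLessThan_iff)
    then obtain z where z: "y < z" "z < x" "x powr p - y powr p = p * z powr (p - 1) * (x - y)" by auto
    have "p * z powr (p - 1) * (x - y) \<le> p * M powr (p - 1) * (x - y)"
      using z that p by (intro mult_right_mono mult_left_mono powr_mono2) auto
    moreover have "0 \<le> p * z powr (p - 1) * (x - y)" using z p that by simp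
    ultimately show ?thesis using z that by simp
  qed
  have *: "\<bar>\<bar>a\<bar> powr p - \<bar>b\<bar> powr p\<bar> \<le> p * M powr (p - 1) * \<bar>\<bar>a\<bar> - \<bar>b\<bar>\<bar>"
  proof -
    consider "\<bar>a\<bar> = \<bar>b\<bar>" | "\<bar>b\<bar> < \<bar>a\<bar>" | "\<bar>a\<bar> < \<bar>b\<bar>" by linarith
    then show ?thesis
    proof cases
      case 2 then show ?thesis using main[of "\<bar>b\<bar>" "\<bar>a\<bar>"] M by simp
    next
      case 3 then show ?thesis using main[of "\<bar>a\<bar>" "\<bar>b\<bar>"] M by (simp add: abs_minus_commute)
    qed simp
  qed
  also have "\<dots> \<le> p * M powr (p - 1) * \<bar>a - b\<bar>"
    using p by (intro mult_left_mono) auto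
  finally show ?thesis .
qed

text \<open>One passage through both equations. The weight \<open>\<mu>\<close> exceeds twice the product of the two
  Lipschitz constants, so the weighted distance is halved.\<close>

lemma contraction_step:
  assumes p: "1 < p" and q: "1 < q" and k: "light_cone_kernel k" and T: "0 \<le> T" and d: "0 \<le> d"
    and cV: "cont2 V1" "cont2 V2" and cU: "cont2 U1" "cont2 U2"
    and bV: "\<And>t x. 0 \<le> t \<Longrightarrow> t \<le> T \<Longrightarrow> \<bar>V1 t x\<bar> \<le> M \<and> \<bar>V2 t x\<bar> \<le> M"
    and bU: "\<And>t x. 0 \<le> t \<Longrightarrow> t \<le> T \<Longrightarrow> \<bar>U1 t x\<bar> \<le> M' \<and> \<bar>U2 t x\<bar> \<le> M'"
    and U1: "\<And>t x. 0 \<le> t \<Longrightarrow> t \<le> T \<Longrightarrow> U1 t x = a t x + duhamel k (\<lambda>s y. \<bar>V1 s y\<bar> powr p) t x"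
    and U2: "\<And>t x. 0 \<le> t \<Longrightarrow> t \<le> T \<Longrightarrow> U2 t x = a t x + duhamel k (\<lambda>s y. \<bar>V2 s y\<bar> powr p) t x"
    and \<mu>: "\<mu> = 1 + 2 * (T * (p * M powr (p - 1))) * (T * (q * M' powr (q - 1)))"
    and V: "\<And>t x. 0 \<le> t \<Longrightarrow> t \<le> T \<Longrightarrow> \<bar>V1 t x - V2 t x\<bar> \<le> d * exp (\<mu> * t)"
    and t: "0 \<le> t" "t \<le> T"
  shows "\<bar>U1 t x - U2 t x\<bar> \<le> T * (p * M powr (p - 1) * d) / \<mu> * exp (\<mu> * t)"
    and "\<bar>duhamel (\<lambda>t z. 1 / 2) (\<lambda>s y. \<bar>U1 s y\<bar> powr q) t x - duhamel (\<lambda>t z. 1 / 2) (\<lambda>s y. \<bar>U2 s y\<bar> powr q) t x\<bar>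
      \<le> d / 2 * exp (\<mu> * t)"
proof -
  define Lp' Lq' where "Lp' = p * M powr (p - 1)" and "Lq' = q * M' powr (q - 1)"
  have L0: "0 \<le> Lp'" "0 \<le> Lq'" using p q by (auto simp: Lp'_def Lq'_def)
  have l1: "1 \<le> \<mu>" unfolding \<mu> Lp'_def[symmetric] Lq'_def[symmetric] using L0 T by simp
  have l0: "0 < \<mu>" using l1 by simp
  have p0: "0 < p" "0 < q" using p q by auto
  have dU: "\<bar>U1 t x - U2 t x\<bar> \<le> T * (Lp' * d) / \<mu> * exp (\<mu> * t)" if t: "0 \<le> t" "t \<le> T" for t x
  proof -
    have "\<bar>duhamel k (\<lambda>s y. \<bar>V1 s y\<bar> powr p) t x - duhamel k (\<lambda>s y. \<bar>V2 s y\<bar> powr p) t x\<bar> \<le> T * (Lp' * d) / \<mu> * exp (\<mu> * t)"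
    proof (rule duhamel_exp_weight[OF k cont2_abs_powr[OF cV(1) p0(1)] cont2_abs_powr[OF cV(2) p0(1)] l0 _ t])
      fix s y assume s: "0 \<le> s" "s \<le> t"
      then have sT: "s \<le> T" using t by simp
      have "\<bar>\<bar>V1 s y\<bar> powr p - \<bar>V2 s y\<bar> powr p\<bar> \<le> Lp' * \<bar>V1 s y - V2 s y\<bar>"
        unfolding Lp'_def using bV[OF s(1) sT] by (intro abs_powr_Lipschitz p) auto
      also have "\<dots> \<le> Lp' * (d * exp (\<mu> * s))" by (intro mult_left_mono V s sT L0)
      finally show "\<bar>\<bar>V1 s y\<bar> powr p - \<bar>V2 s y\<bar> powr p\<bar> \<le> Lp' * d * exp (\<mu> * s)" by (simp add: mult.assoc)
    qed (use L0 d in simp)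
    then show ?thesis using U1[OF t] U2[OF t] by simp
  qed
  from dU[OF t] show "\<bar>U1 t x - U2 t x\<bar> \<le> T * (p * M powr (p - 1) * d) / \<mu> * exp (\<mu> * t)"
    by (simp add: Lp'_def)
  define d' where "d' = T * (Lp' * d) / \<mu>"
  have d': "0 \<le> d'" using T L0 d l0 by (simp add: d'_def)
  have "\<bar>duhamel (\<lambda>t z. 1 / 2) (\<lambda>s y. \<bar>U1 s y\<bar> powr q) t x - duhamel (\<lambda>t z. 1 / 2) (\<lambda>s y. \<bar>U2 s y\<bar> powr q) t x\<bar>
      \<le> T * (Lq' * d') / \<mu> * exp (\<mu> * t)"
  proof (rule duhamel_exp_weight[OF light_cone_kernel_half cont2_abs_powr[OF cU(1) p0(2)] cont2_abs_powr[OF cU(2) p0(2)] l0 _ t])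
    fix s y assume s: "0 \<le> s" "s \<le> t"
    then have sT: "s \<le> T" using t by simp
    have "\<bar>\<bar>U1 s y\<bar> powr q - \<bar>U2 s y\<bar> powr q\<bar> \<le> Lq' * \<bar>U1 s y - U2 s y\<bar>"
      unfolding Lq'_def using bU[OF s(1) sT] by (intro abs_powr_Lipschitz q) auto
    also have "\<dots> \<le> Lq' * (d' * exp (\<mu> * s))"
      unfolding d'_def by (intro mult_left_mono dU s sT L0)
    finally show "\<bar>\<bar>U1 s y\<bar> powr q - \<bar>U2 s y\<bar> powr q\<bar> \<le> Lq' * d' * exp (\<mu> * s)" by (simp add: mult.assoc)
  qed (use L0 d' in simp)
  also have "T * (Lq' * d') / \<mu> * exp (\<mu> * t) \<le> d / 2 * exp (\<mu> * t)"
  proof (rule mult_right_mono)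
    have "2 * (T * Lp') * (T * Lq') \<le> \<mu>" unfolding \<mu> Lp'_def Lq'_def by simp
    also have "\<dots> \<le> \<mu> * \<mu>" using l1 by simp
    finally have "2 * (T * Lp') * (T * Lq') * d \<le> \<mu> * \<mu> * d" using d by (rule mult_right_mono)
    then show "T * (Lq' * d') / \<mu> \<le> d / 2"
      using l0 by (simp add: d'_def field_simps)
  qed simp
  finally show "\<bar>duhamel (\<lambda>t z. 1 / 2) (\<lambda>s y. \<bar>U1 s y\<bar> powr q) t x - duhamel (\<lambda>t z. 1 / 2) (\<lambda>s y. \<bar>U2 s y\<bar> powr q) t x\<bar>
      \<le> d / 2 * exp (\<mu> * t)" .
qed

text \<open>Starting from the trivial bound for the difference, each step halves its weighted supremum.\<close>

theorem coupled_uniqueness: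
  assumes p: "1 < p" and q: "1 < q" and k: "light_cone_kernel k" and T: "0 \<le> T"
    and cV: "cont2 V1" "cont2 V2" and cU: "cont2 U1" "cont2 U2"
    and bV: "\<And>t x. 0 \<le> t \<Longrightarrow> t \<le> T \<Longrightarrow> \<bar>V1 t x\<bar> \<le> M \<and> \<bar>V2 t x\<bar> \<le> M"
    and bU: "\<And>t x. 0 \<le> t \<Longrightarrow> t \<le> T \<Longrightarrow> \<bar>U1 t x\<bar> \<le> M' \<and> \<bar>U2 t x\<bar> \<le> M'"
    and U1: "\<And>t x. 0 \<le> t \<Longrightarrow> t \<le> T \<Longrightarrow> U1 t x = a t x + duhamel k (\<lambda>s y. \<bar>V1 s y\<bar> powr p) t x"
    and U2: "\<And>t x. 0 \<le> t \<Longrightarrow> t \<le> T \<Longrightarrow> U2 t x = a t x + duhamel k (\<lambda>s y. \<bar>V2 s y\<bar> powr p) t x"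
    and V1: "\<And>t x. 0 \<le> t \<Longrightarrow> t \<le> T \<Longrightarrow> V1 t x = b t x + duhamel (\<lambda>t z. 1 / 2) (\<lambda>s y. \<bar>U1 s y\<bar> powr q) t x"
    and V2: "\<And>t x. 0 \<le> t \<Longrightarrow> t \<le> T \<Longrightarrow> V2 t x = b t x + duhamel (\<lambda>t z. 1 / 2) (\<lambda>s y. \<bar>U2 s y\<bar> powr q) t x"
    and t: "0 \<le> t" "t \<le> T"
  shows "U1 t x = U2 t x" "V1 t x = V2 t x"
proof -
  (* the weight for which one step through both equations halves distances *)
  define \<mu> where "\<mu> = 1 + 2 * (T * (p * M powr (p - 1))) * (T * (q * M' powr (q - 1)))"
  have l1: "1 \<le> \<mu>" unfolding \<mu>_def using T p q by simp
  have M: "0 \<le> M" using bV[of 0 0] T by auto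
  define d where "d n = 2 * M * (1 / 2) ^ n" for n :: nat
  have d0: "0 \<le> d n" for n using M by (simp add: d_def)
  note step = contraction_step[OF p q k T d0 cV cU bV bU U1 U2 \<mu>_def]
  have V: "\<bar>V1 t x - V2 t x\<bar> \<le> d n * exp (\<mu> * t)" if "0 \<le> t" "t \<le> T" for n t x
    using that
  proof (induction n arbitrary: t x)
    case 0
    have "\<bar>V1 t x - V2 t x\<bar> \<le> 2 * M * 1" using bV[OF 0, of x] by linarith
    also have "\<dots> \<le> 2 * M * exp (\<mu> * t)" using M 0 l1 by (intro mult_left_mono) auto
    finally show ?case by (simp add: d_def)
  next
    case (Suc n)
    have "\<bar>V1 t x - V2 t x\<bar> \<le> d n / 2 * exp (\<mu> * t)"
      using step(2)[of n, OF _ _ _ _ _ _ _ _ Suc.IH Suc.prems] V1[OF Suc.prems] V2[OF Suc.prems] by simp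
    then show ?case by (simp add: d_def)
  qed
  have lim: "(\<lambda>n. d n * c) \<longlonglongrightarrow> 0" for c
  proof -
    have "(\<lambda>n. 2 * M * (1 / 2) ^ n * c) \<longlonglongrightarrow> 2 * M * 0 * c"
      by (intro tendsto_intros LIMSEQ_power_zero) auto
    then show ?thesis by (simp add: d_def)
  qed
  have "\<bar>V1 t x - V2 t x\<bar> \<le> 0"
    by (rule LIMSEQ_le_const[OF lim[of "exp (\<mu> * t)"]]) (use V[OF t] in auto)
  then show "V1 t x = V2 t x" by simp
  have "\<bar>U1 t x - U2 t x\<bar> \<le> T * (p * M powr (p - 1) * d n) / \<mu> * exp (\<mu> * t)" for n
    using step(1)[of n, OF _ _ _ _ _ _ _ _ V t] by simp
  moreover have "(\<lambda>n. T * (p * M powr (p - 1) * d n) / \<mu> * exp (\<mu> * t)) \<longlonglongrightarrow> 0"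
    using lim[of "T * (p * M powr (p - 1)) / \<mu> * exp (\<mu> * t)"] by (simp add: mult_ac)
  ultimately have "\<bar>U1 t x - U2 t x\<bar> \<le> 0" by (intro LIMSEQ_le_const) auto
  then show "U1 t x = U2 t x" by simp
qed

context nakao_fields
begin

definition remainder_const :: real where "remainder_const = 2 * power_const / \<theta>"

lemma remainder_const_pos: "0 < remainder_const" using power_const_pos \<theta> by (simp add: remainder_const_def)

text \<open>The factor two absorbs the passage from \<open>1 + T\<close> to \<open>T\<close>.\<close>

lemma integral_decay_le:
  assumes "0 \<le> t" "t \<le> T" "1 \<le> T"
  shows "integral {0..t} (\<lambda>s. (1 + s) powr (\<theta> - 1)) \<le> 2 / \<theta> * T powr \<theta>"
proof -
  have "((\<lambda>s. (1 + s) powr (\<theta> - 1)) has_integral ((1 + t) powr \<theta> / \<theta> - (1 + 0) powr \<theta> / \<theta>)) {0..t}"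
    using assms \<theta>
    by (intro fundamental_theorem_of_calculus)
       (auto simp: has_real_derivative_iff_has_vector_derivative[symmetric] intro!: derivative_eq_intros)
  then have "integral {0..t} (\<lambda>s. (1 + s) powr (\<theta> - 1)) = (1 + t) powr \<theta> / \<theta> - 1 / \<theta>"
    by (simp add: integral_unique)
  also have "\<dots> \<le> (1 + t) powr \<theta> / \<theta>" using \<theta> by simp
  also have "\<dots> \<le> (2 * T) powr \<theta> / \<theta>" using assms \<theta> by (intro divide_right_mono powr_mono2) auto
  also have "\<dots> = 2 powr \<theta> * T powr \<theta> / \<theta>" using assms by (simp add: powr_mult)
  also have "\<dots> \<le> 2 powr 1 * T powr \<theta> / \<theta>"
    using \<theta> by (intro divide_right_mono mult_right_mono powr_mono) auto
  finally show ?thesis by simp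
qed

text \<open>In one space dimension the undamped propagator is the constant one half on the cone, so the
  remainder at any point is at most half the integral of \<open>\<bar>U\<bar> powr q\<close> over space and time.\<close>

lemma v_bound:
  assumes e: "0 < \<epsilon>" and T: "1 \<le> T" and N: "0 \<le> N"
    and cV: "cont2 V" and cU: "cont2 U"
    and V: "\<And>r y. 0 \<le> r \<Longrightarrow> r \<le> T \<Longrightarrow> V r y = \<epsilon> * Lv r y + n r y"
    and n: "\<And>r y. 0 \<le> r \<Longrightarrow> r \<le> T \<Longrightarrow> 0 \<le> n r y \<and> n r y \<le> N"
    and nz: "\<And>r y. 0 \<le> r \<Longrightarrow> r \<le> T \<Longrightarrow> R + r \<le> \<bar>y\<bar> \<Longrightarrow> n r y = 0"
    and U: "\<And>s x. 0 \<le> s \<Longrightarrow> s \<le> T \<Longrightarrow> U s x = \<epsilon> * Lu s x + duhamel k (\<lambda>r y. \<bar>V r y\<bar> powr p) s x"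
    and t: "0 \<le> t" "t \<le> T"
  shows "0 \<le> duhamel (\<lambda>t z. 1 / 2) (\<lambda>r y. \<bar>U r y\<bar> powr q) t x"
    and "duhamel (\<lambda>t z. 1 / 2) (\<lambda>r y. \<bar>U r y\<bar> powr q) t x \<le>
      remainder_const * (\<epsilon> powr q * T powr \<theta> + \<epsilon> powr (p * q) * T powr (q + 1) + N powr (p * q) * T powr (q + 2))"
    and "R + t \<le> \<bar>x\<bar> \<Longrightarrow> duhamel (\<lambda>t z. 1 / 2) (\<lambda>r y. \<bar>U r y\<bar> powr q) t x = 0"
    and "R + t \<le> \<bar>x\<bar> \<Longrightarrow> U t x = 0"
proof -
  have q0: "0 < q" using q by simp
  note cUq = cont2_abs_powr[OF cU q0]
  have ub: "R + s \<le> \<bar>x\<bar> \<Longrightarrow> U s x = 0"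
      "(\<integral>\<^sup>+x. ennreal (\<bar>U s x\<bar> powr q) \<partial>lborel) \<le>
      ennreal (power_const * (\<epsilon> powr q * (1 + s) powr (\<theta> - 1) + \<epsilon> powr (p * q) * T powr q + N powr (p * q) * T powr (q + 1)))"
    if s: "0 \<le> s" "s \<le> T" for s x
    by (rule u_bound[OF e T s N cV cont2_section[OF cU], of n, OF V n nz U[OF s]]; use s in simp)+
  show "R + t \<le> \<bar>x\<bar> \<Longrightarrow> U t x = 0" by (rule ub(1)[OF t])
  show "0 \<le> duhamel (\<lambda>t z. 1 / 2) (\<lambda>r y. \<bar>U r y\<bar> powr q) t x"
    by (rule duhamel_nonneg[OF light_cone_kernel_half cUq]) simp
  show "duhamel (\<lambda>t z. 1 / 2) (\<lambda>r y. \<bar>U r y\<bar> powr q) t x = 0" if "R + t \<le> \<bar>x\<bar>"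
    by (rule duhamel_support[OF light_cone_kernel_half cUq t(1) that]) (use ub(1) t q0 in simp)
  define X2 X3 where "X2 = \<epsilon> powr (p * q) * T powr q" and "X3 = N powr (p * q) * T powr (q + 1)"
  have X0: "0 \<le> X2" "0 \<le> X3" by (auto simp: X2_def X3_def)
  define e where "e s = power_const / 2 * (\<epsilon> powr q * (1 + s) powr (\<theta> - 1) + (X2 + X3))" for s
  have i1: "(\<lambda>s. (1 + s) powr (\<theta> - 1)) integrable_on {0..t}"
    by (intro integrable_continuous_real continuous_intros) auto
  have ie: "e integrable_on {0..t}"
    unfolding e_def by (intro integrable_continuous_real continuous_intros) auto
  have "\<bar>duhamel (\<lambda>t z. 1 / 2) (\<lambda>r y. \<bar>U r y\<bar> powr q) t x\<bar> \<le> integral {0..t} e"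
  proof (rule duhamel_bound[OF light_cone_kernel_half cUq t(1) _ ie])
    fix s assume s: "0 \<le> s" "s \<le> t"
    have "\<bar>signed_cone (\<lambda>t z. 1 / 2) (\<lambda>y. \<bar>U s y\<bar> powr q) (t - s) x\<bar> \<le> (2 * e s) / 2"
    proof (rule signed_cone_L1_sup[OF light_cone_kernel_half cont2_section[OF cUq]])
      show "(\<integral>\<^sup>+x. ennreal \<bar>\<bar>U s x\<bar> powr q\<bar> \<partial>lborel) \<le> ennreal (2 * e s)"
        using ub(2)[of s] s t by (simp add: e_def X2_def X3_def add.assoc)
      show "0 \<le> 2 * e s" using power_const_pos X0 by (simp add: e_def)
    qed (use s in simp)
    then show "\<bar>signed_cone (\<lambda>t z. 1 / 2) (\<lambda>y. \<bar>U s y\<bar> powr q) (t - s) x\<bar> \<le> e s" by simp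
  qed
  also have "integral {0..t} e = power_const / 2 * (\<epsilon> powr q * integral {0..t} (\<lambda>s. (1 + s) powr (\<theta> - 1)) + t * (X2 + X3))"
  proof -
    have "integral {0..t} (\<lambda>s. \<epsilon> powr q * (1 + s) powr (\<theta> - 1) + (X2 + X3)) =
       integral {0..t} (\<lambda>s. \<epsilon> powr q * (1 + s) powr (\<theta> - 1)) + integral {0..t} (\<lambda>s. X2 + X3)"
      by (rule Henstock_Kurzweil_Integration.integral_add) (auto intro!: integrable_continuous_real continuous_intros)
    then show ?thesis unfolding e_def[abs_def] using t by simp
  qed
  also have "\<dots> \<le> power_const / 2 * (\<epsilon> powr q * (2 / \<theta> * T powr \<theta>) + T * (X2 + X3))"
    using t X0 power_const_pos by (intro mult_left_mono add_mono integral_decay_le T mult_right_mono) auto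
  also have "\<dots> \<le> power_const / 2 * (2 / \<theta> * (\<epsilon> powr q * T powr \<theta>) + 2 / \<theta> * (T * (X2 + X3)))"
  proof -
    have "1 \<le> 2 / \<theta>" using \<theta> by simp
    then have "1 * (T * (X2 + X3)) \<le> 2 / \<theta> * (T * (X2 + X3))" using T X0 by (intro mult_right_mono) auto
    then show ?thesis using power_const_pos by (intro mult_left_mono) (auto simp: mult_ac)
  qed
  also have "\<dots> = power_const / \<theta> * (\<epsilon> powr q * T powr \<theta> + (T * X2 + T * X3))" by (simp add: algebra_simps)
  also have "T * X2 = \<epsilon> powr (p * q) * T powr (q + 1)" using T by (simp add: X2_def powr_add)
  also have "T * X3 = N powr (p * q) * T powr (q + 2)"
  proof -
    have "q + 2 = (q + 1) + 1" by simp
    then have "T powr (q + 2) = T powr ((q + 1) + 1)" by (rule arg_cong)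
    also have "\<dots> = T powr (q + 1) * T" using T by (subst powr_add) simp
    finally show ?thesis by (simp add: X3_def)
  qed
  also have "power_const / \<theta> * (\<epsilon> powr q * T powr \<theta> + (\<epsilon> powr (p * q) * T powr (q + 1) + N powr (p * q) * T powr (q + 2))) \<le>
    remainder_const * (\<epsilon> powr q * T powr \<theta> + \<epsilon> powr (p * q) * T powr (q + 1) + N powr (p * q) * T powr (q + 2))"
    unfolding add.assoc remainder_const_def using power_const_pos \<theta> by (intro mult_right_mono divide_right_mono) auto
  finally show "duhamel (\<lambda>t z. 1 / 2) (\<lambda>r y. \<bar>U r y\<bar> powr q) t x \<le>
      remainder_const * (\<epsilon> powr q * T powr \<theta> + \<epsilon> powr (p * q) * T powr (q + 1) + N powr (p * q) * T powr (q + 2))"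
    by linarith
qed

end

section \<open>Existence up to a prescribed time\<close>

lemma duhamel_clamped_continuous:
  assumes k: "smooth_kernel k" and F: "cont2 F"
    and c: "continuous_on A c" "continuous_on A \<xi>" "\<And>a. a \<in> A \<Longrightarrow> 0 \<le> c a"
  shows "continuous_on A (\<lambda>a. duhamel k F (c a) (\<xi> a))"
proof -
  obtain kt kz where "C1_kernel k kt kz" using k by (auto simp: smooth_kernel_def)
  from C1_cylinder_duhamel[OF this F] obtain Wt Wx where "C1_cylinder (duhamel k F) Wt Wx" by blast
  then have "continuous_on ({0..} \<times> UNIV) (\<lambda>(t, x). duhamel k F t x)" by (simp add: C1_cylinder_def)
  from continuous_on_compose2[OF this continuous_on_Pair[OF c(1,2)]] show ?thesis using c(3) by auto
qed

text \<open>Evaluation at a point is a contraction for the uniform distance.\<close>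

lemma continuous_apply_bcontfun:
  "continuous_on UNIV (\<lambda>w :: 'a::topological_space \<Rightarrow>\<^sub>C 'b::metric_space. apply_bcontfun w z)"
  unfolding continuous_on_iff
proof (intro ballI allI impI)
  fix w :: "'a \<Rightarrow>\<^sub>C 'b" and e :: real assume "0 < e"
  then show "\<exists>d>0. \<forall>w'\<in>UNIV. dist w' w < d \<longrightarrow> dist (apply_bcontfun w' z) (apply_bcontfun w z) < e"
    by (intro exI[of _ e]) (auto intro: le_less_trans[OF dist_bounded])
qed

context nakao_fields
begin

text \<open>Banach's fixed point theorem for the remainder \<open>n = exp (\<mu> t) w\<close> of the undamped component,
  in the closed set of functions \<open>w\<close> for which \<open>n\<close> takes values in \<open>[0, N]\<close> and is supported in
  the cone. The a priori estimate says that this set is mapped into itself. Freezing time outside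
  \<open>[0, T]\<close> makes all functions globally continuous.\<close>

theorem existence:
  assumes e: "0 < \<epsilon>" and T: "1 \<le> T" and N: "0 \<le> N"
    and small: "remainder_const * (\<epsilon> powr q * T powr \<theta> + \<epsilon> powr (p * q) * T powr (q + 1) + N powr (p * q) * T powr (q + 2)) \<le> N"
  shows "\<exists>U V. cont2 U \<and> cont2 V \<and> (\<forall>t x. 0 \<le> t \<longrightarrow> t \<le> T \<longrightarrow>
     U t x = \<epsilon> * Lu t x + duhamel k (\<lambda>s y. \<bar>V s y\<bar> powr p) t x \<and>
     V t x = \<epsilon> * Lv t x + duhamel (\<lambda>t z. 1 / 2) (\<lambda>s y. \<bar>U s y\<bar> powr q) t x \<and>
     (R + t \<le> \<bar>x\<bar> \<longrightarrow> U t x = 0 \<and> V t x = 0))"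
proof -
  have p0: "0 < p" "0 < q" using p q by auto
  have sk: "smooth_kernel k" using k by (simp add: light_cone_kernel_def)
  define M where "M = \<epsilon> * C + N"
  define M' where "M' = \<epsilon> * C + T * T * M powr p"
  define \<mu> where "\<mu> = 1 + 2 * (T * (p * M powr (p - 1))) * (T * (q * M' powr (q - 1)))"
  define cl where "cl t = max 0 (min T t)" for t
  have cl: "0 \<le> cl t" "cl t \<le> T" "0 \<le> t \<Longrightarrow> t \<le> T \<Longrightarrow> cl t = t" for t using T by (auto simp: cl_def)
  have ccl: "continuous_on A (\<lambda>a. cl (f a))" if "continuous_on A f" for A :: "'a::topological_space set" and f
    unfolding cl_def by (intro continuous_intros that)
  define Vf where "Vf w t x = \<epsilon> * Lv (cl t) x + exp (\<mu> * cl t) * apply_bcontfun w (t, x)" for w t x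
  define Uf where "Uf w t x = \<epsilon> * Lu (cl t) x + duhamel k (\<lambda>s y. \<bar>Vf w s y\<bar> powr p) (cl t) x" for w t x
  define Wf where "Wf w t x = duhamel (\<lambda>t z. 1 / 2) (\<lambda>s y. \<bar>Uf w s y\<bar> powr q) (cl t) x" for w t x
  define \<Phi> where "\<Phi> w = Bcontfun (\<lambda>(t, x). exp (- (\<mu> * cl t)) * Wf w t x)" for w
  define S where "S = {w :: (real \<times> real) \<Rightarrow>\<^sub>C real. \<forall>t x. 0 \<le> t \<longrightarrow> t \<le> T \<longrightarrow>
     0 \<le> apply_bcontfun w (t, x) \<and> exp (\<mu> * t) * apply_bcontfun w (t, x) \<le> N \<and>
     (R + t \<le> \<bar>x\<bar> \<longrightarrow> apply_bcontfun w (t, x) = 0)}"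
  have cV: "cont2 (Vf w)" for w
    unfolding Vf_def case_prod_beta
    by (intro continuous_intros cont2_compose[OF cLv] ccl) simp
  have cU: "cont2 (Uf w)" for w
    unfolding Uf_def case_prod_beta
    by (intro continuous_intros cont2_compose[OF cLu] ccl duhamel_clamped_continuous[OF sk cont2_abs_powr[OF cV p0(1)]])
       (auto simp: cl)
  have cW: "cont2 (Wf w)" for w
    unfolding Wf_def case_prod_beta
    by (intro duhamel_clamped_continuous cont2_abs_powr[OF cU p0(2)] smooth_kernel_const ccl continuous_intros) (auto simp: cl)
  have Veq: "Vf w t x = \<epsilon> * Lv t x + exp (\<mu> * t) * apply_bcontfun w (t, x)" if "0 \<le> t" "t \<le> T" for w t x
    using that by (simp add: Vf_def cl)
  have Ueq: "Uf w t x = \<epsilon> * Lu t x + duhamel k (\<lambda>s y. \<bar>Vf w s y\<bar> powr p) t x" if "0 \<le> t" "t \<le> T" for w t x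
    using that by (simp add: Uf_def cl)
  have bounds: "0 \<le> duhamel (\<lambda>t z. 1 / 2) (\<lambda>r y. \<bar>Uf w r y\<bar> powr q) t x"
     "duhamel (\<lambda>t z. 1 / 2) (\<lambda>r y. \<bar>Uf w r y\<bar> powr q) t x \<le> N"
     "R + t \<le> \<bar>x\<bar> \<Longrightarrow> duhamel (\<lambda>t z. 1 / 2) (\<lambda>r y. \<bar>Uf w r y\<bar> powr q) t x = 0"
     "R + t \<le> \<bar>x\<bar> \<Longrightarrow> Uf w t x = 0"
    if w: "w \<in> S" and t: "0 \<le> t" "t \<le> T" for w t x
  proof -
    have n: "0 \<le> exp (\<mu> * r) * apply_bcontfun w (r, y) \<and> exp (\<mu> * r) * apply_bcontfun w (r, y) \<le> N"
      "R + r \<le> \<bar>y\<bar> \<Longrightarrow> exp (\<mu> * r) * apply_bcontfun w (r, y) = 0" if "0 \<le> r" "r \<le> T" for r y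
      using w that by (auto simp: S_def)
    note vb = v_bound[OF e T N cV cU, of w "\<lambda>r y. exp (\<mu> * r) * apply_bcontfun w (r, y)" w, OF Veq n Ueq t]
    show "0 \<le> duhamel (\<lambda>t z. 1 / 2) (\<lambda>r y. \<bar>Uf w r y\<bar> powr q) t x" by (rule vb(1))
    show "duhamel (\<lambda>t z. 1 / 2) (\<lambda>r y. \<bar>Uf w r y\<bar> powr q) t x \<le> N" using order_trans[OF vb(2) small] .
    show "R + t \<le> \<bar>x\<bar> \<Longrightarrow> duhamel (\<lambda>t z. 1 / 2) (\<lambda>r y. \<bar>Uf w r y\<bar> powr q) t x = 0" by (rule vb(3))
    show "R + t \<le> \<bar>x\<bar> \<Longrightarrow> Uf w t x = 0" by (rule vb(4))
  qed
  have p1: "1 \<le> \<mu>" unfolding \<mu>_def using T p q by simp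
  have apply\<Phi>: "apply_bcontfun (\<Phi> w) (t, x) = exp (- (\<mu> * cl t)) * Wf w t x" if w: "w \<in> S" for w t x
  proof -
    have "(\<lambda>(t, x). exp (- (\<mu> * cl t)) * Wf w t x) \<in> bcontfun"
    proof (rule bcontfun_normI)
      show "continuous_on UNIV (\<lambda>(t, x). exp (- (\<mu> * cl t)) * Wf w t x)"
        using cW[of w] unfolding case_prod_beta by (intro continuous_intros ccl)
      fix z :: "real \<times> real"
      obtain t x where z: "z = (t, x)" by (cases z)
      have b: "0 \<le> Wf w t x" "Wf w t x \<le> N" unfolding Wf_def using bounds(1,2)[OF w cl(1,2)] by auto
      have "exp (- (\<mu> * cl t)) * Wf w t x \<le> 1 * N" using b p1 cl(1)[of t] by (intro mult_mono) auto
      then show "norm ((\<lambda>(t, x). exp (- (\<mu> * cl t)) * Wf w t x) z) \<le> N" using b by (simp add: z)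
    qed
    then show ?thesis unfolding \<Phi>_def by (simp add: Bcontfun_inverse)
  qed
  have \<Phi>S: "\<Phi> w \<in> S" if w: "w \<in> S" for w
  proof -
    have "0 \<le> apply_bcontfun (\<Phi> w) (t, x) \<and> exp (\<mu> * t) * apply_bcontfun (\<Phi> w) (t, x) \<le> N \<and>
      (R + t \<le> \<bar>x\<bar> \<longrightarrow> apply_bcontfun (\<Phi> w) (t, x) = 0)" if t: "0 \<le> t" "t \<le> T" for t x
    proof -
      have 1: "apply_bcontfun (\<Phi> w) (t, x) = exp (- (\<mu> * t)) * duhamel (\<lambda>t z. 1 / 2) (\<lambda>r y. \<bar>Uf w r y\<bar> powr q) t x"
        unfolding apply\<Phi>[OF w] Wf_def cl(3)[OF t] ..
      have 2: "exp (\<mu> * t) * (exp (- (\<mu> * t)) * X) = X" for X :: real by (simp add: exp_minus)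
      show ?thesis unfolding 1 2 using bounds(1,2)[OF w t] bounds(3)[OF w t, of x] by auto
    qed
    then show ?thesis by (simp add: S_def)
  qed
  have dist: "dist (\<Phi> w) (\<Phi> w') \<le> 1 / 2 * dist w w'" if w: "w \<in> S" "w' \<in> S" for w w'
  proof (rule dist_bound)
    fix z :: "real \<times> real"
    obtain t x where z: "z = (t, x)" by (cases z)
    define \<tau> where "\<tau> = cl t"
    have \<tau>: "0 \<le> \<tau>" "\<tau> \<le> T" using cl by (auto simp: \<tau>_def)
    have bV: "\<bar>Vf w s y\<bar> \<le> M" if "0 \<le> s" "s \<le> T" "w \<in> S" for w s y
    proof -
      have "\<bar>\<epsilon> * Lv s y\<bar> \<le> \<epsilon> * C" using Lv_sup[OF that(1), of y] e by (simp add: abs_mult)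
      moreover have "0 \<le> exp (\<mu> * s) * apply_bcontfun w (s, y)" "exp (\<mu> * s) * apply_bcontfun w (s, y) \<le> N"
        using that by (auto simp: S_def)
      ultimately show ?thesis unfolding Veq[OF that(1,2)] M_def by linarith
    qed
    have bU: "\<bar>Uf w s y\<bar> \<le> M'" if s: "0 \<le> s" "s \<le> T" "w \<in> S" for w s y
    proof -
      have "\<bar>Lu s y\<bar> \<le> C / sqrt (1 + s)" by (rule Lu_sup[OF s(1)])
      also have "\<dots> \<le> C / 1" using C s by (intro divide_left_mono) auto
      finally have 1: "\<bar>\<epsilon> * Lu s y\<bar> \<le> \<epsilon> * C" using e by (simp add: abs_mult)
      have "\<bar>duhamel k (\<lambda>s y. \<bar>Vf w s y\<bar> powr p) s y\<bar> \<le> integral {0..s} (\<lambda>r. T * M powr p)"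
      proof (rule duhamel_bound[OF k cont2_abs_powr[OF cV p0(1)] s(1)])
        fix r assume r: "0 \<le> r" "r \<le> s"
        have "\<bar>signed_cone k (\<lambda>y. \<bar>Vf w r y\<bar> powr p) (s - r) y\<bar> \<le> (s - r) * M powr p"
        proof (rule signed_cone_abs_le[OF k cont2_section[OF cont2_abs_powr[OF cV p0(1)]]])
          fix z show "\<bar>\<bar>Vf w r z\<bar> powr p\<bar> \<le> M powr p"
            using bV[OF r(1) _ s(3), of z] r s p0 by (auto intro!: powr_mono2)
        qed (use r in simp)
        also have "\<dots> \<le> T * M powr p" using r s by (intro mult_right_mono) auto
        finally show "\<bar>signed_cone k (\<lambda>y. \<bar>Vf w r y\<bar> powr p) (s - r) y\<bar> \<le> T * M powr p" .
      qed auto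
      also have "\<dots> = s * (T * M powr p)" using s by simp
      also have "\<dots> \<le> T * (T * M powr p)" using s T by (intro mult_right_mono) auto
      finally show ?thesis unfolding Ueq[OF s(1,2)] M'_def using 1 by (simp add: mult.assoc)
    qed
    have dV: "\<bar>Vf w s y - Vf w' s y\<bar> \<le> dist w w' * exp (\<mu> * s)" if s: "0 \<le> s" "s \<le> T" for s y
    proof -
      have "Vf w s y - Vf w' s y = exp (\<mu> * s) * (apply_bcontfun w (s, y) - apply_bcontfun w' (s, y))"
        unfolding Veq[OF s] by (simp add: algebra_simps)
      also have "\<bar>\<dots>\<bar> = exp (\<mu> * s) * dist (apply_bcontfun w (s, y)) (apply_bcontfun w' (s, y))"
        by (simp add: abs_mult dist_real_def)
      also have "\<dots> \<le> exp (\<mu> * s) * dist w w'" by (intro mult_left_mono dist_bounded) auto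
      finally show ?thesis by (simp add: mult.commute)
    qed
    have "\<bar>Wf w t x - Wf w' t x\<bar> \<le> dist w w' / 2 * exp (\<mu> * \<tau>)"
      unfolding Wf_def \<tau>_def[symmetric]
    proof (rule contraction_step(2)[OF p q k _ _ cV cV cU cU _ _ Ueq Ueq \<mu>_def dV \<tau>])
      show "\<bar>Vf w t x\<bar> \<le> M \<and> \<bar>Vf w' t x\<bar> \<le> M" if "0 \<le> t" "t \<le> T" for t x using bV that w by blast
      show "\<bar>Uf w t x\<bar> \<le> M' \<and> \<bar>Uf w' t x\<bar> \<le> M'" if "0 \<le> t" "t \<le> T" for t x using bU that w by blast
    qed (use T in auto)
    then have "exp (- (\<mu> * \<tau>)) * \<bar>Wf w t x - Wf w' t x\<bar> \<le> exp (- (\<mu> * \<tau>)) * (dist w w' / 2 * exp (\<mu> * \<tau>))"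
      by (intro mult_left_mono) auto
    also have "\<dots> = dist w w' / 2" by (simp add: exp_minus)
    finally have "exp (- (\<mu> * \<tau>)) * \<bar>Wf w t x - Wf w' t x\<bar> \<le> dist w w' / 2" .
    moreover have "dist (apply_bcontfun (\<Phi> w) z) (apply_bcontfun (\<Phi> w') z) = exp (- (\<mu> * \<tau>)) * \<bar>Wf w t x - Wf w' t x\<bar>"
      unfolding z apply\<Phi>[OF w(1)] apply\<Phi>[OF w(2)] dist_real_def right_diff_distrib[symmetric] abs_mult \<tau>_def by simp
    ultimately show "dist (apply_bcontfun (\<Phi> w) z) (apply_bcontfun (\<Phi> w') z) \<le> 1 / 2 * dist w w'" by simp
  qed
  have "closed S"
  proof -
    have S_eq: "S = (\<Inter>z\<in>{0..T} \<times> UNIV. {w. 0 \<le> apply_bcontfun w z} \<inter> {w. exp (\<mu> * fst z) * apply_bcontfun w z \<le> N})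
       \<inter> (\<Inter>z\<in>{z. 0 \<le> fst z \<and> fst z \<le> T \<and> R + fst z \<le> \<bar>snd z\<bar>}. {w. apply_bcontfun w z = 0})"
      by (auto simp: S_def)
    show ?thesis
      unfolding S_eq
      by (intro closed_Int closed_INT ballI closed_Collect_le closed_Collect_eq continuous_intros continuous_apply_bcontfun)
  qed
  then have "complete S" by (simp add: complete_eq_closed)
  moreover have "(0 :: (real \<times> real) \<Rightarrow>\<^sub>C real) \<in> S" using N by (simp add: S_def zero_bcontfun.rep_eq)
  then have "S \<noteq> {}" by blast
  ultimately have "\<exists>!w. w \<in> S \<and> \<Phi> w = w"
    by (intro Banach_fix[where c = "1/2"]) (use \<Phi>S dist in auto)
  then obtain w where w: "w \<in> S" "\<Phi> w = w" by blast
  show ?thesis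
  proof (rule exI[of _ "Uf w"], rule exI[of _ "Vf w"], intro conjI allI impI cU cV)
    fix t x assume t: "0 \<le> t" "t \<le> T"
    show "Uf w t x = \<epsilon> * Lu t x + duhamel k (\<lambda>s y. \<bar>Vf w s y\<bar> powr p) t x" by (rule Ueq[OF t])
    have "apply_bcontfun w (t, x) = exp (- (\<mu> * t)) * duhamel (\<lambda>t z. 1 / 2) (\<lambda>s y. \<bar>Uf w s y\<bar> powr q) t x"
      using apply\<Phi>[OF w(1), of t x] unfolding w(2) Wf_def cl(3)[OF t] .
    then show Vw: "Vf w t x = \<epsilon> * Lv t x + duhamel (\<lambda>t z. 1 / 2) (\<lambda>s y. \<bar>Uf w s y\<bar> powr q) t x"
      unfolding Veq[OF t] by (simp add: exp_minus)
    assume x: "R + t \<le> \<bar>x\<bar>"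
    show "Uf w t x = 0" by (rule bounds(4)[OF w(1) t x])
    have "R \<le> \<bar>\<bar>x\<bar> - t\<bar>" using x by linarith
    then show "Vf w t x = 0" unfolding Vw using bounds(3)[OF w(1) t x] Lv_strip[OF t(1)] by simp
  qed
qed

end

section \<open>Mild energy solutions and their lifespan\<close>

lemma weak_deriv_diff:
  assumes f: "f1 \<in> Lp 2" "f2 \<in> Lp 2" and g: "g1 \<in> Lp 2" "g2 \<in> Lp 2"
    and w: "weak_deriv f1 g1" "weak_deriv f2 g2"
  shows "weak_deriv (\<lambda>x. f1 x - f2 x) (\<lambda>x. g1 x - g2 x)"
  unfolding weak_deriv_def
proof (intro allI impI)
  fix \<phi> assume t: "test_function \<phi>"
  obtain a b where ab: "\<And>x. x \<notin> {a..b} \<Longrightarrow> \<phi> x = 0" "\<And>x. x \<notin> {a..b} \<Longrightarrow> deriv \<phi> x = 0" "a \<le> b"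
    using test_function_compact_support[OF t] by blast
  note d = test_functionD[OF t]
  have c: "continuous_on UNIV \<phi>" using d(1) by (meson DERIV_isCont continuous_at_imp_continuous_on)
  have i: "integrable lborel (\<lambda>x. f1 x * deriv \<phi> x)" "integrable lborel (\<lambda>x. f2 x * deriv \<phi> x)"
    "integrable lborel (\<lambda>x. g1 x * \<phi> x)" "integrable lborel (\<lambda>x. g2 x * \<phi> x)"
    using integrable_mult_compact_support[OF Lp2_set_integrable d(2) ab(2)] f
      integrable_mult_compact_support[OF Lp2_set_integrable c ab(1)] g by blast+
  show "(LINT x|lborel. (f1 x - f2 x) * deriv \<phi> x) = - (LINT x|lborel. (g1 x - g2 x) * \<phi> x)"
    using w t i by (simp add: left_diff_distrib weak_deriv_def)
qed

lemma Lp2_cong_AE: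
  assumes "f \<in> Lp 2" "g \<in> borel_measurable borel" "AE x in lborel. f x = g x"
  shows "g \<in> Lp 2" "(LINT x|lborel. (f x)\<^sup>2) = (LINT x|lborel. (g x)\<^sup>2)"
proof -
  have [measurable]: "f \<in> borel_measurable borel" "g \<in> borel_measurable borel" using assms by (auto simp: Lp2_iff)
  have ae: "AE x in lborel. (f x)\<^sup>2 = (g x)\<^sup>2" using assms(3) by eventually_elim simp
  have "integrable lborel (\<lambda>x. (g x)\<^sup>2)"
    using assms(1) integrable_cong_AE[OF _ _ ae] by (simp add: Lp2_iff)
  then show "g \<in> Lp 2" by (simp add: Lp2_iff)
  show "(LINT x|lborel. (f x)\<^sup>2) = (LINT x|lborel. (g x)\<^sup>2)" by (rule integral_cong_AE[OF _ _ ae]) measurable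
qed

text \<open>The Sobolev bound for a difference, phrased for the norm in which the curves are continuous.\<close>

lemma H1_sup_distance:
  assumes f: "f1 \<in> Lp 2" "f2 \<in> Lp 2" and g: "g1 \<in> Lp 2" "g2 \<in> Lp 2"
    and w: "weak_deriv f1 g1" "weak_deriv f2 g2" and P: "primitive F1 g1" "primitive F2 g2"
    and ae: "AE x in lborel. f1 x = F1 x" "AE x in lborel. f2 x = F2 x"
  shows "\<bar>F1 x - F2 x\<bar> \<le> 2 * H1_norm (\<lambda>x. f1 x - f2 x)"
proof -
  have sub: "(\<lambda>x. h1 x - h2 x) \<in> Lp 2" if "h1 \<in> Lp 2" "h2 \<in> Lp 2" for h1 h2
    using Lp2_add[OF that(1) Lp2_cmult[OF that(2), of "-1"]] by simp
  have PD: "primitive (\<lambda>x. F1 x - F2 x) (\<lambda>x. g1 x - g2 x)"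
    using primitive_add[OF P(1) primitive_cmult[OF P(2), of "-1"]] by simp
  have aeD: "AE x in lborel. f1 x - f2 x = F1 x - F2 x" using ae by eventually_elim simp
  note c = Lp2_cong_AE[OF sub[OF f] primitive_measurable[OF PD] aeD]
  have n: "H1_norm (\<lambda>x. f1 x - f2 x) = sqrt ((LINT x|lborel. (f1 x - f2 x)\<^sup>2) + (LINT x|lborel. (g1 x - g2 x)\<^sup>2))"
    by (rule H1_norm_eq[OF sub[OF f] sub[OF g] weak_deriv_diff[OF f g w]])
  have nn: "0 \<le> (LINT x|lborel. (f1 x - f2 x)\<^sup>2)" "0 \<le> (LINT x|lborel. (g1 x - g2 x)\<^sup>2)" by simp_all
  have "\<bar>F1 x - F2 x\<bar> \<le> sqrt (LINT x|lborel. (f1 x - f2 x)\<^sup>2) + sqrt (LINT x|lborel. (g1 x - g2 x)\<^sup>2)"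
    using sobolev_bound[OF PD c(1) sub[OF g], of x] unfolding c(2) .
  also have "\<dots> \<le> H1_norm (\<lambda>x. f1 x - f2 x) + H1_norm (\<lambda>x. f1 x - f2 x)"
    unfolding n using nn by (intro add_mono real_sqrt_le_mono) auto
  finally show ?thesis by simp
qed

text \<open>A curve that is continuous in \<open>H\<^sup>1\<close> has representatives that depend continuously on time in
  the uniform norm; they are jointly continuous and bounded on compact time intervals.\<close>

theorem C0_H1_representative:
  assumes u: "C0_H1 T u" and t1: "0 \<le> t1" "ereal t1 < T"
  shows "\<exists>w M. cont2 w \<and> (\<forall>t. 0 \<le> t \<longrightarrow> t \<le> t1 \<longrightarrow> (AE x in lborel. u t x = w t x) \<and> (\<forall>x. \<bar>w t x\<bar> \<le> M))"
proof -
  have TI: "{0..t1} \<subseteq> time_interval T"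
    using t1(2) by (auto simp: time_interval_def intro: le_less_trans[of _ "ereal t1"])
  have "\<exists>F g. primitive F g \<and> g \<in> Lp 2 \<and> weak_deriv (u t) g \<and> (AE x in lborel. u t x = F x)" if "t \<in> time_interval T" for t
  proof -
    have "u t \<in> H1" using u that by (simp add: C0_H1_def)
    then obtain g where "g \<in> Lp 2" "weak_deriv (u t) g" "u t \<in> Lp 2" by (auto simp: H1_def)
    then show ?thesis using weak_deriv_imp_primitive by blast
  qed
  then obtain F g where F: "\<And>t. t \<in> time_interval T \<Longrightarrow> primitive (F t) (g t)"
    "\<And>t. t \<in> time_interval T \<Longrightarrow> g t \<in> Lp 2" "\<And>t. t \<in> time_interval T \<Longrightarrow> weak_deriv (u t) (g t)"
    "\<And>t. t \<in> time_interval T \<Longrightarrow> AE x in lborel. u t x = F t x" by metis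
  have uL: "u t \<in> Lp 2" if "t \<in> time_interval T" for t using u that by (simp add: C0_H1_def H1_def)
  have Fb: "F t \<in> bcontfun" if t: "t \<in> time_interval T" for t
  proof (rule bcontfun_normI[OF primitive_continuous[OF F(1)[OF t]]])
    show "norm (F t x) \<le> sqrt (LINT x|lborel. (F t x)\<^sup>2) + sqrt (LINT x|lborel. (g t x)\<^sup>2)" for x
      using sobolev_bound[OF F(1)[OF t] Lp2_cong_AE(1)[OF uL[OF t] primitive_measurable[OF F(1)[OF t]] F(4)[OF t]] F(2)[OF t]]
      by simp
  qed
  define B where "B t = Bcontfun (F t)" for t
  have B: "apply_bcontfun (B t) = F t" if "t \<in> time_interval T" for t
    using Fb[OF that] by (simp add: B_def Bcontfun_inverse)
  have cB: "continuous_on {0..t1} B"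
    unfolding continuous_on_def
  proof
    fix t assume "t \<in> {0..t1}"
    then have t: "t \<in> time_interval T" using TI by blast
    have "((\<lambda>s. H1_norm (\<lambda>x. u s x - u t x)) \<longlongrightarrow> 0) (at t within time_interval T)" using u t by (simp add: C0_H1_def)
    then have "((\<lambda>s. H1_norm (\<lambda>x. u s x - u t x)) \<longlongrightarrow> 0) (at t within {0..t1})" using TI by (rule tendsto_within_subset)
    then have l: "((\<lambda>s. 2 * H1_norm (\<lambda>x. u s x - u t x)) \<longlongrightarrow> 0) (at t within {0..t1})" by (rule tendsto_mult_right_zero)
    have "\<forall>\<^sub>F s in at t within {0..t1}. dist (B s) (B t) \<le> 2 * H1_norm (\<lambda>x. u s x - u t x)"
      unfolding eventually_at_filter
    proof (rule always_eventually, intro allI impI)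
      fix s assume "s \<in> {0..t1}"
      then have s: "s \<in> time_interval T" using TI by blast
      show "dist (B s) (B t) \<le> 2 * H1_norm (\<lambda>x. u s x - u t x)"
        by (rule dist_bound)
          (unfold B[OF s] B[OF t] dist_real_def, rule H1_sup_distance[OF uL[OF s] uL[OF t] F(2)[OF s] F(2)[OF t] F(3)[OF s] F(3)[OF t]
             F(1)[OF s] F(1)[OF t] F(4)[OF s] F(4)[OF t]])
    qed
    then have "((\<lambda>s. dist (B s) (B t)) \<longlongrightarrow> 0) (at t within {0..t1})"
      by (intro tendsto_sandwich[OF _ _ tendsto_const l]) auto
    then show "(B \<longlongrightarrow> B t) (at t within {0..t1})" by (rule tendsto_dist_iff[THEN iffD2])
  qed
  define cl where "cl t = max 0 (min t1 t)" for t
  have cl: "cl t \<in> {0..t1}" "0 \<le> t \<Longrightarrow> t \<le> t1 \<Longrightarrow> cl t = t" for t using t1 by (auto simp: cl_def)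
  have ccl: "continuous_on UNIV (\<lambda>p :: real \<times> real. B (cl (fst p)))"
    by (rule continuous_on_compose2[OF cB]) (use cl(1) in \<open>auto simp: cl_def intro!: continuous_intros\<close>)
  define w where "w t x = apply_bcontfun (B (cl t)) x" for t x
  have cw: "cont2 w"
    unfolding continuous_on_def case_prod_beta
  proof
    fix z :: "real \<times> real"
    have "((\<lambda>y. B (cl (fst y))) \<longlongrightarrow> B (cl (fst z))) (at z)"
      using ccl unfolding continuous_on_def by (rule bspec) simp
    then have d: "((\<lambda>y. dist (B (cl (fst y))) (B (cl (fst z)))) \<longlongrightarrow> 0) (at z)" by (rule tendsto_dist_iff[THEN iffD1])
    have "((\<lambda>y. w (fst y) (snd y) - w (fst z) (snd y)) \<longlongrightarrow> 0) (at z)"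
      by (rule Lim_null_comparison[OF _ d]) (simp add: w_def dist_real_def[symmetric] dist_bounded)
    moreover have "((\<lambda>y. w (fst z) (snd y)) \<longlongrightarrow> w (fst z) (snd z)) (at z)"
    proof -
      have "continuous_on UNIV (\<lambda>y :: real \<times> real. apply_bcontfun (B (cl (fst z))) (snd y))"
        by (rule continuous_on_compose2[OF continuous_on_apply_bcontfun[of UNIV]]) (auto intro!: continuous_intros)
      then show ?thesis unfolding continuous_on_def w_def by (rule bspec) simp
    qed
    ultimately have "((\<lambda>y. (w (fst y) (snd y) - w (fst z) (snd y)) + w (fst z) (snd y)) \<longlongrightarrow> 0 + w (fst z) (snd z)) (at z)"
      by (rule tendsto_add)
    then show "((\<lambda>p. w (fst p) (snd p)) \<longlongrightarrow> w (fst z) (snd z)) (at z within UNIV)" by simp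
  qed
  have "bounded (B ` {0..t1})" using compact_continuous_image[OF cB] compact_imp_bounded by blast
  then obtain M where M: "\<And>t. t \<in> {0..t1} \<Longrightarrow> norm (B t) \<le> M"
    unfolding bounded_iff by blast
  have wM: "\<bar>w t x\<bar> \<le> M" for t x
  proof -
    have "norm (apply_bcontfun (B (cl t)) x) \<le> norm (B (cl t))" by (rule norm_bounded)
    then show ?thesis using M[OF cl(1), of t] by (simp add: w_def)
  qed
  have wu: "AE x in lborel. u t x = w t x" if "0 \<le> t" "t \<le> t1" for t
  proof -
    have t: "t \<in> time_interval T" using TI that by auto
    show ?thesis using F(4)[OF t] unfolding w_def cl(2)[OF that] B[OF t] .
  qed
  show ?thesis
    by (rule exI[of _ w], rule exI[of _ M], rule conjI[OF cw]) (use wM wu in simp)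
qed

abbreviation damped_field where
  "damped_field \<equiv> linear_field (\<lambda>t. exp (- t / 2) / 2) damped_kernel0 damped_kernel_dz"

abbreviation wave_field where
  "wave_field \<equiv> linear_field (\<lambda>t. 1 / 2) (\<lambda>t z. 0) (\<lambda>t z. 0)"

lemma damped_linear_AE:
  assumes f: "f \<in> borel_measurable borel" "AE x in lborel. f x = F x" and F: "continuous_on UNIV F"
    and P: "primitive P g" and t: "0 \<le> t"
  shows "AE x in lborel. damped_K0 t f x + damped_K1 t g x = damped_field F P t x"
  using linear_field_eq_AE[OF damped_kernel_system F P t f]
  by (simp add: damped_K0_cone_integral[OF t f(1)] damped_K1_cone_integral[OF t])

lemma wave_linear_AE:
  assumes f: "f \<in> borel_measurable borel" "AE x in lborel. f x = F x" and F: "continuous_on UNIV F"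
    and P: "primitive P g" and t: "0 \<le> t"
  shows "AE x in lborel. wave_K0 t f x + wave_K1 t g x = wave_field F P t x"
proof -
  have "cone_integral (\<lambda>t z. 0) f t x = 0" for x by (simp add: cone_integral_def)
  then show ?thesis using linear_field_eq_AE[OF wave_kernel_system F P t f] by (simp add: wave_K0_def wave_K1_cone_integral)
qed

text \<open>Changing the source on a null set for each time does not change its cone integrals, so the
  Duhamel term of a mild solution may be computed with the continuous representative.\<close>

lemma cone_integral_duhamel:
  assumes k: "cont2 k" and W: "cont2 W" and p: "0 < p" and t: "0 \<le> t"
    and v: "\<And>s. 0 \<le> s \<Longrightarrow> s \<le> t \<Longrightarrow> v s \<in> borel_measurable borel \<and> (AE y in lborel. v s y = W s y)"
  shows "(LBINT s:{0..t}. cone_integral k (\<lambda>y. \<bar>v s y\<bar> powr p) (t - s) x) = duhamel k (\<lambda>s y. \<bar>W s y\<bar> powr p) t x"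
proof -
  have cW: "cont2 (\<lambda>s y. \<bar>W s y\<bar> powr p)" using W p by (rule cont2_abs_powr)
  have eq: "cone_integral k (\<lambda>y. \<bar>v s y\<bar> powr p) (t - s) x = signed_cone k (\<lambda>y. \<bar>W s y\<bar> powr p) (t - s) x" if s: "s \<in> {0..t}" for s
  proof -
    have [measurable]: "v s \<in> borel_measurable borel" "W s \<in> borel_measurable borel"
      using v[of s] s cont2_section[OF W] by (auto intro: borel_measurable_continuous_onI)
    have ae: "AE y in lborel. \<bar>v s y\<bar> powr p = \<bar>W s y\<bar> powr p"
    proof -
      have "AE y in lborel. v s y = W s y" using v[of s] s by auto
      then show ?thesis by eventually_elim simp
    qed
    have "cone_integral k (\<lambda>y. \<bar>v s y\<bar> powr p) (t - s) x = cone_integral k (\<lambda>y. \<bar>W s y\<bar> powr p) (t - s) x"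
      by (rule cone_integral_cong_AE[OF k _ _ ae]) measurable
    then show ?thesis using cone_integral_eq_signed_cone[OF k cont2_section[OF cW], of "t - s" s x] s by simp
  qed
  have "(LBINT s:{0..t}. cone_integral k (\<lambda>y. \<bar>v s y\<bar> powr p) (t - s) x) = (LBINT s:{0..t}. signed_cone k (\<lambda>y. \<bar>W s y\<bar> powr p) (t - s) x)"
    by (rule set_lebesgue_integral_cong) (use eq in auto)
  also have "\<dots> = duhamel k (\<lambda>s y. \<bar>W s y\<bar> powr p) t x"
    unfolding duhamel_def
    by (intro set_borel_integral_eq_integral(2) borel_integrable_atLeastAtMost' continuous_on_signed_cone[OF k cW] continuous_intros)
  finally show ?thesis .
qed

lemma damped_duhamel:
  assumes W: "cont2 W" and p: "0 < p" and t: "0 \<le> t"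
    and v: "\<And>s. 0 \<le> s \<Longrightarrow> s \<le> t \<Longrightarrow> v s \<in> borel_measurable borel \<and> (AE y in lborel. v s y = W s y)"
  shows "(LBINT s:{0..t}. damped_K1 (t - s) (\<lambda>y. \<bar>v s y\<bar> powr p) x) = duhamel damped_kernel (\<lambda>s y. \<bar>W s y\<bar> powr p) t x"
proof -
  have "(LBINT s:{0..t}. damped_K1 (t - s) (\<lambda>y. \<bar>v s y\<bar> powr p) x) = (LBINT s:{0..t}. cone_integral damped_kernel (\<lambda>y. \<bar>v s y\<bar> powr p) (t - s) x)"
    by (rule set_lebesgue_integral_cong) (auto simp: damped_K1_cone_integral)
  also have "\<dots> = duhamel damped_kernel (\<lambda>s y. \<bar>W s y\<bar> powr p) t x"
    by (rule cone_integral_duhamel[OF smooth_kernel_cont2[OF smooth_damped_kernels(1)] W p t v])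
  finally show ?thesis .
qed

lemma wave_duhamel:
  assumes W: "cont2 W" and p: "0 < p" and t: "0 \<le> t"
    and v: "\<And>s. 0 \<le> s \<Longrightarrow> s \<le> t \<Longrightarrow> v s \<in> borel_measurable borel \<and> (AE y in lborel. v s y = W s y)"
  shows "(LBINT s:{0..t}. wave_K1 (t - s) (\<lambda>y. \<bar>v s y\<bar> powr p) x) = duhamel (\<lambda>t z. 1 / 2) (\<lambda>s y. \<bar>W s y\<bar> powr p) t x"
  unfolding wave_K1_cone_integral
  by (rule cone_integral_duhamel[OF smooth_kernel_cont2[OF smooth_kernel_const] W p t v])

text \<open>Initial data together with the continuous representatives of the displacements and the
  primitives of the velocities.\<close>

locale nakao_data =
  fixes p q :: real and f0 f1 g0 g1 F f' P G g' Q :: "real \<Rightarrow> real"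
  assumes pq: "1 < p" "1 < q"
    and f0: "f0 \<in> borel_measurable borel" "AE x in lborel. f0 x = F x" and F: "primitive F f'" "f' \<in> Lp 2"
    and f1: "f1 \<in> Lp 2" and P: "primitive P f1"
    and g0: "g0 \<in> borel_measurable borel" "AE x in lborel. g0 x = G x" and G: "primitive G g'" "g' \<in> Lp 2"
    and g1: "g1 \<in> Lp 2" and Q: "primitive Q g1"
begin

text \<open>The classical part collects the regular part of the linear field and the Duhamel integral.\<close>

lemma field_solution_regular:
  assumes K: "kernel_system \<kappa> \<kappa>' k k0 kz" and k: "smooth_kernel k" and A: "primitive A A'" "A' \<in> Lp 2" and B: "primitive B B'" "B' \<in> Lp 2"
    and H: "cont2 H" and T: "0 < T" and R: "0 < R"
    and U: "\<And>t x. 0 \<le> t \<Longrightarrow> t < T \<Longrightarrow> U t x = linear_field \<kappa> k0 kz A B t x + duhamel k H t x"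
    and Z: "\<And>t x. 0 \<le> t \<Longrightarrow> t < T \<Longrightarrow> R + t \<le> \<bar>x\<bar> \<Longrightarrow> U t x = 0"
  shows "C0_H1 (ereal T) U" "C1_L2 (ereal T) U"
proof -
  obtain Wt Wx where W: "C1_cylinder (\<lambda>t x. signed_cone k0 A t x + signed_cone kz B t x) Wt Wx"
    using linear_field_C1[OF K primitive_continuous[OF A(1)] primitive_continuous[OF B(1)]] by blast
  obtain kt kz' where "C1_kernel k kt kz'" using k by (auto simp: smooth_kernel_def)
  from C1_cylinder_duhamel[OF this H] obtain Dt Dx where D: "C1_cylinder (duhamel k H) Dt Dx" by blast
  have kap: "(\<kappa> has_real_derivative \<kappa>' t) (at t)" "continuous_on UNIV \<kappa>'" for t using K by (auto simp: kernel_system_def)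
  have pA: "primitive (\<lambda>x. A x + B x) (\<lambda>x. A' x + B' x)" "(\<lambda>x. A' x + B' x) \<in> Lp 2"
    using primitive_add[OF A(1) B(1)] Lp2_add[OF A(2) B(2)] by auto
  have pB: "primitive (\<lambda>x. A x + (-1) * B x) (\<lambda>x. A' x + (-1) * B' x)" "(\<lambda>x. A' x + (-1) * B' x) \<in> Lp 2"
    using primitive_add[OF A(1) primitive_cmult[OF B(1), of "-1"]] Lp2_add[OF A(2) Lp2_cmult[OF B(2), of "-1"]] by auto
  have L: "0 \<le> R + T" using R T by simp
  have U': "U t x = ((signed_cone k0 A t x + signed_cone kz B t x) + duhamel k H t x) + \<kappa> t * (A (x + t) + B (x + t)) + \<kappa> t * (A (x - t) + (-1) * B (x - t))"
    if "0 \<le> t" "t < T" for t x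
    unfolding U[OF that] linear_field_def by simp
  have Z': "U t x = 0" if "0 \<le> t" "t < T" "R + T \<le> \<bar>x\<bar>" for t x using Z[OF that(1,2)] that by simp
  show "C0_H1 (ereal T) U"
    by (rule travelling_wave_regularity(1)[where U = U and W = "\<lambda>t x. (signed_cone k0 A t x + signed_cone kz B t x) + duhamel k H t x"
      and a = \<kappa> and A = "\<lambda>x. A x + B x" and B = "\<lambda>x. A x + (-1) * B x" and L = "R + T" and T = T,
      OF L C1_cylinder_add[OF W D] kap(1) kap(2) pA pB]) (fact U' Z')+
  show "C1_L2 (ereal T) U"
    by (rule travelling_wave_regularity(2)[where U = U and W = "\<lambda>t x. (signed_cone k0 A t x + signed_cone kz B t x) + duhamel k H t x"
      and a = \<kappa> and A = "\<lambda>x. A x + B x" and B = "\<lambda>x. A x + (-1) * B x" and L = "R + T" and T = T,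
      OF L C1_cylinder_add[OF W D] kap(1) kap(2) pA pB]) (fact U' Z')+
qed

text \<open>A jointly continuous solution of the integral equations with support in the cone has the
  regularity of an energy solution.\<close>

lemma mild_solutionI:
  assumes T: "0 < T" and R: "0 < R" and cU: "cont2 U" and cV: "cont2 V"
    and U: "\<And>t x. 0 \<le> t \<Longrightarrow> t < T \<Longrightarrow> U t x = damped_field F P t x + duhamel damped_kernel (\<lambda>s y. \<bar>V s y\<bar> powr p) t x"
    and V: "\<And>t x. 0 \<le> t \<Longrightarrow> t < T \<Longrightarrow> V t x = wave_field G Q t x + duhamel (\<lambda>t z. 1 / 2) (\<lambda>s y. \<bar>U s y\<bar> powr q) t x"
    and Z: "\<And>t x. 0 \<le> t \<Longrightarrow> t < T \<Longrightarrow> R + t \<le> \<bar>x\<bar> \<Longrightarrow> U t x = 0 \<and> V t x = 0"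
  shows "nakao_mild_solution p q f0 f1 g0 g1 (ereal T) U V"
proof -
  have p0: "0 < p" "0 < q" using pq by auto
  have ZU: "U t x = 0" and ZV: "V t x = 0" if "0 \<le> t" "t < T" "R + t \<le> \<bar>x\<bar>" for t x
    using Z[OF that] by blast+
  note cVp = cont2_abs_powr[OF cV p0(1)] and cUq = cont2_abs_powr[OF cU p0(2)]
  have regU: "C0_H1 (ereal T) U" "C1_L2 (ereal T) U"
    by (rule field_solution_regular(1)[where U = U, OF damped_kernel_system smooth_damped_kernels(1) F P f1 cVp T R], fact U, fact ZU,
        rule field_solution_regular(2)[where U = U, OF damped_kernel_system smooth_damped_kernels(1) F P f1 cVp T R], fact U, fact ZU)
  have regV: "C0_H1 (ereal T) V" "C1_L2 (ereal T) V"
    by (rule field_solution_regular(1)[where U = V, OF wave_kernel_system smooth_kernel_const G Q g1 cUq T R], fact V, fact ZV,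
        rule field_solution_regular(2)[where U = V, OF wave_kernel_system smooth_kernel_const G Q g1 cUq T R], fact V, fact ZV)
  have m: "U s \<in> borel_measurable borel" "V s \<in> borel_measurable borel" for s
    using cont2_section[OF cU] cont2_section[OF cV] by (auto intro: borel_measurable_continuous_onI)
  have eqs: "(AE x in lborel. U t x = damped_K0 t f0 x + damped_K1 t f1 x + (LBINT s:{0..t}. damped_K1 (t - s) (\<lambda>y. \<bar>V s y\<bar> powr p) x)) \<and>
    (AE x in lborel. V t x = wave_K0 t g0 x + wave_K1 t g1 x + (LBINT s:{0..t}. wave_K1 (t - s) (\<lambda>y. \<bar>U s y\<bar> powr q) x))"
    if t: "0 \<le> t" "t < T" for t
  proof
    show "AE x in lborel. U t x = damped_K0 t f0 x + damped_K1 t f1 x + (LBINT s:{0..t}. damped_K1 (t - s) (\<lambda>y. \<bar>V s y\<bar> powr p) x)"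
      using damped_linear_AE[OF f0 primitive_continuous[OF F(1)] P t(1)]
    proof eventually_elim
      case (elim x)
      then show ?case using U[OF t, of x] damped_duhamel[OF cV p0(1) t(1), of V x] m by simp
    qed
    show "AE x in lborel. V t x = wave_K0 t g0 x + wave_K1 t g1 x + (LBINT s:{0..t}. wave_K1 (t - s) (\<lambda>y. \<bar>U s y\<bar> powr q) x)"
      using wave_linear_AE[OF g0 primitive_continuous[OF G(1)] Q t(1)]
    proof eventually_elim
      case (elim x)
      then show ?case using V[OF t, of x] wave_duhamel[OF cU p0(2) t(1), of U x] m by simp
    qed
  qed
  show ?thesis
    unfolding nakao_mild_solution_def using T regU regV eqs by (simp add: time_interval_ereal zero_ereal_def)
qed

text \<open>Conversely, every mild energy solution is represented by a bounded jointly continuous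
  solution of the integral equations, on each compact time interval.\<close>

lemma mild_solutionD:
  assumes sol: "nakao_mild_solution p q f0 f1 g0 g1 T u v" and t1: "0 \<le> t1" "ereal t1 < T"
  shows "\<exists>U V M. cont2 U \<and> cont2 V \<and> (\<forall>t. 0 \<le> t \<longrightarrow> t \<le> t1 \<longrightarrow>
     (AE x in lborel. u t x = U t x) \<and> (AE x in lborel. v t x = V t x) \<and>
     (\<forall>x. \<bar>U t x\<bar> \<le> M \<and> \<bar>V t x\<bar> \<le> M \<and>
       U t x = damped_field F P t x + duhamel damped_kernel (\<lambda>s y. \<bar>V s y\<bar> powr p) t x \<and>
       V t x = wave_field G Q t x + duhamel (\<lambda>t z. 1 / 2) (\<lambda>s y. \<bar>U s y\<bar> powr q) t x))"
proof -
  have p0: "0 < p" "0 < q" using pq by auto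
  have cu: "C0_H1 T u" "C0_H1 T v" using sol by (auto simp: nakao_mild_solution_def)
  obtain U M1 where U: "cont2 U" "\<And>t. 0 \<le> t \<Longrightarrow> t \<le> t1 \<Longrightarrow> (AE x in lborel. u t x = U t x) \<and> (\<forall>x. \<bar>U t x\<bar> \<le> M1)"
    using C0_H1_representative[OF cu(1) t1] by blast
  obtain V M2 where V: "cont2 V" "\<And>t. 0 \<le> t \<Longrightarrow> t \<le> t1 \<Longrightarrow> (AE x in lborel. v t x = V t x) \<and> (\<forall>x. \<bar>V t x\<bar> \<le> M2)"
    using C0_H1_representative[OF cu(2) t1] by blast
  have TI: "t \<in> time_interval T" if "0 \<le> t" "t \<le> t1" for t
    using that t1(2) by (auto simp: time_interval_def intro: le_less_trans[of _ "ereal t1"])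
  have um: "u t \<in> borel_measurable borel" "v t \<in> borel_measurable borel" if "0 \<le> t" "t \<le> t1" for t
    using TI[OF that] cu by (auto simp: C0_H1_def H1_def Lp2_iff)
  have cD: "continuous_on UNIV (\<lambda>x. duhamel k H t x)" if "smooth_kernel k" "cont2 H" "0 \<le> t" for k H t
    by (rule duhamel_clamped_continuous[OF that(1,2)]) (use that in auto)
  have cF: "continuous_on UNIV (damped_field F P t)" "continuous_on UNIV (wave_field G Q t)" for t
    using cont2_section[OF linear_field_continuous[OF damped_kernel_system primitive_continuous[OF F(1)] primitive_continuous[OF P]]]
      cont2_section[OF linear_field_continuous[OF wave_kernel_system primitive_continuous[OF G(1)] primitive_continuous[OF Q]]]
    by auto
  have eU: "U t x = damped_field F P t x + duhamel damped_kernel (\<lambda>s y. \<bar>V s y\<bar> powr p) t x" if t: "0 \<le> t" "t \<le> t1" for t x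
  proof (rule AE_eq_continuous_on_open[where f = "U t" and S = UNIV and
      g = "\<lambda>x. damped_field F P t x + duhamel damped_kernel (\<lambda>s y. \<bar>V s y\<bar> powr p) t x"])
    show "continuous_on UNIV (U t)" by (rule cont2_section[OF U(1)])
    show "continuous_on UNIV (\<lambda>x. damped_field F P t x + duhamel damped_kernel (\<lambda>s y. \<bar>V s y\<bar> powr p) t x)"
      by (intro continuous_intros cF cD smooth_damped_kernels cont2_abs_powr V(1) p0 t)
    have 1: "AE x in lborel. u t x = damped_K0 t f0 x + damped_K1 t f1 x + (LBINT s:{0..t}. damped_K1 (t - s) (\<lambda>y. \<bar>v s y\<bar> powr p) x)"
      using sol TI[OF t] by (simp add: nakao_mild_solution_def)
    have 2: "(LBINT s:{0..t}. damped_K1 (t - s) (\<lambda>y. \<bar>v s y\<bar> powr p) x) = duhamel damped_kernel (\<lambda>s y. \<bar>V s y\<bar> powr p) t x" for x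
      by (rule damped_duhamel[OF V(1) p0(1) t(1)]) (use V(2) um t in auto)
    have 3: "AE x in lborel. u t x = U t x" using U(2)[OF t] by blast
    show "AE x in lborel. x \<in> UNIV \<longrightarrow> U t x = damped_field F P t x + duhamel damped_kernel (\<lambda>s y. \<bar>V s y\<bar> powr p) t x"
      using 1 3 damped_linear_AE[OF f0 primitive_continuous[OF F(1)] P t(1)] by eventually_elim (simp add: 2)
  qed auto
  have eV: "V t x = wave_field G Q t x + duhamel (\<lambda>t z. 1 / 2) (\<lambda>s y. \<bar>U s y\<bar> powr q) t x" if t: "0 \<le> t" "t \<le> t1" for t x
  proof (rule AE_eq_continuous_on_open[where f = "V t" and S = UNIV and
      g = "\<lambda>x. wave_field G Q t x + duhamel (\<lambda>t z. 1 / 2) (\<lambda>s y. \<bar>U s y\<bar> powr q) t x"])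
    show "continuous_on UNIV (V t)" by (rule cont2_section[OF V(1)])
    show "continuous_on UNIV (\<lambda>x. wave_field G Q t x + duhamel (\<lambda>t z. 1 / 2) (\<lambda>s y. \<bar>U s y\<bar> powr q) t x)"
      by (intro continuous_intros cF cD smooth_kernel_const cont2_abs_powr U(1) p0 t)
    have 1: "AE x in lborel. v t x = wave_K0 t g0 x + wave_K1 t g1 x + (LBINT s:{0..t}. wave_K1 (t - s) (\<lambda>y. \<bar>u s y\<bar> powr q) x)"
      using sol TI[OF t] by (simp add: nakao_mild_solution_def)
    have 2: "(LBINT s:{0..t}. wave_K1 (t - s) (\<lambda>y. \<bar>u s y\<bar> powr q) x) = duhamel (\<lambda>t z. 1 / 2) (\<lambda>s y. \<bar>U s y\<bar> powr q) t x" for x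
      by (rule wave_duhamel[OF U(1) p0(2) t(1)]) (use U(2) um t in auto)
    have 3: "AE x in lborel. v t x = V t x" using V(2)[OF t] by blast
    show "AE x in lborel. x \<in> UNIV \<longrightarrow> V t x = wave_field G Q t x + duhamel (\<lambda>t z. 1 / 2) (\<lambda>s y. \<bar>U s y\<bar> powr q) t x"
      using 1 3 wave_linear_AE[OF g0 primitive_continuous[OF G(1)] Q t(1)] by eventually_elim (simp add: 2)
  qed auto
  show ?thesis
  proof (rule exI[of _ U], rule exI[of _ V], rule exI[of _ "max M1 M2"], intro conjI allI impI U(1) V(1))
    fix t assume t: "0 \<le> t" "t \<le> t1"
    show "AE x in lborel. u t x = U t x" using U(2)[OF t] by blast
    show "AE x in lborel. v t x = V t x" using V(2)[OF t] by blast
    fix x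
    show "\<bar>U t x\<bar> \<le> max M1 M2" using U(2)[OF t] by (simp add: le_max_iff_disj)
    show "\<bar>V t x\<bar> \<le> max M1 M2" using V(2)[OF t] by (simp add: le_max_iff_disj)
    show "U t x = damped_field F P t x + duhamel damped_kernel (\<lambda>s y. \<bar>V s y\<bar> powr p) t x" by (rule eU[OF t])
    show "V t x = wave_field G Q t x + duhamel (\<lambda>t z. 1 / 2) (\<lambda>s y. \<bar>U s y\<bar> powr q) t x" by (rule eV[OF t])
  qed
qed

text \<open>If the lifespan were smaller, the solution given here would coincide with the maximal
  solution as long as the latter exists, by uniqueness, and would therefore extend it.\<close>

theorem lifespan_ge:
  assumes T: "0 < T" and R: "0 < R" and cU: "cont2 U" and cV: "cont2 V"
    and U: "\<And>t x. 0 \<le> t \<Longrightarrow> t \<le> T \<Longrightarrow> U t x = damped_field F P t x + duhamel damped_kernel (\<lambda>s y. \<bar>V s y\<bar> powr p) t x"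
    and V: "\<And>t x. 0 \<le> t \<Longrightarrow> t \<le> T \<Longrightarrow> V t x = wave_field G Q t x + duhamel (\<lambda>t z. 1 / 2) (\<lambda>s y. \<bar>U s y\<bar> powr q) t x"
    and Z: "\<And>t x. 0 \<le> t \<Longrightarrow> t \<le> T \<Longrightarrow> R + t \<le> \<bar>x\<bar> \<Longrightarrow> U t x = 0 \<and> V t x = 0"
    and life: "is_nakao_lifespan p q f0 f1 g0 g1 S"
  shows "ereal T \<le> S"
proof (rule ccontr)
  assume "\<not> ereal T \<le> S"
  then have ST: "S < ereal T" by simp
  obtain u v where max: "nakao_maximal_solution p q f0 f1 g0 g1 S u v" using life by (auto simp: is_nakao_lifespan_def)
  then have sol: "nakao_mild_solution p q f0 f1 g0 g1 S u v" by (simp add: nakao_maximal_solution_def)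
  have mild: "nakao_mild_solution p q f0 f1 g0 g1 (ereal T) U V"
    by (rule mild_solutionI[OF T R cU cV]) (use U V Z in auto)
  have bound: "\<exists>M. \<forall>t x. 0 \<le> t \<longrightarrow> t \<le> T \<longrightarrow> \<bar>H t x\<bar> \<le> M"
    if cH: "cont2 H" and zH: "\<And>t x. 0 \<le> t \<Longrightarrow> t \<le> T \<Longrightarrow> R + t \<le> \<bar>x\<bar> \<Longrightarrow> H t x = 0" for H
  proof -
    have "compact ((\<lambda>(t, x). H t x) ` ({0..T} \<times> {-(R+T)..R+T}))"
      by (intro compact_continuous_image continuous_on_subset[OF cH] compact_Times) auto
    then obtain M where "\<forall>y\<in>(\<lambda>(t, x). H t x) ` ({0..T} \<times> {-(R+T)..R+T}). norm y \<le> M"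
      by (meson compact_imp_bounded bounded_iff)
    then have M: "\<bar>H t x\<bar> \<le> M" if "t \<in> {0..T}" "x \<in> {-(R+T)..R+T}" for t x
      using that by (metis (no_types, lifting) SigmaI case_prod_conv imageI real_norm_def)
    have "\<bar>H t x\<bar> \<le> max M 0" if "0 \<le> t" "t \<le> T" for t x
    proof (cases "x \<in> {-(R+T)..R+T}")
      case False
      then have "R + t \<le> \<bar>x\<bar>" using that by (auto simp: abs_if split: if_splits)
      then show ?thesis using zH that by simp
    qed (use M that in \<open>auto simp: le_max_iff_disj\<close>)
    then show ?thesis by blast
  qed
  obtain MU where MU: "\<And>t x. 0 \<le> t \<Longrightarrow> t \<le> T \<Longrightarrow> \<bar>U t x\<bar> \<le> MU" using bound[OF cU] Z by blast
  obtain MV where MV: "\<And>t x. 0 \<le> t \<Longrightarrow> t \<le> T \<Longrightarrow> \<bar>V t x\<bar> \<le> MV" using bound[OF cV] Z by blast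
  have "(AE x in lborel. U t x = u t x) \<and> (AE x in lborel. V t x = v t x)" if t: "t \<in> time_interval S" for t
  proof -
    have t0: "0 \<le> t" "ereal t < S" using t by (auto simp: time_interval_def)
    have tT: "t \<le> T" using t0(2) ST by (metis ereal_less_eq(3) less_imp_le order.strict_trans)
    from mild_solutionD[OF sol t0] obtain U' V' M where U': "cont2 U'" "cont2 V'" and
      e: "\<forall>s. 0 \<le> s \<longrightarrow> s \<le> t \<longrightarrow>
       (AE x in lborel. u s x = U' s x) \<and> (AE x in lborel. v s x = V' s x) \<and>
       (\<forall>x. \<bar>U' s x\<bar> \<le> M \<and> \<bar>V' s x\<bar> \<le> M \<and>
       U' s x = damped_field F P s x + duhamel damped_kernel (\<lambda>s y. \<bar>V' s y\<bar> powr p) s x \<and>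
       V' s x = wave_field G Q s x + duhamel (\<lambda>t z. 1 / 2) (\<lambda>s y. \<bar>U' s y\<bar> powr q) s x)"
      by (elim exE conjE) (rule that)
    have e1: "\<bar>U' s x\<bar> \<le> M" "\<bar>V' s x\<bar> \<le> M"
       "U' s x = damped_field F P s x + duhamel damped_kernel (\<lambda>s y. \<bar>V' s y\<bar> powr p) s x"
       "V' s x = wave_field G Q s x + duhamel (\<lambda>t z. 1 / 2) (\<lambda>s y. \<bar>U' s y\<bar> powr q) s x"
      if "0 \<le> s" "s \<le> t" for s x
      using e[rule_format, OF that] by blast+
    define N where "N = max M (max MU MV)"
    have "U t x = U' t x \<and> V t x = V' t x" for x
    proof
      have 1: "\<bar>V s x\<bar> \<le> N \<and> \<bar>V' s x\<bar> \<le> N" "\<bar>U s x\<bar> \<le> N \<and> \<bar>U' s x\<bar> \<le> N" if "0 \<le> s" "s \<le> t" for s x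
        using e1(1,2)[OF that, of x] MU[of s x] MV[of s x] that tT by (simp_all add: N_def le_max_iff_disj)
      have 2: "U s x = damped_field F P s x + duhamel damped_kernel (\<lambda>s y. \<bar>V s y\<bar> powr p) s x"
        "V s x = wave_field G Q s x + duhamel (\<lambda>t z. 1 / 2) (\<lambda>s y. \<bar>U s y\<bar> powr q) s x"
        if "0 \<le> s" "s \<le> t" for s x
        using U[of s x] V[of s x] that tT by simp_all
      note uniq = coupled_uniqueness[OF pq light_cone_kernel_damped t0(1) cV U'(2) cU U'(1) 1(1) 1(2) 2(1) e1(3) 2(2) e1(4) t0(1) order_refl]
      show "U t x = U' t x" by (rule uniq(1))
      show "V t x = V' t x" by (rule uniq(2))
    qed
    note same = this
    have ae: "AE x in lborel. u t x = U' t x" "AE x in lborel. v t x = V' t x" using e t0(1) by auto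
    have "AE x in lborel. U t x = u t x" using ae(1) by eventually_elim (simp add: same)
    moreover have "AE x in lborel. V t x = v t x" using ae(2) by eventually_elim (simp add: same)
    ultimately show ?thesis by simp
  qed
  note agree = this
  have "\<exists>T' u' v'. S < T' \<and> nakao_mild_solution p q f0 f1 g0 g1 T' u' v' \<and>
      (\<forall>t \<in> time_interval S. (AE x in lborel. u' t x = u t x) \<and> (AE x in lborel. v' t x = v t x))"
  proof (rule exI[of _ "ereal T"], rule exI[of _ U], rule exI[of _ V], rule conjI[OF ST], rule conjI[OF mild], rule ballI)
    show "(AE x in lborel. U t x = u t x) \<and> (AE x in lborel. V t x = v t x)" if "t \<in> time_interval S" for t
      by (rule agree[OF that])
  qed
  moreover from max have "\<not> (\<exists>T' u' v'. S < T' \<and> nakao_mild_solution p q f0 f1 g0 g1 T' u' v' \<and>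
      (\<forall>t \<in> time_interval S. (AE x in lborel. u' t x = u t x) \<and> (AE x in lborel. v' t x = v t x)))"
    unfolding nakao_maximal_solution_def by (rule conjunct2)
  ultimately show False by (rule notE[rotated])
qed

end

section \<open>The two lifespan exponents\<close>

text \<open>With \<open>Y\<close> the sum of the first two terms and \<open>N = 2 K Y\<close> the inequality closes as soon as \<open>Y
  powr (p q - 1) * T powr (q + 2)\<close> is small. Inserting \<open>T = c \<epsilon> powr (- X)\<close>, the two hypotheses on
  \<open>X\<close> say that the powers of \<open>\<epsilon>\<close> are nonnegative, and the constant \<open>c\<close> provides the smallness.\<close>

lemma lifespan_rate:
  fixes p q K \<theta> X :: real
  assumes pq: "1 < p" "1 < q" and K: "0 < K" and \<theta>: "0 < \<theta>" and X: "0 < X"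
    and X1: "X * (\<theta> * (p * q - 1) + q + 2) \<le> q * (p * q - 1)"
    and X2: "X * (p * q * (q + 1) + 1) \<le> p * q * (p * q - 1)"
  shows "\<exists>\<epsilon>0>0. \<exists>c>0. \<forall>\<epsilon>. 0 < \<epsilon> \<and> \<epsilon> \<le> \<epsilon>0 \<longrightarrow> 1 \<le> c * \<epsilon> powr (- X) \<and>
     (\<exists>N\<ge>0. K * (\<epsilon> powr q * (c * \<epsilon> powr (- X)) powr \<theta> + \<epsilon> powr (p * q) * (c * \<epsilon> powr (- X)) powr (q + 1)
        + N powr (p * q) * (c * \<epsilon> powr (- X)) powr (q + 2)) \<le> N)"
proof -
  define m where "m = p * q - 1"
  have pq1: "1 < p * q" using pq by (metis less_1_mult)
  have m: "0 < m" using pq1 by (simp add: m_def)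
  (* collects the constants produced by closing the inequality with N = 2 K Y *)
  define A where "A = (2 * K) powr (p * q) * (2 powr m * 2)"
  have A: "0 < A" using K by (simp add: A_def)
  define c where "c = min 1 (1 / A)"
  have c: "0 < c" "c \<le> 1" "A * c \<le> 1"
  proof -
    show "0 < c" "c \<le> 1" using A by (auto simp: c_def)
    have "A * c \<le> A * (1 / A)" using A by (intro mult_left_mono) (auto simp: c_def)
    then show "A * c \<le> 1" using A by simp
  qed
  (* the second entry makes the final time at least one *)
  define \<epsilon>0 where "\<epsilon>0 = min 1 (c powr (1 / X))"
  have \<epsilon>0: "0 < \<epsilon>0" using c by (simp add: \<epsilon>0_def)
  show ?thesis
  proof (rule exI[of _ \<epsilon>0], rule conjI[OF \<epsilon>0], rule exI[of _ c], rule conjI[OF c(1)], intro allI impI)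
    fix \<epsilon> :: real assume "0 < \<epsilon> \<and> \<epsilon> \<le> \<epsilon>0"
    then have e: "0 < \<epsilon>" "\<epsilon> \<le> 1" "\<epsilon> \<le> c powr (1 / X)" by (auto simp: \<epsilon>0_def)
    define T where "T = c * \<epsilon> powr (- X)"
    have "\<epsilon> powr X \<le> (c powr (1 / X)) powr X" using e X by (intro powr_mono2) auto
    also have "\<dots> = c" using X c by (simp add: powr_powr)
    finally have T1: "1 \<le> T" using e by (simp add: T_def powr_minus field_simps)
    define Y where "Y = \<epsilon> powr q * T powr \<theta> + \<epsilon> powr (p * q) * T powr (q + 1)"
    have Y: "0 < Y" using e T1 by (simp add: Y_def add_pos_pos)
    define N where "N = 2 * K * Y"
    have small: "\<epsilon> powr a * T powr b \<le> c" if "X * b \<le> a" "1 \<le> b" for a b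
    proof -
      have "\<epsilon> powr a * T powr b = c powr b * \<epsilon> powr (a - X * b)"
      proof -
        have "T powr b = c powr b * \<epsilon> powr (- X * b)" by (simp add: T_def powr_mult powr_powr)
        moreover have "\<epsilon> powr a * \<epsilon> powr (- X * b) = \<epsilon> powr (a - X * b)"
          by (simp add: powr_add[symmetric])
        ultimately show ?thesis by (simp add: mult.left_commute)
      qed
      also have "\<dots> \<le> c powr 1 * 1"
        using e c that by (intro mult_mono powr_mono' powr_le1) auto
      finally show ?thesis using c by simp
    qed
    have mT: "Y powr m * T powr (q + 2) \<le> 2 powr m * (2 * c)"
    proof -
      have "Y powr m \<le> 2 powr m * ((\<epsilon> powr q * T powr \<theta>) powr m + (\<epsilon> powr (p * q) * T powr (q + 1)) powr m)"
        unfolding Y_def using m by (intro powr_sum_le) auto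
      then have "Y powr m * T powr (q + 2) \<le> 2 powr m * ((\<epsilon> powr q * T powr \<theta>) powr m + (\<epsilon> powr (p * q) * T powr (q + 1)) powr m) * T powr (q + 2)"
        by (rule mult_right_mono) simp
      also have "\<dots> = 2 powr m * (\<epsilon> powr (q * m) * T powr (\<theta> * m + q + 2) + \<epsilon> powr (p * q * m) * T powr ((q + 1) * m + (q + 2)))"
        using e T1 by (simp add: powr_mult powr_powr powr_add algebra_simps)
      also have "\<dots> \<le> 2 powr m * (c + c)"
      proof (intro mult_left_mono add_mono small)
        show "X * (\<theta> * m + q + 2) \<le> q * m" using X1 by (simp add: m_def)
        show "1 \<le> \<theta> * m + q + 2" using \<theta> m pq by (simp add: add_increasing)
        have "(q + 1) * m + (q + 2) = p * q * (q + 1) + 1" by (simp add: m_def algebra_simps)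
        then show "X * ((q + 1) * m + (q + 2)) \<le> p * q * m" using X2 by (simp only: m_def)
        show "1 \<le> (q + 1) * m + (q + 2)" using m pq by (simp add: add_increasing)
      qed auto
      finally show ?thesis by simp
    qed
    have "N powr (p * q) * T powr (q + 2) \<le> Y"
    proof -
      have "N powr (p * q) = (2 * K) powr (p * q) * (Y powr m * Y)"
        using Y K powr_add[of Y m 1] by (simp add: N_def powr_mult m_def)
      then have "N powr (p * q) * T powr (q + 2) = (2 * K) powr (p * q) * (Y powr m * T powr (q + 2)) * Y" by simp
      also have "\<dots> \<le> (2 * K) powr (p * q) * (2 powr m * (2 * c)) * Y"
        using Y by (intro mult_right_mono mult_left_mono mT) auto
      also have "\<dots> = A * c * Y" by (simp add: A_def)
      also have "\<dots> \<le> 1 * Y" using c Y by (intro mult_right_mono) auto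
      finally show ?thesis by simp
    qed
    then have "K * (Y + N powr (p * q) * T powr (q + 2)) \<le> K * (Y + Y)" using K by (intro mult_left_mono add_left_mono) auto
    then have "K * (Y + N powr (p * q) * T powr (q + 2)) \<le> N" by (simp add: N_def)
    then show "1 \<le> c * \<epsilon> powr (- X) \<and>
     (\<exists>N\<ge>0. K * (\<epsilon> powr q * (c * \<epsilon> powr (- X)) powr \<theta> + \<epsilon> powr (p * q) * (c * \<epsilon> powr (- X)) powr (q + 1)
        + N powr (p * q) * (c * \<epsilon> powr (- X)) powr (q + 2)) \<le> N)"
      using T1 Y K unfolding T_def[symmetric] Y_def[symmetric] by (intro conjI exI[of _ N]) (auto simp: N_def)
  qed
qed

text \<open>The threshold is the positive root of the quadratic; dividing the other root out leaves a
  positive factor.\<close>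

lemma P_H_sign:
  fixes p q :: real
  assumes q: "1 < q" "q < 3" and p: "1 < p"
  defines "h \<equiv> q * (3 - q) * p\<^sup>2 - (2 * q\<^sup>2 - q - 1) * p - 2"
  shows "p \<le> P_H q \<Longrightarrow> h \<le> 0" "P_H q < p \<Longrightarrow> 0 < h"
proof -
  define a b where "a = q * (3 - q)" and "b = 2 * q\<^sup>2 - q - 1"
  define r where "r = sqrt (b\<^sup>2 + 8 * a)"
  define s where "s = P_H q"
  have a: "0 < a" using q by (simp add: a_def)
  have s: "s = (b + r) / (2 * a)"
    unfolding s_def P_H_eq[OF q] by (simp add: a_def b_def r_def mult.assoc)
  have r2: "r\<^sup>2 = b\<^sup>2 + 8 * a" using a by (simp add: r_def)
  have "\<bar>b\<bar> < r"
  proof -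
    have "\<bar>b\<bar> = sqrt (b\<^sup>2)" by simp
    also have "\<dots> < r" unfolding r_def using a by (intro real_sqrt_less_mono) auto
    finally show ?thesis .
  qed
  then have s0: "0 < s" unfolding s using a by (intro divide_pos_pos) auto
  have root: "a * s\<^sup>2 - b * s - 2 = 0"
  proof -
    have "a * s\<^sup>2 - b * s - 2 = (r\<^sup>2 - b\<^sup>2 - 8 * a) / (4 * a)"
      unfolding s using a by (simp add: field_simps power2_eq_square)
    then show ?thesis by (simp add: r2)
  qed
  have "(p - s) * (a * p * s + 2) = s * (a * p\<^sup>2 - b * p - 2) - p * (a * s\<^sup>2 - b * s - 2)"
    by (simp add: power2_eq_square algebra_simps)
  then have key: "(p - s) * (a * p * s + 2) = s * h" unfolding root by (simp add: h_def a_def b_def)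
  have pos: "0 < a * p * s + 2" using a p s0 by (intro add_pos_pos mult_pos_pos) auto
  show "h \<le> 0" if "p \<le> P_H q"
  proof -
    have "s * h \<le> 0" unfolding key[symmetric] using pos that by (intro mult_nonpos_nonneg) (auto simp: s_def)
    then show ?thesis using s0 by (simp add: mult_le_0_iff)
  qed
  show "0 < h" if "P_H q < p"
  proof -
    have "0 < s * h" unfolding key[symmetric] using pos that by (intro mult_pos_pos) (auto simp: s_def)
    then show ?thesis using s0 by (simp add: zero_less_mult_iff)
  qed
qed

text \<open>The estimate for every rate \<open>X\<close> allowed by the a priori bound; the theorem optimises \<open>X\<close> and
  \<open>\<theta>\<close>.\<close>

theorem lifespan_lower_bound:
  fixes p q R \<theta> X :: real and u0 u1 v0 v1 :: "real \<Rightarrow> real"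
  assumes pq: "1 < p" "1 < q"
    and u: "u0 \<in> H1" "u1 \<in> Lp 2" and v: "v0 \<in> H1" "v1 \<in> Lp 2"
    and R: "0 < R" and supp: "ess_supp u0 \<union> ess_supp u1 \<union> ess_supp v0 \<union> ess_supp v1 \<subseteq> {-R..R}"
    and mean: "(LINT x|lborel. v1 x) = 0"
    and \<theta>: "0 < \<theta>" "\<theta> \<le> 1" "1 - (q - 1) / 2 \<le> \<theta>" and X: "0 < X"
    and X1: "X * (\<theta> * (p * q - 1) + q + 2) \<le> q * (p * q - 1)"
    and X2: "X * (p * q * (q + 1) + 1) \<le> p * q * (p * q - 1)"
  shows "\<exists>\<epsilon>0>0. \<exists>c>0. \<forall>\<epsilon> T. 0 < \<epsilon> \<and> \<epsilon> \<le> \<epsilon>0 \<and>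
    is_nakao_lifespan p q (\<lambda>x. \<epsilon> * u0 x) (\<lambda>x. \<epsilon> * u1 x) (\<lambda>x. \<epsilon> * v0 x) (\<lambda>x. \<epsilon> * v1 x) T \<longrightarrow>
    ereal (c * \<epsilon> powr (- X)) \<le> T"
proof -
  have s: "ess_supp u0 \<subseteq> {-R..R}" "ess_supp u1 \<subseteq> {-R..R}" "ess_supp v0 \<subseteq> {-R..R}" "ess_supp v1 \<subseteq> {-R..R}"
    using supp by auto
  obtain F f' where F: "primitive F f'" "f' \<in> Lp 2" "AE x in lborel. u0 x = F x" "\<And>x. R \<le> \<bar>x\<bar> \<Longrightarrow> F x = 0"
    using H1_compact_representative[OF u(1) s(1)] by blast
  obtain G g' where G: "primitive G g'" "g' \<in> Lp 2" "AE x in lborel. v0 x = G x" "\<And>x. R \<le> \<bar>x\<bar> \<Longrightarrow> G x = 0"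
    using H1_compact_representative[OF v(1) s(3)] by blast
  obtain P where P: "primitive P u1" "integrable lborel u1"
    using L2_compact_primitive[OF u(2) s(2) R] by blast
  obtain Q where Q: "primitive Q v1" "\<And>x. x \<le> - R \<Longrightarrow> Q x = 0" "\<And>x. R \<le> x \<Longrightarrow> Q x = (LINT y|lborel. v1 y)"
    using L2_compact_primitive[OF v(2) s(4) R] by blast
  have Qz: "Q x = 0" if "R \<le> \<bar>x\<bar>" for x
    using Q(2)[of x] Q(3)[of x] mean that by (auto simp: abs_if split: if_splits)
  have cF: "continuous_on UNIV F" "continuous_on UNIV G" using F(1) G(1) by (auto intro: primitive_continuous)
  obtain C1 where C1: "0 < C1" "\<And>t x. 0 \<le> t \<Longrightarrow> \<bar>damped_field F P t x\<bar> \<le> C1 / sqrt (1 + t)"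
    "\<And>t. 0 \<le> t \<Longrightarrow> (\<integral>\<^sup>+x. ennreal \<bar>damped_field F P t x\<bar> \<partial>lborel) \<le> ennreal C1"
    using damped_field_decay[OF cF(1) P(1) F(4) P(2)] by blast
  obtain C2 where C2: "0 < C2" "\<And>t x. 0 \<le> t \<Longrightarrow> \<bar>wave_field G Q t x\<bar> \<le> C2"
    "\<And>t x. 0 \<le> t \<Longrightarrow> R \<le> \<bar>\<bar>x\<bar> - t\<bar> \<Longrightarrow> wave_field G Q t x = 0"
    using wave_field_strip[OF cF(2) Q(1) G(4) Qz] by blast
  define C where "C = C1 + C2"
  interpret nakao_fields p q R C \<theta> damped_kernel "damped_field F P" "wave_field G Q"
  proof
    show "0 < C" using C1 C2 by (simp add: C_def)
    show "cont2 (damped_field F P)"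
      by (rule linear_field_continuous[OF damped_kernel_system cF(1) primitive_continuous[OF P(1)]])
    show "cont2 (wave_field G Q)"
      by (rule linear_field_continuous[OF wave_kernel_system cF(2) primitive_continuous[OF Q(1)]])
    fix t :: real assume t: "0 \<le> t"
    show "integral {-t..t} (damped_kernel t) \<le> 2" by (rule damped_kernel_mass(1)[OF t])
    show "(\<integral>\<^sup>+x. ennreal \<bar>damped_field F P t x\<bar> \<partial>lborel) \<le> ennreal C"
      using C2(1) by (intro order_trans[OF C1(3)[OF t]] ennreal_leI) (simp add: C_def)
    fix x
    have "C1 / sqrt (1 + t) \<le> C / sqrt (1 + t)" using C2(1) t by (intro divide_right_mono) (auto simp: C_def)
    then show "\<bar>damped_field F P t x\<bar> \<le> C / sqrt (1 + t)" using C1(2)[OF t, of x] by linarith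
    show "damped_field F P t x = 0" if "R + t \<le> \<bar>x\<bar>"
      by (rule linear_field_support[OF damped_kernel_system cF(1) P(1) t F(4) ess_supp_interval_AE[OF s(2)] R that])
    show "\<bar>wave_field G Q t x\<bar> \<le> C" using C2(2)[OF t, of x] C1(1) by (simp add: C_def)
    show "wave_field G Q t x = 0" if "R \<le> \<bar>\<bar>x\<bar> - t\<bar>" by (rule C2(3)[OF t that])
  qed (use pq R \<theta> light_cone_kernel_damped in auto)
  from lifespan_rate[OF pq remainder_const_pos \<theta>(1) X X1 X2] obtain \<epsilon>0 c where ec: "0 < \<epsilon>0" "0 < c"
    and rate: "\<And>\<epsilon>. 0 < \<epsilon> \<and> \<epsilon> \<le> \<epsilon>0 \<Longrightarrow> 1 \<le> c * \<epsilon> powr (- X) \<and>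
     (\<exists>N\<ge>0. remainder_const * (\<epsilon> powr q * (c * \<epsilon> powr (- X)) powr \<theta> + \<epsilon> powr (p * q) * (c * \<epsilon> powr (- X)) powr (q + 1)
        + N powr (p * q) * (c * \<epsilon> powr (- X)) powr (q + 2)) \<le> N)" by blast
  show ?thesis
  proof (rule exI[of _ \<epsilon>0], rule conjI[OF ec(1)], rule exI[of _ c], rule conjI[OF ec(2)], intro allI impI, elim conjE)
    fix \<epsilon> :: real and T :: ereal
    assume e: "0 < \<epsilon>" "\<epsilon> \<le> \<epsilon>0"
      and life: "is_nakao_lifespan p q (\<lambda>x. \<epsilon> * u0 x) (\<lambda>x. \<epsilon> * u1 x) (\<lambda>x. \<epsilon> * v0 x) (\<lambda>x. \<epsilon> * v1 x) T"
    define S where "S = c * \<epsilon> powr (- X)"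
    obtain N where S: "1 \<le> S" and N: "0 \<le> N"
      "remainder_const * (\<epsilon> powr q * S powr \<theta> + \<epsilon> powr (p * q) * S powr (q + 1) + N powr (p * q) * S powr (q + 2)) \<le> N"
      using rate[of \<epsilon>] e unfolding S_def by blast
    from existence[OF e(1) S N] obtain U V where UV: "cont2 U" "cont2 V" and
      eq: "\<forall>t x. 0 \<le> t \<longrightarrow> t \<le> S \<longrightarrow>
     U t x = \<epsilon> * damped_field F P t x + duhamel damped_kernel (\<lambda>s y. \<bar>V s y\<bar> powr p) t x \<and>
     V t x = \<epsilon> * wave_field G Q t x + duhamel (\<lambda>t z. 1 / 2) (\<lambda>s y. \<bar>U s y\<bar> powr q) t x \<and>
     (R + t \<le> \<bar>x\<bar> \<longrightarrow> U t x = 0 \<and> V t x = 0)" by (elim exE conjE) (rule that)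
    interpret D: nakao_data p q "\<lambda>x. \<epsilon> * u0 x" "\<lambda>x. \<epsilon> * u1 x" "\<lambda>x. \<epsilon> * v0 x" "\<lambda>x. \<epsilon> * v1 x"
      "\<lambda>x. \<epsilon> * F x" "\<lambda>x. \<epsilon> * f' x" "\<lambda>x. \<epsilon> * P x" "\<lambda>x. \<epsilon> * G x" "\<lambda>x. \<epsilon> * g' x" "\<lambda>x. \<epsilon> * Q x"
    proof
      have m: "u0 \<in> borel_measurable borel" "v0 \<in> borel_measurable borel" using u v by (auto simp: H1_def Lp2_iff)
      then show "(\<lambda>x. \<epsilon> * u0 x) \<in> borel_measurable borel" "(\<lambda>x. \<epsilon> * v0 x) \<in> borel_measurable borel" by measurable
      show "AE x in lborel. \<epsilon> * u0 x = \<epsilon> * F x" using F(3) by eventually_elim simp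
      show "AE x in lborel. \<epsilon> * v0 x = \<epsilon> * G x" using G(3) by eventually_elim simp
    qed (use pq in \<open>auto intro!: primitive_cmult Lp2_cmult F G P Q u v\<close>)
    have "ereal S \<le> T"
    proof (rule D.lifespan_ge[OF _ R UV _ _ _ life])
      show "0 < S" using S by simp
      fix t x assume t: "0 \<le> t" "t \<le> S"
      note E = eq[rule_format, OF t, of x]
      show "U t x = damped_field (\<lambda>x. \<epsilon> * F x) (\<lambda>x. \<epsilon> * P x) t x + duhamel damped_kernel (\<lambda>s y. \<bar>V s y\<bar> powr p) t x"
        using E unfolding linear_field_cmult by blast
      show "V t x = wave_field (\<lambda>x. \<epsilon> * G x) (\<lambda>x. \<epsilon> * Q x) t x + duhamel (\<lambda>t z. 1 / 2) (\<lambda>s y. \<bar>U s y\<bar> powr q) t x"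
        using E unfolding linear_field_cmult by blast
      show "U t x = 0 \<and> V t x = 0" if "R + t \<le> \<bar>x\<bar>" using E that by blast
    qed
    then show "ereal (c * \<epsilon> powr (- X)) \<le> T" by (simp add: S_def)
  qed
qed

theorem theorem2p3:
  fixes p q R :: real and u0 u1 v0 v1 :: "real \<Rightarrow> real"
  assumes "1 < p" and "1 < q"
    and "u0 \<in> H1 \<inter> Lp 1" and "u1 \<in> Lp 2 \<inter> Lp 1 \<inter> Lp q"
    and "v0 \<in> H1" and "v1 \<in> Lp 2 \<inter> Lp 1"
    and "0 < R"
    and "ess_supp u0 \<union> ess_supp u1 \<union> ess_supp v0 \<union> ess_supp v1 \<subseteq> {-R..R}"
    and "(LINT x|lborel. v1 x) = 0"
  shows "\<exists>\<epsilon>0 > 0. \<exists>c > 0. \<forall>\<epsilon> T.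
    0 < \<epsilon> \<and> \<epsilon> \<le> \<epsilon>0 \<and>
    is_nakao_lifespan p q (\<lambda>x. \<epsilon> * u0 x) (\<lambda>x. \<epsilon> * u1 x) (\<lambda>x. \<epsilon> * v0 x) (\<lambda>x. \<epsilon> * v1 x) T \<longrightarrow>
    (q \<ge> 3 \<or> (1 < q \<and> q < 3 \<and> 1 < p \<and> p \<le> P_H q) \<longrightarrow>
       T \<ge> ereal (c * \<epsilon> powr (- (p * q * (p * q - 1) / (p * q * (q + 1) + 1))))) \<and>
    (1 < q \<and> q < 3 \<and> p > P_H q \<longrightarrow>
       T \<ge> ereal (c * \<epsilon> powr (- (2 * q * (p * q - 1) / (p * q * (3 - q) + 3 * q + 1)))))"
proof -
  have pq: "1 < p" "1 < q" by fact+
  have pq1: "1 < p * q" using pq by (metis less_1_mult)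
  define m where "m = p * q - 1"
  have m: "0 < m" using pq1 by (simp add: m_def)
  define E2 where "E2 = p * q * (q + 1) + 1"
  have E2: "0 < E2" using pq pq1 by (simp add: E2_def add_pos_pos)
  have bound: "\<exists>\<epsilon>0>0. \<exists>c>0. \<forall>\<epsilon> T. 0 < \<epsilon> \<and> \<epsilon> \<le> \<epsilon>0 \<and>
    is_nakao_lifespan p q (\<lambda>x. \<epsilon> * u0 x) (\<lambda>x. \<epsilon> * u1 x) (\<lambda>x. \<epsilon> * v0 x) (\<lambda>x. \<epsilon> * v1 x) T \<longrightarrow>
    ereal (c * \<epsilon> powr (- X)) \<le> T"
    if "0 < \<theta>" "\<theta> \<le> 1" "1 - (q - 1) / 2 \<le> \<theta>" "0 < X" "X * (\<theta> * m + q + 2) \<le> q * m" "X * E2 \<le> p * q * m" for \<theta> X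
    using lifespan_lower_bound[OF pq _ _ _ _ _ _ _ that(1-4)] that(5,6) assms unfolding m_def E2_def by blast
  define X where "X = p * q * m / E2"
  have X0: "0 < X" using pq m E2 by (simp add: X_def)
  have XE2: "X * E2 = p * q * m" using E2 by (simp add: X_def)
  have X1: "X * E1 \<le> q * m" if "p * E1 \<le> E2" for E1
  proof -
    have "X * E1 = q * m * (p * E1) / E2" by (simp add: X_def)
    also have "\<dots> \<le> q * m * E2 / E2" using that pq m E2 by (intro divide_right_mono mult_left_mono) auto
    finally show ?thesis using E2 by simp
  qed
  consider "3 \<le> q" | "q < 3" "p \<le> P_H q" | "q < 3" "P_H q < p" by linarith
  then show ?thesis
  proof cases
    case 1
    define \<theta> where "\<theta> = min 1 (1 / m)"
    have \<theta>: "0 < \<theta>" "\<theta> \<le> 1" using m by (auto simp: \<theta>_def)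
    have "1 \<le> (q - 1) / 2" using 1 by simp
    then have "1 - (q - 1) / 2 \<le> 0" by (simp only: diff_le_0_iff_le)
    then have \<theta>': "1 - (q - 1) / 2 \<le> \<theta>" using less_imp_le[OF \<theta>(1)] by (rule order_trans)
    have "\<theta> * m \<le> 1 / m * m" using m by (intro mult_right_mono) (auto simp: \<theta>_def)
    then have "p * (\<theta> * m + q + 2) \<le> p * (q + 3)" using m pq by (intro mult_left_mono) auto
    also have "\<dots> \<le> p * (q * (q + 1))"
    proof (rule mult_left_mono)
      have "3 * 3 \<le> q * q" using 1 by (intro mult_mono) auto
      then show "q + 3 \<le> q * (q + 1)" by (simp add: algebra_simps)
    qed (use pq in simp)
    also have "\<dots> \<le> E2" by (simp add: E2_def mult.assoc)
    finally have "X * (\<theta> * m + q + 2) \<le> q * m" by (rule X1)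
    from bound[OF \<theta> \<theta>' X0 this] XE2 1 show ?thesis unfolding X_def m_def E2_def by force
  next
    case 2
    define \<theta> where "\<theta> = (3 - q) / 2"
    have \<theta>: "0 < \<theta>" "\<theta> \<le> 1" "1 - (q - 1) / 2 \<le> \<theta>" using 2 pq by (auto simp: \<theta>_def field_simps)
    have "2 * (p * (\<theta> * m + q + 2)) - 2 * E2 = q * (3 - q) * p\<^sup>2 - (2 * q\<^sup>2 - q - 1) * p - 2"
      by (simp add: \<theta>_def m_def E2_def power2_eq_square field_simps)
    also have "\<dots> \<le> 0" by (rule P_H_sign(1)[OF pq(2) 2(1) pq(1) 2(2)])
    finally have "p * (\<theta> * m + q + 2) \<le> E2" by simp
    then have "X * (\<theta> * m + q + 2) \<le> q * m" by (rule X1)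
    from bound[OF \<theta> X0 this] XE2 2 show ?thesis unfolding X_def m_def E2_def by force
  next
    case 3
    define \<theta> where "\<theta> = (3 - q) / 2"
    have \<theta>: "0 < \<theta>" "\<theta> \<le> 1" "1 - (q - 1) / 2 \<le> \<theta>" using 3 pq by (auto simp: \<theta>_def field_simps)
    define E1 where "E1 = \<theta> * m + q + 2"
    have E1: "0 < E1" using \<theta> m pq by (simp add: E1_def add_pos_pos)
    have "0 < q * (3 - q) * p\<^sup>2 - (2 * q\<^sup>2 - q - 1) * p - 2" by (rule P_H_sign(2)[OF pq(2) 3(1) pq(1) 3(2)])
    also have "\<dots> = 2 * (p * E1) - 2 * E2"
      by (simp add: E1_def \<theta>_def m_def E2_def power2_eq_square field_simps)
    finally have E21: "E2 \<le> p * E1" by simp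
    define Z where "Z = q * m / E1"
    have Z0: "0 < Z" using pq m E1 by (simp add: Z_def)
    have Z1: "Z * (\<theta> * m + q + 2) \<le> q * m" using E1 by (simp add: Z_def E1_def[symmetric])
    have "Z * E2 = q * m * E2 / E1" by (simp add: Z_def)
    also have "\<dots> \<le> q * m * (p * E1) / E1" using E21 pq m E1 by (intro divide_right_mono mult_left_mono) auto
    finally have Z2: "Z * E2 \<le> p * q * m" using E1 by (simp add: mult_ac)
    have "Z = 2 * q * m / (2 * E1)" by (simp add: Z_def)
    also have "2 * E1 = p * q * (3 - q) + 3 * q + 1"
      by (simp add: E1_def \<theta>_def m_def field_simps)
    finally have Zeq: "2 * q * (p * q - 1) / (p * q * (3 - q) + 3 * q + 1) = Z" by (simp add: m_def)
    from bound[OF \<theta> Z0 Z1 Z2] 3 show ?thesis unfolding Zeq by force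
  qed
qed

end
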